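(* Let $\zeta$ be a primitive root of unity, $k\in\mathbb N$, and suppose $q\to\zeta$ radially within the unit disk: (a) If $\zeta$ has order $2k-1$, then \[\lim_{q\to\zeta} \big( \chi_0(q) - 2\mathcal{B}(\chi_0;q)\big) = -3\sum_{n=0}^{k-1} (-\zeta)^{n^2}(\zeta;\zeta^2)_n+2,\qquad \lim_{q\to\zeta} \big( \chi_1(q) - 2\mathcal{B}(\chi_1;q)\big) = 3\zeta^{-1}\sum_{n=0}^{k-1} (-\zeta)^{(n+1)^2}(\zeta;\zeta^2)_n.\] (b) If $\zeta$ has order $2k$, then \[\lim_{q\to\zeta} \big(\chi_0(q) + \mathcal{B}(\chi_0;q)\big) = 6\sum_{n=1}^{k} \frac{\zeta^{2n^2}}{(\zeta;\zeta^2)_n}+2,\qquad \lim_{q\to\zeta} \big( \chi_1(q) + \mathcal{B}(\chi_1;q)\big) = 6\sum_{n=1}^{k} \frac{\zeta^{2n(n-1)}}{(\zeta;\zeta^2)_n}.\] Moreover, $\mathcal{B}(\chi_0;q)$ and $\mathcal{B}(\chi_1;q)$ are modular forms of weight $1/2$ with level $\Gamma_1(10)$.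
   Context: Let $q=e^{2\pi i\tau}$ with $\tau$ in the upper half-plane, $(a;q)_\infty=\prod_{j\ge0}(1-aq^j)$ and $(a;q)_n=(a;q)_\infty/(aq^n;q)_\infty$ for all $n\in\mathbb Z$. Ramanujan's 5th order mock theta functions: $\chi_0(q)=\sum_{n\ge0} q^n/(q^{n+1};q)_n$, $\chi_1(q)=\sum_{n\ge0} q^n/(q^{n+1};q)_{n+1}$, $\phi_0(q)=\sum_{n\ge0} q^{n^2}(-q;q^2)_n$, $\phi_1(q)=\sum_{n\ge0} q^{(n+1)^2}(-q;q^2)_n$, $F_0(q)=\sum_{n\ge0} q^{2n^2}/(q;q^2)_n$, $F_1(q)=\sum_{n\ge0} q^{2n(n+1)}/(q;q^2)_{n+1}$; these satisfy $\chi_0(q)=2F_0(q)-\phi_0(-q)$ and $\chi_1(q)=2F_1(q)+q^{-1}\phi_1(-q)$. For $M(q)=\sum_{n\ge0}c(n;q)$ the bilateral series is $B(M;q)=\sum_{n\in\mathbb Z}c(n;q)$ (negative-index summands via the definition of $(a;q)_n$ for negative $n$). One defines $\mathcal{B}(\chi_0;q):=2B(F_0;q)-B(\phi_0;-q)$ and $\mathcal{B}(\chi_1;q):=2B(F_1;q)+q^{-1}B(\phi_1;-q)$; since $B(F_0;q)=B(\phi_0;-q)$ and $B(F_1;q)=-q^{-1}B(\phi_1;-q)$, these equal $B(F_0;q)$ and $B(F_1;q)$ respectively. "Modular form" means modular up to a rational power of $q$ with respect to some character. *)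

theory Defs
  imports "HOL-Analysis.Analysis" "HOL-Number_Theory.Cong"
begin

definition qpoch_inf :: "complex \<Rightarrow> complex \<Rightarrow> complex" where
  "qpoch_inf a q = (\<Prod>j. 1 - a * q ^ j)"

definition qpoch :: "complex \<Rightarrow> complex \<Rightarrow> int \<Rightarrow> complex" where
  "qpoch a q n = qpoch_inf a q / qpoch_inf (a * q powi n) q"

text \<open>
  The infinite products only make sense for \<open>norm q < 1\<close>.  At a root of unity, \<open>(a; q)\<^sub>n\<close> with
  \<open>n \<ge> 0\<close> is read as the finite product to which the quotient reduces inside the unit disc
  (lemma \<open>qpoch_eq_qpoch_fin\<close>).
\<close>
definition qpoch_fin :: "complex \<Rightarrow> complex \<Rightarrow> nat \<Rightarrow> complex" where
  "qpoch_fin a q n = (\<Prod>j<n. 1 - a * q ^ j)"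

lemma convergent_prod_qpoch:
  fixes a q :: complex
  assumes "norm q < 1"
  shows "convergent_prod (\<lambda>j. 1 - a * q ^ j)"
proof -
  have "summable (\<lambda>j. norm (a * q ^ j))"
    using assms by (simp add: norm_mult norm_power summable_mult summable_geometric)
  then have "summable (\<lambda>j. norm ((1 - a * q ^ j) - 1))"
    by simp
  then show ?thesis
    by (intro abs_convergent_prod_imp_convergent_prod summable_imp_abs_convergent_prod)
qed

lemma qpoch_inf_split:
  assumes "norm q < 1"
  shows "qpoch_inf a q = qpoch_fin a q n * qpoch_inf (a * q ^ n) q"
proof (induction n)
  case (Suc n)
  have "qpoch_inf b q = (1 - b) * qpoch_inf (b * q) q" for b
  proof -
    have "(\<lambda>j. 1 - b * q ^ j) has_prod (qpoch_inf (b * q) q * (1 - b * q ^ 0))"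
      using convergent_prod_has_prod[OF convergent_prod_qpoch[OF assms, of "b * q"]]
      by (intro has_prod_Suc_imp) (simp add: qpoch_inf_def mult_ac)
    then show ?thesis
      unfolding qpoch_inf_def by (metis has_prod_unique mult.commute mult.right_neutral power_0)
  qed
  from this[of "a * q ^ n"] Suc show ?case
    by (simp add: qpoch_fin_def mult_ac)
qed (simp add: qpoch_fin_def)

lemma qpoch_eq_qpoch_fin:
  assumes "norm q < 1" "qpoch_inf (a * q ^ n) q \<noteq> 0"
  shows "qpoch a q (int n) = qpoch_fin a q n"
  using assms qpoch_inf_split[of q a n] by (simp add: qpoch_def)

text \<open>
  A series \<open>M(q) = \<Sum>n\<ge>0. c(n; q)\<close> is represented by its family of summands \<open>c\<close>, defined for all
  integers \<open>n\<close>; the bilateral series depends on this family and not only on the function \<open>M\<close>.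
\<close>
definition unilateral :: "(int \<Rightarrow> complex \<Rightarrow> complex) \<Rightarrow> complex \<Rightarrow> complex" where
  "unilateral c q = (\<Sum>n. c (int n) q)"

definition bilateral :: "(int \<Rightarrow> complex \<Rightarrow> complex) \<Rightarrow> complex \<Rightarrow> complex" where
  "bilateral c q = (\<Sum>\<^sub>\<infinity>n\<in>UNIV. c n q)"

definition chi0_term :: "int \<Rightarrow> complex \<Rightarrow> complex" where
  "chi0_term n q = q powi n / qpoch (q powi (n + 1)) q n"

definition chi1_term :: "int \<Rightarrow> complex \<Rightarrow> complex" where
  "chi1_term n q = q powi n / qpoch (q powi (n + 1)) q (n + 1)"

definition phi0_term :: "int \<Rightarrow> complex \<Rightarrow> complex" where
  "phi0_term n q = q powi (n\<^sup>2) * qpoch (- q) (q\<^sup>2) n"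

definition phi1_term :: "int \<Rightarrow> complex \<Rightarrow> complex" where
  "phi1_term n q = q powi ((n + 1)\<^sup>2) * qpoch (- q) (q\<^sup>2) n"

definition F0_term :: "int \<Rightarrow> complex \<Rightarrow> complex" where
  "F0_term n q = q powi (2 * n\<^sup>2) / qpoch q (q\<^sup>2) n"

definition F1_term :: "int \<Rightarrow> complex \<Rightarrow> complex" where
  "F1_term n q = q powi (2 * n * (n + 1)) / qpoch q (q\<^sup>2) (n + 1)"

definition chi0 :: "complex \<Rightarrow> complex" where
  "chi0 = unilateral chi0_term"

definition chi1 :: "complex \<Rightarrow> complex" where
  "chi1 = unilateral chi1_term"

text \<open>
  These are not the bilateral series of \<open>chi0_term\<close> and \<open>chi1_term\<close>: they are induced by the
  relations \<open>\<chi>\<^sub>0(q) = 2 F\<^sub>0(q) - \<phi>\<^sub>0(-q)\<close> and \<open>\<chi>\<^sub>1(q) = 2 F\<^sub>1(q) + q\<^sup>-\<^sup>1 \<phi>\<^sub>1(-q)\<close>.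
\<close>
definition B_chi0 :: "complex \<Rightarrow> complex" where
  "B_chi0 q = 2 * bilateral F0_term q - bilateral phi0_term (- q)"

definition B_chi1 :: "complex \<Rightarrow> complex" where
  "B_chi1 q = 2 * bilateral F1_term q + inverse q * bilateral phi1_term (- q)"

definition primitive_root_of_unity :: "nat \<Rightarrow> complex \<Rightarrow> bool" where
  "primitive_root_of_unity m \<zeta> \<longleftrightarrow> m > 0 \<and> \<zeta> ^ m = 1 \<and> (\<forall>j. 0 < j \<and> j < m \<longrightarrow> \<zeta> ^ j \<noteq> 1)"

definition has_radial_limit :: "(complex \<Rightarrow> complex) \<Rightarrow> complex \<Rightarrow> complex \<Rightarrow> bool" where
  "has_radial_limit f \<zeta> l \<longleftrightarrow> ((\<lambda>r::real. f (of_real r * \<zeta>)) \<longlongrightarrow> l) (at_left 1)"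

definition upper_half_plane :: "complex set" where
  "upper_half_plane = {\<tau>. Im \<tau> > 0}"

definition SL2Z :: "(int^2^2) set" where
  "SL2Z = {A. det A = 1}"

definition Gamma1 :: "nat \<Rightarrow> (int^2^2) set" where
  "Gamma1 N = {A \<in> SL2Z. [A$1$1 = 1] (mod int N) \<and> [A$2$1 = 0] (mod int N) \<and>
     [A$2$2 = 1] (mod int N)}"

definition act :: "int^2^2 \<Rightarrow> complex \<Rightarrow> complex" where
  "act A = moebius (of_int (A$1$1)) (of_int (A$1$2)) (of_int (A$2$1)) (of_int (A$2$2))"

text \<open>\<open>(c \<tau> + d)\<^sup>k\<close> for real \<open>k\<close>, with the principal branch (argument in \<open>(-\<pi>, \<pi>]\<close>).\<close>
definition automorphy :: "real \<Rightarrow> int^2^2 \<Rightarrow> complex \<Rightarrow> complex" where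
  "automorphy k A \<tau> = (of_int (A$2$1) * \<tau> + of_int (A$2$2)) powr of_real k"

definition slash :: "real \<Rightarrow> (complex \<Rightarrow> complex) \<Rightarrow> int^2^2 \<Rightarrow> complex \<Rightarrow> complex" where
  "slash k f A \<tau> = f (act A \<tau>) / automorphy k A \<tau>"

text \<open>
  For non-integral weight, the role of a character is played by a unitary multiplier system:
  a map \<open>v\<close> that makes \<open>v A * automorphy k A\<close> a cocycle.  For integral \<open>k\<close> this is precisely a unitary
  character.
\<close>
definition multiplier_system :: "(int^2^2) set \<Rightarrow> real \<Rightarrow> (int^2^2 \<Rightarrow> complex) \<Rightarrow> bool" where
  "multiplier_system \<Gamma> k v \<longleftrightarrow>
     (\<forall>A\<in>\<Gamma>. norm (v A) = 1) \<and>
     (\<forall>A\<in>\<Gamma>. \<forall>B\<in>\<Gamma>. \<forall>\<tau>\<in>upper_half_plane.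
        v (A ** B) * automorphy k (A ** B) \<tau> =
          (v A * automorphy k A (act B \<tau>)) * (v B * automorphy k B \<tau>))"

text \<open>
  An expansion in powers of \<open>exp (2\<pi>i\<tau>/h)\<close> with exponents in \<open>\<kappa> + \<nat>\<close>.  As \<open>\<kappa>\<close> may be any real
  number, finitely many exponents may be negative.
\<close>
definition meromorphic_at_i_infinity :: "(complex \<Rightarrow> complex) \<Rightarrow> bool" where
  "meromorphic_at_i_infinity g \<longleftrightarrow>
     (\<exists>(h::nat) (\<kappa>::real) (a :: nat \<Rightarrow> complex). h > 0 \<and>
        (\<forall>\<tau>\<in>upper_half_plane.
           (\<lambda>n. a n * exp (2 * of_real pi * \<i> * of_real (\<kappa> + real n) * \<tau> / of_nat h)) sums g \<tau>))"

text \<open>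
  Poles at the cusps are allowed (weakly holomorphic forms).  They do occur for the functions
  considered here: \<open>B_chi0 q = 1 - q + \<dots>\<close> becomes modular after multiplication by \<open>q\<close> to the power \<open>-1/120\<close>,
  which has a pole at infinity, and both functions grow exponentially as \<open>q\<close> tends radially
  to \<open>1\<close>.
\<close>
definition modular_form ::
    "(int^2^2) set \<Rightarrow> real \<Rightarrow> (int^2^2 \<Rightarrow> complex) \<Rightarrow> (complex \<Rightarrow> complex) \<Rightarrow> bool" where
  "modular_form \<Gamma> k v f \<longleftrightarrow>
     f holomorphic_on upper_half_plane \<and>
     (\<forall>A\<in>\<Gamma>. \<forall>\<tau>\<in>upper_half_plane. f (act A \<tau>) = v A * automorphy k A \<tau> * f \<tau>) \<and>
     (\<forall>A\<in>SL2Z. meromorphic_at_i_infinity (slash k f A))"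

text \<open>
  Modularity of a function of \<open>q = exp (2\<pi>i\<tau>)\<close> up to a rational power of \<open>q\<close> (taken to be
  \<open>exp (2\<pi>ir\<tau>)\<close>) with respect to some character.
\<close>
definition modular_up_to_q_power :: "(int^2^2) set \<Rightarrow> real \<Rightarrow> (complex \<Rightarrow> complex) \<Rightarrow> bool" where
  "modular_up_to_q_power \<Gamma> k F \<longleftrightarrow>
     (\<exists>(r::rat) v. multiplier_system \<Gamma> k v \<and>
        modular_form \<Gamma> k v
          (\<lambda>\<tau>. exp (2 * of_real pi * \<i> * of_rat r * \<tau>) * F (exp (2 * of_real pi * \<i> * \<tau>))))"

end

theory Submission
  imports Defs "HOL-Complex_Analysis.Complex_Analysis"
begin

text \<open>
  The substitutions \<open>n \<mapsto> -n\<close> and \<open>n \<mapsto> -n-1\<close> show that the bilateral series are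
  \<open>F\<^sub>0 + \<Phi>\<^sub>0 - 1\<close> and \<open>F\<^sub>1 + \<Phi>\<^sub>1\<close>, where \<open>\<Phi>\<^sub>0(q) = \<phi>\<^sub>0(-q)\<close> and
  \<open>\<Phi>\<^sub>1(q) = -q\<^sup>-\<^sup>1 \<phi>\<^sub>1(-q)\<close>.  Together with the mock theta relations \<open>\<chi>\<^sub>i = 2 F\<^sub>i - \<Phi>\<^sub>i\<close>, the four
  functions in the limits become \<open>2 - 3 \<Phi>\<^sub>0\<close>, \<open>-3 \<Phi>\<^sub>1\<close>, \<open>3 F\<^sub>0 - 1\<close> and \<open>3 F\<^sub>1\<close>.  Near a root
  of unity of the relevant parity, the summands of these series decay geometrically from one period of
  the exponent to the next, uniformly along the radius, so the limit may be taken termwise.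

  For the modularity, the bilateral series are expanded in theta functions; Rogers-Ramanujan type
  identities (a finite pentagonal number identity and Bailey's lemma) sum the coefficients and
  yield the even part of \<open>\<theta>\<^sub>4 G\<close> and the odd part of \<open>\<theta>\<^sub>4 H\<close> in \<open>q\<^sup>1\<^sup>/\<^sup>2\<close>, where \<open>G\<close> and \<open>H\<close> are the
  Rogers-Ramanujan functions.  These are quotients of \<open>\<eta>\<close> and Klein forms.  The behaviour of Klein forms under
  \<open>SL\<^sub>2(\<int>)\<close> follows from Liouville's theorem, and that of \<open>\<eta>\<close> from expressing \<open>\<eta>\<^sup>6\<close> by the Klein
  forms at the three half periods.
\<close>

section \<open>\<open>q\<close>-Pochhammer symbols\<close>

text \<open>The combinations in the limits discard the half of the series that misbehaves. Let m be
  the order of \<zeta>^2 and u = r^((2n+1)m). Over m steps the product (q;q^2)_n acquires a factor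
  close to 1 - u if the order of \<zeta> is odd and close to 1 + u if it is even. In the odd case
  dividing by it, as the F-series do, is unbounded as u tends to 1, whereas u (1 - u) stays small;
  in the even case multiplying by it, as the \<Phi>-series do, gives ratios near 2, whereas u / (1 +
  u) stays below 1. The obstacle to modularity is that an even or odd part in t = q^(1/2) is a sum
  of two terms, exchanged by t -> -t, that is, by \<tau> -> \<tau> + 1. They have one factor of
  weight 1/2 in common, for which a constant of modulus 1 is shown to exist for each matrix; as this
  factor has no zeros, the cocycle law follows from its transformation. What remains are two Klein
  quotients of weight 0, and their phases must be known exactly, since a matrix in \<Gamma>_1(10)
  with odd upper right entry exchanges the two terms.\<close>

lemma qpoch_inf_rec:
  assumes "norm q < 1"
  shows "qpoch_inf a q = (1 - a) * qpoch_inf (a * q) q"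
  using qpoch_inf_split[OF assms, of a 1] by (simp add: qpoch_fin_def)

lemma qpoch_inf_0_left [simp]: "qpoch_inf 0 q = 1"
  by (simp add: qpoch_inf_def)

lemma qpoch_fin_0 [simp]: "qpoch_fin a q 0 = 1"
  by (simp add: qpoch_fin_def)

lemma qpoch_fin_Suc: "qpoch_fin a q (Suc n) = qpoch_fin a q n * (1 - a * q ^ n)"
  by (simp add: qpoch_fin_def)

lemma qpoch_fin_LIMSEQ:
  assumes "norm q < 1"
  shows "(\<lambda>n. qpoch_fin a q n) \<longlonglongrightarrow> qpoch_inf a q"
proof -
  have "(\<lambda>j. 1 - a * q ^ j) has_prod qpoch_inf a q"
    unfolding qpoch_inf_def using convergent_prod_qpoch[OF assms] by blast
  from has_prod_imp_tendsto'[OF this] show ?thesis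
    by (simp add: qpoch_fin_def)
qed

lemma qpoch_inf_eq_0_iff:
  assumes "norm q < 1"
  shows "qpoch_inf a q = 0 \<longleftrightarrow> (\<exists>j. a * q ^ j = 1)"
proof -
  have "(\<lambda>j. 1 - a * q ^ j) has_prod qpoch_inf a q"
    unfolding qpoch_inf_def using convergent_prod_qpoch[OF assms] by blast
  from has_prod_eq_0_iff[OF this] show ?thesis by auto
qed

lemma qpoch_inf_nonzero:
  assumes "norm q < 1" "norm a < 1"
  shows "qpoch_inf a q \<noteq> 0"
proof
  assume "qpoch_inf a q = 0"
  then obtain j where j: "a * q ^ j = 1"
    using qpoch_inf_eq_0_iff[OF assms(1)] by blast
  have "norm (a * q ^ j) \<le> norm a * 1"
    unfolding norm_mult norm_power
    by (intro mult_left_mono power_le_one) (use assms in auto)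
  with j assms show False by simp
qed

lemma qpoch_fin_nonzero:
  assumes "norm q < 1" "norm a < 1"
  shows "qpoch_fin a q n \<noteq> 0"
  using qpoch_inf_nonzero[OF assms] qpoch_inf_split[OF assms(1), of a n] by auto

text \<open>Both arguments vary, as is needed for functions of \<tau> and of the local parameter at
  a cusp. On a small closed disc the modulus of \<open>g\<close> stays below one \<rho> < 1 and
  \<open>f\<close> is bounded by \<open>C\<close>, so the n-th factor differs from 1 by at most C
  \<rho>^n and the partial products converge uniformly.\<close>

lemma qpoch_inf_holomorphic:
  assumes f: "f holomorphic_on S" and g: "g holomorphic_on S" and S: "open S"
    and less: "\<And>z. z \<in> S \<Longrightarrow> norm (g z) < 1"
  shows "(\<lambda>z. qpoch_inf (f z) (g z)) holomorphic_on S"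
proof (rule holomorphic_uniform_sequence[OF S])
  show "(\<lambda>z. qpoch_fin (f z) (g z) n) holomorphic_on S" for n
    unfolding qpoch_fin_def by (intro holomorphic_intros f g)
  fix x assume x: "x \<in> S"
  define \<rho> where "\<rho> = (norm (g x) + 1) / 2"
  have \<rho>: "norm (g x) < \<rho>" "\<rho> < 1" "0 < \<rho>"
  proof -
    show "norm (g x) < \<rho>" "\<rho> < 1" using less[OF x] by (auto simp: \<rho>_def)
    show "0 < \<rho>" unfolding \<rho>_def by (simp add: add_nonneg_pos)
  qed
  obtain d1 where d1: "d1 > 0" "cball x d1 \<subseteq> S"
    using S x open_contains_cball by blast
  have "continuous_on S (\<lambda>z. norm (g z))"
    by (intro continuous_intros holomorphic_on_imp_continuous_on g)
  then have "\<exists>d>0. \<forall>z\<in>S. dist z x < d \<longrightarrow> dist (norm (g z)) (norm (g x)) < \<rho> - norm (g x)"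
    using x \<rho>(1) unfolding continuous_on_iff by (meson diff_gt_0_iff_gt)
  then obtain d2 where d2: "d2 > 0"
    "\<And>z. z \<in> S \<Longrightarrow> dist z x < d2 \<Longrightarrow> dist (norm (g z)) (norm (g x)) < \<rho> - norm (g x)"
    by blast
  have d2': "norm (g z) < \<rho>" if "z \<in> S" "dist z x < d2" for z
    using d2(2)[OF that] by (simp add: dist_real_def)
  define d where "d = min d1 (d2 / 2)"
  have d: "d > 0" "cball x d \<subseteq> S" "\<And>z. z \<in> cball x d \<Longrightarrow> norm (g z) < \<rho>"
  proof -
    show "d > 0" using d1 d2 by (simp add: d_def)
    show sub: "cball x d \<subseteq> S" using d1 by (auto simp: d_def)
    fix z assume z: "z \<in> cball x d"
    then have "dist z x < d2" using d2(1) by (auto simp: d_def dist_commute)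
    then show "norm (g z) < \<rho>" using d2' z sub by blast
  qed
  have cf: "continuous_on (cball x d) f" and cg: "continuous_on (cball x d) g"
    using f g d(2) holomorphic_on_imp_continuous_on continuous_on_subset by blast+
  have "bounded (f ` cball x d)"
    using compact_imp_bounded[OF compact_continuous_image[OF cf compact_cball]] .
  then obtain C where "\<forall>y\<in>f ` cball x d. norm y \<le> C"
    unfolding bounded_iff by blast
  then have C: "norm (f z) \<le> C" if "z \<in> cball x d" for z
    using that by blast
  have C0: "C \<ge> 0" using C[of x] d(1) norm_ge_zero[of "f x"]
    by (meson centre_in_cball less_imp_le order_trans)
  have "uniformly_convergent_on (cball x d) (\<lambda>N z. \<Prod>n<N. 1 - f z * g z ^ n)"
  proof (rule Infinite_Products.uniformly_convergent_on_prod')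
    show "uniformly_convergent_on (cball x d) (\<lambda>N z. \<Sum>n<N. norm (1 - f z * g z ^ n - 1))"
    proof (rule Weierstrass_m_test'_ev)
      show "\<forall>\<^sub>F n in sequentially. \<forall>z\<in>cball x d. norm (norm (1 - f z * g z ^ n - 1)) \<le> C * \<rho> ^ n"
      proof (intro always_eventually allI ballI)
        fix n z assume z: "z \<in> cball x d"
        show "norm (norm (1 - f z * g z ^ n - 1)) \<le> C * \<rho> ^ n"
          using C[OF z] d(3)[OF z] C0
          by (simp add: norm_mult norm_power) (intro mult_mono power_mono, auto)
      qed
      show "summable (\<lambda>n. C * \<rho> ^ n)"
        using \<rho> by (intro summable_mult summable_geometric) auto
    qed
  qed (auto intro!: continuous_intros cf cg)
  then obtain l where l: "uniform_limit (cball x d) (\<lambda>N z. \<Prod>n<N. 1 - f z * g z ^ n) l sequentially"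
    by (auto simp: uniformly_convergent_on_def)
  have "l z = qpoch_inf (f z) (g z)" if z: "z \<in> cball x d" for z
  proof -
    have "(\<lambda>N. \<Prod>n<N. 1 - f z * g z ^ n) \<longlonglongrightarrow> l z"
      using tendsto_uniform_limitI[OF l z] .
    moreover have "(\<lambda>N. \<Prod>n<N. 1 - f z * g z ^ n) \<longlonglongrightarrow> qpoch_inf (f z) (g z)"
      using qpoch_fin_LIMSEQ[of "g z" "f z"] less d(2) z by (auto simp: qpoch_fin_def)
    ultimately show ?thesis using LIMSEQ_unique by blast
  qed
  then have "uniform_limit (cball x d) (\<lambda>n z. qpoch_fin (f z) (g z) n) (\<lambda>z. qpoch_inf (f z) (g z)) sequentially"
    by (intro uniform_limit_cong'[THEN iffD1, OF _ _ l]) (simp_all add: qpoch_fin_def)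
  then show "\<exists>d. 0 < d \<and> cball x d \<subseteq> S \<and>
      uniform_limit (cball x d) (\<lambda>n z. qpoch_fin (f z) (g z) n) (\<lambda>z. qpoch_inf (f z) (g z)) sequentially"
    using d by blast
qed

lemma continuous_qpoch_inf_left:
  assumes "norm q < 1"
  shows "isCont (\<lambda>a. qpoch_inf a q) a"
proof -
  have "(\<lambda>a. qpoch_inf a q) holomorphic_on UNIV"
    by (intro qpoch_inf_holomorphic holomorphic_intros) (use assms in auto)
  then show ?thesis
    using holomorphic_on_imp_continuous_on continuous_on_eq_continuous_at by blast
qed

text \<open>Sorting the factors by the residue of the exponent modulo \<open>m\<close> is exact for
  the first n m factors, and both sides converge along this subsequence.\<close>

lemma qpoch_inf_dissect:
  assumes q: "norm q < 1" and m: "m > 0"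
  shows "qpoch_inf a q = (\<Prod>i<m. qpoch_inf (a * q ^ i) (q ^ m))"
proof -
  have qm: "norm (q ^ m) < 1"
    using q m by (simp add: norm_power power_less_one_iff)
  have eq: "qpoch_fin a q (n * m) = (\<Prod>i<m. qpoch_fin (a * q ^ i) (q ^ m) n)" for n
  proof -
    have "qpoch_fin a q (n * m) = (\<Prod>l<n. prod (\<lambda>j. 1 - a * q ^ j) {l * m..<l * m + m})"
      unfolding qpoch_fin_def by (rule prod.nat_group[symmetric])
    also have "\<dots> = (\<Prod>l<n. \<Prod>i<m. 1 - a * q ^ (l * m + i))"
    proof (rule prod.cong)
      fix l assume "l \<in> {..<n}"
      show "prod (\<lambda>j. 1 - a * q ^ j) {l * m..<l * m + m} = (\<Prod>i<m. 1 - a * q ^ (l * m + i))"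
        using prod.shift_bounds_nat_ivl[of "\<lambda>j. 1 - a * q ^ j" 0 "l * m" m]
        by (simp add: atLeast0LessThan add.commute)
    qed simp
    also have "\<dots> = (\<Prod>i<m. \<Prod>l<n. 1 - a * q ^ (l * m + i))"
      by (rule prod.swap)
    also have "\<dots> = (\<Prod>i<m. qpoch_fin (a * q ^ i) (q ^ m) n)"
      unfolding qpoch_fin_def by (simp add: power_add power_mult[symmetric] mult_ac)
    finally show ?thesis .
  qed
  have "filterlim (\<lambda>n. n * m) sequentially sequentially"
    by (rule filterlim_subseq) (use m in \<open>auto simp: strict_mono_def\<close>)
  from filterlim_compose[OF qpoch_fin_LIMSEQ[OF q, of a] this]
  have "(\<lambda>n. qpoch_fin a q (n * m)) \<longlonglongrightarrow> qpoch_inf a q" .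
  moreover have "(\<lambda>n. \<Prod>i<m. qpoch_fin (a * q ^ i) (q ^ m) n) \<longlonglongrightarrow> (\<Prod>i<m. qpoch_inf (a * q ^ i) (q ^ m))"
    by (intro tendsto_prod qpoch_fin_LIMSEQ qm)
  ultimately show ?thesis
    unfolding eq using LIMSEQ_unique by blast
qed

lemma qpoch_inf_minus_mult:
  assumes q: "norm q < 1"
  shows "qpoch_inf a q * qpoch_inf (- a) q = qpoch_inf (a\<^sup>2) (q\<^sup>2)"
proof -
  have "norm (q\<^sup>2) < 1" using q by (simp add: norm_power power_less_one_iff)
  have eq: "qpoch_fin a q n * qpoch_fin (-a) q n = qpoch_fin (a\<^sup>2) (q\<^sup>2) n" for n
    unfolding qpoch_fin_def prod.distrib[symmetric]
    by (rule prod.cong) (auto simp: algebra_simps power2_eq_square power_mult_distrib)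
  have "(\<lambda>n. qpoch_fin (a\<^sup>2) (q\<^sup>2) n) \<longlonglongrightarrow> qpoch_inf a q * qpoch_inf (- a) q"
    unfolding eq[symmetric] by (intro tendsto_mult qpoch_fin_LIMSEQ q)
  then show ?thesis
    using qpoch_fin_LIMSEQ[OF \<open>norm (q\<^sup>2) < 1\<close>, of "a\<^sup>2"] LIMSEQ_unique by blast
qed

text \<open>Partitions into odd parts against partitions into distinct parts: (q;q) =
  (q;q^2)(q^2;q^2) and (q;q)(-q;q) = (q^2;q^2), where the nonzero factor (q^2;q^2) cancels.\<close>

lemma euler_odd_distinct:
  assumes q: "norm q < 1"
  shows "qpoch_inf q (q\<^sup>2) * qpoch_inf (- q) q = 1"
proof -
  have q2: "norm (q\<^sup>2) < 1" using q by (simp add: norm_power power_less_one_iff)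
  have "qpoch_inf q q = qpoch_inf q (q\<^sup>2) * qpoch_inf (q\<^sup>2) (q\<^sup>2)"
    using qpoch_inf_dissect[OF q, of 2 q] by (simp add: numeral_2_eq_2 lessThan_Suc mult.commute)
  moreover have "qpoch_inf q q * qpoch_inf (- q) q = qpoch_inf (q\<^sup>2) (q\<^sup>2)"
    by (rule qpoch_inf_minus_mult[OF q])
  moreover have "qpoch_inf (q\<^sup>2) (q\<^sup>2) \<noteq> 0"
    by (rule qpoch_inf_nonzero[OF q2 q2])
  ultimately show ?thesis by (simp add: mult_ac)
qed

section \<open>Reciprocals of (q;q)_k and unconditional sums over the integers\<close>

lemma norm_power_int_powr:
  assumes "(q::complex) \<noteq> 0"
  shows "norm (q powi k) = norm q powr (of_int k)"
  using assms by (simp add: norm_power_int powr_real_of_int')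

text \<open>The reciprocal of (q;q)_k, continued by 0 to k < 0. With this value the recurrence
  \<open>ipoch_pred\<close> holds for every integer \<open>k\<close>, so series may run over all
  integers and be shifted or reflected without boundary terms.\<close>

definition ipoch :: "complex \<Rightarrow> int \<Rightarrow> complex" where
  "ipoch q k = (if k < 0 then 0 else inverse (qpoch_fin q q (nat k)))"

lemma ipoch_neg [simp]: "k < 0 \<Longrightarrow> ipoch q k = 0"
  by (simp add: ipoch_def)

lemma ipoch_nat: "ipoch q (int n) = inverse (qpoch_fin q q n)"
  by (simp add: ipoch_def)

lemma ipoch_0 [simp]: "ipoch q 0 = 1"
  by (simp add: ipoch_def)

lemma ipoch_pred:
  assumes q: "norm q < 1" "q \<noteq> 0"
  shows "ipoch q (k - 1) = (1 - q powi k) * ipoch q k"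
proof (cases "k > 0")
  case True
  define n where "n = nat (k - 1)"
  have k: "k = int (Suc n)" using True by (simp add: n_def)
  have "1 - q * q ^ n \<noteq> 0"
    using qpoch_fin_nonzero[OF q(1) q(1), of "Suc n"] by (auto simp: qpoch_fin_Suc)
  then show ?thesis
    by (simp add: k ipoch_def nat_add_distrib qpoch_fin_Suc power_int_add q(2) mult.commute)
next
  case False
  then show ?thesis by (cases "k = 0") auto
qed

lemma ipoch_bounded:
  assumes q: "norm q < 1"
  obtains C where "C > 0" "\<And>k. norm (ipoch q k) \<le> C"
proof -
  have "(\<lambda>n. inverse (qpoch_fin q q n)) \<longlonglongrightarrow> inverse (qpoch_inf q q)"
    by (intro tendsto_intros qpoch_fin_LIMSEQ qpoch_inf_nonzero q)
  then have "Bseq (\<lambda>n. inverse (qpoch_fin q q n))"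
    by (intro convergent_imp_Bseq convergentI)
  then obtain C where "C > 0" "\<And>n. norm (inverse (qpoch_fin q q n)) \<le> C"
    by (elim BseqE) blast
  then show ?thesis
    by (intro that[of C]) (auto simp: ipoch_def)
qed

lemma ipoch_LIMSEQ:
  assumes q: "norm q < 1"
  shows "(\<lambda>n. ipoch q (int n)) \<longlonglongrightarrow> inverse (qpoch_inf q q)"
  unfolding ipoch_nat by (intro tendsto_intros qpoch_fin_LIMSEQ qpoch_inf_nonzero q)

lemma has_sum_int_nonneg:
  fixes f :: "int \<Rightarrow> 'a :: {comm_monoid_add, topological_space}"
  assumes "((\<lambda>n::nat. f (int n)) has_sum S) UNIV" "\<And>n. n < 0 \<Longrightarrow> f n = 0"
  shows "(f has_sum S) UNIV"
proof -
  have "(f has_sum S) (range int)"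
    using assms(1) by (subst has_sum_reindex) (auto simp: o_def)
  then show ?thesis
    by (rule has_sum_cong_neutral[THEN iffD1, rotated -1])
       (use assms(2) in \<open>auto, metis rangeI nonneg_int_cases not_less\<close>)
qed

lemma summable_on_int:
  fixes f :: "int \<Rightarrow> real"
  assumes "(\<lambda>n::nat. f (int n)) summable_on UNIV" "(\<lambda>n::nat. f (- int n)) summable_on UNIV"
  shows "f summable_on UNIV"
proof -
  have "f summable_on (range int)" "f summable_on (range (\<lambda>n. - int n))"
    using assms by (simp_all add: summable_on_reindex inj_on_def o_def)
  then have "f summable_on (range int \<union> range (\<lambda>n. - int n))"
    by (rule summable_on_union)
  also have "range int \<union> range (\<lambda>n. - int n) = UNIV"
    by (auto, metis int_cases2 rangeI)
  finally show ?thesis .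
qed

lemma gauss_summable:
  fixes r e :: real
  assumes "0 < r" "r < 1" "0 < e"
  shows "(\<lambda>n::int. r powr (e * of_int n ^ 2)) summable_on UNIV"
proof -
  have *: "(\<lambda>n::nat. r powr (e * real n ^ 2)) summable_on UNIV"
  proof (rule summable_on_comparison_test)
    have "r powr e < 1" using assms by (simp add: powr01_less_one)
    then have "summable (\<lambda>n. (r powr e) ^ n)" by (intro summable_geometric) auto
    then show "(\<lambda>n. (r powr e) ^ n) summable_on UNIV"
      by (subst summable_on_UNIV_nonneg_real_iff) auto
    show "r powr (e * real n ^ 2) \<le> (r powr e) ^ n" for n
    proof -
      have "real n \<le> real n ^ 2"
        by (metis of_nat_mono of_nat_power power2_nat_le_imp_le order_refl power2_nat_le_eq_le le_square power2_eq_square)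
      then have "e * real n \<le> e * real n ^ 2" using assms by simp
      then have "r powr (e * real n ^ 2) \<le> r powr (e * real n)"
        using assms by (intro powr_mono') auto
      also have "\<dots> = (r powr e) ^ n"
        using assms by (simp add: powr_powr[symmetric] powr_realpow)
      finally show ?thesis .
    qed
  qed (use assms in auto)
  show ?thesis
    by (rule summable_on_int) (use * in auto)
qed

lemma abs_summable_gauss:
  fixes f :: "int \<Rightarrow> complex"
  assumes "0 < r" "r < 1" "0 < e" "\<And>n. norm (f n) \<le> C * r powr (e * of_int n ^ 2)"
  shows "(\<lambda>x. norm (f x)) summable_on UNIV"
  by (rule summable_on_comparison_test[OF summable_on_cmult_right[OF gauss_summable[OF assms(1-3)], of C]])
     (use assms(4) in auto)

lemma abs_summable_times:
  fixes f :: "'a \<Rightarrow> complex" and g :: "'b \<Rightarrow> complex"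
  assumes f: "(\<lambda>x. norm (f x)) summable_on UNIV" and g: "(\<lambda>x. norm (g x)) summable_on UNIV"
  shows "(\<lambda>x. norm (f (fst x) * g (snd x))) summable_on UNIV"
proof -
  have "(\<lambda>x. norm (f (fst x) * g (snd x))) summable_on (SIGMA x:UNIV. UNIV)"
  proof (rule summable_on_SigmaI)
    fix x
    show "((\<lambda>y. norm (f (fst (x, y)) * g (snd (x, y)))) has_sum norm (f x) * infsum (\<lambda>y. norm (g y)) UNIV) UNIV"
      unfolding fst_conv snd_conv norm_mult using g by (intro has_sum_cmult_right has_sum_infsum)
    show "(\<lambda>x. norm (f x) * infsum (\<lambda>y. norm (g y)) UNIV) summable_on UNIV"
      using f by (rule summable_on_cmult_left)
  qed auto
  then show ?thesis by simp
qed

text \<open>Fubini for an absolutely summable family, in the form in which a double series is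
  evaluated in two ways: the series of row sums and of column sums converge as part of the
  conclusion.\<close>

lemma has_sum_double:
  fixes f :: "'a \<times> 'b \<Rightarrow> complex"
  assumes f: "(\<lambda>x. norm (f x)) summable_on UNIV"
    and r: "\<And>x. ((\<lambda>y. f (x, y)) has_sum g x) UNIV"
    and c: "\<And>y. ((\<lambda>x. f (x, y)) has_sum h y) UNIV"
  obtains S where "(f has_sum S) UNIV" "(g has_sum S) UNIV" "(h has_sum S) UNIV"
proof
  have s: "f summable_on UNIV"
    using f by (rule abs_summable_summable)
  then show S: "(f has_sum infsum f UNIV) UNIV"
    by (rule has_sum_infsum)
  then have S1: "(f has_sum infsum f UNIV) (UNIV \<times> UNIV)" by simp
  then show "(g has_sum infsum f UNIV) UNIV"
    by (rule has_sum_SigmaD) (use r in auto)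
  have "((\<lambda>(x, y). f (y, x)) has_sum infsum f UNIV) (UNIV \<times> UNIV)"
    using S1 by (subst (asm) has_sum_swap)
  then show "(h has_sum infsum f UNIV) UNIV"
    by (rule has_sum_SigmaD) (use c in auto)
qed

lemma has_sum_times:
  fixes f :: "'a \<Rightarrow> complex" and g :: "'b \<Rightarrow> complex"
  assumes f: "(\<lambda>x. norm (f x)) summable_on UNIV" and g: "(\<lambda>x. norm (g x)) summable_on UNIV"
    and F: "(f has_sum F) UNIV" and G: "(g has_sum G) UNIV"
  shows "((\<lambda>x. f (fst x) * g (snd x)) has_sum F * G) UNIV"
proof -
  have r: "((\<lambda>y. f (fst (x, y)) * g (snd (x, y))) has_sum f x * G) UNIV" for x
    using has_sum_cmult_right[OF G] by simp
  have c: "((\<lambda>x. f (fst (x, y)) * g (snd (x, y))) has_sum F * g y) UNIV" for y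
    using has_sum_cmult_left[OF F] by simp
  obtain S where S: "((\<lambda>x. f (fst x) * g (snd x)) has_sum S) UNIV" "((\<lambda>x. f x * G) has_sum S) UNIV"
    by (rule has_sum_double[OF abs_summable_times[OF f g] r c])
  moreover have "((\<lambda>x. f x * G) has_sum F * G) UNIV"
    by (rule has_sum_cmult_left[OF F])
  ultimately have "S = F * G" by (intro has_sum_unique)
  with S show ?thesis by simp
qed

lemma abs_summable_gauss2:
  fixes f :: "int \<times> int \<Rightarrow> complex"
  assumes "0 < r" "r < 1" "0 < e"
    "\<And>m n. norm (f (m, n)) \<le> C * r powr (e * (of_int m ^ 2 + of_int n ^ 2))"
  shows "(\<lambda>x. norm (f x)) summable_on UNIV"
proof (rule summable_on_comparison_test)
  let ?g = "\<lambda>n::int. complex_of_real (r powr (e * of_int n ^ 2))"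
  have s: "(\<lambda>x. norm (?g x)) summable_on UNIV"
    using gauss_summable[OF assms(1-3)] by simp
  show "(\<lambda>x. C * norm (?g (fst x) * ?g (snd x))) summable_on UNIV"
    by (rule summable_on_cmult_right[OF abs_summable_times[OF s s]])
  show "norm (f x) \<le> C * norm (?g (fst x) * ?g (snd x))" if "x \<in> UNIV" for x
    using assms(4)[of "fst x" "snd x"] by (simp add: norm_mult powr_add[symmetric] ring_distribs)
qed auto

section \<open>Euler's expansion of the infinite product\<close>

lemma euler_summable:
  assumes q: "norm q < 1"
  shows "summable (\<lambda>n. norm ((-1) ^ n * q ^ (n choose 2) / qpoch_fin q q n * z ^ n))"
proof -
  let ?f = "\<lambda>n. (-1) ^ n * q ^ (n choose 2) / qpoch_fin q q n * z ^ n"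
  have "(\<lambda>n. norm z * norm q ^ n / norm (1 - q * q ^ n)) \<longlonglongrightarrow> norm z * 0 / norm (1 - q * 0)"
    by (intro tendsto_intros LIMSEQ_power_zero) (use q in auto)
  then have "(\<lambda>n. norm z * norm q ^ n / norm (1 - q * q ^ n)) \<longlonglongrightarrow> 0" by simp
  then have "eventually (\<lambda>n. norm z * norm q ^ n / norm (1 - q * q ^ n) < 1/2) sequentially"
    by (rule order_tendstoD) simp
  then obtain N where N: "\<And>n. n \<ge> N \<Longrightarrow> norm z * norm q ^ n / norm (1 - q * q ^ n) < 1/2"
    by (auto simp: eventually_sequentially)
  show ?thesis
  proof (rule summable_ratio_test)
    fix n assume n: "n \<ge> N"
    have "?f (Suc n) = - (z * q ^ n / (1 - q * q ^ n)) * ?f n"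
      by (simp add: qpoch_fin_Suc numeral_2_eq_2 power_add mult_ac)
    then have "norm (?f (Suc n)) = norm z * norm q ^ n / norm (1 - q * q ^ n) * norm (?f n)"
      by (simp only: norm_mult norm_minus_cancel norm_divide norm_power)
    also have "\<dots> \<le> 1/2 * norm (?f n)"
      using N[OF n] by (intro mult_right_mono) auto
    finally show "norm (norm (?f (Suc n))) \<le> 1/2 * norm (norm (?f n))" by simp
  qed simp
qed

text \<open>The coefficients satisfy c_(n+1) (1 - q^(n+1)) = - q^n c_n, which amounts to the
  functional equation S(z) = (1 - z) S(qz). Iterating it and using continuity of the power series at
  0, where S is 1, produces the infinite product.\<close>

lemma euler_sums:
  assumes q: "norm q < 1"
  shows "(\<lambda>n. (-1) ^ n * q ^ (n choose 2) / qpoch_fin q q n * z ^ n) sums qpoch_inf z q"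
proof -
  define c where "c = (\<lambda>n. (-1) ^ n * q ^ (n choose 2) / qpoch_fin q q n)"
  define S where "S = (\<lambda>z. \<Sum>n. c n * z ^ n)"
  have sm: "summable (\<lambda>n. c n * z ^ n)" for z
    using summable_norm_cancel[OF euler_summable[OF q]] by (simp add: c_def)
  have c_Suc: "c (Suc n) * (1 - q ^ Suc n) = - (q ^ n) * c n" for n
  proof -
    have "qpoch_fin q q (Suc n) \<noteq> 0" by (rule qpoch_fin_nonzero[OF q q])
    then have "1 - q * q ^ n \<noteq> 0" "qpoch_fin q q n \<noteq> 0" by (auto simp: qpoch_fin_Suc)
    then show ?thesis by (simp add: c_def qpoch_fin_Suc numeral_2_eq_2 power_add field_simps)
  qed
  have rec: "S z = (1 - z) * S (z * q)" for z
  proof -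
    have "(\<lambda>n. c n * z ^ n - c n * (z * q) ^ n) sums (S z - S (z * q))"
      unfolding S_def by (intro sums_diff summable_sums sm)
    moreover have "(\<lambda>n. c (Suc n) * z ^ Suc n - c (Suc n) * (z * q) ^ Suc n) sums (- z * S (z * q))"
    proof -
      have "(\<lambda>n. - z * (c n * (z * q) ^ n)) sums (- z * S (z * q))"
        unfolding S_def by (intro sums_mult summable_sums sm)
      moreover have "c (Suc n) * z ^ Suc n - c (Suc n) * (z * q) ^ Suc n = - z * (c n * (z * q) ^ n)" for n
      proof -
        have "c (Suc n) * z ^ Suc n - c (Suc n) * (z * q) ^ Suc n = (c (Suc n) * (1 - q ^ Suc n)) * z ^ Suc n"
          by (simp add: power_mult_distrib algebra_simps)
        also have "\<dots> = - z * (c n * (z * q) ^ n)"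
          unfolding c_Suc by (simp add: power_mult_distrib algebra_simps)
        finally show ?thesis .
      qed
      ultimately show ?thesis by (simp only:)
    qed
    then have "(\<lambda>n. c n * z ^ n - c n * (z * q) ^ n) sums (- z * S (z * q))"
      by (subst (asm) sums_Suc_iff) simp
    ultimately have "S z - S (z * q) = - z * S (z * q)" by (rule sums_unique2)
    then show ?thesis by (simp add: algebra_simps)
  qed
  have it: "S z = qpoch_fin z q n * S (z * q ^ n)" for n
  proof (induction n)
    case (Suc n)
    then show ?case using rec[of "z * q ^ n"] by (simp add: qpoch_fin_Suc mult_ac)
  qed simp
  have "isCont S 0"
    unfolding S_def by (rule isCont_powser[where K = 1]) (use sm[of 1] in auto)
  moreover have "(\<lambda>n. z * q ^ n) \<longlonglongrightarrow> 0"
    using tendsto_mult[OF tendsto_const LIMSEQ_power_zero[OF q], of z] by simp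
  ultimately have "(\<lambda>n. S (z * q ^ n)) \<longlonglongrightarrow> S 0"
    by (rule isCont_tendsto_compose)
  moreover have "S 0 = 1"
    unfolding S_def by (subst powser_zero) (simp add: c_def numeral_2_eq_2)
  ultimately have "(\<lambda>n. qpoch_fin z q n * S (z * q ^ n)) \<longlonglongrightarrow> qpoch_inf z q * 1"
    by (intro tendsto_mult qpoch_fin_LIMSEQ q) auto
  then have "(\<lambda>n. S z) \<longlonglongrightarrow> qpoch_inf z q"
    by (simp flip: it)
  then have "S z = qpoch_inf z q" by (simp add: LIMSEQ_const_iff)
  then show ?thesis using summable_sums[OF sm[of z]] by (simp add: S_def c_def)
qed

lemma int_choose_two: "int (n choose 2) = int n * (int n - 1) div 2"
proof (cases n)
  case (Suc m)
  have "(n * (n - 1)) div 2 = (Suc m * m) div 2" by (simp add: Suc)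
  then show ?thesis by (simp only: choose_two zdiv_int Suc) (simp add: algebra_simps)
qed simp

lemma euler_has_sum:
  assumes q: "norm q < 1" "q \<noteq> 0"
  shows "((\<lambda>n::int. (-z) powi n * q powi (n * (n - 1) div 2) * ipoch q n) has_sum qpoch_inf z q) UNIV"
    and "(\<lambda>n::int. norm ((-z) powi n * q powi (n * (n - 1) div 2) * ipoch q n)) summable_on UNIV"
proof -
  let ?f = "\<lambda>n::int. (-z) powi n * q powi (n * (n - 1) div 2) * ipoch q n"
  have eq: "?f (int n) = (-1) ^ n * q ^ (n choose 2) / qpoch_fin q q n * z ^ n" for n
    unfolding int_choose_two[symmetric] by (simp add: ipoch_nat power_minus[of z] field_simps)
  have "((\<lambda>n. ?f (int n)) has_sum qpoch_inf z q) UNIV"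
    unfolding eq by (rule norm_summable_imp_has_sum[OF euler_summable[OF q(1)] euler_sums[OF q(1)]])
  then show "(?f has_sum qpoch_inf z q) UNIV"
    by (rule has_sum_int_nonneg) auto
  then show "(\<lambda>n. norm (?f n)) summable_on UNIV"
    by (simp add: has_sum_imp_summable flip: summable_on_iff_abs_summable_on_complex)
qed

section \<open>Durfee and triple product identities\<close>

lemma has_sum_shift_int:
  fixes f :: "int \<Rightarrow> 'a :: {comm_monoid_add, topological_space}"
  shows "((\<lambda>n. f (n + c)) has_sum S) UNIV \<longleftrightarrow> (f has_sum S) UNIV"
  by (rule has_sum_reindex_bij_betw, rule bij_betwI[where g = "\<lambda>n. n - c"]) auto

lemma has_sum_reflect_int:
  fixes f :: "int \<Rightarrow> 'a :: {comm_monoid_add, topological_space}"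
  shows "((\<lambda>n. f (c - n)) has_sum S) UNIV \<longleftrightarrow> (f has_sum S) UNIV"
  by (rule has_sum_reindex_bij_betw, rule bij_betwI[where g = "\<lambda>n. c - n"]) auto

lemma has_sum_diff:
  fixes f g :: "'a \<Rightarrow> complex"
  assumes "(f has_sum a) A" "(g has_sum b) A"
  shows "((\<lambda>x. f x - g x) has_sum a - b) A"
  using has_sum_add[OF assms(1) has_sum_uminusI[OF assms(2)]] by simp

lemma two_tri: "2 * (n * (n - 1) div 2) = n * (n - 1 :: int)"
  by simp

text \<open>Summand of Durfee's rectangle identity: q^(n(n+s)) counts a rectangle with sides n and n
  + s, the two reciprocals count the partitions beside and below it. The shift \<open>s\<close> may
  be negative; the summand then vanishes for n < -s.\<close>

definition durfee_term :: "complex \<Rightarrow> int \<Rightarrow> int \<Rightarrow> complex" where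
  "durfee_term q s n = q powi (n\<^sup>2 + s * n) * ipoch q n * ipoch q (n + s)"

lemma durfee_term_bound:
  assumes q: "norm q < 1" "q \<noteq> 0" and C: "\<And>k. norm (ipoch q k) \<le> C"
    and e: "n \<ge> 0 \<Longrightarrow> e \<le> of_int (n\<^sup>2 + s * n)"
  shows "norm (durfee_term q s n) \<le> C\<^sup>2 * norm q powr e"
proof (cases "n \<ge> 0")
  case True
  have C0: "0 \<le> C" using C[of 0] by simp
  have "norm (durfee_term q s n) = norm q powr (of_int (n\<^sup>2 + s * n)) * norm (ipoch q n) * norm (ipoch q (n + s))"
    unfolding durfee_term_def norm_mult norm_power_int_powr[OF q(2)] ..
  also have "\<dots> \<le> norm q powr e * C * C"
    using e[OF True] q C0 by (intro mult_mono C powr_mono') auto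
  finally show ?thesis by (simp add: power2_eq_square mult_ac)
qed (simp add: durfee_term_def)

lemma durfee_summable:
  assumes q: "norm q < 1" "q \<noteq> 0"
  shows "(\<lambda>n. norm (durfee_term q s n)) summable_on UNIV"
proof -
  obtain C where C: "C > 0" "\<And>k. norm (ipoch q k) \<le> C" by (rule ipoch_bounded[OF q(1)]) (rule that)
  show ?thesis
  proof (rule abs_summable_gauss[where r = "norm q" and e = "1/2" and C = "C\<^sup>2 * norm q powr (- (of_int s)\<^sup>2 / 2)"])
    fix n
    have "norm (durfee_term q s n) \<le> C\<^sup>2 * norm q powr (- (of_int s)\<^sup>2 / 2 + 1/2 * (of_int n)\<^sup>2)"
    proof (rule durfee_term_bound[OF q C(2)])
      have "0 \<le> (of_int n + of_int s :: real)\<^sup>2" by simp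
      then show "- (of_int s)\<^sup>2 / 2 + 1/2 * (of_int n)\<^sup>2 \<le> (of_int (n\<^sup>2 + s * n) :: real)"
        by (simp add: power2_sum field_simps)
    qed
    then show "norm (durfee_term q s n) \<le> C\<^sup>2 * norm q powr (- (of_int s)\<^sup>2 / 2) * norm q powr (1/2 * (of_int n)\<^sup>2)"
      unfolding powr_add by (simp only: mult_ac)
  qed (use q in auto)
qed

text \<open>Over the common factor \<open>ipoch q n * ipoch q (n + s + 1)\<close> the difference of
  the summands for s and s + 1 carries 1 - q^n - q^(n+s+1). The part 1 - q^n lowers the index of the
  first reciprocal and becomes, after n -> n + 1, q^(s+1) times the summand for s + 2; the rest is -
  q^(s+1) times the summand for s + 1.\<close>

lemma durfee_rec:
  assumes q: "norm q < 1" "q \<noteq> 0"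
  defines "D \<equiv> \<lambda>s. infsum (durfee_term q s) UNIV"
  shows "D s - D (s + 1) = - (q powi (s + 1)) * (D (s + 1) - D (s + 2))"
proof -
  have D: "(durfee_term q s has_sum D s) UNIV" for s
    unfolding D_def using has_sum_infsum[OF abs_summable_summable[OF durfee_summable[OF q, of s]]] .
  have "((\<lambda>n. q powi (s + 1) * durfee_term q (s + 2) n) has_sum q powi (s + 1) * D (s + 2)) UNIV"
    by (intro has_sum_cmult_right D)
  moreover have "q powi (s + 1) * durfee_term q (s + 2) n =
      q powi ((n + 1)\<^sup>2 + s * (n + 1)) * ipoch q (n + 1 - 1) * ipoch q ((n + 1) + s + 1)" for n
  proof -
    have "(n + 1)\<^sup>2 + s * (n + 1) = (s + 1) + (n\<^sup>2 + (s + 2) * n)"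
      by (simp add: power2_eq_square algebra_simps)
    then show ?thesis
      by (simp add: durfee_term_def power_int_add q(2) algebra_simps)
  qed
  ultimately have "((\<lambda>n. q powi ((n + 1)\<^sup>2 + s * (n + 1)) * ipoch q (n + 1 - 1) * ipoch q ((n + 1) + s + 1))
      has_sum q powi (s + 1) * D (s + 2)) UNIV" by (simp only:)
  then have w: "((\<lambda>n. q powi (n\<^sup>2 + s * n) * ipoch q (n - 1) * ipoch q (n + s + 1))
      has_sum q powi (s + 1) * D (s + 2)) UNIV"
    by (rule has_sum_shift_int[where c = 1, THEN iffD1])
  have "((\<lambda>n. q powi (n\<^sup>2 + s * n) * ipoch q (n - 1) * ipoch q (n + s + 1) - q powi (s + 1) * durfee_term q (s + 1) n)
      has_sum q powi (s + 1) * D (s + 2) - q powi (s + 1) * D (s + 1)) UNIV"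
    by (intro has_sum_diff w has_sum_cmult_right D)
  moreover have "q powi (n\<^sup>2 + s * n) * ipoch q (n - 1) * ipoch q (n + s + 1) - q powi (s + 1) * durfee_term q (s + 1) n
      = durfee_term q s n - durfee_term q (s + 1) n" for n
  proof -
    have "ipoch q (n + s) = (1 - q powi (n + s + 1)) * ipoch q (n + s + 1)"
      using ipoch_pred[OF q, of "n + s + 1"] by simp
    moreover have "n\<^sup>2 + (s + 1) * n = (n\<^sup>2 + s * n) + n" by (simp add: algebra_simps)
    moreover have "n + (s + 1) = n + s + 1" by simp
    ultimately show ?thesis
      unfolding durfee_term_def ipoch_pred[OF q, of n]
      by (simp add: power_int_add q(2)) (simp add: algebra_simps)
  qed
  ultimately have "((\<lambda>n. durfee_term q s n - durfee_term q (s + 1) n)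
      has_sum q powi (s + 1) * D (s + 2) - q powi (s + 1) * D (s + 1)) UNIV" by (simp only:)
  moreover have "((\<lambda>n. durfee_term q s n - durfee_term q (s + 1) n) has_sum D s - D (s + 1)) UNIV"
    by (intro has_sum_diff D)
  ultimately have "D s - D (s + 1) = q powi (s + 1) * D (s + 2) - q powi (s + 1) * D (s + 1)"
    using has_sum_unique by blast
  then show ?thesis by (simp add: algebra_simps)
qed

text \<open>By the recurrence a difference of consecutive sums is at most |q|^N times a difference
  further out. All sums are bounded by one constant \<open>K\<close>, so the differences vanish and
  the sum does not depend on \<open>s\<close>. As s tends to infinity only the term n = 0 survives,
  which tends to 1/(q;q).\<close>

lemma durfee_nonneg:
  assumes q: "norm q < 1" "q \<noteq> 0"
  shows "infsum (durfee_term q (int s)) UNIV = inverse (qpoch_inf q q)"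
proof -
  define D where "D = (\<lambda>s. infsum (durfee_term q (int s)) UNIV)"
  obtain C where C: "C > 0" "\<And>k. norm (ipoch q k) \<le> C" by (rule ipoch_bounded[OF q(1)]) (rule that)
  have r: "0 < norm q" "norm q < 1" using q by auto
  define K where "K = C\<^sup>2 * infsum (\<lambda>n::int. norm q powr (1 * (of_int n)\<^sup>2)) UNIV"
  have K: "((\<lambda>n::int. C\<^sup>2 * norm q powr (1 * (of_int n)\<^sup>2)) has_sum K) UNIV"
    unfolding K_def by (intro has_sum_cmult_right has_sum_infsum gauss_summable r) simp
  have Ds: "(durfee_term q (int s) has_sum D s) UNIV" for s
    unfolding D_def using has_sum_infsum[OF abs_summable_summable[OF durfee_summable[OF q, of "int s"]]] .
  have bnd: "norm (D s) \<le> K" for s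
  proof (rule norm_infsum_le[OF Ds K])
    show "norm (durfee_term q (int s) n) \<le> C\<^sup>2 * norm q powr (1 * (of_int n)\<^sup>2)" for n
      by (rule durfee_term_bound[OF q C(2)]) simp
  qed
  have bnd0: "norm (D s - ipoch q (int s)) \<le> norm q ^ s * K" for s
  proof (rule norm_infsum_le)
    have "((\<lambda>n. durfee_term q (int s) n - (if n = 0 then ipoch q (int s) else 0)) has_sum
        D s - ipoch q (int s)) UNIV"
    proof (rule has_sum_diff)
      show "(durfee_term q (int s) has_sum D s) UNIV" by (rule Ds)
      have "((\<lambda>n::int. if n = 0 then ipoch q (int s) else 0) has_sum ipoch q (int s)) {0}"
        using has_sum_finite[of "{0::int}" "\<lambda>n. if n = 0 then ipoch q (int s) else 0"] by simp
      then show "((\<lambda>n::int. if n = 0 then ipoch q (int s) else 0) has_sum ipoch q (int s)) UNIV"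
        by (rule has_sum_cong_neutral[THEN iffD1, rotated -1]) auto
    qed
    then show "((\<lambda>n. durfee_term q (int s) n - (if n = 0 then ipoch q (int s) else 0)) has_sum
        D s - ipoch q (int s)) UNIV" .
    show "((\<lambda>n::int. norm q ^ s * (C\<^sup>2 * norm q powr (1 * (of_int n)\<^sup>2))) has_sum norm q ^ s * K) UNIV"
      by (intro has_sum_cmult_right K)
    fix n :: int
    show "norm (durfee_term q (int s) n - (if n = 0 then ipoch q (int s) else 0)) \<le>
        norm q ^ s * (C\<^sup>2 * norm q powr (1 * (of_int n)\<^sup>2))"
    proof (cases "n = 0")
      case True
      then show ?thesis using C by (simp add: durfee_term_def)
    next
      case False
      have "norm (durfee_term q (int s) n) \<le> C\<^sup>2 * norm q powr (real s + 1 * (of_int n)\<^sup>2)"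
      proof (rule durfee_term_bound[OF q C(2)])
        assume "0 \<le> n"
        then have "int s * 1 \<le> int s * n" using False by (intro mult_left_mono) auto
        then have "of_int (int s + n\<^sup>2) \<le> (of_int (n\<^sup>2 + int s * n) :: real)"
          by (subst of_int_le_iff) simp
        then show "real s + 1 * (of_int n)\<^sup>2 \<le> (of_int (n\<^sup>2 + int s * n) :: real)" by simp
      qed
      then show ?thesis using False r by (simp add: powr_add powr_realpow mult_ac)
    qed
  qed
  have step: "norm (D s - D (Suc s)) \<le> norm q * norm (D (Suc s) - D (Suc (Suc s)))" for s
  proof -
    have "D s - D (Suc s) = - (q powi (int s + 1)) * (D (Suc s) - D (Suc (Suc s)))"
      using durfee_rec[OF q, of "int s"] by (simp add: D_def add_ac)
    also have "norm \<dots> = norm q ^ Suc s * norm (D (Suc s) - D (Suc (Suc s)))"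
      by (simp add: norm_mult norm_power_int norm_power power_int_add r(1) mult_ac q(2))
    also have "\<dots> \<le> norm q ^ 1 * norm (D (Suc s) - D (Suc (Suc s)))"
      by (intro mult_right_mono power_decreasing) (use r in auto)
    finally show ?thesis by simp
  qed
  have "norm (D s - D (Suc s)) \<le> norm q ^ N * norm (D (s + N) - D (Suc (s + N)))" for s N
  proof (induction N arbitrary: s)
    case (Suc N)
    have "norm (D s - D (Suc s)) \<le> norm q * norm (D (Suc s) - D (Suc (Suc s)))" by (rule step)
    also have "\<dots> \<le> norm q * (norm q ^ N * norm (D (Suc s + N) - D (Suc (Suc s + N))))"
      by (intro mult_left_mono Suc.IH) auto
    finally show ?case by simp
  qed simp
  also have "norm q ^ N * norm (D (s + N) - D (Suc (s + N))) \<le> norm q ^ N * (K + K)" for s N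
    by (intro mult_left_mono order_trans[OF norm_triangle_ineq4] add_mono bnd) auto
  finally have le: "norm (D s - D (Suc s)) \<le> norm q ^ N * (K + K)" for s N .
  have "(\<lambda>N. norm q ^ N * (K + K)) \<longlonglongrightarrow> 0 * (K + K)"
    by (intro tendsto_intros LIMSEQ_power_zero) (use r in auto)
  then have "norm (D s - D (Suc s)) \<le> 0" for s
    using LIMSEQ_le_const[of "\<lambda>N. norm q ^ N * (K + K)" 0 "norm (D s - D (Suc s))"] le by auto
  then have "D (Suc s) = D s" for s by (metis norm_le_zero_iff right_minus_eq)
  then have const: "D s = D 0" for s by (induction s) auto
  have "(\<lambda>s. norm q ^ s * K) \<longlonglongrightarrow> 0 * K"
    by (intro tendsto_intros LIMSEQ_power_zero) (use r in auto)
  then have lim0: "(\<lambda>s. norm q ^ s * K) \<longlonglongrightarrow> 0" by simp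
  have "\<forall>\<^sub>F s in sequentially. norm (D s - ipoch q (int s)) \<le> norm q ^ s * K"
    by (intro always_eventually allI bnd0)
  then have "(\<lambda>s. D s - ipoch q (int s)) \<longlonglongrightarrow> 0"
    by (rule Lim_null_comparison[OF _ lim0])
  from tendsto_add[OF this ipoch_LIMSEQ[OF q(1)]] have "D \<longlonglongrightarrow> inverse (qpoch_inf q q)" by simp
  moreover have "D \<longlonglongrightarrow> D 0"
  proof -
    have "D = (\<lambda>_. D 0)" by (rule ext) (rule const)
    then show ?thesis by (metis tendsto_const)
  qed
  ultimately have "D 0 = inverse (qpoch_inf q q)" using LIMSEQ_unique by blast
  then show ?thesis using const[of s] by (simp add: D_def)
qed

lemma durfee:
  assumes q: "norm q < 1" "q \<noteq> 0"
  shows "(durfee_term q s has_sum inverse (qpoch_inf q q)) UNIV"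
proof -
  have pos: "(durfee_term q (int s) has_sum inverse (qpoch_inf q q)) UNIV" for s
    using has_sum_infsum[OF abs_summable_summable[OF durfee_summable[OF q, of "int s"]]] durfee_nonneg[OF q, of s] by simp
  show ?thesis
  proof (cases "s \<ge> 0")
    case True
    then show ?thesis using pos[of "nat s"] by simp
  next
    case False
    \<comment> \<open>For s < 0 the shift n -> n - s exchanges the two reciprocals and turns the
      exponent n^2 + sn into n^2 - sn.\<close>
    have "durfee_term q (int (nat (-s))) n = durfee_term q s (n - s)" for n
    proof -
      have "(n - s)\<^sup>2 + s * (n - s) = n\<^sup>2 + (-s) * n" by (simp add: power2_eq_square algebra_simps)
      then show ?thesis using False by (simp add: durfee_term_def mult_ac)
    qed
    then have "((\<lambda>n. durfee_term q s (n + (-s))) has_sum inverse (qpoch_inf q q)) UNIV"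
      using pos[of "nat (-s)"] by (subst (asm) has_sum_cong[where g = "\<lambda>n. durfee_term q s (n + (-s))"]) simp_all
    then show ?thesis by (rule has_sum_shift_int[THEN iffD1])
  qed
qed

text \<open>Multiply Euler's expansions of (z;q) and (q/z;q), with indices a and b, and sort by n =
  a - b. The powers of z collect to (-z)^n, and for fixed n the sum over b is Durfee's identity with
  shift n, whose value 1/(q;q) is the same for all n.\<close>

theorem jacobi_triple_product:
  assumes q: "norm q < 1" "q \<noteq> 0" and z: "z \<noteq> 0"
  shows "((\<lambda>n::int. (-z) powi n * q powi (n * (n - 1) div 2)) has_sum
           qpoch_inf q q * qpoch_inf z q * qpoch_inf (q / z) q) UNIV"
proof -
  define E where "E = (\<lambda>z (n::int). (-z) powi n * q powi (n * (n - 1) div 2) * ipoch q n)"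
  have "((\<lambda>x. E z (fst x) * E (q / z) (snd x)) has_sum qpoch_inf z q * qpoch_inf (q / z) q) UNIV"
    unfolding E_def by (intro has_sum_times euler_has_sum q)
  moreover have bij: "bij_betw (\<lambda>x::int \<times> int. (fst x + snd x, snd x)) UNIV UNIV"
    by (rule bij_betwI[where g = "\<lambda>x. (fst x - snd x, snd x)"]) auto
  ultimately have "((\<lambda>x. E z (fst x + snd x) * E (q / z) (snd x)) has_sum qpoch_inf z q * qpoch_inf (q / z) q) UNIV"
    using has_sum_reindex_bij_betw[OF bij, of "\<lambda>x. E z (fst x) * E (q / z) (snd x)"] by simp
  moreover have "E z (fst x + snd x) * E (q / z) (snd x) =
      (-z) powi (fst x) * q powi (fst x * (fst x - 1) div 2) * durfee_term q (fst x) (snd x)" for x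
  proof (cases x)
    case (Pair n b)
    define t where "t = (\<lambda>n::int. n * (n - 1) div 2)"
    have "2 * (t (n + b) + t b + b) = 2 * (t n + (b\<^sup>2 + n * b))"
      unfolding distrib_left t_def two_tri by (simp add: power2_eq_square algebra_simps)
    then have e: "t (n + b) + t b + b = t n + (b\<^sup>2 + n * b)" by simp
    have zz: "(-z) powi (n + b) * (- (q / z)) powi b = (-z) powi n * q powi b"
      using z by (simp add: power_int_add power_int_divide_distrib flip: power_int_mult_distrib)
    have "E z (n + b) * E (q / z) b = ((-z) powi (n + b) * (- (q / z)) powi b) *
        (q powi t (n + b) * q powi t b) * ipoch q b * ipoch q (b + n)"
      unfolding E_def t_def by (simp add: mult_ac add_ac)
    also have "\<dots> = (-z) powi n * q powi (t (n + b) + t b + b) * ipoch q b * ipoch q (b + n)"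
      unfolding zz by (simp add: power_int_add q(2) mult_ac)
    also have "\<dots> = (-z) powi n * q powi (t n) * durfee_term q n b"
      unfolding e by (simp add: power_int_add q(2) durfee_term_def mult_ac)
    finally show ?thesis by (simp add: Pair t_def)
  qed
  ultimately have "((\<lambda>x. (-z) powi (fst x) * q powi (fst x * (fst x - 1) div 2) * durfee_term q (fst x) (snd x))
      has_sum qpoch_inf z q * qpoch_inf (q / z) q) (UNIV \<times> UNIV)" by simp
  then have "((\<lambda>n. (-z) powi n * q powi (n * (n - 1) div 2) * inverse (qpoch_inf q q))
      has_sum qpoch_inf z q * qpoch_inf (q / z) q) UNIV"
    by (rule has_sum_SigmaD) (auto intro!: has_sum_cmult_right durfee q)
  from has_sum_cmult_left[OF this, of "qpoch_inf q q"] show ?thesis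
    using qpoch_inf_nonzero[OF q(1) q(1)] by (simp add: mult.assoc) (simp add: mult_ac)
qed

section \<open>Rogers-Ramanujan type identities\<close>

lemma powi_split: "(q::complex) \<noteq> 0 \<Longrightarrow> c = a + b \<Longrightarrow> q powi c = q powi a * q powi b"
  by (simp add: power_int_add)

lemma has_sum_finite_support:
  fixes f :: "int \<Rightarrow> complex"
  assumes "\<And>j. j \<notin> {a..b} \<Longrightarrow> f j = 0"
  shows "(f has_sum infsum f UNIV) UNIV"
proof (rule has_sum_infsum, rule finite_nonzero_values_imp_summable_on)
  have "{j \<in> UNIV. f j \<noteq> 0} \<subseteq> {a..b}" using assms by blast
  then show "finite {j \<in> UNIV. f j \<noteq> 0}" by (rule finite_subset) simp
qed

text \<open>The exponents 6j^2 + j and 6j^2 + 5j + 1 are the generalised pentagonal numbers of even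
  and of odd index, with their signs. For d = 0 and d = 1 the sum over \<open>j\<close> is
  1/(q;q)_(2n+d), see \<open>burge_int\<close>; in the language of Bailey pairs, these reciprocals
  correspond to coefficients supported on the indices 3j and 3j + 1.\<close>

definition burge :: "complex \<Rightarrow> int \<Rightarrow> int \<Rightarrow> int \<Rightarrow> complex" where
  "burge q d n j = q powi (6 * j\<^sup>2 + j) * ipoch q (n - 3 * j) * ipoch q (n + d + 3 * j)
     - q powi (6 * j\<^sup>2 + 5 * j + 1) * ipoch q (n - 3 * j - 1) * ipoch q (n + d + 3 * j + 1)"

lemma burge_support: "j \<notin> {- \<bar>n\<bar> - \<bar>d\<bar> - 1..\<bar>n\<bar>} \<Longrightarrow> burge q d n j = 0"
  by (auto simp: burge_def)

lemma burge_has_sum: "(burge q d n has_sum infsum (burge q d n) UNIV) UNIV"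
  by (rule has_sum_finite_support[where a = "- \<bar>n\<bar> - \<bar>d\<bar> - 1" and b = "\<bar>n\<bar>"]) (rule burge_support)

text \<open>Write 1 - q^(2n+1) as (1 - A) + A (1 - B) with A = q^(n+3j+1) and B = q^(n-3j). On the
  first family the part 1 - A lowers a reciprocal as desired, and the part A (1 - B) leaves the
  error \<open>e j\<close>. The second family, treated alike, leaves the same error at the reflected
  index -1 - j with the opposite sign, so the errors cancel in the sum over all
  \<open>j\<close>.\<close>

lemma burge_odd:
  assumes q: "norm q < 1" "q \<noteq> 0"
  shows "(1 - q powi (2 * n + 1)) * infsum (burge q 1 n) UNIV = infsum (burge q 0 n) UNIV"
proof -
  define e where "e = (\<lambda>j. q powi (6 * j\<^sup>2 + 4 * j + n + 1) * ipoch q (n - 3 * j - 1) * ipoch q (n + 3 * j + 1))"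
  have pred: "ipoch q (k - 1) = (1 - q powi k) * ipoch q k" for k
    by (rule ipoch_pred[OF q])
  have eq: "(1 - q powi (2 * n + 1)) * burge q 1 n j = burge q 0 n j + (e j - e (- 1 - j))" for j
  proof -
    have 1: "ipoch q (n + 3 * j) = (1 - q powi (n + 3 * j + 1)) * ipoch q (n + 3 * j + 1)"
      using pred[of "n + 3 * j + 1"] by simp
    have 2: "ipoch q (n + 3 * j + 1) = (1 - q powi (n + 3 * j + 2)) * ipoch q (n + 3 * j + 2)"
      using pred[of "n + 3 * j + 2"] by (simp add: algebra_simps)
    have 3: "ipoch q (n - 3 * j - 2) = (1 - q powi (n - 3 * j - 1)) * ipoch q (n - 3 * j - 1)"
      using pred[of "n - 3 * j - 1"] by simp
    have A: "(1 - q powi (2 * n + 1)) * (q powi (6 * j\<^sup>2 + j) * ipoch q (n - 3 * j) * ipoch q (n + 3 * j + 1))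
      = q powi (6 * j\<^sup>2 + j) * ipoch q (n - 3 * j) * ipoch q (n + 3 * j) + e j"
    proof -
      have x1: "q powi (6 * j\<^sup>2 + 4 * j + n + 1) = q powi (6 * j\<^sup>2 + j) * q powi (n + 3 * j + 1)"
        and x2: "q powi (2 * n + 1) = q powi (n + 3 * j + 1) * q powi (n - 3 * j)"
        by (rule powi_split[OF q(2)], simp)+
      show ?thesis unfolding e_def 1 pred[of "n - 3 * j"] x1 x2 by (simp add: algebra_simps)
    qed
    have B: "(1 - q powi (2 * n + 1)) * (q powi (6 * j\<^sup>2 + 5 * j + 1) * ipoch q (n - 3 * j - 1) * ipoch q (n + 3 * j + 2))
      = q powi (6 * j\<^sup>2 + 5 * j + 1) * ipoch q (n - 3 * j - 1) * ipoch q (n + 3 * j + 1) + e (- 1 - j)"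
    proof -
      have "6 * (- 1 - j)\<^sup>2 + 4 * (- 1 - j) + n + 1 = (6 * j\<^sup>2 + 5 * j + 1) + (n + 3 * j + 2)"
        by (simp add: power2_eq_square algebra_simps)
      then have x1: "q powi (6 * (- 1 - j)\<^sup>2 + 4 * (- 1 - j) + n + 1) = q powi (6 * j\<^sup>2 + 5 * j + 1) * q powi (n + 3 * j + 2)"
        by (rule powi_split[OF q(2)])
      have x2: "q powi (2 * n + 1) = q powi (n + 3 * j + 2) * q powi (n - 3 * j - 1)"
        by (intro powi_split[OF q(2)]) simp
      have x3: "n - 3 * (- 1 - j) - 1 = n + 3 * j + 2" "n + 3 * (- 1 - j) + 1 = n - 3 * j - 2" by simp_all
      show ?thesis unfolding e_def x1 x2 x3 3 2 by (simp add: algebra_simps)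
    qed
    have x4: "n + 1 + 3 * j = n + 3 * j + 1" "n + 3 * j + 1 + 1 = n + 3 * j + 2" by simp_all
    show ?thesis
      unfolding burge_def x4 right_diff_distrib A B by (simp add: algebra_simps)
  qed
  have supp: "j \<notin> {- \<bar>n\<bar> - 1..\<bar>n\<bar>} \<Longrightarrow> e j = 0" for j by (auto simp: e_def)
  have e: "(e has_sum infsum e UNIV) UNIV"
    by (rule has_sum_finite_support[OF supp])
  have e': "((\<lambda>j. e (- 1 - j)) has_sum infsum e UNIV) UNIV"
    using e by (subst has_sum_reflect_int)
  have "((\<lambda>j. burge q 0 n j + (e j - e (- 1 - j))) has_sum
      (infsum (burge q 0 n) UNIV + (infsum e UNIV - infsum e UNIV))) UNIV"
    by (rule has_sum_add[OF burge_has_sum has_sum_diff[OF e e']])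
  moreover have "((\<lambda>j. (1 - q powi (2 * n + 1)) * burge q 1 n j) has_sum
      (1 - q powi (2 * n + 1)) * infsum (burge q 1 n) UNIV) UNIV"
    by (rule has_sum_cmult_right[OF burge_has_sum])
  ultimately show ?thesis unfolding eq using has_sum_unique by fastforce
qed

text \<open>The companion step from 2n - 1 to 2n, by the same splitting of 1 - q^(2n); here the
  error of the second family is that of the first at -j.\<close>

lemma burge_even:
  assumes q: "norm q < 1" "q \<noteq> 0"
  shows "(1 - q powi (2 * n)) * infsum (burge q 0 n) UNIV = infsum (burge q 1 (n - 1)) UNIV"
proof -
  define e where "e = (\<lambda>j. q powi (6 * j\<^sup>2 - 2 * j + n) * ipoch q (n - 3 * j) * ipoch q (n + 3 * j - 1))"
  have pred: "ipoch q (k - 1) = (1 - q powi k) * ipoch q k" for k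
    by (rule ipoch_pred[OF q])
  have eq: "(1 - q powi (2 * n)) * burge q 0 n j = burge q 1 (n - 1) j + (e j - e (0 - j))" for j
  proof -
    have 3: "ipoch q (n - 3 * j - 2) = (1 - q powi (n - 3 * j - 1)) * ipoch q (n - 3 * j - 1)"
      using pred[of "n - 3 * j - 1"] by simp
    have 4: "ipoch q (n + 3 * j) = (1 - q powi (n + 3 * j + 1)) * ipoch q (n + 3 * j + 1)"
      using pred[of "n + 3 * j + 1"] by simp
    have A: "(1 - q powi (2 * n)) * (q powi (6 * j\<^sup>2 + j) * ipoch q (n - 3 * j) * ipoch q (n + 3 * j))
      = q powi (6 * j\<^sup>2 + j) * ipoch q (n - 3 * j - 1) * ipoch q (n + 3 * j) + e j"
    proof -
      have x1: "q powi (6 * j\<^sup>2 - 2 * j + n) = q powi (6 * j\<^sup>2 + j) * q powi (n - 3 * j)"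
        and x2: "q powi (2 * n) = q powi (n + 3 * j) * q powi (n - 3 * j)"
        by (rule powi_split[OF q(2)], simp)+
      show ?thesis unfolding e_def pred[of "n + 3 * j"] pred[of "n - 3 * j"] x1 x2 by (simp add: algebra_simps)
    qed
    have B: "(1 - q powi (2 * n)) * (q powi (6 * j\<^sup>2 + 5 * j + 1) * ipoch q (n - 3 * j - 1) * ipoch q (n + 3 * j + 1))
      = q powi (6 * j\<^sup>2 + 5 * j + 1) * ipoch q (n - 3 * j - 2) * ipoch q (n + 3 * j + 1) + e (0 - j)"
    proof -
      have x1: "q powi (6 * (0 - j)\<^sup>2 - 2 * (0 - j) + n) = q powi (6 * j\<^sup>2 + 5 * j + 1) * q powi (n - 3 * j - 1)"
        and x2: "q powi (2 * n) = q powi (n + 3 * j + 1) * q powi (n - 3 * j - 1)"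
        by (rule powi_split[OF q(2)], simp)+
      have x3: "n - 3 * (0 - j) = n + 3 * j" "n + 3 * (0 - j) - 1 = n - 3 * j - 1" by simp_all
      show ?thesis unfolding e_def x1 x2 x3 3 4 by (simp add: algebra_simps)
    qed
    have x4: "n - 1 - 3 * j = n - 3 * j - 1" "n - 1 + 1 + 3 * j = n + 3 * j" "n - 3 * j - 1 - 1 = n - 3 * j - 2"
      "n + 0 + 3 * j = n + 3 * j" by simp_all
    show ?thesis
      unfolding burge_def x4 right_diff_distrib A B by (simp add: algebra_simps)
  qed
  have supp: "j \<notin> {- \<bar>n\<bar> - 1..\<bar>n\<bar>} \<Longrightarrow> e j = 0" for j by (auto simp: e_def)
  have e: "(e has_sum infsum e UNIV) UNIV"
    by (rule has_sum_finite_support[OF supp])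
  have e': "((\<lambda>j. e (0 - j)) has_sum infsum e UNIV) UNIV"
    using e by (subst has_sum_reflect_int)
  have "((\<lambda>j. burge q 1 (n - 1) j + (e j - e (0 - j))) has_sum
      (infsum (burge q 1 (n - 1)) UNIV + (infsum e UNIV - infsum e UNIV))) UNIV"
    by (rule has_sum_add[OF burge_has_sum has_sum_diff[OF e e']])
  moreover have "((\<lambda>j. (1 - q powi (2 * n)) * burge q 0 n j) has_sum
      (1 - q powi (2 * n)) * infsum (burge q 0 n) UNIV) UNIV"
    by (rule has_sum_cmult_right[OF burge_has_sum])
  ultimately show ?thesis unfolding eq using has_sum_unique by fastforce
qed

lemma one_minus_powi_nonzero:
  assumes q: "norm q < 1" "q \<noteq> (0::complex)" and "k > 0"
  shows "1 - q powi k \<noteq> 0"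
proof
  assume "1 - q powi k = 0"
  then have "norm (q powi k) = 1" by simp
  moreover have "norm (q powi k) < 1"
    using assms by (simp add: power_int_def norm_power power_less_one_iff)
  ultimately show False by simp
qed

text \<open>The recurrences lead from 2n to 2n + 1 and on to 2n + 2 with the same nonzero factors 1
  - q^k that relate consecutive values of \<open>ipoch\<close>. For n = 0 only the term j = 0
  survives.\<close>

lemma burge_nat:
  assumes q: "norm q < 1" "q \<noteq> 0"
  shows "infsum (burge q 0 (int n)) UNIV = ipoch q (2 * int n) \<and>
         infsum (burge q 1 (int n)) UNIV = ipoch q (2 * int n + 1)"
proof -
  have odd: "infsum (burge q 1 (int n)) UNIV = ipoch q (2 * int n + 1)"
    if "infsum (burge q 0 (int n)) UNIV = ipoch q (2 * int n)" for n
  proof -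
    have "(1 - q powi (2 * int n + 1)) * infsum (burge q 1 (int n)) UNIV =
        (1 - q powi (2 * int n + 1)) * ipoch q (2 * int n + 1)"
      using burge_odd[OF q, of "int n"] that ipoch_pred[OF q, of "2 * int n + 1"] by simp
    then show ?thesis using one_minus_powi_nonzero[OF q, of "2 * int n + 1"] by simp
  qed
  have "infsum (burge q 0 (int n)) UNIV = ipoch q (2 * int n)" for n
  proof (induction n)
    case 0
    have "burge q 0 0 j = (if j = 0 then 1 else 0)" for j
      by (cases "j > 0"; cases "j = 0") (auto simp: burge_def)
    then have "infsum (burge q 0 0) UNIV = infsum (\<lambda>j::int. if j = 0 then 1 else 0) UNIV" by presburger
    also have "\<dots> = infsum (\<lambda>j::int. 1) {0}" by (rule infsum_cong_neutral) auto
    finally show ?case by simp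
  next
    case (Suc n)
    have "int (Suc n) - 1 = int n" "2 * int (Suc n) - 1 = 2 * int n + 1" by simp_all
    then have "(1 - q powi (2 * int (Suc n))) * infsum (burge q 0 (int (Suc n))) UNIV =
        (1 - q powi (2 * int (Suc n))) * ipoch q (2 * int (Suc n))"
      using burge_even[OF q, of "int (Suc n)"] odd[OF Suc] ipoch_pred[OF q, of "2 * int (Suc n)"]
      by (simp only:)
    then show ?case using one_minus_powi_nonzero[OF q, of "2 * int (Suc n)"] by simp
  qed
  then show ?thesis using odd by blast
qed

lemma burge_int:
  assumes q: "norm q < 1" "q \<noteq> 0"
  shows "(burge q 0 n has_sum ipoch q (2 * n)) UNIV"
    and "(burge q 1 n has_sum ipoch q (2 * n + 1)) UNIV"
proof -
  have "infsum (burge q 0 n) UNIV = ipoch q (2 * n) \<and> infsum (burge q 1 n) UNIV = ipoch q (2 * n + 1)"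
  proof (cases "n \<ge> 0")
    case True
    then show ?thesis using burge_nat[OF q, of "nat n"] by simp
  next
    case False
    have "burge q 0 n j = 0" "burge q 1 n j = 0" for j
      using False by (cases "j \<ge> 0"; auto simp: burge_def)+
    then have "burge q 0 n = (\<lambda>_. 0)" "burge q 1 n = (\<lambda>_. 0)" by auto
    then show ?thesis using False by simp
  qed
  then show "(burge q 0 n has_sum ipoch q (2 * n)) UNIV" "(burge q 1 n has_sum ipoch q (2 * n + 1)) UNIV"
    using burge_has_sum by metis+
qed

text \<open>The sum for 1/(q;q)_(2n) brought to the shape that Bailey's lemma needs for d = 1. After
  j -> -j in the first family both families have the common factor
  \<open>ipoch q (n - 3 * j) * ipoch q (n + 1 + 3 * j)\<close>, up to 1 - q^(n+3j+1) and 1 -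
  q^(n-3j); the parts depending on n cancel because n + 3j + 1 = (6j + 1) + (n - 3j).\<close>

lemma burge_int1:
  assumes q: "norm q < 1" "q \<noteq> 0"
  shows "((\<lambda>j. (q powi (6 * j\<^sup>2 - j) - q powi (6 * j\<^sup>2 + 5 * j + 1)) * ipoch q (n - 3 * j) * ipoch q (n + 1 + 3 * j))
    has_sum ipoch q (2 * n)) UNIV"
proof -
  define f where "f = (\<lambda>j. q powi (6 * j\<^sup>2 + j) * ipoch q (n - 3 * j) * ipoch q (n + 3 * j))"
  define g where "g = (\<lambda>j. q powi (6 * j\<^sup>2 + 5 * j + 1) * ipoch q (n - 3 * j - 1) * ipoch q (n + 3 * j + 1))"
  have f: "(f has_sum infsum f UNIV) UNIV"
    by (rule has_sum_finite_support[where a = "- \<bar>n\<bar> - 1" and b = "\<bar>n\<bar>"]) (auto simp: f_def)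
  have g: "(g has_sum infsum g UNIV) UNIV"
    by (rule has_sum_finite_support[where a = "- \<bar>n\<bar> - 1" and b = "\<bar>n\<bar>"]) (auto simp: g_def)
  have "burge q 0 n = (\<lambda>j. f j - g j)" by (simp add: burge_def f_def g_def fun_eq_iff)
  then have "infsum f UNIV - infsum g UNIV = ipoch q (2 * n)"
    using burge_int(1)[OF q, of n] has_sum_diff[OF f g] has_sum_unique by metis
  moreover have "((\<lambda>j. f (0 - j)) has_sum infsum f UNIV) UNIV"
    using f by (subst has_sum_reflect_int)
  ultimately have "((\<lambda>j. f (0 - j) - g j) has_sum ipoch q (2 * n)) UNIV"
    using has_sum_diff[OF _ g] by metis
  moreover have "f (0 - j) - g j =
    (q powi (6 * j\<^sup>2 - j) - q powi (6 * j\<^sup>2 + 5 * j + 1)) * ipoch q (n - 3 * j) * ipoch q (n + 1 + 3 * j)" for j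
  proof -
    have 1: "ipoch q (n + 3 * j) = (1 - q powi (n + 3 * j + 1)) * ipoch q (n + 3 * j + 1)"
      using ipoch_pred[OF q, of "n + 3 * j + 1"] by simp
    have x1: "q powi (6 * j\<^sup>2 + 5 * j + 1) = q powi (6 * j\<^sup>2 - j) * q powi (6 * j + 1)"
      and x2: "q powi (n + 3 * j + 1) = q powi (6 * j + 1) * q powi (n - 3 * j)"
      by (rule powi_split[OF q(2)], simp)+
    have x3: "f (0 - j) = q powi (6 * j\<^sup>2 - j) * ipoch q (n - 3 * j) * ipoch q (n + 3 * j)"
      by (simp add: f_def)
    have x4: "n + 1 + 3 * j = n + 3 * j + 1" by simp
    show ?thesis
      unfolding x3 g_def ipoch_pred[OF q, of "n - 3 * j"] 1 x4 x1 x2 by (simp add: algebra_simps)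
  qed
  ultimately show ?thesis by simp
qed

text \<open>The analogue for 1/(q;q)_(2n+1) and d = 2; here it is the second family that is
  reflected, by j -> -1 - j.\<close>

lemma burge_int2:
  assumes q: "norm q < 1" "q \<noteq> 0"
  shows "((\<lambda>j. (q powi (6 * j\<^sup>2 + j) - q powi (6 * j\<^sup>2 + 7 * j + 2)) * ipoch q (n - 3 * j) * ipoch q (n + 2 + 3 * j))
    has_sum ipoch q (2 * n + 1)) UNIV"
proof -
  define f where "f = (\<lambda>j. q powi (6 * j\<^sup>2 + j) * ipoch q (n - 3 * j) * ipoch q (n + 1 + 3 * j))"
  define g where "g = (\<lambda>j. q powi (6 * j\<^sup>2 + 5 * j + 1) * ipoch q (n - 3 * j - 1) * ipoch q (n + 1 + 3 * j + 1))"
  have f: "(f has_sum infsum f UNIV) UNIV"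
    by (rule has_sum_finite_support[where a = "- \<bar>n\<bar> - 1" and b = "\<bar>n\<bar>"]) (auto simp: f_def)
  have g: "(g has_sum infsum g UNIV) UNIV"
    by (rule has_sum_finite_support[where a = "- \<bar>n\<bar> - 1" and b = "\<bar>n\<bar>"]) (auto simp: g_def)
  have "burge q 1 n = (\<lambda>j. f j - g j)" by (simp add: burge_def f_def g_def fun_eq_iff)
  then have "infsum f UNIV - infsum g UNIV = ipoch q (2 * n + 1)"
    using burge_int(2)[OF q, of n] has_sum_diff[OF f g] has_sum_unique by metis
  moreover have "((\<lambda>j. g (- 1 - j)) has_sum infsum g UNIV) UNIV"
    using g by (subst has_sum_reflect_int)
  ultimately have "((\<lambda>j. f j - g (- 1 - j)) has_sum ipoch q (2 * n + 1)) UNIV"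
    using has_sum_diff[OF f] by metis
  moreover have "f j - g (- 1 - j) =
    (q powi (6 * j\<^sup>2 + j) - q powi (6 * j\<^sup>2 + 7 * j + 2)) * ipoch q (n - 3 * j) * ipoch q (n + 2 + 3 * j)" for j
  proof -
    have 1: "ipoch q (n + 1 + 3 * j) = (1 - q powi (n + 2 + 3 * j)) * ipoch q (n + 2 + 3 * j)"
      using ipoch_pred[OF q, of "n + 2 + 3 * j"] by (simp add: algebra_simps)
    have "6 * (- 1 - j)\<^sup>2 + 5 * (- 1 - j) + 1 = 6 * j\<^sup>2 + 7 * j + 2"
      by (simp add: power2_eq_square algebra_simps)
    moreover have "n - 3 * (- 1 - j) - 1 = n + 2 + 3 * j" "n + 1 + 3 * (- 1 - j) + 1 = n - 3 * j - 1" by simp_all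
    ultimately have x3: "g (- 1 - j) = q powi (6 * j\<^sup>2 + 7 * j + 2) * ipoch q (n + 2 + 3 * j) * ipoch q (n - 3 * j - 1)"
      unfolding g_def by (simp only:)
    have x1: "q powi (6 * j\<^sup>2 + 7 * j + 2) = q powi (6 * j\<^sup>2 + j) * q powi (6 * j + 2)"
      and x2: "q powi (n + 2 + 3 * j) = q powi (6 * j + 2) * q powi (n - 3 * j)"
      by (rule powi_split[OF q(2)], simp)+
    show ?thesis
      unfolding f_def x3 ipoch_pred[OF q, of "n - 3 * j"] 1 x1 x2 by (simp add: algebra_simps)
  qed
  ultimately show ?thesis by simp
qed

section \<open>Bailey's lemma and the Rogers type identities\<close>

lemma norm_powi_le_1:
  assumes "norm q < 1" "(q::complex) \<noteq> 0" "0 \<le> k"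
  shows "norm (q powi k) \<le> 1"
  using assms by (simp add: power_int_def norm_power power_le_one)

lemma abs_le_square_int: "\<bar>j\<bar> \<le> (j::int)\<^sup>2"
proof -
  have "\<bar>j\<bar> * 1 \<le> \<bar>j\<bar> * \<bar>j\<bar>" by (cases "j = 0", simp, intro mult_left_mono) auto
  then show ?thesis by (simp add: power2_eq_square)
qed

text \<open>The limiting case of Bailey's lemma. Summing over \<open>n\<close> first, the
  substitution n -> n + r turns the inner series into Durfee's series with shift d + 2r, whose value
  does not depend on r. The growth condition on \<open>r\<close> bounds \<open>j\<close> by the
  support of the summand and makes the double series absolutely convergent.\<close>

lemma bailey_sum:
  assumes q: "norm q < 1" "q \<noteq> 0" and d: "d \<ge> 0"
    and w: "\<And>j. norm (w j) \<le> W" and r: "\<And>j. \<bar>j\<bar> \<le> \<bar>r j\<bar>"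
    and \<beta>: "\<And>n. ((\<lambda>j. w j * ipoch q (n - r j) * ipoch q (n + d + r j)) has_sum \<beta> n) UNIV"
  obtains S where "((\<lambda>n. q powi (n\<^sup>2 + d * n) * \<beta> n) has_sum S) UNIV"
    "((\<lambda>j. w j * q powi ((r j)\<^sup>2 + d * r j)) has_sum qpoch_inf q q * S) UNIV"
proof -
  obtain C where C: "C > 0" "\<And>k. norm (ipoch q k) \<le> C" by (rule ipoch_bounded[OF q(1)]) (rule that)
  have W0: "0 \<le> W" using w[of 0] norm_ge_zero[of "w 0"] by linarith
  define f where "f = (\<lambda>(n, j). q powi (n\<^sup>2 + d * n) * (w j * ipoch q (n - r j) * ipoch q (n + d + r j)))"
  have "(\<lambda>x. norm (f x)) summable_on UNIV"
  \<comment> \<open>On the support |j| is at most n + d. There n^2 + dn exceeds (n^2 + j^2)/8 - 3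
    d^2/4 by at least 3 (2n + d)^2/16 + 7 d^2/16, which explains the constants.\<close>
  proof (rule abs_summable_gauss2[where r = "norm q" and e = "1/8" and C = "W * C * C * norm q powr (- 3/4 * (of_int d)\<^sup>2)"])
    fix n j :: int
    show "norm (f (n, j)) \<le> W * C * C * norm q powr (- 3/4 * (of_int d)\<^sup>2) * norm q powr (1/8 * ((of_int n)\<^sup>2 + (of_int j)\<^sup>2))"
    proof (cases "r j \<le> n \<and> - (n + d) \<le> r j")
      case True
      then have "\<bar>r j\<bar> \<le> n + d" using d by auto
      then have "\<bar>j\<bar> \<le> n + d" using r[of j] by linarith
      then have "j\<^sup>2 \<le> (n + d)\<^sup>2" using abs_le_square_iff[of j "n + d"] by auto
      then have j: "(of_int j)\<^sup>2 \<le> (of_int n + of_int d :: real)\<^sup>2"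
        by (metis of_int_add of_int_le_iff of_int_power)
      let ?X = "1/8 * ((of_int n)\<^sup>2 + (of_int n + of_int d)\<^sup>2) + (- 3/4 * (of_int d)\<^sup>2) :: real"
      have "1/8 * ((of_int n)\<^sup>2 + (of_int j)\<^sup>2) + (- 3/4 * (of_int d)\<^sup>2) \<le> ?X"
        using j by simp
      also have "?X \<le> of_int (n\<^sup>2 + d * n)"
      proof (rule diff_ge_0_iff_ge[THEN iffD1])
        show "0 \<le> of_int (n\<^sup>2 + d * n) - ?X"
      proof -
        have "of_int (n\<^sup>2 + d * n) - ?X = 3/16 * (2 * of_int n + of_int d)\<^sup>2 + 7/16 * (of_int d)\<^sup>2"
          by (simp add: power2_eq_square field_simps)
        then show ?thesis by simp
        qed
      qed
      finally have e: "1/8 * ((of_int n)\<^sup>2 + (of_int j)\<^sup>2) + (- 3/4 * (of_int d)\<^sup>2) \<le> (of_int (n\<^sup>2 + d * n) :: real)" .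
      have "norm (f (n, j)) = norm q powr (of_int (n\<^sup>2 + d * n)) * (norm (w j) * norm (ipoch q (n - r j)) * norm (ipoch q (n + d + r j)))"
        by (simp add: f_def norm_mult norm_power_int_powr q(2))
      also have "\<dots> \<le> norm q powr (1/8 * ((of_int n)\<^sup>2 + (of_int j)\<^sup>2) + (- 3/4 * (of_int d)\<^sup>2)) * (W * C * C)"
        using q e W0 C(1) by (intro mult_mono powr_mono' C w) auto
      finally show ?thesis unfolding powr_add by (simp only: mult_ac)
    next
      case False
      then have "f (n, j) = 0" by (auto simp: f_def)
      then show ?thesis using W0 C(1) by simp
    qed
  qed (use q in auto)
  moreover have "((\<lambda>j. f (n, j)) has_sum q powi (n\<^sup>2 + d * n) * \<beta> n) UNIV" for n
    unfolding f_def prod.case by (rule has_sum_cmult_right[OF \<beta>])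
  moreover have "((\<lambda>n. f (n, j)) has_sum w j * q powi ((r j)\<^sup>2 + d * r j) * inverse (qpoch_inf q q)) UNIV" for j
  proof -
    have "((\<lambda>n. w j * q powi ((r j)\<^sup>2 + d * r j) * durfee_term q (d + 2 * r j) n) has_sum
        w j * q powi ((r j)\<^sup>2 + d * r j) * inverse (qpoch_inf q q)) UNIV"
      by (rule has_sum_cmult_right[OF durfee[OF q]])
    moreover have "w j * q powi ((r j)\<^sup>2 + d * r j) * durfee_term q (d + 2 * r j) n = f (n + r j, j)" for n
    proof -
      have 1: "q powi ((n + r j)\<^sup>2 + d * (n + r j)) = q powi ((r j)\<^sup>2 + d * r j) * q powi (n\<^sup>2 + (d + 2 * r j) * n)"
        by (rule powi_split[OF q(2)]) (simp add: power2_eq_square algebra_simps)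
      have 2: "n + r j - r j = n" "n + r j + d + r j = n + (d + 2 * r j)" by simp_all
      show ?thesis unfolding f_def prod.case 1 2 durfee_term_def by (simp add: mult_ac)
    qed
    ultimately show ?thesis
      using has_sum_shift_int[of "\<lambda>n. f (n, j)" "r j"] by simp
  qed
  ultimately obtain S where S: "((\<lambda>n. q powi (n\<^sup>2 + d * n) * \<beta> n) has_sum S) UNIV"
    "((\<lambda>j. w j * q powi ((r j)\<^sup>2 + d * r j) * inverse (qpoch_inf q q)) has_sum S) UNIV"
    by (rule has_sum_double)
  from has_sum_cmult_left[OF S(2), of "qpoch_inf q q"]
  have "((\<lambda>j. w j * q powi ((r j)\<^sup>2 + d * r j)) has_sum S * qpoch_inf q q) UNIV"
    using qpoch_inf_nonzero[OF q(1) q(1)] by (simp add: mult.assoc)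
  then show ?thesis using that S(1) by (simp add: mult.commute)
qed

text \<open>Bailey's lemma is applied to the two families separately, with r = 3j and r = 3j + 1;
  adding r^2 + dr to the pentagonal exponents gives the exponents with leading term 15 j^2.\<close>

lemma bailey_burge:
  assumes q: "norm q < 1" "q \<noteq> 0" and d: "d = 0 \<or> d = 1"
    and \<beta>: "\<And>n. (burge q d n has_sum \<beta> n) UNIV"
  obtains S V V' where "((\<lambda>n. q powi (n\<^sup>2 + d * n) * \<beta> n) has_sum S) UNIV"
    "((\<lambda>j. q powi (15 * j\<^sup>2 + (3 * d + 1) * j)) has_sum V) UNIV"
    "((\<lambda>j. q powi (15 * j\<^sup>2 + (11 + 3 * d) * j + (2 + d))) has_sum V') UNIV"
    "qpoch_inf q q * S = V - V'"
proof -
  define f where "f = (\<lambda>n j. q powi (6 * j\<^sup>2 + j) * ipoch q (n - (3 * j)) * ipoch q (n + d + (3 * j)))"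
  define g where "g = (\<lambda>n j. q powi (6 * j\<^sup>2 + 5 * j + 1) * ipoch q (n - (3 * j + 1)) * ipoch q (n + d + (3 * j + 1)))"
  have f: "(f n has_sum infsum (f n) UNIV) UNIV" for n
    by (rule has_sum_finite_support[where a = "- \<bar>n\<bar> - 1" and b = "\<bar>n\<bar>"]) (use d in \<open>auto simp: f_def\<close>)
  have g: "(g n has_sum infsum (g n) UNIV) UNIV" for n
    by (rule has_sum_finite_support[where a = "- \<bar>n\<bar> - 1" and b = "\<bar>n\<bar>"]) (use d in \<open>auto simp: g_def\<close>)
  have "burge q d n = (\<lambda>j. f n j - g n j)" for n
    by (simp add: burge_def f_def g_def fun_eq_iff algebra_simps)
  then have fg: "\<beta> n = infsum (f n) UNIV - infsum (g n) UNIV" for n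
    using \<beta>[of n] has_sum_diff[OF f g] has_sum_unique by metis
  have nn: "0 \<le> 6 * j\<^sup>2 + j" "0 \<le> 6 * j\<^sup>2 + 5 * j + 1" for j :: int
    using abs_le_square_int[of j] by (auto simp: abs_if split: if_splits)
  obtain S1 where S1: "((\<lambda>n. q powi (n\<^sup>2 + d * n) * infsum (f n) UNIV) has_sum S1) UNIV"
    "((\<lambda>j. q powi (6 * j\<^sup>2 + j) * q powi ((3 * j)\<^sup>2 + d * (3 * j))) has_sum qpoch_inf q q * S1) UNIV"
    by (rule bailey_sum[OF q _ norm_powi_le_1[OF q nn(1)], where d = d and r = "\<lambda>j. 3 * j" and \<beta> = "\<lambda>n. infsum (f n) UNIV"])
       (use d f in \<open>auto simp: f_def\<close>)
  obtain S2 where S2: "((\<lambda>n. q powi (n\<^sup>2 + d * n) * infsum (g n) UNIV) has_sum S2) UNIV"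
    "((\<lambda>j. q powi (6 * j\<^sup>2 + 5 * j + 1) * q powi ((3 * j + 1)\<^sup>2 + d * (3 * j + 1))) has_sum qpoch_inf q q * S2) UNIV"
    by (rule bailey_sum[OF q _ norm_powi_le_1[OF q nn(2)], where d = d and r = "\<lambda>j. 3 * j + 1" and \<beta> = "\<lambda>n. infsum (g n) UNIV"])
       (use d g in \<open>auto simp: g_def\<close>)
  have "((\<lambda>n. q powi (n\<^sup>2 + d * n) * \<beta> n) has_sum S1 - S2) UNIV"
    using has_sum_diff[OF S1(1) S2(1)] by (simp add: fg right_diff_distrib)
  moreover have "q powi (6 * j\<^sup>2 + j) * q powi ((3 * j)\<^sup>2 + d * (3 * j)) = q powi (15 * j\<^sup>2 + (3 * d + 1) * j)" for j
    by (rule powi_split[OF q(2), symmetric]) (simp add: power2_eq_square algebra_simps)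
  moreover have "q powi (6 * j\<^sup>2 + 5 * j + 1) * q powi ((3 * j + 1)\<^sup>2 + d * (3 * j + 1)) = q powi (15 * j\<^sup>2 + (11 + 3 * d) * j + (2 + d))" for j
    by (rule powi_split[OF q(2), symmetric]) (simp add: power2_eq_square algebra_simps)
  ultimately show ?thesis
    using that[of "S1 - S2" "qpoch_inf q q * S1" "qpoch_inf q q * S2"] S1(2) S2(2) by (simp add: right_diff_distrib)
qed

lemma bailey_two:
  assumes q: "norm q < 1" "q \<noteq> 0" and d: "d \<ge> 0"
    and a: "\<And>j. 0 \<le> a j" and b: "\<And>j::int. 0 \<le> b j"
    and \<beta>: "\<And>n. ((\<lambda>j. (q powi (a j) - q powi (b j)) * ipoch q (n - 3 * j) * ipoch q (n + d + 3 * j)) has_sum \<beta> n) UNIV"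
    and V: "((\<lambda>j. q powi (a j + (9 * j\<^sup>2 + 3 * d * j))) has_sum V) UNIV"
    and V': "((\<lambda>j. q powi (b j + (9 * j\<^sup>2 + 3 * d * j))) has_sum V') UNIV"
  obtains S where "((\<lambda>n. q powi (n\<^sup>2 + d * n) * \<beta> n) has_sum S) UNIV" "qpoch_inf q q * S = V - V'"
proof -
  have le: "norm (q powi (a j) - q powi (b j)) \<le> 2" for j
    using norm_triangle_ineq4[of "q powi (a j)" "q powi (b j)"] norm_powi_le_1[OF q a[of j]] norm_powi_le_1[OF q b[of j]] by linarith
  obtain S where S: "((\<lambda>n. q powi (n\<^sup>2 + d * n) * \<beta> n) has_sum S) UNIV"
    "((\<lambda>j. (q powi (a j) - q powi (b j)) * q powi ((3 * j)\<^sup>2 + d * (3 * j))) has_sum qpoch_inf q q * S) UNIV"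
    by (rule bailey_sum[OF q d le, where r = "\<lambda>j. 3 * j" and \<beta> = \<beta>]) (use \<beta> in auto)
  have "(q powi (a j) - q powi (b j)) * q powi ((3 * j)\<^sup>2 + d * (3 * j)) =
      q powi (a j + (9 * j\<^sup>2 + 3 * d * j)) - q powi (b j + (9 * j\<^sup>2 + 3 * d * j))" for j
    by (simp add: power_int_add q(2) left_diff_distrib power_mult_distrib mult_ac)
  then have "qpoch_inf q q * S = V - V'"
    using S(2) has_sum_diff[OF V V'] has_sum_unique by force
  then show ?thesis using that S(1) by blast
qed

lemma quadratic_exp_has_sum:
  assumes q: "norm q < 1" "(q::complex) \<noteq> 0" and a: "0 < a"
  shows "((\<lambda>n. q powi (a * n\<^sup>2 + b * n + c)) has_sum infsum (\<lambda>n. q powi (a * n\<^sup>2 + b * n + c)) UNIV) UNIV"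
proof (rule has_sum_infsum, rule abs_summable_summable, rule abs_summable_gauss[where r = "norm q" and e = "1/2" and C = "norm q powr (of_int c - of_int (b\<^sup>2) / 2)"])
  fix n :: int
  have "0 \<le> (of_int n + of_int b :: real)\<^sup>2" by simp
  then have "(of_int n)\<^sup>2 + of_int b * of_int n \<ge> - of_int (b\<^sup>2) / 2 + 1/2 * (of_int n :: real)\<^sup>2"
    by (simp add: power2_sum field_simps)
  moreover have "1 * (of_int n)\<^sup>2 \<le> of_int a * (of_int n :: real)\<^sup>2"
    using a by (intro mult_right_mono) auto
  ultimately have "(of_int c - of_int (b\<^sup>2) / 2) + 1/2 * (of_int n)\<^sup>2 \<le> (of_int (a * n\<^sup>2 + b * n + c) :: real)"
    by simp
  then have "norm q powr (of_int (a * n\<^sup>2 + b * n + c)) \<le> norm q powr ((of_int c - of_int (b\<^sup>2) / 2) + 1/2 * (of_int n)\<^sup>2)"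
    using q by (intro powr_mono') auto
  then show "norm (q powi (a * n\<^sup>2 + b * n + c)) \<le> norm q powr (of_int c - of_int (b\<^sup>2) / 2) * norm q powr (1/2 * (of_int n)\<^sup>2)"
    unfolding norm_power_int_powr[OF q(2)] powr_add .
qed (use q in auto)

text \<open>This identity and the three that follow evaluate the coefficients in the theta
  expansions of the bilateral series. The right-hand sides stay differences of theta series: at q =
  t^4 they become series with leading exponent 60 j^2, which reappear in the lattice sums for the
  parity parts.\<close>

lemma rogers_0:
  assumes q: "norm q < 1" "q \<noteq> 0"
  obtains S V V' where "((\<lambda>n. q powi (n\<^sup>2) * ipoch q (2 * n)) has_sum S) UNIV"
    "((\<lambda>j. q powi (15 * j\<^sup>2 + j)) has_sum V) UNIV"
    "((\<lambda>j. q powi (15 * j\<^sup>2 + 11 * j + 2)) has_sum V') UNIV"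
    "qpoch_inf q q * S = V - V'"
  by (rule bailey_burge[OF q _ burge_int(1)[OF q]]) (use that in auto)

lemma rogers_1:
  assumes q: "norm q < 1" "q \<noteq> 0"
  obtains S V V' where "((\<lambda>n. q powi (n\<^sup>2 + n) * ipoch q (2 * n + 1)) has_sum S) UNIV"
    "((\<lambda>j. q powi (15 * j\<^sup>2 + 4 * j)) has_sum V) UNIV"
    "((\<lambda>j. q powi (15 * j\<^sup>2 + 14 * j + 3)) has_sum V') UNIV"
    "qpoch_inf q q * S = V - V'"
  by (rule bailey_burge[OF q _ burge_int(2)[OF q]]) (use that in auto)

lemma rogers_2:
  assumes q: "norm q < 1" "q \<noteq> 0"
  obtains S V V' where "((\<lambda>n. q powi (n\<^sup>2 + n) * ipoch q (2 * n)) has_sum S) UNIV"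
    "((\<lambda>j. q powi (15 * j\<^sup>2 + 2 * j)) has_sum V) UNIV"
    "((\<lambda>j. q powi (15 * j\<^sup>2 + 8 * j + 1)) has_sum V') UNIV"
    "qpoch_inf q q * S = V - V'"
proof -
  have a: "0 \<le> 6 * j\<^sup>2 - j" and b: "0 \<le> 6 * j\<^sup>2 + 5 * j + 1" for j :: int
    using abs_le_square_int[of j] by (auto simp: abs_if split: if_splits)
  have e1: "6 * j\<^sup>2 - j + (9 * j\<^sup>2 + 3 * 1 * j) = 15 * j\<^sup>2 + 2 * j + 0"
    and e2: "6 * j\<^sup>2 + 5 * j + 1 + (9 * j\<^sup>2 + 3 * 1 * j) = 15 * j\<^sup>2 + 8 * j + 1" for j :: int by simp_all
  define V where "V = infsum (\<lambda>j. q powi (15 * j\<^sup>2 + 2 * j + 0)) UNIV"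
  define V' where "V' = infsum (\<lambda>j. q powi (15 * j\<^sup>2 + 8 * j + 1)) UNIV"
  have V: "((\<lambda>j. q powi (6 * j\<^sup>2 - j + (9 * j\<^sup>2 + 3 * 1 * j))) has_sum V) UNIV"
    unfolding e1 V_def by (rule quadratic_exp_has_sum[OF q]) simp
  have V': "((\<lambda>j. q powi (6 * j\<^sup>2 + 5 * j + 1 + (9 * j\<^sup>2 + 3 * 1 * j))) has_sum V') UNIV"
    unfolding e2 V'_def by (rule quadratic_exp_has_sum[OF q]) simp
  obtain S where "((\<lambda>n. q powi (n\<^sup>2 + 1 * n) * ipoch q (2 * n)) has_sum S) UNIV" "qpoch_inf q q * S = V - V'"
    by (rule bailey_two[OF q _ a b burge_int1[OF q] V V']) auto
  then show ?thesis using that[of S V V'] V V' unfolding e1 e2 by simp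
qed

lemma rogers_3:
  assumes q: "norm q < 1" "q \<noteq> 0"
  obtains S V V' where "((\<lambda>n. q powi (n\<^sup>2 + 2 * n) * ipoch q (2 * n + 1)) has_sum S) UNIV"
    "((\<lambda>j. q powi (15 * j\<^sup>2 + 7 * j)) has_sum V) UNIV"
    "((\<lambda>j. q powi (15 * j\<^sup>2 + 13 * j + 2)) has_sum V') UNIV"
    "qpoch_inf q q * S = V - V'"
proof -
  have a: "0 \<le> 6 * j\<^sup>2 + j" for j :: int
    using abs_le_square_int[of j] by (auto simp: abs_if split: if_splits)
  have b: "0 \<le> 6 * j\<^sup>2 + 7 * j + 2" for j :: int
  proof -
    have "0 \<le> (j + 1)\<^sup>2" by simp
    then have "0 \<le> j\<^sup>2 + 2 * j + 1" by (simp add: power2_sum)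
    then show ?thesis using abs_le_square_int[of j] by (cases "j = -1"; cases "j \<ge> 0") auto
  qed
  have e1: "6 * j\<^sup>2 + j + (9 * j\<^sup>2 + 3 * 2 * j) = 15 * j\<^sup>2 + 7 * j + 0"
    and e2: "6 * j\<^sup>2 + 7 * j + 2 + (9 * j\<^sup>2 + 3 * 2 * j) = 15 * j\<^sup>2 + 13 * j + 2" for j :: int by simp_all
  define V where "V = infsum (\<lambda>j. q powi (15 * j\<^sup>2 + 7 * j + 0)) UNIV"
  define V' where "V' = infsum (\<lambda>j. q powi (15 * j\<^sup>2 + 13 * j + 2)) UNIV"
  have V: "((\<lambda>j. q powi (6 * j\<^sup>2 + j + (9 * j\<^sup>2 + 3 * 2 * j))) has_sum V) UNIV"
    unfolding e1 V_def by (rule quadratic_exp_has_sum[OF q]) simp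
  have V': "((\<lambda>j. q powi (6 * j\<^sup>2 + 7 * j + 2 + (9 * j\<^sup>2 + 3 * 2 * j))) has_sum V') UNIV"
    unfolding e2 V'_def by (rule quadratic_exp_has_sum[OF q]) simp
  obtain S where "((\<lambda>n. q powi (n\<^sup>2 + 2 * n) * ipoch q (2 * n + 1)) has_sum S) UNIV" "qpoch_inf q q * S = V - V'"
    by (rule bailey_two[OF q _ a b burge_int2[OF q] V V']) auto
  then show ?thesis using that[of S V V'] V V' unfolding e1 e2 by simp
qed

section \<open>The bilateral series as products\<close>

lemma powi_of_power: "(t ^ n) powi m = (t :: complex) powi (int n * m)"
  by (simp add: power_int_mult)

lemma has_sum_even_odd:
  fixes h :: "int \<Rightarrow> complex"
  assumes e: "((\<lambda>j. h (2 * j)) has_sum a) UNIV" and o: "((\<lambda>j. h (2 * j + 1)) has_sum b) UNIV"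
  shows "(h has_sum a + b) UNIV"
proof -
  have "(h has_sum a) (range (\<lambda>j. 2 * j))"
    using e by (subst has_sum_reindex) (auto simp: o_def inj_on_def)
  moreover have "(h has_sum b) (range (\<lambda>j. 2 * j + 1))"
    using o by (subst has_sum_reindex) (auto simp: o_def inj_on_def)
  moreover have "range (\<lambda>j. 2 * j) \<inter> range (\<lambda>j::int. 2 * j + 1) = {}"
    by auto presburger
  ultimately have "(h has_sum a + b) (range (\<lambda>j. 2 * j) \<union> range (\<lambda>j. 2 * j + 1))"
    by (rule has_sum_Un_disjoint)
  also have "range (\<lambda>j. 2 * j) \<union> range (\<lambda>j::int. 2 * j + 1) = UNIV"
  proof -
    have "x \<in> range (\<lambda>j. 2 * j) \<union> range (\<lambda>j::int. 2 * j + 1)" for x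
      by (cases "even x") (auto elim!: evenE oddE)
    then show ?thesis by auto
  qed
  finally show ?thesis .
qed

text \<open>Each product (s q^n;q) is expanded by Euler's identity and the sum over \<open>n\<close>
  is taken first; for fixed \<open>m\<close> it is a theta series whose linear exponent is shifted
  by m. Since |s|^2 = |q|, the exponent of |q| is n^2 + nm + m^2/2 - \<nu>n, whose quadratic part is
  positive definite, so the interchange is legitimate.\<close>

lemma bilateral_expand:
  assumes q: "norm q < 1" "q \<noteq> 0" and s: "s\<^sup>2 = q"
    and \<theta>: "\<And>m. ((\<lambda>n. q powi (n\<^sup>2 - \<nu> * n + n * m)) has_sum \<theta> m) UNIV"
  obtains T where "((\<lambda>n. q powi (n\<^sup>2 - \<nu> * n) * qpoch_inf (s * q powi n) q) has_sum T) UNIV"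
    "((\<lambda>m. (-s) powi m * q powi (m * (m - 1) div 2) * ipoch q m * \<theta> m) has_sum T) UNIV"
proof -
  obtain C where C: "C > 0" "\<And>k. norm (ipoch q k) \<le> C" by (rule ipoch_bounded[OF q(1)]) (rule that)
  have s0: "s \<noteq> 0" using s q by auto
  have ns: "norm s powr 2 = norm q"
    using s s0 by (simp add: norm_power flip: s)
  define f where "f = (\<lambda>(n, m). q powi (n\<^sup>2 - \<nu> * n) * ((- (s * q powi n)) powi m * q powi (m * (m - 1) div 2) * ipoch q m))"
  have f_alt: "f (n, m) = (-s) powi m * q powi (m * (m - 1) div 2) * ipoch q m * q powi (n\<^sup>2 - \<nu> * n + n * m)" for n m
  proof -
    have "(- (s * q powi n)) powi m = ((-s) * q powi n) powi m" by simp
    also have "\<dots> = (-s) powi m * q powi (n * m)"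
      by (simp only: power_int_mult_distrib power_int_mult)
    finally show ?thesis by (simp add: f_def power_int_add q(2) mult_ac)
  qed
  have "(\<lambda>x. norm (f x)) summable_on UNIV"
  proof (rule abs_summable_gauss2[where r = "norm q" and e = "1/10" and C = "C * norm q powr (- (of_int \<nu>)\<^sup>2)"])
    fix n m :: int
    let ?e = "of_int (n\<^sup>2 - \<nu> * n + n * m) + (of_int m)\<^sup>2 / 2 :: real"
    have tri: "of_int (m * (m - 1) div 2) = (of_int m)\<^sup>2 / 2 - of_int m / (2::real)"
    proof -
      define t where "t = m * (m - 1) div 2"
      have "2 * t = m * (m - 1)" unfolding t_def by (rule two_tri)
      then have "of_int (2 * t) = (of_int (m * (m - 1)) :: real)" by (simp only:)
      then have "of_int t = (of_int m)\<^sup>2 / 2 - of_int m / (2::real)" by (simp add: power2_eq_square field_simps)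
      then show ?thesis by (simp only: t_def)
    qed
    have "norm ((-s) powi m) = norm q powr (of_int m / 2)"
      unfolding ns[symmetric] powr_powr using s0 by (simp add: norm_power_int powr_real_of_int')
    then have "norm (f (n, m)) = norm q powr (of_int m / 2) * norm q powr ((of_int m)\<^sup>2 / 2 - of_int m / 2) *
        norm (ipoch q m) * norm q powr (of_int (n\<^sup>2 - \<nu> * n + n * m))"
      unfolding f_alt norm_mult norm_power_int_powr[OF q(2)] tri by simp
    also have "\<dots> = norm (ipoch q m) * norm q powr ?e"
    proof -
      have "norm q powr ?e = norm q powr (of_int m / 2 + ((of_int m)\<^sup>2 / 2 - of_int m / 2) + of_int (n\<^sup>2 - \<nu> * n + n * m))"
        by (rule arg_cong[where f = "\<lambda>x. norm q powr x"]) simp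
      then show ?thesis unfolding powr_add by (simp only: mult_ac)
    qed
    also have "\<dots> \<le> C * norm q powr (- (of_int \<nu>)\<^sup>2 + 1/10 * ((of_int n)\<^sup>2 + (of_int m)\<^sup>2))"
    proof (intro mult_mono C powr_mono')
      \<comment> \<open>Completing the squares shows that (n^2 + m^2)/10 can be split off at the
        price of the constant \<nu>^2.\<close>
      have "?e - (- (of_int \<nu>)\<^sup>2 + 1/10 * ((of_int n)\<^sup>2 + (of_int m)\<^sup>2)) =
         2/5 * (of_int m + 5/4 * of_int n)\<^sup>2 + (of_int \<nu> - of_int n / 2)\<^sup>2 + 1/40 * (of_int n)\<^sup>2"
        by (simp add: power2_eq_square field_simps)
      then have "0 \<le> ?e - (- (of_int \<nu>)\<^sup>2 + 1/10 * ((of_int n)\<^sup>2 + (of_int m)\<^sup>2))" by simp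
      then show "- (of_int \<nu>)\<^sup>2 + 1/10 * ((of_int n)\<^sup>2 + (of_int m)\<^sup>2) \<le> ?e"
        by (rule diff_ge_0_iff_ge[THEN iffD1])
    qed (use q C in auto)
    finally show "norm (f (n, m)) \<le> C * norm q powr (- (of_int \<nu>)\<^sup>2) * norm q powr (1/10 * ((of_int n)\<^sup>2 + (of_int m)\<^sup>2))"
      unfolding powr_add by (simp only: mult_ac)
  qed (use q in auto)
  moreover have "((\<lambda>m. f (n, m)) has_sum q powi (n\<^sup>2 - \<nu> * n) * qpoch_inf (s * q powi n) q) UNIV" for n
    unfolding f_def prod.case by (rule has_sum_cmult_right[OF euler_has_sum(1)[OF q]])
  moreover have "((\<lambda>n. f (n, m)) has_sum (-s) powi m * q powi (m * (m - 1) div 2) * ipoch q m * \<theta> m) UNIV" for m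
    unfolding f_alt by (rule has_sum_cmult_right[OF \<theta>])
  ultimately show ?thesis by (rule has_sum_double) (rule that)
qed

text \<open>Completing the square in \<open>n\<close> for m = 2j or m = 2j + 1 reduces the inner
  theta series to q^(-j^2) \<theta>0 or q^(-j^2-j) \<theta>1. Together with Euler's power of q and
  the power of -s this leaves q^(j^2) or -s q^(j^2+j), the coefficients of the series
  \<open>A\<close> and \<open>C\<close>.\<close>

lemma bilateral_0:
  assumes q: "norm q < 1" "q \<noteq> 0" and s: "s\<^sup>2 = q"
    and \<theta>0: "((\<lambda>n. q powi (n\<^sup>2)) has_sum \<theta>0) UNIV"
    and \<theta>1: "((\<lambda>n. q powi (n\<^sup>2 + n)) has_sum \<theta>1) UNIV"
    and A: "((\<lambda>n. q powi (n\<^sup>2) * ipoch q (2 * n)) has_sum A) UNIV"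
    and C: "((\<lambda>n. q powi (n\<^sup>2 + n) * ipoch q (2 * n + 1)) has_sum C) UNIV"
  shows "((\<lambda>n. q powi (n\<^sup>2) * qpoch_inf (s * q powi n) q) has_sum \<theta>0 * A - s * \<theta>1 * C) UNIV"
proof -
  define \<theta> where "\<theta> = (\<lambda>m. if even m then q powi (- (m div 2)\<^sup>2) * \<theta>0 else q powi (- (m div 2)\<^sup>2 - m div 2) * \<theta>1)"
  have \<theta>: "((\<lambda>n. q powi (n\<^sup>2 - 0 * n + n * m)) has_sum \<theta> m) UNIV" for m
  proof (cases "even m")
    case True
    then obtain j where j: "m = 2 * j" by (elim evenE)
    have "q powi (- j\<^sup>2) * q powi ((n + j)\<^sup>2) = q powi (n\<^sup>2 - 0 * n + n * m)" for n
      by (rule powi_split[OF q(2), symmetric]) (simp add: j power2_eq_square algebra_simps)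
    then show ?thesis
      using has_sum_cmult_right[OF has_sum_shift_int[THEN iffD2, OF \<theta>0], of "q powi (- j\<^sup>2)" j] by (simp add: \<theta>_def j)
  next
    case False
    then obtain j where j: "m = 2 * j + 1" by (elim oddE)
    have "q powi (- j\<^sup>2 - j) * q powi ((n + j)\<^sup>2 + (n + j)) = q powi (n\<^sup>2 - 0 * n + n * m)" for n
      by (rule powi_split[OF q(2), symmetric]) (simp add: j power2_eq_square algebra_simps)
    then show ?thesis
      using has_sum_cmult_right[OF has_sum_shift_int[THEN iffD2, OF \<theta>1], of "q powi (- j\<^sup>2 - j)" j] by (simp add: \<theta>_def j)
  qed
  define h where "h = (\<lambda>m. (-s) powi m * q powi (m * (m - 1) div 2) * ipoch q m * \<theta> m)"
  obtain T where T: "((\<lambda>n. q powi (n\<^sup>2 - 0 * n) * qpoch_inf (s * q powi n) q) has_sum T) UNIV" "(h has_sum T) UNIV"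
    by (rule bilateral_expand[OF q s \<theta>]) (rule that, assumption, simp add: h_def)
  have s0: "s \<noteq> 0" using s q by auto
  have sj: "(-s) powi (2 * j) = q powi j" for j
    using s by (simp add: power_int_mult)
  have tri: "(2 * j) * (2 * j - 1) div 2 = 2 * j\<^sup>2 - j" "(2 * j + 1) * (2 * j + 1 - 1) div 2 = 2 * j\<^sup>2 + j" for j :: int
    using two_tri[of "2 * j"] two_tri[of "2 * j + 1"] by (simp_all add: power2_eq_square algebra_simps)
  have "h (2 * j) = \<theta>0 * (q powi (j\<^sup>2) * ipoch q (2 * j))" for j
  proof -
    have "q powi (j\<^sup>2) = q powi j * (q powi (2 * j\<^sup>2 - j) * q powi (- j\<^sup>2))"
      by (simp add: q(2) add_ac flip: power_int_add)
    then show ?thesis unfolding h_def sj tri \<theta>_def by (simp add: mult_ac)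
  qed
  moreover have "h (2 * j + 1) = - s * \<theta>1 * (q powi (j\<^sup>2 + j) * ipoch q (2 * j + 1))" for j
  proof -
    have "q powi (j\<^sup>2 + j) = q powi j * (q powi (2 * j\<^sup>2 + j) * q powi (- j\<^sup>2 - j))"
      by (simp add: q(2) add_ac flip: power_int_add)
    moreover have "(-s) powi (2 * j + 1) = - s * q powi j"
      using s0 by (subst powi_split[of "-s" _ "2 * j" 1]) (auto simp: sj)
    ultimately show ?thesis unfolding h_def tri \<theta>_def by (simp add: mult_ac)
  qed
  ultimately have "(h has_sum \<theta>0 * A + (- s * \<theta>1 * C)) UNIV"
    by (intro has_sum_even_odd) (simp_all only: has_sum_cmult_right[OF A] has_sum_cmult_right[OF C])
  then have "T = \<theta>0 * A + (- s * \<theta>1 * C)" using T(2) has_sum_unique by blast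
  then show ?thesis using T(1) by simp
qed

text \<open>With the linear term -n the two theta constants trade places: even \<open>m\<close> now
  gives \<theta>1 and odd \<open>m\<close> gives \<theta>0.\<close>

lemma bilateral_1:
  assumes q: "norm q < 1" "q \<noteq> 0" and s: "s\<^sup>2 = q"
    and \<theta>0: "((\<lambda>n. q powi (n\<^sup>2)) has_sum \<theta>0) UNIV"
    and \<theta>1: "((\<lambda>n. q powi (n\<^sup>2 + n)) has_sum \<theta>1) UNIV"
    and A: "((\<lambda>n. q powi (n\<^sup>2 + n) * ipoch q (2 * n)) has_sum A) UNIV"
    and C: "((\<lambda>n. q powi (n\<^sup>2 + 2 * n) * ipoch q (2 * n + 1)) has_sum C) UNIV"
  shows "((\<lambda>n. q powi (n\<^sup>2 - n) * qpoch_inf (s * q powi n) q) has_sum \<theta>1 * A - s * \<theta>0 * C) UNIV"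
proof -
  define \<theta> where "\<theta> = (\<lambda>m. if even m then q powi (- (m div 2)\<^sup>2 + m div 2) * \<theta>1 else q powi (- (m div 2)\<^sup>2) * \<theta>0)"
  have \<theta>: "((\<lambda>n. q powi (n\<^sup>2 - 1 * n + n * m)) has_sum \<theta> m) UNIV" for m
  proof (cases "even m")
    case True
    then obtain j where j: "m = 2 * j" by (elim evenE)
    have "q powi (- j\<^sup>2 + j) * q powi ((n + (j - 1))\<^sup>2 + (n + (j - 1))) = q powi (n\<^sup>2 - 1 * n + n * m)" for n
      by (rule powi_split[OF q(2), symmetric]) (simp add: j power2_eq_square algebra_simps)
    then show ?thesis
      using has_sum_cmult_right[OF has_sum_shift_int[THEN iffD2, OF \<theta>1], of "q powi (- j\<^sup>2 + j)" "j - 1"] by (simp add: \<theta>_def j)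
  next
    case False
    then obtain j where j: "m = 2 * j + 1" by (elim oddE)
    have "q powi (- j\<^sup>2) * q powi ((n + j)\<^sup>2) = q powi (n\<^sup>2 - 1 * n + n * m)" for n
      by (rule powi_split[OF q(2), symmetric]) (simp add: j power2_eq_square algebra_simps)
    then show ?thesis
      using has_sum_cmult_right[OF has_sum_shift_int[THEN iffD2, OF \<theta>0], of "q powi (- j\<^sup>2)" j] by (simp add: \<theta>_def j)
  qed
  define h where "h = (\<lambda>m. (-s) powi m * q powi (m * (m - 1) div 2) * ipoch q m * \<theta> m)"
  obtain T where T: "((\<lambda>n. q powi (n\<^sup>2 - 1 * n) * qpoch_inf (s * q powi n) q) has_sum T) UNIV" "(h has_sum T) UNIV"
    by (rule bilateral_expand[OF q s \<theta>]) (rule that, assumption, simp add: h_def)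
  have s0: "s \<noteq> 0" using s q by auto
  have sj: "(-s) powi (2 * j) = q powi j" for j
    using s by (simp add: power_int_mult)
  have tri: "(2 * j) * (2 * j - 1) div 2 = 2 * j\<^sup>2 - j" "(2 * j + 1) * (2 * j + 1 - 1) div 2 = 2 * j\<^sup>2 + j" for j :: int
    using two_tri[of "2 * j"] two_tri[of "2 * j + 1"] by (simp_all add: power2_eq_square algebra_simps)
  have "h (2 * j) = \<theta>1 * (q powi (j\<^sup>2 + j) * ipoch q (2 * j))" for j
  proof -
    have "q powi (j\<^sup>2 + j) = q powi j * (q powi (2 * j\<^sup>2 - j) * q powi (- j\<^sup>2 + j))"
      by (simp add: q(2) add_ac flip: power_int_add)
    then show ?thesis unfolding h_def sj tri \<theta>_def by (simp add: mult_ac)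
  qed
  moreover have "h (2 * j + 1) = - s * \<theta>0 * (q powi (j\<^sup>2 + 2 * j) * ipoch q (2 * j + 1))" for j
  proof -
    have "q powi (j\<^sup>2 + 2 * j) = q powi j * (q powi (2 * j\<^sup>2 + j) * q powi (- j\<^sup>2))"
      by (simp add: q(2) add_ac flip: power_int_add)
    moreover have "(-s) powi (2 * j + 1) = - s * q powi j"
      using s0 by (subst powi_split[of "-s" _ "2 * j" 1]) (auto simp: sj)
    ultimately show ?thesis unfolding h_def tri \<theta>_def by (simp add: mult_ac)
  qed
  ultimately have "(h has_sum \<theta>1 * A + (- s * \<theta>0 * C)) UNIV"
    by (intro has_sum_even_odd) (simp_all only: has_sum_cmult_right[OF A] has_sum_cmult_right[OF C])
  then have "T = \<theta>1 * A + (- s * \<theta>0 * C)" using T(2) has_sum_unique by blast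
  then show ?thesis using T(1) by simp
qed

section \<open>Parity parts of products of two theta series\<close>

lemma has_sum_four:
  fixes H :: "'b \<Rightarrow> complex" and \<phi>1 \<phi>2 \<phi>3 \<phi>4 :: "'a \<Rightarrow> 'b"
  assumes inj: "inj \<phi>1" "inj \<phi>2" "inj \<phi>3" "inj \<phi>4"
    and disj: "range \<phi>1 \<inter> range \<phi>2 = {}" "range \<phi>1 \<inter> range \<phi>3 = {}" "range \<phi>1 \<inter> range \<phi>4 = {}"
      "range \<phi>2 \<inter> range \<phi>3 = {}" "range \<phi>2 \<inter> range \<phi>4 = {}" "range \<phi>3 \<inter> range \<phi>4 = {}"
    and supp: "\<And>x. x \<notin> range \<phi>1 \<union> range \<phi>2 \<union> range \<phi>3 \<union> range \<phi>4 \<Longrightarrow> H x = 0"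
    and sums: "((\<lambda>x. H (\<phi>1 x)) has_sum S1) UNIV" "((\<lambda>x. H (\<phi>2 x)) has_sum S2) UNIV"
      "((\<lambda>x. H (\<phi>3 x)) has_sum S3) UNIV" "((\<lambda>x. H (\<phi>4 x)) has_sum S4) UNIV"
  shows "(H has_sum S1 + S2 + S3 + S4) UNIV"
proof -
  have "(H has_sum S1) (range \<phi>1)" "(H has_sum S2) (range \<phi>2)" "(H has_sum S3) (range \<phi>3)" "(H has_sum S4) (range \<phi>4)"
    using sums inj by (simp_all add: has_sum_reindex o_def)
  then have "(H has_sum S1 + S2 + S3 + S4) (range \<phi>1 \<union> range \<phi>2 \<union> range \<phi>3 \<union> range \<phi>4)"
    using disj by (intro has_sum_Un_disjoint) (simp_all add: Int_Un_distrib2)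
  then show ?thesis
    by (rule has_sum_cong_neutral[THEN iffD1, rotated -1]) (use supp in auto)
qed

text \<open>Summand of a theta series with alternating signs. The division is exact when a + b is
  even, as \<open>pent_jtp\<close> assumes; the triple product in base t^a then applies with
  argument t^((a+b)/2).\<close>

definition pent_term :: "int \<Rightarrow> int \<Rightarrow> complex \<Rightarrow> int \<Rightarrow> complex" where
  "pent_term a b t k = (if even k then 1 else -1) * t powi ((a * k\<^sup>2 + b * k) div 2)"

lemma pent_jtp:
  assumes t: "norm t < 1" "t \<noteq> 0" and ab: "even (int a + b)" "2 * int c = int a + b" "0 < c" "c < a"
  shows "(pent_term (int a) b t has_sum qpoch_inf (t ^ a) (t ^ a) * qpoch_inf (t ^ c) (t ^ a) * qpoch_inf (t ^ (a - c)) (t ^ a)) UNIV"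
proof -
  have q: "norm (t ^ a) < 1" "t ^ a \<noteq> 0" using t ab by (auto simp: norm_power power_less_one_iff)
  have "t ^ a / t ^ c = t ^ (a - c)" using t ab by (simp add: power_diff)
  moreover have "(- (t ^ c)) powi n * (t ^ a) powi (n * (n - 1) div 2) = pent_term (int a) b t n" for n
  proof -
    define T where "T = n * (n - 1) div 2"
    have T: "n * (n - 1) = 2 * T" by (simp only: T_def two_tri)
    have "even (int a * n\<^sup>2 + b * n)" using ab(1) by simp
    then have "2 * ((int a * n\<^sup>2 + b * n) div 2) = int a * n\<^sup>2 + b * n" by simp
    also have "\<dots> = int a * (n * (n - 1)) + (int a + b) * n" by (simp add: power2_eq_square algebra_simps)
    also have "\<dots> = 2 * (int c * n + int a * T)" unfolding T ab(2)[symmetric] by (simp add: algebra_simps)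
    finally have e: "(int a * n\<^sup>2 + b * n) div 2 = int c * n + int a * (n * (n - 1) div 2)"
      unfolding T_def by (metis mult_cancel_left zero_neq_numeral)
    show ?thesis
      unfolding pent_term_def e by (simp add: power_int_minus_left powi_of_power power_int_add t(2))
  qed
  ultimately show ?thesis
    using jacobi_triple_product[OF q, of "t ^ c"] t by simp
qed

lemma pent_3_1:
  assumes t: "norm t < 1" "t \<noteq> 0"
  shows "(pent_term 3 1 t has_sum qpoch_inf t t) UNIV"
proof -
  have "qpoch_inf t t = qpoch_inf (t ^ 3) (t ^ 3) * qpoch_inf (t ^ 2) (t ^ 3) * qpoch_inf (t ^ (3 - 2)) (t ^ 3)"
    using qpoch_inf_dissect[OF t(1), of 3 t] by (simp add: lessThan_Suc numeral_3_eq_3 numeral_2_eq_2 mult_ac)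
  then show ?thesis using pent_jtp[OF t, of 3 1 2] by simp
qed

lemma pent_5_1:
  assumes t: "norm t < 1" "t \<noteq> 0"
  shows "(pent_term 5 1 t has_sum qpoch_inf (t ^ 5) (t ^ 5) * qpoch_inf (t ^ 3) (t ^ 5) * qpoch_inf (t ^ 2) (t ^ 5)) UNIV"
  using pent_jtp[OF t, of 5 1 3] by simp

lemma pent_5_3:
  assumes t: "norm t < 1" "t \<noteq> 0"
  shows "(pent_term 5 3 t has_sum qpoch_inf (t ^ 5) (t ^ 5) * qpoch_inf (t ^ 4) (t ^ 5) * qpoch_inf t (t ^ 5)) UNIV"
  using pent_jtp[OF t, of 5 3 4] by simp

lemma has_sum_imp_norm_summable:
  fixes f :: "'a \<Rightarrow> complex"
  assumes "(f has_sum S) UNIV"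
  shows "(\<lambda>x. norm (f x)) summable_on UNIV"
  using has_sum_imp_summable[OF assms] by (simp flip: summable_on_iff_abs_summable_on_complex)

lemma has_sum_prod:
  fixes f :: "'a \<Rightarrow> complex" and g :: "'b \<Rightarrow> complex"
  assumes "(f has_sum F) UNIV" "(g has_sum G) UNIV"
  shows "((\<lambda>x. f (fst x) * g (snd x)) has_sum F * G) UNIV"
  by (rule has_sum_times[OF has_sum_imp_norm_summable[OF assms(1)] has_sum_imp_norm_summable[OF assms(2)] assms])

text \<open>Replacing t by -t multiplies the term with exponent e by (-1)^e and leaves the signs
  attached to the indices alone, so half the sum keeps the even exponents and half the difference
  the odd ones.\<close>

lemma pent_parity:
  assumes F: "(pent_term a b t has_sum F) UNIV" "(pent_term c d t has_sum G) UNIV"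
    and F': "(pent_term a b (-t) has_sum F') UNIV" "(pent_term c d (-t) has_sum G') UNIV"
  defines "e \<equiv> \<lambda>x. (a * (fst x)\<^sup>2 + b * fst x) div 2 + (c * (snd x)\<^sup>2 + d * snd x) div 2"
  assumes t: "t \<noteq> 0"
  shows "((\<lambda>x. if even (e x) then (if even (fst x + snd x) then 1 else -1) * t powi e x else 0) has_sum (F * G + F' * G') / 2) UNIV"
    and "((\<lambda>x. if odd (e x) then (if even (fst x + snd x) then 1 else -1) * t powi e x else 0) has_sum (F * G - F' * G') / 2) UNIV"
proof -
  have p: "pent_term a b u (fst x) * pent_term c d u (snd x) = (if even (fst x + snd x) then 1 else -1) * u powi e x"
    if "u \<noteq> 0" for u x
    using that by (simp add: pent_term_def e_def power_int_add)
  have 1: "((\<lambda>x. (if even (fst x + snd x) then 1 else -1) * t powi e x) has_sum F * G) UNIV"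
    using has_sum_prod[OF F] p[OF t] by simp
  have "((\<lambda>x. (if even (fst x + snd x) then 1 else -1) * (-t) powi e x) has_sum F' * G') UNIV"
    using has_sum_prod[OF F'] p[of "-t"] t by simp
  then have 2: "((\<lambda>x. (if even (fst x + snd x) then 1 else -1) * (if even (e x) then t powi e x else - (t powi e x))) has_sum F' * G') UNIV"
    by (simp only: power_int_minus_left)
  show "((\<lambda>x. if even (e x) then (if even (fst x + snd x) then 1 else -1) * t powi e x else 0) has_sum (F * G + F' * G') / 2) UNIV"
  proof -
    have "((\<lambda>x. 1/2 * ((if even (fst x + snd x) then 1 else -1) * t powi e x + (if even (fst x + snd x) then 1 else -1) * (if even (e x) then t powi e x else - (t powi e x))))
      has_sum 1/2 * (F * G + F' * G')) UNIV"
      by (rule has_sum_cmult_right[OF has_sum_add[OF 1 2]])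
    moreover have "(\<lambda>x. 1/2 * ((if even (fst x + snd x) then 1 else -1) * t powi e x + (if even (fst x + snd x) then 1 else -1) * (if even (e x) then t powi e x else - (t powi e x))))
      = (\<lambda>x. if even (e x) then (if even (fst x + snd x) then 1 else -1) * t powi e x else 0)" by (auto simp: fun_eq_iff)
    ultimately show ?thesis by simp
  qed
  show "((\<lambda>x. if odd (e x) then (if even (fst x + snd x) then 1 else -1) * t powi e x else 0) has_sum (F * G - F' * G') / 2) UNIV"
  proof -
    have "((\<lambda>x. 1/2 * ((if even (fst x + snd x) then 1 else -1) * t powi e x - (if even (fst x + snd x) then 1 else -1) * (if even (e x) then t powi e x else - (t powi e x))))
      has_sum 1/2 * (F * G - F' * G')) UNIV"
      by (rule has_sum_cmult_right[OF has_sum_diff[OF 1 2]])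
    moreover have "(\<lambda>x. 1/2 * ((if even (fst x + snd x) then 1 else -1) * t powi e x - (if even (fst x + snd x) then 1 else -1) * (if even (e x) then t powi e x else - (t powi e x))))
      = (\<lambda>x. if odd (e x) then (if even (fst x + snd x) then 1 else -1) * t powi e x else 0)" by (auto simp: fun_eq_iff)
    ultimately show ?thesis by simp
  qed
qed

lemma half_sum: "even A \<Longrightarrow> even B \<Longrightarrow> A + B = 2 * (E::int) \<Longrightarrow> A div 2 + B div 2 = E"
  by presburger

text \<open>For x = (k, l) one has 2e = 4(k^2 + l^2) + (k + l)(k - l + 1), and the last two factors
  have opposite parity, so e is even exactly if 4 divides k + l or k - l + 1. These pairs form four
  classes modulo 8, parametrised by \<open>\<phi>1\<close> to \<open>\<phi>4\<close>. The directions
  (1,-1) and (3,5) are orthogonal for 5k^2 + 3l^2, as are (1,1) and (3,-5); hence the exponent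
  separates in the new coordinates and each class contributes a product of two theta series.\<close>

lemma lattice_even:
  assumes t: "t \<noteq> (0::complex)"
    and \<theta>0: "((\<lambda>n. t powi (4 * n\<^sup>2)) has_sum \<theta>0) UNIV"
    and \<theta>1: "((\<lambda>n. t powi (4 * n\<^sup>2 + 4 * n)) has_sum \<theta>1) UNIV"
    and V: "((\<lambda>j. t powi (60 * j\<^sup>2 + 4 * j)) has_sum V) UNIV"
    and V': "((\<lambda>j. t powi (60 * j\<^sup>2 + 44 * j + 8)) has_sum V') UNIV"
    and W: "((\<lambda>j. t powi (60 * j\<^sup>2 + 16 * j)) has_sum W) UNIV"
    and W': "((\<lambda>j. t powi (60 * j\<^sup>2 + 56 * j + 12)) has_sum W') UNIV"
  defines "e \<equiv> \<lambda>x. (5 * (fst x)\<^sup>2 + 1 * fst x) div 2 + (3 * (snd x)\<^sup>2 + 1 * snd x) div 2"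
  shows "((\<lambda>x. if even (e x) then (if even (fst x + snd x) then 1 else -1) * t powi e x else 0)
    has_sum \<theta>0 * V + - (\<theta>0 * V') + - (t\<^sup>2 * (\<theta>1 * W)) + t\<^sup>2 * (\<theta>1 * W')) UNIV"
    (is "(?H has_sum _) UNIV")
proof -
  define \<phi>1 where "\<phi>1 = (\<lambda>x::int \<times> int. (3 * snd x + fst x, 5 * snd x - fst x))"
  define \<phi>2 where "\<phi>2 = (\<lambda>x::int \<times> int. (3 * snd x + 1 + fst x, fst x - 5 * snd x - 2))"
  define \<phi>3 where "\<phi>3 = (\<lambda>x::int \<times> int. (- (3 * snd x + fst x + 1), 5 * snd x - fst x))"
  define \<phi>4 where "\<phi>4 = (\<lambda>x::int \<times> int. (- (3 * snd x + fst x + 2), fst x - 5 * snd x - 2))"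
  have r1: "x \<in> range \<phi>1 \<longleftrightarrow> (fst x + snd x) mod 8 = 0" for x
  proof
    assume m: "(fst x + snd x) mod 8 = 0"
    define j where "j = (fst x + snd x) div 8"
    have "fst x + snd x = 8 * j + 0"
      using mult_div_mod_eq[of 8 "fst x + snd x"] unfolding m by (simp add: j_def)
    then have "x = \<phi>1 (fst x - 3 * j, j)"
      by (cases x) (simp add: \<phi>1_def)
    then show "x \<in> range \<phi>1" by blast
  qed (erule rangeE, simp add: \<phi>1_def, presburger?)
  have r2: "x \<in> range \<phi>2 \<longleftrightarrow> (fst x - snd x) mod 8 = 3" for x
  proof
    assume m: "(fst x - snd x) mod 8 = 3"
    define j where "j = (fst x - snd x) div 8"
    have "fst x - snd x = 8 * j + 3"
      using mult_div_mod_eq[of 8 "fst x - snd x"] unfolding m by (simp add: j_def)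
    then have "x = \<phi>2 (fst x - 1 - 3 * j, j)"
      by (cases x) (simp add: \<phi>2_def)
    then show "x \<in> range \<phi>2" by blast
  qed (erule rangeE, simp add: \<phi>2_def, presburger?)
  have r3: "x \<in> range \<phi>3 \<longleftrightarrow> (fst x - snd x) mod 8 = 7" for x
  proof
    assume m: "(fst x - snd x) mod 8 = 7"
    define j where "j = - ((fst x - snd x) div 8) - 1"
    have "fst x - snd x = 8 * (- j - 1) + 7"
      using mult_div_mod_eq[of 8 "fst x - snd x"] unfolding m by (simp add: j_def)
    then have "x = \<phi>3 (- fst x - 1 - 3 * j, j)"
      by (cases x) (simp add: \<phi>3_def)
    then show "x \<in> range \<phi>3" by blast
  qed (erule rangeE, simp add: \<phi>3_def, presburger?)
  have r4: "x \<in> range \<phi>4 \<longleftrightarrow> (fst x + snd x) mod 8 = 4" for x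
  proof
    assume m: "(fst x + snd x) mod 8 = 4"
    define j where "j = - ((fst x + snd x) div 8) - 1"
    have "fst x + snd x = 8 * (- j - 1) + 4"
      using mult_div_mod_eq[of 8 "fst x + snd x"] unfolding m by (simp add: j_def)
    then have "x = \<phi>4 (- fst x - 2 - 3 * j, j)"
      by (cases x) (simp add: \<phi>4_def)
    then show "x \<in> range \<phi>4" by blast
  qed (erule rangeE, simp add: \<phi>4_def, presburger?)
  have e1: "e (\<phi>1 x) = 4 * (fst x)\<^sup>2 + (60 * (snd x)\<^sup>2 + 4 * snd x)" for x
    unfolding e_def \<phi>1_def by (intro half_sum; (simp add: power2_eq_square algebra_simps)?; blast?)
  have e2: "e (\<phi>2 x) = 4 * (fst x)\<^sup>2 + (60 * (snd x)\<^sup>2 + 44 * snd x + 8)" for x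
    unfolding e_def \<phi>2_def by (intro half_sum; (simp add: power2_eq_square algebra_simps)?; blast?)
  have e3: "e (\<phi>3 x) = (4 * (fst x)\<^sup>2 + 4 * fst x) + (60 * (snd x)\<^sup>2 + 16 * snd x) + 2" for x
    unfolding e_def \<phi>3_def by (intro half_sum; (simp add: power2_eq_square algebra_simps)?; blast?)
  have e4: "e (\<phi>4 x) = (4 * (fst x)\<^sup>2 + 4 * fst x) + (60 * (snd x)\<^sup>2 + 56 * snd x + 12) + 2" for x
    unfolding e_def \<phi>4_def by (intro half_sum; (simp add: power2_eq_square algebra_simps)?; blast?)
  have p2: "t powi (A + B + 2) = t\<^sup>2 * (t powi A * t powi B)" for A B
    using t by (simp add: power_int_add)
  have H1: "?H (\<phi>1 x) = t powi (4 * (fst x)\<^sup>2) * t powi (60 * (snd x)\<^sup>2 + 4 * snd x)" for x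
    unfolding e1 using t by (simp add: \<phi>1_def power_int_add)
  have H2: "?H (\<phi>2 x) = - (t powi (4 * (fst x)\<^sup>2) * t powi (60 * (snd x)\<^sup>2 + 44 * snd x + 8))" for x
    unfolding e2 using t by (simp add: \<phi>2_def power_int_add)
  have H3: "?H (\<phi>3 x) = - (t\<^sup>2 * (t powi (4 * (fst x)\<^sup>2 + 4 * fst x) * t powi (60 * (snd x)\<^sup>2 + 16 * snd x)))" for x
    unfolding e3 p2 by (simp add: \<phi>3_def)
  have H4: "?H (\<phi>4 x) = t\<^sup>2 * (t powi (4 * (fst x)\<^sup>2 + 4 * fst x) * t powi (60 * (snd x)\<^sup>2 + 56 * snd x + 12))" for x
    unfolding e4 p2 by (simp add: \<phi>4_def)
  show ?thesis
  proof (rule has_sum_four[of \<phi>1 \<phi>2 \<phi>3 \<phi>4])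
    show "inj \<phi>1" by (rule inj_on_inverseI[where g = "\<lambda>x. (fst x - 3 * ((fst x + snd x) div 8), (fst x + snd x) div 8)"]) (simp add: \<phi>1_def)
    show "inj \<phi>2" by (auto simp: inj_on_def \<phi>2_def)
    show "inj \<phi>3" by (auto simp: inj_on_def \<phi>3_def)
    show "inj \<phi>4" by (auto simp: inj_on_def \<phi>4_def)
    show "range \<phi>1 \<inter> range \<phi>2 = {}"
      unfolding disjoint_iff r1 r2 by (intro allI impI) presburger
    show "range \<phi>1 \<inter> range \<phi>3 = {}"
      unfolding disjoint_iff r1 r3 by (intro allI impI) presburger
    show "range \<phi>1 \<inter> range \<phi>4 = {}"
      unfolding disjoint_iff r1 r4 by (intro allI impI) presburger
    show "range \<phi>2 \<inter> range \<phi>3 = {}"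
      unfolding disjoint_iff r2 r3 by (intro allI impI) presburger
    show "range \<phi>2 \<inter> range \<phi>4 = {}"
      unfolding disjoint_iff r2 r4 by (intro allI impI) presburger
    show "range \<phi>3 \<inter> range \<phi>4 = {}"
      unfolding disjoint_iff r3 r4 by (intro allI impI) presburger
    show "?H x = 0" if "x \<notin> range \<phi>1 \<union> range \<phi>2 \<union> range \<phi>3 \<union> range \<phi>4" for x
    proof -
      obtain k l where x: "x = (k, l)" by (cases x)
      have m1: "a mod 8 \<noteq> 0 \<Longrightarrow> a mod 8 \<noteq> 4 \<Longrightarrow> \<not> 4 dvd a" for a :: int by presburger
      have m2: "a mod 8 \<noteq> 3 \<Longrightarrow> a mod 8 \<noteq> 7 \<Longrightarrow> \<not> 4 dvd (a + 1)" for a :: int by presburger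
      have nr: "\<not> 4 dvd (k + l)" "\<not> 4 dvd (k - l + 1)"
        using that m1[of "k + l"] m2[of "k - l"] unfolding Un_iff r1 r2 r3 r4 x fst_conv snd_conv by blast+
      have "odd (e x)"
      proof
        assume "even (e x)"
        then obtain m where m: "e x = 2 * m" by (elim evenE)
        have "2 * e x = (5 * k\<^sup>2 + 1 * k) + (3 * l\<^sup>2 + 1 * l)"
        proof -
          have "even (5 * k\<^sup>2 + 1 * k)" "even (3 * l\<^sup>2 + 1 * l)" by simp_all
          then show ?thesis unfolding e_def x by simp
        qed
        then have "(k + l) * (k - l + 1) = 4 * (m - k\<^sup>2 - l\<^sup>2)"
          unfolding m by (simp add: power2_eq_square algebra_simps)
        then have d: "4 dvd (k + l) * (k - l + 1)" by simp
        show False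
        proof (cases "even (k + l)")
          case True
          then have "coprime (2 ^ 2) (k - l + 1)" by (subst coprime_power_left_iff) auto
          then show False using d nr by (simp add: coprime_dvd_mult_left_iff)
        next
          case False
          then have "coprime (2 ^ 2) (k + l)" by (subst coprime_power_left_iff) auto
          then show False using d nr by (simp add: coprime_dvd_mult_right_iff)
        qed
      qed
      then show ?thesis by simp
    qed
    show "((\<lambda>x. ?H (\<phi>1 x)) has_sum \<theta>0 * V) UNIV"
      unfolding H1 by (rule has_sum_prod[OF \<theta>0 V])
    show "((\<lambda>x. ?H (\<phi>2 x)) has_sum - (\<theta>0 * V')) UNIV"
      unfolding H2 by (rule has_sum_uminusI[OF has_sum_prod[OF \<theta>0 V']])
    show "((\<lambda>x. ?H (\<phi>3 x)) has_sum - (t\<^sup>2 * (\<theta>1 * W))) UNIV"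
      unfolding H3 by (rule has_sum_uminusI[OF has_sum_cmult_right[OF has_sum_prod[OF \<theta>1 W]]])
    show "((\<lambda>x. ?H (\<phi>4 x)) has_sum t\<^sup>2 * (\<theta>1 * W')) UNIV"
      unfolding H4 by (rule has_sum_cmult_right[OF has_sum_prod[OF \<theta>1 W']])
  qed
qed

text \<open>The same method for 2e = 4(k^2 + l^2 + k) + (k - l)(k + l - 1): e is odd exactly if the
  even one of the last two factors is 2 modulo 4, that is, if k - l is 2 or k + l is 3 modulo 4. The
  constant terms of the separated exponents produce the factors t and t^3.\<close>

lemma lattice_odd:
  assumes t: "t \<noteq> (0::complex)"
    and \<theta>0: "((\<lambda>n. t powi (4 * n\<^sup>2)) has_sum \<theta>0) UNIV"
    and \<theta>1: "((\<lambda>n. t powi (4 * n\<^sup>2 + 4 * n)) has_sum \<theta>1) UNIV"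
    and V: "((\<lambda>j. t powi (60 * j\<^sup>2 + 8 * j)) has_sum V) UNIV"
    and V': "((\<lambda>j. t powi (60 * j\<^sup>2 + 32 * j + 4)) has_sum V') UNIV"
    and W: "((\<lambda>j. t powi (60 * j\<^sup>2 + 28 * j)) has_sum W) UNIV"
    and W': "((\<lambda>j. t powi (60 * j\<^sup>2 + 52 * j + 8)) has_sum W') UNIV"
  defines "e \<equiv> \<lambda>x. (5 * (fst x)\<^sup>2 + 3 * fst x) div 2 + (3 * (snd x)\<^sup>2 + 1 * snd x) div 2"
  shows "((\<lambda>x. if odd (e x) then (if even (fst x + snd x) then 1 else -1) * t powi e x else 0)
    has_sum - (t * (\<theta>1 * V)) + t * (\<theta>1 * V') + t ^ 3 * (\<theta>0 * W) + - (t ^ 3 * (\<theta>0 * W'))) UNIV"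
    (is "(?H has_sum _) UNIV")
proof -
  define \<phi>1 where "\<phi>1 = (\<lambda>x::int \<times> int. (- (3 * snd x + fst x + 1), fst x - 5 * snd x))"
  define \<phi>2 where "\<phi>2 = (\<lambda>x::int \<times> int. (3 * snd x + fst x + 1, fst x - 5 * snd x - 1))"
  define \<phi>3 where "\<phi>3 = (\<lambda>x::int \<times> int. (- (3 * snd x + fst x + 1), 5 * snd x - fst x + 1))"
  define \<phi>4 where "\<phi>4 = (\<lambda>x::int \<times> int. (3 * snd x + fst x + 1, 5 * snd x - fst x + 2))"
  have r1: "x \<in> range \<phi>1 \<longleftrightarrow> (fst x + snd x) mod 8 = 7" for x
  proof
    assume m: "(fst x + snd x) mod 8 = 7"
    define j where "j = - ((fst x + snd x) div 8) - 1"
    have "fst x + snd x = 8 * (- j - 1) + 7"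
      using mult_div_mod_eq[of 8 "fst x + snd x"] unfolding m by (simp add: j_def)
    then have "x = \<phi>1 (- fst x - 1 - 3 * j, j)"
      by (cases x) (simp add: \<phi>1_def)
    then show "x \<in> range \<phi>1" by blast
  qed (erule rangeE, simp add: \<phi>1_def, presburger?)
  have r2: "x \<in> range \<phi>2 \<longleftrightarrow> (fst x - snd x) mod 8 = 2" for x
  proof
    assume m: "(fst x - snd x) mod 8 = 2"
    define j where "j = (fst x - snd x) div 8"
    have "fst x - snd x = 8 * j + 2"
      using mult_div_mod_eq[of 8 "fst x - snd x"] unfolding m by (simp add: j_def)
    then have "x = \<phi>2 (fst x - 1 - 3 * j, j)"
      by (cases x) (simp add: \<phi>2_def)
    then show "x \<in> range \<phi>2" by blast
  qed (erule rangeE, simp add: \<phi>2_def, presburger?)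
  have r3: "x \<in> range \<phi>3 \<longleftrightarrow> (fst x - snd x) mod 8 = 6" for x
  proof
    assume m: "(fst x - snd x) mod 8 = 6"
    define j where "j = - ((fst x - snd x) div 8) - 1"
    have "fst x - snd x = 8 * (- j - 1) + 6"
      using mult_div_mod_eq[of 8 "fst x - snd x"] unfolding m by (simp add: j_def)
    then have "x = \<phi>3 (- fst x - 1 - 3 * j, j)"
      by (cases x) (simp add: \<phi>3_def)
    then show "x \<in> range \<phi>3" by blast
  qed (erule rangeE, simp add: \<phi>3_def, presburger?)
  have r4: "x \<in> range \<phi>4 \<longleftrightarrow> (fst x + snd x) mod 8 = 3" for x
  proof
    assume m: "(fst x + snd x) mod 8 = 3"
    define j where "j = (fst x + snd x) div 8"
    have "fst x + snd x = 8 * j + 3"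
      using mult_div_mod_eq[of 8 "fst x + snd x"] unfolding m by (simp add: j_def)
    then have "x = \<phi>4 (fst x - 1 - 3 * j, j)"
      by (cases x) (simp add: \<phi>4_def)
    then show "x \<in> range \<phi>4" by blast
  qed (erule rangeE, simp add: \<phi>4_def, presburger?)
  have e1: "e (\<phi>1 x) = (4 * (fst x)\<^sup>2 + 4 * fst x) + (60 * (snd x)\<^sup>2 + 8 * snd x) + 1" for x
    unfolding e_def \<phi>1_def by (intro half_sum; (simp add: power2_eq_square algebra_simps)?; blast?)
  have e2: "e (\<phi>2 x) = (4 * (fst x)\<^sup>2 + 4 * fst x) + (60 * (snd x)\<^sup>2 + 32 * snd x + 4) + 1" for x
    unfolding e_def \<phi>2_def by (intro half_sum; (simp add: power2_eq_square algebra_simps)?; blast?)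
  have e3: "e (\<phi>3 x) = 4 * (fst x)\<^sup>2 + (60 * (snd x)\<^sup>2 + 28 * snd x) + 3" for x
    unfolding e_def \<phi>3_def by (intro half_sum; (simp add: power2_eq_square algebra_simps)?; blast?)
  have e4: "e (\<phi>4 x) = 4 * (fst x)\<^sup>2 + (60 * (snd x)\<^sup>2 + 52 * snd x + 8) + 3" for x
    unfolding e_def \<phi>4_def by (intro half_sum; (simp add: power2_eq_square algebra_simps)?; blast?)
  have p1: "t powi (A + B + 1) = t * (t powi A * t powi B)" for A B
    using t by (simp add: power_int_add)
  have p3: "t powi (A + B + 3) = t ^ 3 * (t powi A * t powi B)" for A B
    using t by (simp add: power_int_add)
  have H1: "?H (\<phi>1 x) = - (t * (t powi (4 * (fst x)\<^sup>2 + 4 * fst x) * t powi (60 * (snd x)\<^sup>2 + 8 * snd x)))" for x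
    unfolding e1 p1 by (simp add: \<phi>1_def)
  have H2: "?H (\<phi>2 x) = t * (t powi (4 * (fst x)\<^sup>2 + 4 * fst x) * t powi (60 * (snd x)\<^sup>2 + 32 * snd x + 4))" for x
    unfolding e2 p1 by (simp add: \<phi>2_def)
  have H3: "?H (\<phi>3 x) = t ^ 3 * (t powi (4 * (fst x)\<^sup>2) * t powi (60 * (snd x)\<^sup>2 + 28 * snd x))" for x
    unfolding e3 p3 by (simp add: \<phi>3_def)
  have H4: "?H (\<phi>4 x) = - (t ^ 3 * (t powi (4 * (fst x)\<^sup>2) * t powi (60 * (snd x)\<^sup>2 + 52 * snd x + 8)))" for x
    unfolding e4 p3 by (simp add: \<phi>4_def)
  show ?thesis
  proof (rule has_sum_four[of \<phi>1 \<phi>2 \<phi>3 \<phi>4])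
    show "inj \<phi>1" by (auto simp: inj_on_def \<phi>1_def)
    show "inj \<phi>2" by (auto simp: inj_on_def \<phi>2_def)
    show "inj \<phi>3" by (auto simp: inj_on_def \<phi>3_def)
    show "inj \<phi>4" by (auto simp: inj_on_def \<phi>4_def)
    show "range \<phi>1 \<inter> range \<phi>2 = {}"
      unfolding disjoint_iff r1 r2 by (intro allI impI) presburger
    show "range \<phi>1 \<inter> range \<phi>3 = {}"
      unfolding disjoint_iff r1 r3 by (intro allI impI) presburger
    show "range \<phi>1 \<inter> range \<phi>4 = {}"
      unfolding disjoint_iff r1 r4 by (intro allI impI) presburger
    show "range \<phi>2 \<inter> range \<phi>3 = {}"
      unfolding disjoint_iff r2 r3 by (intro allI impI) presburger
    show "range \<phi>2 \<inter> range \<phi>4 = {}"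
      unfolding disjoint_iff r2 r4 by (intro allI impI) presburger
    show "range \<phi>3 \<inter> range \<phi>4 = {}"
      unfolding disjoint_iff r3 r4 by (intro allI impI) presburger
    show "?H x = 0" if "x \<notin> range \<phi>1 \<union> range \<phi>2 \<union> range \<phi>3 \<union> range \<phi>4" for x
    proof -
      obtain k l where x: "x = (k, l)" by (cases x)
      have m1: "a mod 8 \<noteq> 7 \<Longrightarrow> a mod 8 \<noteq> 3 \<Longrightarrow> a mod 4 \<noteq> 3" for a :: int by presburger
      have m2: "a mod 8 \<noteq> 2 \<Longrightarrow> a mod 8 \<noteq> 6 \<Longrightarrow> a mod 4 \<noteq> 2" for a :: int by presburger
      have nr: "(k + l) mod 4 \<noteq> 3" "(k - l) mod 4 \<noteq> 2"
        using that m1[of "k + l"] m2[of "k - l"] unfolding Un_iff r1 r2 r3 r4 x fst_conv snd_conv by blast+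
      have "4 dvd (k - l) * (k + l - 1)"
      proof (cases "even (k - l)")
        case True
        then have "4 dvd (k - l)" using nr by presburger
        then show ?thesis by simp
      next
        case False
        then have "4 dvd (k + l - 1)" using nr by presburger
        then show ?thesis by simp
      qed
      then obtain m where m: "(k - l) * (k + l - 1) = 4 * m" by (elim dvdE)
      have "2 * e x = (5 * k\<^sup>2 + 3 * k) + (3 * l\<^sup>2 + 1 * l)"
      proof -
        have "even (5 * k\<^sup>2 + 3 * k)" "even (3 * l\<^sup>2 + 1 * l)" by simp_all
        then show ?thesis unfolding e_def x by simp
      qed
      also have "\<dots> = (k - l) * (k + l - 1) + 4 * (k\<^sup>2 + l\<^sup>2 + k)"
        by (simp add: power2_eq_square algebra_simps)
      finally have "e x = 2 * (m + (k\<^sup>2 + l\<^sup>2 + k))" unfolding m by simp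
      then show ?thesis by simp
    qed
    show "((\<lambda>x. ?H (\<phi>1 x)) has_sum - (t * (\<theta>1 * V))) UNIV"
      unfolding H1 by (rule has_sum_uminusI[OF has_sum_cmult_right[OF has_sum_prod[OF \<theta>1 V]]])
    show "((\<lambda>x. ?H (\<phi>2 x)) has_sum t * (\<theta>1 * V')) UNIV"
      unfolding H2 by (rule has_sum_cmult_right[OF has_sum_prod[OF \<theta>1 V']])
    show "((\<lambda>x. ?H (\<phi>3 x)) has_sum t ^ 3 * (\<theta>0 * W)) UNIV"
      unfolding H3 by (rule has_sum_cmult_right[OF has_sum_prod[OF \<theta>0 W]])
    show "((\<lambda>x. ?H (\<phi>4 x)) has_sum - (t ^ 3 * (\<theta>0 * W'))) UNIV"
      unfolding H4 by (rule has_sum_uminusI[OF has_sum_cmult_right[OF has_sum_prod[OF \<theta>0 W']]])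
  qed
qed

section \<open>Reflection and evaluation of the bilateral series\<close>

lemma norm_square_less_1: "norm (q::complex) < 1 \<Longrightarrow> norm (q\<^sup>2) < 1"
  by (simp add: norm_power power_less_one_iff)

text \<open>This is (q^(2n+1);q^2) for any integer n, so that (q;q^2)_n is a quotient of two of its
  values. Its factors contain only odd powers of q and hence never vanish, which makes the summands
  of negative index genuine quotients.\<close>

definition odd_poch :: "complex \<Rightarrow> int \<Rightarrow> complex" where
  "odd_poch q n = qpoch_inf (q * (q\<^sup>2) powi n) (q\<^sup>2)"

lemma odd_poch_rec:
  assumes q: "norm q < 1" "q \<noteq> 0"
  shows "odd_poch q n = (1 - q powi (2 * n + 1)) * odd_poch q (n + 1)"
proof -
  have "q * (q\<^sup>2) powi n = q powi (2 * n + 1)"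
    using q(2) by (simp add: powi_of_power power_int_add)
  moreover have "q * (q\<^sup>2) powi n * q\<^sup>2 = q * (q\<^sup>2) powi (n + 1)"
    using q(2) by (simp add: power_int_add)
  ultimately show ?thesis
    unfolding odd_poch_def using qpoch_inf_rec[OF norm_square_less_1[OF q(1)], of "q * (q\<^sup>2) powi n"] by simp
qed

lemma odd_powi_neq_1:
  assumes q: "norm q < 1" "(q::complex) \<noteq> 0" and "k \<noteq> 0"
  shows "q powi k \<noteq> 1"
proof (cases "k > 0")
  case True
  then show ?thesis using one_minus_powi_nonzero[OF q True] by auto
next
  case False
  then have "k < 0" using assms by simp
  then have "q powi (-k) \<noteq> 1" using one_minus_powi_nonzero[OF q, of "-k"] by auto
  then show ?thesis by (simp add: power_int_minus)
qed

lemma odd_poch_nonzero: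
  assumes q: "norm q < 1" "q \<noteq> 0"
  shows "odd_poch q n \<noteq> 0"
proof
  assume "odd_poch q n = 0"
  then obtain j where "q * (q\<^sup>2) powi n * (q\<^sup>2) ^ j = 1"
    unfolding odd_poch_def qpoch_inf_eq_0_iff[OF norm_square_less_1[OF q(1)]] by blast
  moreover have "q * (q\<^sup>2) powi n * (q\<^sup>2) ^ j = q powi (2 * n + 1 + 2 * int j)"
  proof -
    have "(q\<^sup>2) powi n = q powi (2 * n)" by (simp add: powi_of_power)
    moreover have "(q\<^sup>2) ^ j = q powi (2 * int j)"
      using powi_of_power[of q 2 "int j"] by simp
    ultimately show ?thesis using q(2) by (simp add: power_int_add)
  qed
  moreover have "2 * n + 1 + 2 * int j \<noteq> 0" by presburger
  ultimately show False using odd_powi_neq_1[OF q] by auto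
qed

text \<open>Each step exchanges a factor 1 - q^(2n+1) for 1 - q^(-(2n+1)), that is, multiplies by -
  q^(-(2n+1)); these exponents add up to the square. The reflection converts the summands of the
  F-series at negative index into those of the \<phi>-series at -q, where a power of -q absorbs the
  sign.\<close>

lemma odd_poch_reflect_nat:
  assumes q: "norm q < 1" "q \<noteq> 0"
  shows "odd_poch q (- int n) * odd_poch q (int n) =
    (if even n then 1 else -1) * q powi (- (int n)\<^sup>2) * (odd_poch q 0)\<^sup>2"
proof (induction n)
  case (Suc n)
  have 1: "odd_poch q (int n) = (1 - q powi (2 * int n + 1)) * odd_poch q (int n + 1)"
    by (rule odd_poch_rec[OF q])
  have "odd_poch q (- int n - 1) = (1 - q powi (2 * (- int n - 1) + 1)) * odd_poch q (- int n)"
    using odd_poch_rec[OF q, of "- int n - 1"] by simp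
  moreover have "2 * (- int n - 1) + 1 = - (2 * int n + 1)" by simp
  ultimately have 2: "odd_poch q (- int n - 1) = (1 - q powi (- (2 * int n + 1))) * odd_poch q (- int n)"
    by (simp only:)
  have 3: "1 - q powi (- (2 * int n + 1)) = - (q powi (- (2 * int n + 1))) * (1 - q powi (2 * int n + 1))"
    using q(2) by (simp add: right_diff_distrib flip: power_int_add)
  have "odd_poch q (- int n - 1) * odd_poch q (int n + 1)
      = - (q powi (- (2 * int n + 1))) * (odd_poch q (- int n) * odd_poch q (int n))"
    unfolding 2 3 using 1 by (simp add: mult_ac)
  also have "\<dots> = (if even (Suc n) then 1 else -1) * (q powi (- (2 * int n + 1)) * q powi (- (int n)\<^sup>2)) * (odd_poch q 0)\<^sup>2"
    unfolding Suc by simp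
  also have "q powi (- (2 * int n + 1)) * q powi (- (int n)\<^sup>2) = q powi (- (int (Suc n))\<^sup>2)"
    by (rule powi_split[OF q(2), symmetric]) (simp add: power2_eq_square algebra_simps)
  finally have "odd_poch q (- int n - 1) * odd_poch q (int n + 1) =
      (if even (Suc n) then 1 else -1) * q powi (- (int (Suc n))\<^sup>2) * (odd_poch q 0)\<^sup>2" .
  moreover have "- int n - 1 = - int (Suc n)" "int n + 1 = int (Suc n)" by simp_all
  ultimately show ?case by (simp only:)
qed (simp add: power2_eq_square)

lemma odd_poch_reflect:
  assumes q: "norm q < 1" "q \<noteq> 0"
  shows "odd_poch q (- n) / odd_poch q 0 =
    (if even n then 1 else -1) * q powi (- n\<^sup>2) * (odd_poch q 0 / odd_poch q n)"
proof -
  have "odd_poch q (- n) * odd_poch q n = (if even n then 1 else -1) * q powi (- n\<^sup>2) * (odd_poch q 0)\<^sup>2"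
  proof (cases "n \<ge> 0")
    case True
    then show ?thesis using odd_poch_reflect_nat[OF q, of "nat n"] by (simp add: even_nat_iff)
  next
    case False
    then show ?thesis using odd_poch_reflect_nat[OF q, of "nat (-n)"] by (simp add: even_nat_iff mult.commute)
  qed
  then show ?thesis
    using odd_poch_nonzero[OF q] by (simp add: field_simps power2_eq_square)
qed

lemma qpoch_odd: "qpoch q (q\<^sup>2) n = odd_poch q 0 / odd_poch q n"
  by (simp add: qpoch_def odd_poch_def)

lemma odd_poch_fin:
  assumes q: "norm q < 1" "q \<noteq> 0"
  shows "odd_poch q 0 / odd_poch q (int n) = qpoch_fin q (q\<^sup>2) n"
  using qpoch_inf_split[OF norm_square_less_1[OF q(1)], of q n] odd_poch_nonzero[OF q, of "int n"]
  by (simp add: odd_poch_def)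

lemma F0_term_reflect:
  assumes q: "norm q < 1" "q \<noteq> 0"
  shows "F0_term (- n) q = phi0_term n (- q)"
proof -
  have "F0_term (- n) q = q powi (2 * n\<^sup>2) * (odd_poch q (- n) / odd_poch q 0)"
    by (simp add: F0_term_def qpoch_odd)
  also have "\<dots> = (if even n then 1 else -1) * (q powi (2 * n\<^sup>2) * q powi (- n\<^sup>2)) * (odd_poch q 0 / odd_poch q n)"
    unfolding odd_poch_reflect[OF q] by simp
  also have "q powi (2 * n\<^sup>2) * q powi (- n\<^sup>2) = q powi n\<^sup>2"
    by (rule powi_split[OF q(2), symmetric]) simp
  finally show ?thesis by (simp add: phi0_term_def qpoch_odd power_int_minus_left)
qed

lemma F1_term_reflect:
  assumes q: "norm q < 1" "q \<noteq> 0"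
  shows "F1_term (- 1 - n) q = - inverse q * phi1_term n (- q)"
proof -
  have "F1_term (- 1 - n) q = q powi (2 * (- 1 - n) * (- 1 - n + 1)) * (odd_poch q (- n) / odd_poch q 0)"
    by (simp add: F1_term_def qpoch_odd)
  also have "\<dots> = (if even n then 1 else -1) * (q powi (2 * (- 1 - n) * (- 1 - n + 1)) * q powi (- n\<^sup>2)) * (odd_poch q 0 / odd_poch q n)"
    unfolding odd_poch_reflect[OF q] by simp
  also have "q powi (2 * (- 1 - n) * (- 1 - n + 1)) * q powi (- n\<^sup>2) = q powi (-1) * q powi ((n + 1)\<^sup>2)"
    unfolding power_int_add[OF disjI1[OF q(2)], symmetric]
    by (rule arg_cong[where f = "\<lambda>x. q powi x"]) (simp add: power2_eq_square algebra_simps)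
  finally show ?thesis by (simp add: phi1_term_def qpoch_odd power_int_minus_left power_int_minus)
qed

lemma bilateral_phi0:
  assumes q: "norm q < 1" "q \<noteq> 0"
  shows "bilateral phi0_term (- q) = bilateral F0_term q"
proof -
  have "bilateral phi0_term (- q) = infsum (\<lambda>n. F0_term (- n) q) UNIV"
    unfolding bilateral_def F0_term_reflect[OF q] ..
  also have "\<dots> = bilateral F0_term q"
    unfolding bilateral_def by (rule infsum_reindex_bij_betw[OF bij_uminus])
  finally show ?thesis .
qed

lemma bilateral_phi1:
  assumes q: "norm q < 1" "q \<noteq> 0"
  shows "inverse q * bilateral phi1_term (- q) = - bilateral F1_term q"
proof -
  have "- inverse q * bilateral phi1_term (- q) = infsum (\<lambda>n. F1_term (- 1 - n) q) UNIV"
    unfolding bilateral_def F1_term_reflect[OF q] by (rule infsum_cmult_right'[symmetric])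
  also have "\<dots> = bilateral F1_term q"
    unfolding bilateral_def
    by (rule infsum_reindex_bij_betw, rule bij_betwI[where g = "\<lambda>n. - 1 - n"]) auto
  finally show ?thesis by (metis add.inverse_inverse mult_minus_left)
qed

lemma B_chi0_eq:
  assumes q: "norm q < 1" "q \<noteq> 0"
  shows "B_chi0 q = bilateral F0_term q"
  unfolding B_chi0_def bilateral_phi0[OF q] by simp

lemma B_chi1_eq:
  assumes q: "norm q < 1" "q \<noteq> 0"
  shows "B_chi1 q = bilateral F1_term q"
  unfolding B_chi1_def bilateral_phi1[OF q] by simp

text \<open>As \<open>\<theta>\<^sub>4(t) = (t; t)\<^sub>\<infinity>\<^sup>2 / (t\<^sup>2; t\<^sup>2)\<^sub>\<infinity>\<close>, the last two identities say that \<open>B_chi0 (t\<^sup>2)\<close> is the even part of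
  \<open>\<theta>\<^sub>4(t) G(t)\<close> and \<open>- t B_chi1 (t\<^sup>2)\<close> the odd part of \<open>\<theta>\<^sub>4(t) H(t)\<close>.\<close>
lemma B_chi_products:
  assumes t: "norm t < 1" "(t::complex) \<noteq> 0"
  defines "g \<equiv> \<lambda>t. qpoch_inf (t ^ 5) (t ^ 5) * qpoch_inf (t ^ 3) (t ^ 5) * qpoch_inf (t ^ 2) (t ^ 5) * qpoch_inf t t"
    and "h \<equiv> \<lambda>t. qpoch_inf (t ^ 5) (t ^ 5) * qpoch_inf (t ^ 4) (t ^ 5) * qpoch_inf t (t ^ 5) * qpoch_inf t t"
  shows "(\<lambda>n. F0_term n (t\<^sup>2)) summable_on UNIV" "(\<lambda>n. F1_term n (t\<^sup>2)) summable_on UNIV"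
    "qpoch_inf (t\<^sup>2) (t\<^sup>2) * B_chi0 (t\<^sup>2) = (g t + g (- t)) / 2"
    "t * (qpoch_inf (t\<^sup>2) (t\<^sup>2) * B_chi1 (t\<^sup>2)) = - ((h t - h (- t)) / 2)"
proof -
  have q: "norm (t ^ 4) < 1" "t ^ 4 \<noteq> 0" using t by (auto simp: norm_power power_less_one_iff)
  have t2: "norm (t\<^sup>2) < 1" "t\<^sup>2 \<noteq> 0" using t norm_square_less_1 by auto
  have s: "(t\<^sup>2)\<^sup>2 = t ^ 4" by simp
  have tm: "norm (-t) < 1" "-t \<noteq> 0" using t by auto
  define \<theta>0 where "\<theta>0 = infsum (\<lambda>n. (t ^ 4) powi (1 * n\<^sup>2 + 0 * n + 0)) UNIV"
  define \<theta>1 where "\<theta>1 = infsum (\<lambda>n. (t ^ 4) powi (1 * n\<^sup>2 + 1 * n + 0)) UNIV"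
  have \<theta>0: "((\<lambda>n. (t ^ 4) powi (n\<^sup>2)) has_sum \<theta>0) UNIV"
    using quadratic_exp_has_sum[OF q, of 1 0 0] by (simp add: \<theta>0_def)
  have \<theta>1: "((\<lambda>n. (t ^ 4) powi (n\<^sup>2 + n)) has_sum \<theta>1) UNIV"
    using quadratic_exp_has_sum[OF q, of 1 1 0] by (simp add: \<theta>1_def)
  have pw: "(t ^ 4) powi k = t powi (4 * k)" for k by (simp add: powi_of_power)
  have \<theta>0': "((\<lambda>n. t powi (4 * n\<^sup>2)) has_sum \<theta>0) UNIV" using \<theta>0 unfolding pw .
  have \<theta>1': "((\<lambda>n. t powi (4 * n\<^sup>2 + 4 * n)) has_sum \<theta>1) UNIV" using \<theta>1 unfolding pw distrib_left .
  have E0: "odd_poch (t\<^sup>2) n = qpoch_inf (t\<^sup>2 * (t ^ 4) powi n) (t ^ 4)" for n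
    unfolding odd_poch_def s ..
  have nz: "odd_poch (t\<^sup>2) 0 \<noteq> 0" by (rule odd_poch_nonzero[OF t2])
  have dis: "qpoch_inf (t\<^sup>2) (t\<^sup>2) = odd_poch (t\<^sup>2) 0 * qpoch_inf (t ^ 4) (t ^ 4)"
  proof -
    have "qpoch_inf (t\<^sup>2) (t\<^sup>2) = qpoch_inf (t\<^sup>2) ((t\<^sup>2)\<^sup>2) * qpoch_inf (t\<^sup>2 * t\<^sup>2) ((t\<^sup>2)\<^sup>2)"
      using qpoch_inf_dissect[OF t2(1), of 2 "t\<^sup>2"] by (simp add: lessThan_Suc numeral_2_eq_2 mult.commute)
    then show ?thesis unfolding s E0 by (simp flip: power_add)
  qed
  have F0: "F0_term n (t\<^sup>2) = (t ^ 4) powi n\<^sup>2 * qpoch_inf (t\<^sup>2 * (t ^ 4) powi n) (t ^ 4) * inverse (odd_poch (t\<^sup>2) 0)" for n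
    unfolding F0_term_def qpoch_odd E0[symmetric] by (simp add: powi_of_power field_simps)
  \<comment> \<open>The shift by -1 turns 2n(n+1) into 2(n^2 - n) and the index n + 1 of the
    Pochhammer symbol into n, which is the shape of \<open>bilateral_1\<close> in base t^4 with s =
    t^2.\<close>
  have F1: "F1_term (n + (-1)) (t\<^sup>2) = (t ^ 4) powi (n\<^sup>2 - n) * qpoch_inf (t\<^sup>2 * (t ^ 4) powi n) (t ^ 4) * inverse (odd_poch (t\<^sup>2) 0)" for n
  proof -
    have "2 * (2 * (n + - 1) * (n + - 1 + 1)) = 4 * (n\<^sup>2 - n)" by (simp add: power2_eq_square algebra_simps)
    then have "(t\<^sup>2) powi (2 * (n + - 1) * (n + - 1 + 1)) = (t ^ 4) powi (n\<^sup>2 - n)"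
      by (simp only: powi_of_power) simp
    then show ?thesis unfolding F1_term_def qpoch_odd E0[symmetric] by (simp add: field_simps)
  qed
  obtain A V V' where A: "((\<lambda>n. (t ^ 4) powi (n\<^sup>2) * ipoch (t ^ 4) (2 * n)) has_sum A) UNIV"
    "((\<lambda>j. (t ^ 4) powi (15 * j\<^sup>2 + j)) has_sum V) UNIV"
    "((\<lambda>j. (t ^ 4) powi (15 * j\<^sup>2 + 11 * j + 2)) has_sum V') UNIV"
    "qpoch_inf (t ^ 4) (t ^ 4) * A = V - V'" by (rule rogers_0[OF q])
  obtain C W W' where C: "((\<lambda>n. (t ^ 4) powi (n\<^sup>2 + n) * ipoch (t ^ 4) (2 * n + 1)) has_sum C) UNIV"
    "((\<lambda>j. (t ^ 4) powi (15 * j\<^sup>2 + 4 * j)) has_sum W) UNIV"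
    "((\<lambda>j. (t ^ 4) powi (15 * j\<^sup>2 + 14 * j + 3)) has_sum W') UNIV"
    "qpoch_inf (t ^ 4) (t ^ 4) * C = W - W'" by (rule rogers_1[OF q])
  have X0: "((\<lambda>n. F0_term n (t\<^sup>2)) has_sum (\<theta>0 * A - t\<^sup>2 * \<theta>1 * C) * inverse (odd_poch (t\<^sup>2) 0)) UNIV"
    unfolding F0 by (rule has_sum_cmult_left[OF bilateral_0[OF q s \<theta>0 \<theta>1 A(1) C(1)]])
  then show "(\<lambda>n. F0_term n (t\<^sup>2)) summable_on UNIV" by (rule has_sum_imp_summable)
  have "B_chi0 (t\<^sup>2) = (\<theta>0 * A - t\<^sup>2 * \<theta>1 * C) * inverse (odd_poch (t\<^sup>2) 0)"
    unfolding B_chi0_eq[OF t2] bilateral_def using X0 by (rule infsumI)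
  then have "qpoch_inf (t\<^sup>2) (t\<^sup>2) * B_chi0 (t\<^sup>2) = qpoch_inf (t ^ 4) (t ^ 4) * (\<theta>0 * A - t\<^sup>2 * \<theta>1 * C)"
    unfolding dis using nz by simp
  also have "\<dots> = \<theta>0 * (V - V') - t\<^sup>2 * \<theta>1 * (W - W')"
    unfolding A(4)[symmetric] C(4)[symmetric] by (simp add: algebra_simps)
  \<comment> \<open>One lattice sum is evaluated twice: as the even part of a product of two theta
    series, and through the four sublattices.\<close>
  also have "\<dots> = (g t + g (- t)) / 2"
  proof (rule has_sum_unique)
    show "((\<lambda>x. if even ((5 * (fst x)\<^sup>2 + 1 * fst x) div 2 + (3 * (snd x)\<^sup>2 + 1 * snd x) div 2)
        then (if even (fst x + snd x) then 1 else -1) * t powi ((5 * (fst x)\<^sup>2 + 1 * fst x) div 2 + (3 * (snd x)\<^sup>2 + 1 * snd x) div 2)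
        else 0) has_sum (g t + g (- t)) / 2) UNIV"
      unfolding g_def
      by (rule pent_parity(1)[OF pent_5_1[OF t] pent_3_1[OF t] pent_5_1[OF tm] pent_3_1[OF tm] t(2)])
    have "((\<lambda>x. if even ((5 * (fst x)\<^sup>2 + 1 * fst x) div 2 + (3 * (snd x)\<^sup>2 + 1 * snd x) div 2)
        then (if even (fst x + snd x) then 1 else -1) * t powi ((5 * (fst x)\<^sup>2 + 1 * fst x) div 2 + (3 * (snd x)\<^sup>2 + 1 * snd x) div 2)
        else 0) has_sum \<theta>0 * V + - (\<theta>0 * V') + - (t\<^sup>2 * (\<theta>1 * W)) + t\<^sup>2 * (\<theta>1 * W')) UNIV"
      by (rule lattice_even[OF t(2) \<theta>0' \<theta>1']) (use A(2,3) C(2,3) in \<open>simp_all add: pw\<close>)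
    then show "((\<lambda>x. if even ((5 * (fst x)\<^sup>2 + 1 * fst x) div 2 + (3 * (snd x)\<^sup>2 + 1 * snd x) div 2)
        then (if even (fst x + snd x) then 1 else -1) * t powi ((5 * (fst x)\<^sup>2 + 1 * fst x) div 2 + (3 * (snd x)\<^sup>2 + 1 * snd x) div 2)
        else 0) has_sum \<theta>0 * (V - V') - t\<^sup>2 * \<theta>1 * (W - W')) UNIV"
      by (simp add: algebra_simps)
  qed
  finally show "qpoch_inf (t\<^sup>2) (t\<^sup>2) * B_chi0 (t\<^sup>2) = (g t + g (- t)) / 2" .
  obtain A' U U' where A': "((\<lambda>n. (t ^ 4) powi (n\<^sup>2 + n) * ipoch (t ^ 4) (2 * n)) has_sum A') UNIV"
    "((\<lambda>j. (t ^ 4) powi (15 * j\<^sup>2 + 2 * j)) has_sum U) UNIV"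
    "((\<lambda>j. (t ^ 4) powi (15 * j\<^sup>2 + 8 * j + 1)) has_sum U') UNIV"
    "qpoch_inf (t ^ 4) (t ^ 4) * A' = U - U'" by (rule rogers_2[OF q])
  obtain C' Z Z' where C': "((\<lambda>n. (t ^ 4) powi (n\<^sup>2 + 2 * n) * ipoch (t ^ 4) (2 * n + 1)) has_sum C') UNIV"
    "((\<lambda>j. (t ^ 4) powi (15 * j\<^sup>2 + 7 * j)) has_sum Z) UNIV"
    "((\<lambda>j. (t ^ 4) powi (15 * j\<^sup>2 + 13 * j + 2)) has_sum Z') UNIV"
    "qpoch_inf (t ^ 4) (t ^ 4) * C' = Z - Z'" by (rule rogers_3[OF q])
  have "((\<lambda>n. F1_term (n + (-1)) (t\<^sup>2)) has_sum (\<theta>1 * A' - t\<^sup>2 * \<theta>0 * C') * inverse (odd_poch (t\<^sup>2) 0)) UNIV"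
    unfolding F1 by (rule has_sum_cmult_left[OF bilateral_1[OF q s \<theta>0 \<theta>1 A'(1) C'(1)]])
  then have X1: "((\<lambda>n. F1_term n (t\<^sup>2)) has_sum (\<theta>1 * A' - t\<^sup>2 * \<theta>0 * C') * inverse (odd_poch (t\<^sup>2) 0)) UNIV"
    by (rule has_sum_shift_int[THEN iffD1])
  then show "(\<lambda>n. F1_term n (t\<^sup>2)) summable_on UNIV" by (rule has_sum_imp_summable)
  have "B_chi1 (t\<^sup>2) = (\<theta>1 * A' - t\<^sup>2 * \<theta>0 * C') * inverse (odd_poch (t\<^sup>2) 0)"
    unfolding B_chi1_eq[OF t2] bilateral_def using X1 by (rule infsumI)
  then have "qpoch_inf (t\<^sup>2) (t\<^sup>2) * B_chi1 (t\<^sup>2) = qpoch_inf (t ^ 4) (t ^ 4) * (\<theta>1 * A' - t\<^sup>2 * \<theta>0 * C')"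
    unfolding dis using nz by simp
  also have "\<dots> = \<theta>1 * (U - U') - t\<^sup>2 * \<theta>0 * (Z - Z')"
    unfolding A'(4)[symmetric] C'(4)[symmetric] by (simp add: algebra_simps)
  finally have B1: "qpoch_inf (t\<^sup>2) (t\<^sup>2) * B_chi1 (t\<^sup>2) = \<theta>1 * (U - U') - t\<^sup>2 * \<theta>0 * (Z - Z')" .
  have "- (t * (\<theta>1 * U)) + t * (\<theta>1 * U') + t ^ 3 * (\<theta>0 * Z) + - (t ^ 3 * (\<theta>0 * Z')) = (h t - h (- t)) / 2"
  proof (rule has_sum_unique)
    show "((\<lambda>x. if odd ((5 * (fst x)\<^sup>2 + 3 * fst x) div 2 + (3 * (snd x)\<^sup>2 + 1 * snd x) div 2)
        then (if even (fst x + snd x) then 1 else -1) * t powi ((5 * (fst x)\<^sup>2 + 3 * fst x) div 2 + (3 * (snd x)\<^sup>2 + 1 * snd x) div 2)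
        else 0) has_sum (h t - h (- t)) / 2) UNIV"
      unfolding h_def
      by (rule pent_parity(2)[OF pent_5_3[OF t] pent_3_1[OF t] pent_5_3[OF tm] pent_3_1[OF tm] t(2)])
    show "((\<lambda>x. if odd ((5 * (fst x)\<^sup>2 + 3 * fst x) div 2 + (3 * (snd x)\<^sup>2 + 1 * snd x) div 2)
        then (if even (fst x + snd x) then 1 else -1) * t powi ((5 * (fst x)\<^sup>2 + 3 * fst x) div 2 + (3 * (snd x)\<^sup>2 + 1 * snd x) div 2)
        else 0) has_sum - (t * (\<theta>1 * U)) + t * (\<theta>1 * U') + t ^ 3 * (\<theta>0 * Z) + - (t ^ 3 * (\<theta>0 * Z'))) UNIV"
      by (rule lattice_odd[OF t(2) \<theta>0' \<theta>1']) (use A'(2,3) C'(2,3) in \<open>simp_all add: pw\<close>)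
  qed
  moreover have "t * (qpoch_inf (t\<^sup>2) (t\<^sup>2) * B_chi1 (t\<^sup>2)) =
      - (- (t * (\<theta>1 * U)) + t * (\<theta>1 * U') + t ^ 3 * (\<theta>0 * Z) + - (t ^ 3 * (\<theta>0 * Z')))"
    unfolding B1 by (simp add: algebra_simps power2_eq_square power3_eq_cube)
  ultimately show "t * (qpoch_inf (t\<^sup>2) (t\<^sup>2) * B_chi1 (t\<^sup>2)) = - ((h t - h (- t)) / 2)"
    by (simp only:)
qed

lemma infsum_int_split:
  fixes f :: "int \<Rightarrow> complex"
  assumes f: "f summable_on UNIV"
  shows "infsum f UNIV = (\<Sum>n. f (int n)) + (\<Sum>n. f (- 1 - int n))"
    and "summable (\<lambda>n. f (int n))" and "summable (\<lambda>n. f (- 1 - int n))"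
proof -
  have 1: "(f has_sum infsum f (range int)) (range int)"
    and 2: "(f has_sum infsum f (range (\<lambda>n. - 1 - int n))) (range (\<lambda>n. - 1 - int n))"
    by (intro has_sum_infsum summable_on_subset_banach[OF f]; simp)+
  have "range int \<inter> range (\<lambda>n. - 1 - int n) = {}" by auto
  from has_sum_Un_disjoint[OF 1 2 this]
  have "(f has_sum infsum f (range int) + infsum f (range (\<lambda>n. - 1 - int n))) (range int \<union> range (\<lambda>n. - 1 - int n))" .
  also have "range int \<union> range (\<lambda>n. - 1 - int n) = UNIV"
  proof -
    have "x \<in> range int \<union> range (\<lambda>n. - 1 - int n)" for x
    proof (cases "x \<ge> 0")
      case True
      then have "x = int (nat x)" by simp
      then show ?thesis by blast
    next
      case False
      then have "x = - 1 - int (nat (- 1 - x))" by simp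
      then show ?thesis by blast
    qed
    then show ?thesis by auto
  qed
  finally have 3: "infsum f UNIV = infsum f (range int) + infsum f (range (\<lambda>n. - 1 - int n))"
    by (rule infsumI)
  have "((\<lambda>n. f (int n)) has_sum infsum f (range int)) UNIV"
    using 1 by (subst (asm) has_sum_reindex) (auto simp: o_def)
  then have 4: "(\<lambda>n. f (int n)) sums infsum f (range int)" by (rule has_sum_imp_sums)
  have "((\<lambda>n. f (- 1 - int n)) has_sum infsum f (range (\<lambda>n. - 1 - int n))) UNIV"
    using 2 by (subst (asm) has_sum_reindex) (auto simp: o_def inj_on_def)
  then have 5: "(\<lambda>n. f (- 1 - int n)) sums infsum f (range (\<lambda>n. - 1 - int n))" by (rule has_sum_imp_sums)
  show "infsum f UNIV = (\<Sum>n. f (int n)) + (\<Sum>n. f (- 1 - int n))"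
    unfolding 3 using sums_unique[OF 4] sums_unique[OF 5] by simp
  show "summable (\<lambda>n. f (int n))" "summable (\<lambda>n. f (- 1 - int n))"
    using 4 5 sums_summable by blast+
qed

text \<open>The reflection n -> -n for F0 meets the term n = 0 in both halves, hence the correction
  -1, while n -> -1 - n for F1 maps the negative indices exactly onto the nonnegative ones.
  Summability is taken from the product formulas, which are stated at squares, hence the square root
  of \<open>q\<close>.\<close>

lemma B_chi_series:
  assumes q: "norm q < 1" "q \<noteq> 0"
  shows "B_chi0 q = (\<Sum>n. q ^ (2 * n\<^sup>2) / qpoch_fin q (q\<^sup>2) n) + (\<Sum>n. (-1) ^ n * q ^ n\<^sup>2 * qpoch_fin q (q\<^sup>2) n) - 1"
    and "B_chi1 q = (\<Sum>n. q ^ (2 * n * (n + 1)) / qpoch_fin q (q\<^sup>2) (n + 1)) + (\<Sum>n. (-1) ^ n * q ^ (n\<^sup>2 + 2 * n) * qpoch_fin q (q\<^sup>2) n)"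
proof -
  define t where "t = csqrt q"
  have t: "t\<^sup>2 = q" by (simp add: t_def)
  have "norm t < 1"
  proof -
    have "norm t ^ 2 < 1" using t q(1) by (metis norm_power)
    then show ?thesis by (simp add: power_less_one_iff)
  qed
  moreover have "t \<noteq> 0" using t q by auto
  ultimately have sm: "(\<lambda>n. F0_term n q) summable_on UNIV" "(\<lambda>n. F1_term n q) summable_on UNIV"
    using B_chi_products(1,2)[of t] unfolding t by blast+
  have a0: "F0_term (int n) q = q ^ (2 * n\<^sup>2) / qpoch_fin q (q\<^sup>2) n" for n
  proof -
    have "q powi (2 * (int n)\<^sup>2) = q ^ (2 * n\<^sup>2)" by (simp flip: power_int_of_nat)
    then show ?thesis by (simp add: F0_term_def qpoch_odd odd_poch_fin[OF q])
  qed
  have b0: "F0_term (- int n) q = (-1) ^ n * q ^ n\<^sup>2 * qpoch_fin q (q\<^sup>2) n" for n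
  proof -
    have "(- q) powi ((int n)\<^sup>2) = (-1) ^ n * q ^ n\<^sup>2"
    proof -
      have "(- q) powi ((int n)\<^sup>2) = (-q) ^ n\<^sup>2" by (simp flip: power_int_of_nat)
      also have "\<dots> = (-1) ^ n\<^sup>2 * q ^ n\<^sup>2" by (rule power_minus)
      finally show ?thesis by (simp add: uminus_power_if)
    qed
    then show ?thesis unfolding F0_term_reflect[OF q] by (simp add: phi0_term_def qpoch_odd odd_poch_fin[OF q])
  qed
  have "(\<Sum>n. F0_term (- 1 - int n) q) = (\<Sum>n. (-1) ^ n * q ^ n\<^sup>2 * qpoch_fin q (q\<^sup>2) n) - 1"
  proof -
    have e: "- 1 - int n = - int (Suc n)" for n by simp
    have "summable (\<lambda>n. F0_term (- int (Suc n)) q)"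
      using infsum_int_split(3)[OF sm(1)] unfolding e .
    then have "summable (\<lambda>n. F0_term (- int n) q)" by (subst (asm) summable_Suc_iff)
    from suminf_split_head[OF this] show ?thesis unfolding e b0 by simp
  qed
  then show "B_chi0 q = (\<Sum>n. q ^ (2 * n\<^sup>2) / qpoch_fin q (q\<^sup>2) n) + (\<Sum>n. (-1) ^ n * q ^ n\<^sup>2 * qpoch_fin q (q\<^sup>2) n) - 1"
    unfolding B_chi0_eq[OF q] bilateral_def infsum_int_split(1)[OF sm(1)] a0 by simp
  have a1: "F1_term (int n) q = q ^ (2 * n * (n + 1)) / qpoch_fin q (q\<^sup>2) (n + 1)" for n
  proof -
    have "q powi (2 * int n * (int n + 1)) = q powi int (2 * n * (n + 1))"
      by (rule arg_cong[where f = "\<lambda>x. q powi x"]) (simp add: algebra_simps)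
    also have "\<dots> = q ^ (2 * n * (n + 1))" by (rule power_int_of_nat)
    finally have "q powi (2 * int n * (int n + 1)) = q ^ (2 * n * (n + 1))" .
    moreover have "int n + 1 = int (n + 1)" by simp
    ultimately show ?thesis by (simp only: F1_term_def qpoch_odd odd_poch_fin[OF q])
  qed
  have b1: "F1_term (- 1 - int n) q = (-1) ^ n * q ^ (n\<^sup>2 + 2 * n) * qpoch_fin q (q\<^sup>2) n" for n
  proof -
    have "(- q) powi ((int n + 1)\<^sup>2) = (-q) powi int (Suc (n\<^sup>2 + 2 * n))"
      by (rule arg_cong[where f = "\<lambda>x. (-q) powi x"]) (simp add: power2_eq_square algebra_simps)
    also have "\<dots> = (-q) ^ Suc (n\<^sup>2 + 2 * n)" by (rule power_int_of_nat)
    also have "\<dots> = (-1) ^ Suc (n\<^sup>2 + 2 * n) * q ^ Suc (n\<^sup>2 + 2 * n)" by (rule power_minus)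
    also have "\<dots> = - ((-1) ^ n) * q * q ^ (n\<^sup>2 + 2 * n)" by (simp add: uminus_power_if)
    finally have "(- q) powi ((int n + 1)\<^sup>2) = - ((-1) ^ n) * q * q ^ (n\<^sup>2 + 2 * n)" .
    then show ?thesis
      unfolding F1_term_reflect[OF q] using q(2) by (simp add: phi1_term_def qpoch_odd odd_poch_fin[OF q])
  qed
  show "B_chi1 q = (\<Sum>n. q ^ (2 * n * (n + 1)) / qpoch_fin q (q\<^sup>2) (n + 1)) + (\<Sum>n. (-1) ^ n * q ^ (n\<^sup>2 + 2 * n) * qpoch_fin q (q\<^sup>2) n)"
    unfolding B_chi1_eq[OF q] bilateral_def infsum_int_split(1)[OF sm(2)] a1 b1 ..
qed

section \<open>The mock theta relations\<close>

text \<open>The coefficient of 2 (-q;q) in the odd moments of \<open>neg_poch\<close> below. Divided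
  by (q^2;q^2)_k it is a convolution in n and k - n, which later allows a series over k to be
  unfolded into a double series.\<close>

definition gauss_partial :: "complex \<Rightarrow> nat \<Rightarrow> complex" where
  "gauss_partial q k = (\<Sum>n\<le>k. (-1) ^ n * q ^ n\<^sup>2 * (qpoch_fin (q\<^sup>2) (q\<^sup>2) k / qpoch_fin (q\<^sup>2) (q\<^sup>2) (k - n)))"

text \<open>Let \<open>u n\<close> be the quotient of Pochhammer symbols for k + 1. Replacing
  \<open>u n\<close> by \<open>u (Suc n)\<close> leaves terms with exponent n^2 + 2(k - n) + 2 = 2k
  + 1 + (n - 1)^2, hence q^(2k+1) times the same kind of sum with shifted index; the shift leaves
  the boundary term q^(2k+2).\<close>

lemma gauss_partial_Suc:
  assumes q: "norm q < 1"
  shows "gauss_partial q (Suc k) = q ^ (2 * k + 2) + (1 - q ^ (2 * k + 2)) * (1 - q ^ (2 * k + 1)) * gauss_partial q k"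
proof -
  define P where "P = qpoch_fin (q\<^sup>2) (q\<^sup>2)"
  have Pnz: "P n \<noteq> 0" for n
    unfolding P_def by (intro qpoch_fin_nonzero norm_square_less_1 q)
  define u where "u = (\<lambda>n. P (Suc k) / P (Suc k - n))"
  have u_Suc: "u (Suc n) = (1 - q ^ (2 * (k - n) + 2)) * u n" if "n \<le> k" for n
  proof -
    have e: "Suc k - n = Suc (k - n)" using that by simp
    have "P (Suc k - n) = P (k - n) * (1 - q ^ (2 * (k - n) + 2))"
      unfolding e by (simp add: P_def qpoch_fin_Suc power_add power_mult power2_eq_square mult_ac power_mult_distrib)
    moreover from this have "1 - q ^ (2 * (k - n) + 2) \<noteq> 0" using Pnz[of "Suc k - n"] by (metis mult_zero_right)
    ultimately show ?thesis unfolding u_def diff_Suc_Suc by (simp only:) simp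
  qed
  have E: "gauss_partial q (Suc k) = (\<Sum>n\<le>Suc k. (-1) ^ n * q ^ n\<^sup>2 * u n)"
    by (simp add: gauss_partial_def u_def P_def)
  have E': "(1 - q ^ (2 * k + 2)) * gauss_partial q k = (\<Sum>n\<le>k. (-1) ^ n * q ^ n\<^sup>2 * u (Suc n))"
  proof -
    have "P (Suc k) = (1 - q ^ (2 * k + 2)) * P k"
      by (simp add: P_def qpoch_fin_Suc power_add power_mult power2_eq_square mult_ac power_mult_distrib)
    then show ?thesis
      unfolding gauss_partial_def sum_distrib_left by (intro sum.cong) (auto simp: u_def P_def)
  qed
  have step: "(-1) ^ n * q ^ n\<^sup>2 * u (Suc n) = (-1) ^ n * q ^ n\<^sup>2 * u n - (-1) ^ n * q ^ (n\<^sup>2 + 2 * (k - n) + 2) * u n" if "n \<le> k" for n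
    unfolding u_Suc[OF that] by (simp add: power_add algebra_simps)
  have "(\<Sum>n\<le>k. (-1) ^ n * q ^ (n\<^sup>2 + 2 * (k - n) + 2) * u n) + (-1) ^ Suc k * q ^ (Suc k)\<^sup>2 * u (Suc k)
      = q ^ (2 * k + 2) - q ^ (2 * k + 1) * (\<Sum>n\<le>k. (-1) ^ n * q ^ n\<^sup>2 * u (Suc n))"
  proof -
    define v where "v = (\<lambda>n. (-1) ^ n * q ^ (if n = 0 then 2 * k + 2 else 2 * k + 1 + (n - 1)\<^sup>2) * u n)"
    have "(-1) ^ n * q ^ (n\<^sup>2 + 2 * (k - n) + 2) * u n = v n" if n: "n \<le> k" for n
    proof (cases n)
      case (Suc m)
      then have "n\<^sup>2 + 2 * (k - n) + 2 = 2 * k + 1 + (n - 1)\<^sup>2"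
        using n by (simp add: power2_eq_square algebra_simps)
      then show ?thesis by (simp add: v_def Suc)
    qed (simp add: v_def)
    moreover have "(-1) ^ Suc k * q ^ (Suc k)\<^sup>2 * u (Suc k) = v (Suc k)"
    proof -
      have "(Suc k)\<^sup>2 = 2 * k + 1 + k\<^sup>2" by (simp add: power2_eq_square)
      then show ?thesis by (simp add: v_def)
    qed
    ultimately have "(\<Sum>n\<le>k. (-1) ^ n * q ^ (n\<^sup>2 + 2 * (k - n) + 2) * u n) + (-1) ^ Suc k * q ^ (Suc k)\<^sup>2 * u (Suc k) = (\<Sum>n\<le>Suc k. v n)"
      by simp
    also have "\<dots> = v 0 + (\<Sum>n\<le>k. v (Suc n))" by (rule sum.atMost_Suc_shift)
    also have "v 0 = q ^ (2 * k + 2)" using Pnz by (simp add: v_def u_def)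
    also have "(\<Sum>n\<le>k. v (Suc n)) = - (q ^ (2 * k + 1) * (\<Sum>n\<le>k. (-1) ^ n * q ^ n\<^sup>2 * u (Suc n)))"
      unfolding sum_distrib_left sum_negf[symmetric] by (intro sum.cong) (simp_all add: v_def power_add)
    finally show ?thesis by simp
  qed
  moreover have "gauss_partial q (Suc k) = (\<Sum>n\<le>k. (-1) ^ n * q ^ n\<^sup>2 * u (Suc n))
     + ((\<Sum>n\<le>k. (-1) ^ n * q ^ (n\<^sup>2 + 2 * (k - n) + 2) * u n) + (-1) ^ Suc k * q ^ (Suc k)\<^sup>2 * u (Suc k))"
  proof -
    have "(\<Sum>n\<le>k. (-1) ^ n * q ^ n\<^sup>2 * u (Suc n)) =
        (\<Sum>n\<le>k. (-1) ^ n * q ^ n\<^sup>2 * u n) - (\<Sum>n\<le>k. (-1) ^ n * q ^ (n\<^sup>2 + 2 * (k - n) + 2) * u n)"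
      unfolding sum_subtractf[symmetric] by (intro sum.cong) (simp_all only: step atMost_iff)
    then show ?thesis unfolding E by simp
  qed
  ultimately have "gauss_partial q (Suc k) = (\<Sum>n\<le>k. (-1) ^ n * q ^ n\<^sup>2 * u (Suc n))
     + (q ^ (2 * k + 2) - q ^ (2 * k + 1) * (\<Sum>n\<le>k. (-1) ^ n * q ^ n\<^sup>2 * u (Suc n)))" by simp
  also have "\<dots> = q ^ (2 * k + 2) + (1 - q ^ (2 * k + 1)) * ((1 - q ^ (2 * k + 2)) * gauss_partial q k)"
    unfolding E' by (simp add: algebra_simps)
  finally show ?thesis by (simp add: mult_ac)
qed

definition neg_poch :: "complex \<Rightarrow> nat \<Rightarrow> complex" where
  "neg_poch q n = qpoch_inf (- (q ^ (n + 1))) q"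

lemma neg_poch_LIMSEQ:
  assumes q: "norm q < 1"
  shows "neg_poch q \<longlonglongrightarrow> 1"
proof -
  have "(\<lambda>n. - (q ^ (n + 1))) \<longlonglongrightarrow> 0"
    using tendsto_minus[OF LIMSEQ_ignore_initial_segment[OF LIMSEQ_power_zero[OF q], of 1]] by simp
  from isCont_tendsto_compose[OF continuous_qpoch_inf_left[OF q] this]
  show ?thesis by (simp add: neg_poch_def[abs_def])
qed

lemma neg_poch_bounded:
  assumes q: "norm q < 1"
  obtains C where "C > 0" "\<And>n. norm (neg_poch q n) \<le> C"
proof -
  have "Bseq (neg_poch q)"
    using neg_poch_LIMSEQ[OF q] by (intro convergent_imp_Bseq convergentI)
  then show ?thesis by (elim BseqE) (blast intro: that)
qed

lemma neg_poch_summable: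
  assumes q: "norm q < 1"
  shows "summable (\<lambda>n. norm (q ^ (n * Suc j) * neg_poch q n))"
proof -
  obtain C where C: "C > 0" "\<And>n. norm (neg_poch q n) \<le> C" by (rule neg_poch_bounded[OF q]) (rule that)
  show ?thesis
  proof (rule summable_comparison_test')
    show "summable (\<lambda>n. norm q ^ n * C)"
      using q by (intro summable_mult2 summable_geometric) auto
    show "norm (norm (q ^ (n * Suc j) * neg_poch q n)) \<le> norm q ^ n * C" for n
    proof -
      have "norm q ^ (n * Suc j) \<le> norm q ^ n"
        using q by (intro power_decreasing) auto
      then show ?thesis using C(2)[of n] C(1)
        by (simp only: norm_mult norm_power real_norm_def abs_mult abs_norm_cancel power_abs) (intro mult_mono, auto)
    qed
  qed
qed

text \<open>Since (-q^n;q) = (1 + q^n)(-q^(n+1);q), each summand is a difference of consecutive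
  products. The series telescopes from (-1;q) = 2 (-q;q) to the limit 1.\<close>

lemma neg_poch_moment_1:
  assumes q: "norm q < 1"
  shows "(\<lambda>n. q ^ n * neg_poch q n) sums (2 * qpoch_inf (- q) q - 1)"
proof -
  define f where "f = (\<lambda>n. qpoch_inf (- (q ^ n)) q)"
  have "q ^ n * neg_poch q n = f n - f (Suc n)" for n
    unfolding f_def neg_poch_def using qpoch_inf_rec[OF q, of "- (q ^ n)"] by (simp add: algebra_simps)
  moreover have "(\<lambda>n. f n - f (Suc n)) sums (f 0 - 1)"
  proof (rule telescope_sums')
    have "(\<lambda>n. f (Suc n)) \<longlonglongrightarrow> 1" using neg_poch_LIMSEQ[OF q] by (simp add: f_def neg_poch_def[abs_def])
    then show "f \<longlonglongrightarrow> 1" by (rule LIMSEQ_imp_Suc)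
  qed
  moreover have "f 0 = 2 * qpoch_inf (- q) q"
    unfolding f_def using qpoch_inf_rec[OF q, of "-1"] by simp
  ultimately show ?thesis by simp
qed

text \<open>The series of q^(n(j+1)) (-q^n;q) is evaluated twice: splitting off the factor 1 + q^n
  gives the sum of two consecutive moments, and separating the term n = 0 gives q^(j+1) times the
  earlier moment.\<close>

lemma neg_poch_moment_Suc:
  assumes q: "norm q < 1" and S: "(\<lambda>n. q ^ (n * Suc j) * neg_poch q n) sums S"
  shows "(\<lambda>n. q ^ (n * Suc (Suc j)) * neg_poch q n) sums ((q ^ Suc j - 1) * S + 2 * qpoch_inf (- q) q)"
proof -
  have sm: "summable (\<lambda>n. q ^ (n * Suc (Suc j)) * neg_poch q n)"
    using neg_poch_summable[OF q] by (rule summable_norm_cancel)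
  define S' where "S' = (\<Sum>n. q ^ (n * Suc (Suc j)) * neg_poch q n)"
  have S': "(\<lambda>n. q ^ (n * Suc (Suc j)) * neg_poch q n) sums S'"
    using sm by (simp add: S'_def summable_sums)
  define g where "g = (\<lambda>n. q ^ (n * Suc j) * qpoch_inf (- (q ^ n)) q)"
  have "g = (\<lambda>n. q ^ (n * Suc j) * neg_poch q n + q ^ (n * Suc (Suc j)) * neg_poch q n)"
  proof
    fix n
    have "qpoch_inf (- (q ^ n)) q = (1 + q ^ n) * neg_poch q n"
      unfolding neg_poch_def using qpoch_inf_rec[OF q, of "- (q ^ n)"] by (simp add: mult.commute)
    then show "g n = q ^ (n * Suc j) * neg_poch q n + q ^ (n * Suc (Suc j)) * neg_poch q n"
      by (simp add: g_def algebra_simps power_add)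
  qed
  then have 1: "g sums (S + S')" using sums_add[OF S S'] by (simp only:)
  have "(\<lambda>n. g (Suc n)) = (\<lambda>n. q ^ Suc j * (q ^ (n * Suc j) * neg_poch q n))"
    by (rule ext) (simp add: g_def neg_poch_def power_add algebra_simps)
  then have "(\<lambda>n. g (Suc n)) sums (q ^ Suc j * S)" using sums_mult[OF S, of "q ^ Suc j"] by (simp only:)
  then have "g sums (q ^ Suc j * S + g 0)" by (simp add: sums_Suc_iff)
  then have "S + S' = q ^ Suc j * S + g 0" using 1 sums_unique2 by blast
  moreover have "g 0 = 2 * qpoch_inf (- q) q"
    unfolding g_def using qpoch_inf_rec[OF q, of "-1"] by simp
  ultimately have "S' = (q ^ Suc j - 1) * S + 2 * qpoch_inf (- q) q" by (simp add: algebra_simps)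
  then show ?thesis using S' by simp
qed

text \<open>Two steps of the moment recursion multiply by (1 - q^(2k+1))(1 - q^(2k+2)) and add 2
  (-q;q) q^(2k+2). These are the recurrences of \<open>gauss_partial\<close> and, without the added
  term, of (q;q)_(2k).\<close>

lemma neg_poch_moment_odd:
  assumes q: "norm q < 1"
  shows "(\<lambda>n. q ^ (n * Suc (2 * k)) * neg_poch q n) sums
    (2 * qpoch_inf (- q) q * gauss_partial q k - qpoch_fin q q (2 * k))"
proof (induction k)
  case 0
  then show ?case using neg_poch_moment_1[OF q] by (simp add: gauss_partial_def)
next
  case (Suc k)
  define H where "H = qpoch_inf (- q) q"
  from neg_poch_moment_Suc[OF q neg_poch_moment_Suc[OF q Suc.IH]]
  have "(\<lambda>n. q ^ (n * Suc (2 * Suc k)) * neg_poch q n) sums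
    ((q ^ Suc (Suc (2 * k)) - 1) * ((q ^ Suc (2 * k) - 1) * (2 * H * gauss_partial q k - qpoch_fin q q (2 * k)) + 2 * H) + 2 * H)"
    by (simp add: H_def)
  also have "(q ^ Suc (Suc (2 * k)) - 1) * ((q ^ Suc (2 * k) - 1) * (2 * H * gauss_partial q k - qpoch_fin q q (2 * k)) + 2 * H) + 2 * H
    = 2 * H * gauss_partial q (Suc k) - qpoch_fin q q (2 * Suc k)"
  proof -
    have "qpoch_fin q q (2 * Suc k) = (1 - q ^ Suc (Suc (2 * k))) * (1 - q ^ Suc (2 * k)) * qpoch_fin q q (2 * k)"
      by (simp add: qpoch_fin_Suc mult_ac)
    moreover have "gauss_partial q (Suc k) = q ^ Suc (Suc (2 * k)) + (1 - q ^ Suc (Suc (2 * k))) * (1 - q ^ Suc (2 * k)) * gauss_partial q k"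
      using gauss_partial_Suc[OF q, of k] by simp
    ultimately show ?thesis by (simp only:) (simp add: algebra_simps)
  qed
  finally show ?case by (simp add: H_def)
qed

lemma even_poch_split:
  assumes q: "norm q < 1"
  shows "qpoch_fin q q (2 * k) = qpoch_fin q (q\<^sup>2) k * qpoch_fin (q\<^sup>2) (q\<^sup>2) k"
proof (induction k)
  case (Suc k)
  have "2 * Suc k = Suc (Suc (2 * k))" by simp
  then show ?case using Suc
    by (simp only: qpoch_fin_Suc) (simp add: power_mult power2_eq_square mult_ac power_mult_distrib)
qed simp

text \<open>Expanding \<open>(b q\<^sup>2\<^sup>n; q\<^sup>2)\<^sub>\<infinity>\<close> by Euler's identity turns the left-hand side into the odd moments
  of \<open>(-q\<^sup>n\<^sup>+\<^sup>1; q)\<^sub>\<infinity>\<close>.\<close>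
lemma mock_theta_relation:
  assumes q: "norm q < 1" "q \<noteq> 0" and b: "norm b < 1"
  shows "(\<Sum>n. q ^ n * (qpoch_inf (b * q ^ (2 * n)) (q\<^sup>2) * neg_poch q n)) =
     2 * qpoch_inf (- q) q * (\<Sum>n. b ^ n * (q\<^sup>2) ^ (n choose 2) * q ^ n\<^sup>2 * qpoch_inf (b * q ^ (2 * n)) (q\<^sup>2))
     - (\<Sum>k. (- b) ^ k * (q\<^sup>2) ^ (k choose 2) * qpoch_fin q (q\<^sup>2) k)"
    and "summable (\<lambda>n. b ^ n * (q\<^sup>2) ^ (n choose 2) * q ^ n\<^sup>2 * qpoch_inf (b * q ^ (2 * n)) (q\<^sup>2))"
proof -
  have q2: "norm (q\<^sup>2) < 1" by (rule norm_square_less_1[OF q(1)])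
  define P where "P = qpoch_fin (q\<^sup>2) (q\<^sup>2)"
  have Pnz: "P n \<noteq> 0" for n unfolding P_def by (rule qpoch_fin_nonzero[OF q2 q2])
  define c where "c = (\<lambda>b k. (-1) ^ k * (q\<^sup>2) ^ (k choose 2) / P k * b ^ k)"
  have c_sums: "(c b has_sum qpoch_inf b (q\<^sup>2)) UNIV" for b
    unfolding c_def P_def by (rule norm_summable_imp_has_sum[OF euler_summable[OF q2] euler_sums[OF q2]])
  have c_abs: "(\<lambda>k. norm (c b k)) summable_on UNIV" for b
    by (rule has_sum_imp_norm_summable[OF c_sums])
  have h_abs: "(\<lambda>n. norm (q ^ (n * Suc 0) * neg_poch q n)) summable_on UNIV"
    using neg_poch_summable[OF q(1), of 0] by (subst summable_on_UNIV_nonneg_real_iff) auto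
  \<comment> \<open>The factor q^(2nk) hidden in the coefficient at b q^(2n) is what makes each
    column an odd moment.\<close>
  define f where "f = (\<lambda>(n, k). q ^ n * neg_poch q n * c (b * q ^ (2 * n)) k)"
  have f_alt: "f (n, k) = c b k * (q ^ (n * Suc (2 * k)) * neg_poch q n)" for n k
    by (simp add: f_def c_def power_mult_distrib power_add power_mult[symmetric] algebra_simps)
  have f_abs: "(\<lambda>x. norm (f x)) summable_on UNIV"
  proof (rule summable_on_comparison_test[OF abs_summable_times[OF h_abs c_abs[of b]]])
    fix x :: "nat \<times> nat"
    obtain n k where x: "x = (n, k)" by (cases x)
    have "norm q ^ (n * Suc (2 * k)) \<le> norm q ^ n"
      using q by (intro power_decreasing) auto
    then have "norm (c b k) * (norm q ^ (n * Suc (2 * k)) * norm (neg_poch q n)) \<le> norm (c b k) * (norm q ^ n * norm (neg_poch q n))"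
      by (intro mult_left_mono mult_right_mono) auto
    then show "norm (f x) \<le> norm (q ^ (fst x * Suc 0) * neg_poch q (fst x) * c b (snd x))"
      by (simp add: x f_alt norm_mult norm_power mult_ac)
  qed auto
  define M where "M = (\<lambda>k. 2 * qpoch_inf (- q) q * gauss_partial q k - qpoch_fin q q (2 * k))"
  have row: "((\<lambda>k. f (n, k)) has_sum q ^ n * neg_poch q n * qpoch_inf (b * q ^ (2 * n)) (q\<^sup>2)) UNIV" for n
    unfolding f_def prod.case by (rule has_sum_cmult_right[OF c_sums])
  have col: "((\<lambda>n. f (n, k)) has_sum c b k * M k) UNIV" for k
    unfolding f_alt M_def
    by (intro has_sum_cmult_right norm_summable_imp_has_sum neg_poch_summable neg_poch_moment_odd q)
  obtain T where T: "((\<lambda>n. q ^ n * neg_poch q n * qpoch_inf (b * q ^ (2 * n)) (q\<^sup>2)) has_sum T) UNIV"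
    "((\<lambda>k. c b k * M k) has_sum T) UNIV"
    by (rule has_sum_double[OF f_abs row col])
  define g where "g = (\<lambda>(n, m). b ^ n * (q\<^sup>2) ^ (n choose 2) * q ^ n\<^sup>2 * c (b * q ^ (2 * n)) m)"
  have g_abs: "(\<lambda>x. norm (g x)) summable_on UNIV"
  proof (rule summable_on_comparison_test)
    have "(\<lambda>n. norm (b ^ n)) summable_on UNIV"
      using b summable_geometric[of "norm b"] by (subst summable_on_UNIV_nonneg_real_iff) (auto simp: norm_power)
    from abs_summable_times[OF this c_abs[of b]]
    show "(\<lambda>x. norm (b ^ fst x * c b (snd x))) summable_on UNIV" .
    fix x :: "nat \<times> nat"
    obtain n m where x: "x = (n, m)" by (cases x)
    have "g x = b ^ n * c b m * ((q\<^sup>2) ^ (n choose 2) * q ^ n\<^sup>2 * q ^ (2 * n * m))"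
    proof -
      have "(b * q ^ (2 * n)) ^ m = b ^ m * q ^ (2 * n * m)" by (simp only: power_mult_distrib power_mult)
      moreover have "B * X * Y * (s * Z / p * (u * W)) = B * (s * Z / p * u) * (X * Y * W)"
        for B X Y s Z p u W :: complex by simp
      ultimately show ?thesis unfolding x g_def c_def prod.case by simp
    qed
    moreover have "norm ((q\<^sup>2) ^ (n choose 2) * q ^ n\<^sup>2 * q ^ (2 * n * m)) \<le> 1"
      unfolding norm_mult norm_power using q by (intro mult_le_one power_le_one) auto
    ultimately show "norm (g x) \<le> norm (b ^ fst x * c b (snd x))"
      unfolding norm_mult[of "b ^ n * c b m"] x by (simp add: norm_mult mult_left_le)
  qed auto
  define G where "G = infsum g UNIV"
  have g_sum: "(g has_sum G) UNIV"
    unfolding G_def by (rule has_sum_infsum[OF abs_summable_summable[OF g_abs]])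
  have G1: "((\<lambda>n. b ^ n * (q\<^sup>2) ^ (n choose 2) * q ^ n\<^sup>2 * qpoch_inf (b * q ^ (2 * n)) (q\<^sup>2)) has_sum G) UNIV"
  proof (rule has_sum_SigmaD[where B = "\<lambda>_. UNIV"])
    show "(g has_sum G) (UNIV \<times> UNIV)" using g_sum by simp
    show "((\<lambda>m. g (n, m)) has_sum b ^ n * (q\<^sup>2) ^ (n choose 2) * q ^ n\<^sup>2 * qpoch_inf (b * q ^ (2 * n)) (q\<^sup>2)) UNIV" for n
      unfolding g_def prod.case by (rule has_sum_cmult_right[OF c_sums])
  qed
  \<comment> \<open>Regrouping \<open>g\<close> along k = n + m turns it into the convolution
    contained in \<open>gauss_partial\<close>; the triangular exponents match because C(n+m,2) =
    C(n,2) + C(m,2) + nm.\<close>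
  have G2: "((\<lambda>k. c b k * gauss_partial q k) has_sum G) UNIV"
  proof (rule has_sum_SigmaD[where B = "\<lambda>k. {..k}" and f = "\<lambda>(k, n). g (n, k - n)"])
    have bij: "bij_betw (\<lambda>(k, n). (n, k - n)) (SIGMA k:UNIV. {..k}) (UNIV :: (nat \<times> nat) set)"
      by (rule bij_betwI[where g = "\<lambda>(n, m). (n + m, n)"]) auto
    show "((\<lambda>(k, n). g (n, k - n)) has_sum G) (SIGMA k:UNIV. {..k})"
      using has_sum_reindex_bij_betw[OF bij, of g G] g_sum by (simp add: case_prod_unfold)
    fix k :: nat
    have "c b k * gauss_partial q k = (\<Sum>n\<le>k. g (n, k - n))"
      unfolding gauss_partial_def sum_distrib_left P_def[symmetric]
    proof (rule sum.cong)
      fix n assume "n \<in> {..k}"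
      then obtain m where m: "k = n + m" using le_Suc_ex by auto
      have ch: "(n + m) choose 2 = (n choose 2) + (m choose 2) + n * m"
        by (induction m) (simp_all add: numeral_2_eq_2 algebra_simps)
      have sg: "(-1) ^ (n + m) * (-1) ^ n = ((-1) ^ m :: complex)"
        by (simp add: power_add mult_ac flip: power_mult_distrib)
      have "c b k * ((-1) ^ n * q ^ n\<^sup>2 * (P k / P (k - n))) =
          ((-1) ^ (n + m) * (-1) ^ n) * (q\<^sup>2) ^ ((n + m) choose 2) * q ^ n\<^sup>2 / P m * b ^ (n + m)"
        using Pnz[of "n + m"] by (simp add: c_def m)
      also have "\<dots> = g (n, k - n)"
      proof -
        have e1: "(b * q ^ (2 * n)) ^ m = b ^ m * q ^ (2 * n * m)" by (simp only: power_mult_distrib power_mult)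
        have e2: "(q\<^sup>2) ^ ((n choose 2) + (m choose 2) + n * m) = (q\<^sup>2) ^ (n choose 2) * (q\<^sup>2) ^ (m choose 2) * q ^ (2 * n * m)"
          by (simp add: power_add power_mult)
        have e3: "n + m - n = m" by simp
        have "s * (X * Z * W) * Y / p * (u * v) = u * X * Y * (s * Z / p * (v * W))"
          for s X Z W Y p u v :: complex by simp
        then show ?thesis
          unfolding sg ch e2 g_def c_def m prod.case e3 e1 power_add[of b] by blast
      qed
      finally show "c b k * ((-1) ^ n * q ^ n\<^sup>2 * (P k / P (k - n))) = g (n, k - n)" .
    qed simp
    then show "((\<lambda>n. (case (k, n) of (k, n) \<Rightarrow> g (n, k - n))) has_sum c b k * gauss_partial q k) {..k}"
      by (simp add: has_sum_finite)
  qed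
  \<comment> \<open>The denominator (q^2;q^2)_k of Euler's coefficient cancels the even factors of
    (q;q)_(2k) and leaves (q;q^2)_k.\<close>
  have cM: "c b k * M k = 2 * qpoch_inf (- q) q * (c b k * gauss_partial q k) - (- b) ^ k * (q\<^sup>2) ^ (k choose 2) * qpoch_fin q (q\<^sup>2) k" for k
  proof -
    have "c b k * qpoch_fin q q (2 * k) = (- b) ^ k * (q\<^sup>2) ^ (k choose 2) * qpoch_fin q (q\<^sup>2) k"
      unfolding even_poch_split[OF q(1)] P_def[symmetric] using Pnz[of k] by (simp add: c_def power_minus[of b])
    then show ?thesis by (simp add: M_def algebra_simps)
  qed
  have "((\<lambda>k. 2 * qpoch_inf (- q) q * (c b k * gauss_partial q k) - c b k * M k) has_sum 2 * qpoch_inf (- q) q * G - T) UNIV"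
    by (rule has_sum_diff[OF has_sum_cmult_right[OF G2] T(2)])
  then have "((\<lambda>k. (- b) ^ k * (q\<^sup>2) ^ (k choose 2) * qpoch_fin q (q\<^sup>2) k) has_sum 2 * qpoch_inf (- q) q * G - T) UNIV"
    unfolding cM by simp
  note R = sums_unique[OF has_sum_imp_sums[OF this]]
  note L = sums_unique[OF has_sum_imp_sums[OF T(1)]]
  note Gs = has_sum_imp_sums[OF G1]
  show "(\<Sum>n. q ^ n * (qpoch_inf (b * q ^ (2 * n)) (q\<^sup>2) * neg_poch q n)) =
     2 * qpoch_inf (- q) q * (\<Sum>n. b ^ n * (q\<^sup>2) ^ (n choose 2) * q ^ n\<^sup>2 * qpoch_inf (b * q ^ (2 * n)) (q\<^sup>2))
     - (\<Sum>k. (- b) ^ k * (q\<^sup>2) ^ (k choose 2) * qpoch_fin q (q\<^sup>2) k)"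
    unfolding R[symmetric] sums_unique[OF Gs, symmetric] using L by (simp add: mult_ac)
  show "summable (\<lambda>n. b ^ n * (q\<^sup>2) ^ (n choose 2) * q ^ n\<^sup>2 * qpoch_inf (b * q ^ (2 * n)) (q\<^sup>2))"
    using Gs by (rule sums_summable)
qed

section \<open>Radial limits\<close>

lemma double_choose_two: "n + 2 * (n choose 2) = n\<^sup>2"
  by (induction n) (simp_all add: numeral_2_eq_2 power2_eq_square)

lemma power_choose_two:
  "(q::complex) ^ (d * n) * (q\<^sup>2) ^ (n choose 2) = q ^ (n\<^sup>2 + d * n - n)" if "d > 0"
proof -
  have "d * n + 2 * (n choose 2) = n\<^sup>2 + d * n - n"
    using double_choose_two[of n] by simp
  then show ?thesis by (metis power_add power_mult)
qed

text \<open>Splitting (q^(2n+1);q) by parity and using (q^(2n+2);q^2) = (q^(n+1);q)(-q^(n+1);q), the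
  summand of \<open>chi0\<close> becomes q^n (q^(2n+1);q^2)(-q^(n+1);q), the left side of
  \<open>mock_theta_relation\<close> for b = q; \<open>chi1\<close> is the case b = q^3. On the
  right, (-q;q) = 1/(q;q^2) turns the first series into an F-series.\<close>

lemma chi_series:
  assumes q: "norm q < 1" "q \<noteq> 0"
  shows "chi0 q = 2 * (\<Sum>n. q ^ (2 * n\<^sup>2) / qpoch_fin q (q\<^sup>2) n) - (\<Sum>n. (-1) ^ n * q ^ n\<^sup>2 * qpoch_fin q (q\<^sup>2) n)"
    and "chi1 q = 2 * (\<Sum>n. q ^ (2 * n * (n + 1)) / qpoch_fin q (q\<^sup>2) (n + 1)) - (\<Sum>n. (-1) ^ n * q ^ (n\<^sup>2 + 2 * n) * qpoch_fin q (q\<^sup>2) n)"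
proof -
  have q2: "norm (q\<^sup>2) < 1" by (rule norm_square_less_1[OF q(1)])
  have q3: "norm (q ^ 3) < 1" using q by (simp add: norm_power power_less_one_iff)
  have nzE: "qpoch_inf q (q\<^sup>2) \<noteq> 0" by (rule qpoch_inf_nonzero[OF q2 q(1)])
  have nz: "qpoch_inf (q ^ (n + 1)) q \<noteq> 0" for n
    using q by (intro qpoch_inf_nonzero) (auto simp: norm_power power_less_one_iff simp del: power_Suc)
  have H: "qpoch_inf (- q) q = inverse (qpoch_inf q (q\<^sup>2))"
    using euler_odd_distinct[OF q(1)] nzE by (simp add: field_simps)
  have dis: "qpoch_inf a q = qpoch_inf a (q\<^sup>2) * qpoch_inf (a * q) (q\<^sup>2)" for a
    using qpoch_inf_dissect[OF q(1), of 2 a] by (simp add: lessThan_Suc numeral_2_eq_2 mult.commute)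
  have ev: "qpoch_inf (q ^ (2 * n + 2)) (q\<^sup>2) = qpoch_inf (q ^ (n + 1)) q * neg_poch q n" for n
  proof -
    have "(q ^ (n + 1))\<^sup>2 = q ^ (2 * n + 2)" by (simp add: power_mult[symmetric] mult.commute flip: power_Suc)
    then show ?thesis unfolding neg_poch_def qpoch_inf_minus_mult[OF q(1)] by simp
  qed
  have c0: "chi0_term (int n) q = q ^ n * (qpoch_inf (q * q ^ (2 * n)) (q\<^sup>2) * neg_poch q n)" for n
  proof -
    have p: "q powi (int n + 1) = q ^ (n + 1)" using q(2) by (simp add: power_int_add)
    have e: "q ^ (n + 1) * q ^ n = q * q ^ (2 * n)" by (simp add: mult_2 power_add)
    have e': "q * q ^ (2 * n) * q = q ^ (2 * n + 2)" by simp
    have "qpoch (q powi (int n + 1)) q (int n) = qpoch_inf (q ^ (n + 1)) q / (qpoch_inf (q * q ^ (2 * n)) (q\<^sup>2) * (qpoch_inf (q ^ (n + 1)) q * neg_poch q n))"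
      unfolding p qpoch_def power_int_of_nat e dis[of "q * q ^ (2 * n)"] e' ev ..
    then show ?thesis using nz[of n] by (simp add: chi0_term_def)
  qed
  have c1: "chi1_term (int n) q = q ^ n * (qpoch_inf (q ^ 3 * q ^ (2 * n)) (q\<^sup>2) * neg_poch q n)" for n
  proof -
    have p: "q powi (int n + 1) = q ^ (n + 1)" using q(2) by (simp add: power_int_add)
    have e: "q ^ (n + 1) * q ^ (n + 1) = q ^ (2 * n + 2)" by (simp add: mult_2 power_add)
    have e': "q ^ (2 * n + 2) * q = q ^ 3 * q ^ (2 * n)" by (simp add: power_add numeral_3_eq_3 numeral_2_eq_2 mult_ac)
    have "qpoch (q powi (int n + 1)) q (int n + 1) = qpoch_inf (q ^ (n + 1)) q / ((qpoch_inf (q ^ (n + 1)) q * neg_poch q n) * qpoch_inf (q ^ 3 * q ^ (2 * n)) (q\<^sup>2))"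
      unfolding p qpoch_def e dis[of "q ^ (2 * n + 2)"] e' ev ..
    then show ?thesis using nz[of n] by (simp add: chi1_term_def)
  qed
  have f0: "2 * qpoch_inf (- q) q * (\<Sum>n. q ^ n * (q\<^sup>2) ^ (n choose 2) * q ^ n\<^sup>2 * qpoch_inf (q * q ^ (2 * n)) (q\<^sup>2)) =
      2 * (\<Sum>n. q ^ (2 * n\<^sup>2) / qpoch_fin q (q\<^sup>2) n)"
  proof -
    have "q ^ (2 * n\<^sup>2) / qpoch_fin q (q\<^sup>2) n = inverse (qpoch_inf q (q\<^sup>2)) * (q ^ n * (q\<^sup>2) ^ (n choose 2) * q ^ n\<^sup>2 * qpoch_inf (q * q ^ (2 * n)) (q\<^sup>2))" for n
    proof -
      have 1: "q ^ n * (q\<^sup>2) ^ (n choose 2) * q ^ n\<^sup>2 = q ^ (2 * n\<^sup>2)"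
        using power_choose_two[of 1 q n] by (simp add: mult_2 power_add)
      have 2: "qpoch_inf q (q\<^sup>2) = qpoch_fin q (q\<^sup>2) n * qpoch_inf (q * q ^ (2 * n)) (q\<^sup>2)"
        using qpoch_inf_split[OF q2, of q n] by (simp add: power_mult)
      show ?thesis unfolding 1 using 2 nzE by (simp add: field_simps)
    qed
    then show ?thesis
      unfolding H using suminf_mult[OF mock_theta_relation(2)[OF q q(1)], of "inverse (qpoch_inf q (q\<^sup>2))"] by simp
  qed
  have f1: "2 * qpoch_inf (- q) q * (\<Sum>n. (q ^ 3) ^ n * (q\<^sup>2) ^ (n choose 2) * q ^ n\<^sup>2 * qpoch_inf (q ^ 3 * q ^ (2 * n)) (q\<^sup>2)) =
      2 * (\<Sum>n. q ^ (2 * n * (n + 1)) / qpoch_fin q (q\<^sup>2) (n + 1))"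
  proof -
    have "q ^ (2 * n * (n + 1)) / qpoch_fin q (q\<^sup>2) (n + 1) = inverse (qpoch_inf q (q\<^sup>2)) * ((q ^ 3) ^ n * (q\<^sup>2) ^ (n choose 2) * q ^ n\<^sup>2 * qpoch_inf (q ^ 3 * q ^ (2 * n)) (q\<^sup>2))" for n
    proof -
      have e: "n\<^sup>2 + 3 * n - n + n\<^sup>2 = 2 * n * (n + 1)" by (simp add: power2_eq_square algebra_simps)
      have 1: "(q ^ 3) ^ n * (q\<^sup>2) ^ (n choose 2) * q ^ n\<^sup>2 = q ^ (2 * n * (n + 1))"
        unfolding e[symmetric] power_add[of q _ "n\<^sup>2"] power_mult[symmetric, of q 3 n] by (subst power_choose_two) simp_all
      have e2: "q * (q\<^sup>2) ^ (n + 1) = q ^ 3 * q ^ (2 * n)" by (simp add: power_mult power3_eq_cube power2_eq_square)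
      have 2: "qpoch_inf q (q\<^sup>2) = qpoch_fin q (q\<^sup>2) (n + 1) * qpoch_inf (q ^ 3 * q ^ (2 * n)) (q\<^sup>2)"
        using qpoch_inf_split[OF q2, of q "n + 1"] unfolding e2 .
      show ?thesis unfolding 1 using 2 nzE by (simp add: field_simps)
    qed
    then show ?thesis
      unfolding H using suminf_mult[OF mock_theta_relation(2)[OF q q3], of "inverse (qpoch_inf q (q\<^sup>2))"] by simp
  qed
  have p0: "(- q) ^ k * (q\<^sup>2) ^ (k choose 2) = (-1) ^ k * q ^ k\<^sup>2" for k
    using power_choose_two[of 1 q k] by (simp add: power_minus[of q] mult.assoc)
  have p1: "(- (q ^ 3)) ^ k * (q\<^sup>2) ^ (k choose 2) = (-1) ^ k * q ^ (k\<^sup>2 + 2 * k)" for k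
  proof -
    have "(q ^ 3) ^ k * (q\<^sup>2) ^ (k choose 2) = q ^ (k\<^sup>2 + 3 * k - k)"
      unfolding power_mult[symmetric, of q 3 k] by (rule power_choose_two) simp
    also have "k\<^sup>2 + 3 * k - k = k\<^sup>2 + 2 * k" by simp
    finally show ?thesis by (simp add: power_minus[of "q ^ 3"] mult.assoc)
  qed
  show "chi0 q = 2 * (\<Sum>n. q ^ (2 * n\<^sup>2) / qpoch_fin q (q\<^sup>2) n) - (\<Sum>n. (-1) ^ n * q ^ n\<^sup>2 * qpoch_fin q (q\<^sup>2) n)"
    unfolding chi0_def unilateral_def c0 mock_theta_relation(1)[OF q q(1)] f0 p0 ..
  show "chi1 q = 2 * (\<Sum>n. q ^ (2 * n * (n + 1)) / qpoch_fin q (q\<^sup>2) (n + 1)) - (\<Sum>n. (-1) ^ n * q ^ (n\<^sup>2 + 2 * n) * qpoch_fin q (q\<^sup>2) n)"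
    unfolding chi1_def unilateral_def c1 mock_theta_relation(1)[OF q q3] f1 p1 ..
qed

text \<open>Tannery's theorem with the decay measured over \<open>m\<close> steps at once. The first
  \<open>m\<close> terms are eventually bounded by a common \<open>K\<close>, so the n-th term is at
  most K \<rho>^(n div m). That one neighbourhood serves all \<open>n\<close> in the ratio
  hypothesis makes this majorant uniform.\<close>

lemma suminf_periodic_bound_limit:
  fixes a :: "nat \<Rightarrow> real \<Rightarrow> complex"
  assumes m: "m > 0" and \<rho>: "0 < \<rho>" "\<rho> < 1" and F: "F \<noteq> bot"
    and ratio: "\<forall>\<^sub>F r in F. \<forall>n. norm (a (n + m) r) \<le> \<rho> * norm (a n r)"
    and lim: "\<And>n. ((\<lambda>r. a n r) \<longlongrightarrow> b n) F"
  shows "summable b" and "((\<lambda>r. \<Sum>n. a n r) \<longlongrightarrow> (\<Sum>n. b n)) F"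
proof -
  define K where "K = 1 + (\<Sum>i<m. norm (b i))"
  have ev: "\<forall>\<^sub>F r in F. \<forall>i\<in>{..<m}. norm (a i r) < K"
  proof (subst eventually_ball_finite_distrib)
    show "\<forall>i\<in>{..<m}. \<forall>\<^sub>F r in F. norm (a i r) < K"
    proof
      fix i assume "i \<in> {..<m}"
      then have "norm (b i) \<le> (\<Sum>i<m. norm (b i))" by (intro member_le_sum) auto
      then have "norm (b i) < K" by (simp add: K_def)
      then show "\<forall>\<^sub>F r in F. norm (a i r) < K" by (rule order_tendstoD(2)[OF tendsto_norm[OF lim]])
    qed
  qed simp
  have "\<forall>\<^sub>F r in F. \<forall>n. norm (a n r) \<le> K * \<rho> ^ (n div m)"
    using ev ratio
  proof eventually_elim
    case (elim r)
    have "norm (a (j * m + i) r) \<le> K * \<rho> ^ j" if "i < m" for i j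
    proof (induction j)
      case 0
      then show ?case using elim(1) that by (auto intro: less_imp_le)
    next
      case (Suc j)
      have "norm (a (Suc j * m + i) r) \<le> \<rho> * norm (a (j * m + i) r)"
        using elim(2) by (metis add.assoc add.commute mult_Suc)
      also have "\<dots> \<le> \<rho> * (K * \<rho> ^ j)" using Suc \<rho> by (intro mult_left_mono) auto
      finally show ?case by (simp add: mult_ac)
    qed
    from this[of "n mod m" "n div m" for n] show ?case using m by simp
  qed
  then have bound: "eventually (\<lambda>(n, r). norm (a n r) \<le> K * \<rho> ^ (n div m)) (sequentially \<times>\<^sub>F F)"
    by (subst (asm) eventually_prod2[OF sequentially_bot, symmetric]) (auto elim!: eventually_mono)
  have K0: "K > 0" unfolding K_def by (intro add_pos_nonneg sum_nonneg) auto
  \<comment> \<open>An m-th root of \<rho> compares the staircase \<rho>^(n div m) with a geometric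
    series.\<close>
  define \<sigma> where "\<sigma> = root m \<rho>"
  have \<sigma>: "0 < \<sigma>" "\<sigma> < 1" "\<sigma> ^ m = \<rho>"
    using m \<rho> by (auto simp: \<sigma>_def real_root_lt_1_iff real_root_pow_pos2)
  have "summable (\<lambda>n. K * \<rho> ^ (n div m))"
  proof (rule summable_comparison_test')
    show "summable (\<lambda>n. (K / \<rho>) * \<sigma> ^ n)"
      using \<sigma> by (intro summable_mult summable_geometric) auto
    show "norm (K * \<rho> ^ (n div m)) \<le> (K / \<rho>) * \<sigma> ^ n" for n
    proof -
      have "n \<le> m * (n div m) + m"
        using m by (metis add_le_cancel_left less_imp_le mod_less_divisor mult_div_mod_eq)
      then have "\<sigma> ^ (m * (n div m) + m) \<le> \<sigma> ^ n" using \<sigma> by (intro power_decreasing) auto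
      then have "\<rho> ^ (n div m) * \<rho> \<le> \<sigma> ^ n" by (simp add: power_add power_mult \<sigma>)
      then have "K * (\<rho> ^ (n div m) * \<rho>) \<le> K * \<sigma> ^ n" using K0 by (intro mult_left_mono) auto
      then show ?thesis using K0 \<rho> by (simp add: field_simps)
    qed
  qed
  from tannerys_theorem[OF lim bound this F]
  show "summable b" "((\<lambda>r. \<Sum>n. a n r) \<longlongrightarrow> (\<Sum>n. b n)) F"
    by (auto intro: summable_norm_cancel)
qed

text \<open>Both sides are polynomials in y of degree at most m, and they agree at 0 and at the m
  distinct powers of \<omega>, which is one point more than the degree.\<close>

lemma prod_primitive_root:
  assumes m: "m > 0" "\<omega> ^ m = 1" "\<And>j. 0 < j \<Longrightarrow> j < m \<Longrightarrow> \<omega> ^ j \<noteq> (1::complex)"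
  shows "(\<Prod>i<m. 1 - y * \<omega> ^ i) = 1 - y ^ m"
proof -
  have w0: "\<omega> \<noteq> 0" using m by (auto simp: power_0_left)
  define A where "A = insert 0 ((\<lambda>j. \<omega> ^ j) ` {..<m})"
  have inj: "inj_on (\<lambda>j. \<omega> ^ j) {..<m}"
  proof (rule linorder_inj_onI)
    fix i j assume "i < j" "i \<in> {..<m}" "j \<in> {..<m}"
    moreover then have "\<omega> ^ j = \<omega> ^ i * \<omega> ^ (j - i)" by (simp flip: power_add)
    ultimately show "\<omega> ^ i \<noteq> \<omega> ^ j" using m(3)[of "j - i"] w0 by auto
  qed auto
  have card: "card A = Suc m" using w0 by (simp add: A_def card_image[OF inj] image_iff)
  define p where "p = (\<Prod>i<m. [:1, - (\<omega> ^ i):])"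
  define p' where "p' = 1 - monom (1::complex) m"
  have "degree p \<le> (\<Sum>i<m. degree [:1, - (\<omega> ^ i):])" 
    unfolding p_def by (rule order_trans[OF degree_prod_sum_le]) (simp_all only: o_def finite_lessThan order_refl)
  also have "\<dots> \<le> (\<Sum>i<m. 1)" by (intro sum_mono) auto
  finally have dp: "degree p < card A" using card by simp
  have "degree p' \<le> max (degree (1 :: complex poly)) (degree (monom (1::complex) m))" unfolding p'_def by (rule degree_diff_le_max)
  also have "\<dots> \<le> m" by (simp add: degree_monom_le)
  finally have dp': "degree p' < card A" using card by simp
  have poly_p: "poly p x = (\<Prod>i<m. 1 - x * \<omega> ^ i)" for x by (simp add: p_def poly_prod)
  have poly_p': "poly p' x = 1 - x ^ m" for x by (simp add: p'_def poly_monom)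
  have "p = p'"
  proof (rule poly_eqI_degree[OF _ dp dp'])
    fix x assume x: "x \<in> A"
    show "poly p x = poly p' x"
    proof (cases "x = 0")
      case True
      then show ?thesis using m by (simp add: poly_p poly_p' power_0_left)
    next
      case False
      then obtain j where j: "j < m" "x = \<omega> ^ j" using x by (auto simp: A_def)
      have "x ^ m = 1" unfolding j by (metis m(2) mult.commute power_mult power_one)
      moreover have "\<exists>i<m. \<omega> ^ j * \<omega> ^ i = 1"
      proof (cases "j = 0")
        case True
        then show ?thesis using m(1) by (intro exI[of _ 0]) auto
      next
        case False
        then show ?thesis using j m(2) by (intro exI[of _ "m - j"]) (auto simp flip: power_add)
      qed
      ultimately show ?thesis unfolding poly_p poly_p' using j by (auto intro!: prod_zero)
    qed
  qed
  then show ?thesis using poly_p[of y] poly_p'[of y] by simp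
qed

text \<open>The radius is frozen inside the block: (r\<zeta>)^(s+2i) is replaced by y (\<zeta>^2)^i
  with y = (r\<zeta>)^s, and the resulting product is evaluated by
  \<open>prod_primitive_root\<close>. The point is that the error does not depend on
  \<open>s\<close>. Halving all factors brings their norms down to 1, as the comparison of products
  requires, and costs 2^m.\<close>

lemma block_estimate:
  assumes m: "m > 0" and \<omega>: "(\<zeta>\<^sup>2) ^ m = 1" "\<And>j. 0 < j \<Longrightarrow> j < m \<Longrightarrow> (\<zeta>\<^sup>2) ^ j \<noteq> (1::complex)"
    and \<zeta>: "norm \<zeta> = 1" and r: "0 \<le> r" "r \<le> 1"
  shows "norm ((\<Prod>i<m. 1 - (of_real r * \<zeta>) ^ (s + 2 * i)) - (1 - of_real (r ^ (s * m)) * \<zeta> ^ (s * m))) \<le> 2 ^ m * (real m * (1 - r ^ (2 * m)))"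
proof -
  define y where "y = (of_real r * \<zeta>) ^ s"
  have y: "norm y \<le> 1" unfolding y_def using r \<zeta> by (simp add: norm_power norm_mult power_le_one)
  have pe: "(\<Prod>i<m. 1 - y * (\<zeta>\<^sup>2) ^ i) = 1 - of_real (r ^ (s * m)) * \<zeta> ^ (s * m)"
  proof -
    have "(\<Prod>i<m. 1 - y * (\<zeta>\<^sup>2) ^ i) = 1 - y ^ m" by (rule prod_primitive_root[OF m \<omega>])
    then show ?thesis by (simp only:) (simp add: y_def power_mult_distrib power_mult)
  qed
  define z where "z = (\<lambda>i. (1 - (of_real r * \<zeta>) ^ (s + 2 * i)) / 2)"
  define w where "w = (\<lambda>i. (1 - y * (\<zeta>\<^sup>2) ^ i) / 2)"
  have "norm ((\<Prod>i<m. z i) - (\<Prod>i<m. w i)) \<le> (\<Sum>i<m. norm (z i - w i))"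
  proof (rule norm_prod_diff)
    fix i
    have "norm ((of_real r * \<zeta>) ^ (s + 2 * i)) \<le> 1" using r \<zeta> by (simp add: norm_power norm_mult power_le_one)
    then show "norm (z i) \<le> 1" using norm_triangle_ineq4[of 1 "(of_real r * \<zeta>) ^ (s + 2 * i)"]
      by (simp add: z_def norm_divide)
    have "norm (y * (\<zeta>\<^sup>2) ^ i) \<le> 1" using y \<zeta> by (simp add: norm_power norm_mult)
    then show "norm (w i) \<le> 1" using norm_triangle_ineq4[of 1 "y * (\<zeta>\<^sup>2) ^ i"]
      by (simp add: w_def norm_divide)
  qed
  also have "\<dots> \<le> (\<Sum>i<m. 1 - r ^ (2 * m))"
  proof (rule sum_mono)
    fix i assume i: "i \<in> {..<m}"
    have "(of_real r * \<zeta>) ^ (s + 2 * i) = y * (\<zeta>\<^sup>2) ^ i * of_real (r ^ (2 * i))"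
      by (simp add: y_def power_add power_mult_distrib power_mult[symmetric])
    then have "z i - w i = y * (\<zeta>\<^sup>2) ^ i * (1 - of_real (r ^ (2 * i))) / 2"
      unfolding z_def w_def by (simp only:) (simp add: field_simps)
    note zw = this
    have "norm (z i - w i) = norm y * norm (complex_of_real (1 - r ^ (2 * i))) / 2"
    proof -
      from zw have "norm (z i - w i) = norm (y * (\<zeta>\<^sup>2) ^ i * (1 - of_real (r ^ (2 * i))) / 2)" by (rule arg_cong)
      also have "\<dots> = norm y * norm (complex_of_real (1 - r ^ (2 * i))) / 2"
        by (simp add: norm_mult norm_divide norm_power \<zeta>)
      finally show ?thesis .
    qed
    also have "norm (complex_of_real (1 - r ^ (2 * i))) = 1 - r ^ (2 * i)"
      unfolding norm_of_real using r by (simp add: power_le_one)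
    also have "norm y * (1 - r ^ (2 * i)) / 2 \<le> 1 * (1 - r ^ (2 * i)) / 1"
      using y r by (intro frac_le mult_mono) (auto simp: power_le_one)
    also have "\<dots> \<le> 1 - r ^ (2 * m)" using i r by (simp add: power_decreasing)
    finally show "norm (z i - w i) \<le> 1 - r ^ (2 * m)" .
  qed
  finally have "norm ((\<Prod>i<m. z i) - (\<Prod>i<m. w i)) \<le> real m * (1 - r ^ (2 * m))" by simp
  then have "2 ^ m * norm ((\<Prod>i<m. z i) - (\<Prod>i<m. w i)) \<le> 2 ^ m * (real m * (1 - r ^ (2 * m)))"
    by (rule mult_left_mono) simp
  moreover have "2 ^ m * norm ((\<Prod>i<m. z i) - (\<Prod>i<m. w i)) = norm (2 ^ m * ((\<Prod>i<m. z i) - (\<Prod>i<m. w i)))"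
    by (simp add: norm_mult norm_power)
  moreover have "2 ^ m * ((\<Prod>i<m. z i) - (\<Prod>i<m. w i)) = (\<Prod>i<m. 1 - (of_real r * \<zeta>) ^ (s + 2 * i)) - (1 - of_real (r ^ (s * m)) * \<zeta> ^ (s * m))"
    unfolding pe[symmetric] z_def w_def by (simp add: prod_dividef right_diff_distrib)
  ultimately show ?thesis by simp
qed

text \<open>One neighbourhood of 1 serves all \<open>s\<close>. The tolerance 1/4 is small enough
  that u (1 - u + 1/4) and u / (1 + u - 1/4) stay below 1/2 and 3/4 for u between 0 and 1.\<close>

lemma block_eventually:
  assumes m: "m > 0" and \<omega>: "(\<zeta>\<^sup>2) ^ m = 1" "\<And>j. 0 < j \<Longrightarrow> j < m \<Longrightarrow> (\<zeta>\<^sup>2) ^ j \<noteq> (1::complex)"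
    and \<zeta>: "norm \<zeta> = 1"
  shows "\<forall>\<^sub>F r in at_left (1::real). 0 < r \<and> r < 1 \<and> (\<forall>s. norm ((\<Prod>i<m. 1 - (of_real r * \<zeta>) ^ (s + 2 * i)) - (1 - of_real (r ^ (s * m)) * \<zeta> ^ (s * m))) \<le> 1/4)"
proof -
  have "((\<lambda>r::real. 2 ^ m * (real m * (1 - r ^ (2 * m)))) \<longlongrightarrow> 2 ^ m * (real m * (1 - 1 ^ (2 * m)))) (at_left 1)"
    by (intro tendsto_intros)
  then have "((\<lambda>r::real. 2 ^ m * (real m * (1 - r ^ (2 * m)))) \<longlongrightarrow> 0) (at_left 1)" by simp
  then have "\<forall>\<^sub>F r in at_left (1::real). 2 ^ m * (real m * (1 - r ^ (2 * m))) < 1/4"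
    by (rule order_tendstoD) simp
  moreover have "\<forall>\<^sub>F r in at_left (1::real). 0 < r \<and> r < 1"
    using eventually_at_left_real[of 0 "1::real"] by (auto elim!: eventually_mono)
  ultimately show ?thesis
  proof eventually_elim
    case (elim r)
    then have r: "0 \<le> r" "r \<le> 1" by auto
    show ?case
      by (intro conjI allI order_trans[OF block_estimate[OF m \<omega> \<zeta> r]] less_imp_le[OF elim(1)])
        (use elim in auto)
  qed
qed

lemma qpoch_fin_add:
  "qpoch_fin q (q\<^sup>2) (n + m) = qpoch_fin q (q\<^sup>2) n * (\<Prod>i<m. 1 - q ^ ((2 * n + 1) + 2 * i))"
proof -
  have "qpoch_fin q (q\<^sup>2) (n + m) = (\<Prod>j<n + m. 1 - q ^ (2 * j + 1))"
    by (simp add: qpoch_fin_def power_mult)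
  also have "{..<n + m} = {..<n} \<union> {n..<n + m}" by auto
  also have "(\<Prod>j\<in>{..<n} \<union> {n..<n + m}. 1 - q ^ (2 * j + 1)) = (\<Prod>j<n. 1 - q ^ (2 * j + 1)) * (\<Prod>j=n..<n + m. 1 - q ^ (2 * j + 1))"
    by (rule prod.union_disjoint) auto
  also have "(\<Prod>j=n..<n + m. 1 - q ^ (2 * j + 1)) = (\<Prod>i<m. 1 - q ^ ((2 * n + 1) + 2 * i))"
    using prod.shift_bounds_nat_ivl[of "\<lambda>j. 1 - q ^ (2 * j + 1)" 0 n m] by (simp add: atLeast0LessThan add_ac)
  finally show ?thesis by (simp add: qpoch_fin_def power_mult)
qed

lemma norm_root_of_unity: "(\<zeta>::complex) ^ m = 1 \<Longrightarrow> m > 0 \<Longrightarrow> norm \<zeta> = 1"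
  by (metis norm_one norm_power norm_ge_zero power_eq_1_iff less_not_refl)

lemma tendsto_qpoch_fin_radial:
  "((\<lambda>r. qpoch_fin (of_real r * \<zeta>) ((of_real r * \<zeta>)\<^sup>2) n) \<longlongrightarrow> qpoch_fin \<zeta> (\<zeta>\<^sup>2) n) (at_left (1::real))"
proof -
  have "((\<lambda>r. qpoch_fin (of_real r * \<zeta>) ((of_real r * \<zeta>)\<^sup>2) n) \<longlongrightarrow> qpoch_fin (of_real 1 * \<zeta>) ((of_real 1 * \<zeta>)\<^sup>2) n) (at_left (1::real))"
    unfolding qpoch_fin_def by (intro tendsto_intros)
  then show ?thesis by simp
qed

lemma tendsto_power_radial:
  "((\<lambda>r. (of_real r * \<zeta> :: complex) ^ n) \<longlongrightarrow> \<zeta> ^ n) (at_left (1::real))"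
proof -
  have "((\<lambda>r. (of_real r * \<zeta> :: complex) ^ n) \<longlongrightarrow> (of_real 1 * \<zeta>) ^ n) (at_left (1::real))"
    by (intro tendsto_intros)
  then show ?thesis by simp
qed

text \<open>As the order m = 2k - 1 is odd, \<zeta>^2 also has order m, and a block of m factors is
  close to 1 - u with u = r^((2n+1)m). The power of q contributes at most u per period, so the ratio
  is at most u (1 - u + 1/4). The limit series ends at n = k - 1, since for larger n the product
  contains 1 - \<zeta>^m = 0. The two series in question are d = 0 and d = 2.\<close>

lemma odd_order_limit:
  assumes k: "k \<ge> 1" and \<zeta>: "primitive_root_of_unity (2 * k - 1) \<zeta>"
  shows "((\<lambda>r. \<Sum>n. (-1) ^ n * (of_real r * \<zeta>) ^ (n\<^sup>2 + d * n) * qpoch_fin (of_real r * \<zeta>) ((of_real r * \<zeta>)\<^sup>2) n)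
    \<longlongrightarrow> (\<Sum>n=0..k-1. (-1) ^ n * \<zeta> ^ (n\<^sup>2 + d * n) * qpoch_fin \<zeta> (\<zeta>\<^sup>2) n)) (at_left (1::real))"
proof -
  define m where "m = 2 * k - 1"
  have m: "m > 0" "odd m" using k by (auto simp: m_def)
  have z: "\<zeta> ^ m = 1" "\<And>j. 0 < j \<Longrightarrow> j < m \<Longrightarrow> \<zeta> ^ j \<noteq> 1"
    using \<zeta> by (auto simp: primitive_root_of_unity_def m_def)
  have nz: "norm \<zeta> = 1" by (rule norm_root_of_unity[OF z(1) m(1)])
  have w: "(\<zeta>\<^sup>2) ^ m = 1" "\<And>j. 0 < j \<Longrightarrow> j < m \<Longrightarrow> (\<zeta>\<^sup>2) ^ j \<noteq> 1"
  proof -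
    show "(\<zeta>\<^sup>2) ^ m = 1" using z(1) by (metis mult.commute power_mult power_one)
    fix j assume j: "0 < j" "j < m"
    show "(\<zeta>\<^sup>2) ^ j \<noteq> 1"
    proof
      assume e: "(\<zeta>\<^sup>2) ^ j = 1"
      then have e: "\<zeta> ^ (2 * j) = 1" by (simp add: power_mult)
      show False
      proof (cases "2 * j < m")
        case True
        then show False using z(2)[of "2 * j"] j e by simp
      next
        case False
        moreover have "2 * j \<noteq> m" using m(2) by auto
        ultimately have "0 < 2 * j - m" "2 * j - m < m" using j by auto
        moreover have "\<zeta> ^ (2 * j - m) = 1"
        proof -
          have "\<zeta> ^ (2 * j) = \<zeta> ^ (2 * j - m) * \<zeta> ^ m" using False by (simp flip: power_add)
          then show ?thesis using e z(1) by simp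
        qed
        ultimately show False using z(2) by blast
      qed
    qed
  qed
  define a where "a = (\<lambda>n (r::real). (-1) ^ n * (of_real r * \<zeta>) ^ (n\<^sup>2 + d * n) * qpoch_fin (of_real r * \<zeta>) ((of_real r * \<zeta>)\<^sup>2) n)"
  define b where "b = (\<lambda>n. (-1) ^ n * \<zeta> ^ (n\<^sup>2 + d * n) * qpoch_fin \<zeta> (\<zeta>\<^sup>2) n)"
  have lim: "((\<lambda>r. a n r) \<longlongrightarrow> b n) (at_left 1)" for n
    unfolding a_def b_def by (intro tendsto_mult tendsto_const tendsto_power_radial tendsto_qpoch_fin_radial)
  have be: "\<forall>\<^sub>F r in at_left (1::real). 0 < r \<and> r < 1 \<and> (\<forall>s. norm ((\<Prod>i<m. 1 - (of_real r * \<zeta>) ^ (s + 2 * i)) - (1 - of_real (r ^ (s * m)) * \<zeta> ^ (s * m))) \<le> 1/4)"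
    by (rule block_eventually[OF m(1) w(1) _ nz]) (rule w(2))
  have "\<forall>\<^sub>F r in at_left 1. \<forall>n. norm (a (n + m) r) \<le> 1/2 * norm (a n r)"
    using be
  proof eventually_elim
    case (elim r)
    then have r: "0 < r" "r < 1" by auto
    show ?case
    proof
      fix n
      define Q where "Q = of_real r * \<zeta>"
      define B where "B = (\<Prod>i<m. 1 - Q ^ ((2 * n + 1) + 2 * i))"
      define u where "u = r ^ ((2 * n + 1) * m)"
      have u: "0 \<le> u" "u \<le> 1" using r by (auto simp: u_def power_le_one)
      have "\<zeta> ^ ((2 * n + 1) * m) = 1" using z(1) by (metis mult.commute power_mult power_one)
      then have "norm (B - (1 - of_real u)) \<le> 1/4"
        using elim unfolding B_def Q_def u_def by (metis mult.right_neutral)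
      moreover have "norm (complex_of_real (1 - u)) = 1 - u" unfolding norm_of_real using u by simp
      ultimately have B: "norm B \<le> 1 - u + 1/4"
        using norm_triangle_sub[of B "1 - of_real u"] by (simp add: norm_minus_commute)
      have nQ: "norm Q = r" using r nz by (simp add: Q_def norm_mult)
      have "(n + m)\<^sup>2 + d * (n + m) = (n\<^sup>2 + d * n) + (2 * n * m + m\<^sup>2 + d * m)"
        by (simp add: power2_eq_square algebra_simps)
      then have "norm (a (n + m) r) = norm (a n r) * (r ^ (2 * n * m + m\<^sup>2 + d * m) * norm B)"
        unfolding a_def Q_def[symmetric] qpoch_fin_add B_def
        by (simp add: norm_mult norm_power nQ power_add)
      also have "\<dots> \<le> norm (a n r) * (u * (1 - u + 1/4))"
      proof (intro mult_left_mono mult_mono B)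
        have "(2 * n + 1) * m \<le> 2 * n * m + m\<^sup>2 + d * m"
          using m(1) by (cases m) (auto simp: power2_eq_square)
        then show "r ^ (2 * n * m + m\<^sup>2 + d * m) \<le> u"
          unfolding u_def using r by (intro power_decreasing) auto
      qed (use u in auto)
      also have "u * (1 - u + 1/4) \<le> 1/2"
      proof -
        \<comment> \<open>The quadratic u (5/4 - u) is largest at u = 5/8.\<close>
        have "0 \<le> (u - 5/8)\<^sup>2" by simp
        then show ?thesis by (simp add: power2_eq_square algebra_simps)
      qed
      finally show "norm (a (n + m) r) \<le> 1/2 * norm (a n r)" by (simp add: mult_left_mono)
    qed
  qed
  from suminf_periodic_bound_limit(2)[OF m(1) _ _ _ this lim]
  have "((\<lambda>r. \<Sum>n. a n r) \<longlongrightarrow> (\<Sum>n. b n)) (at_left 1)" by simp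
  moreover have "(\<Sum>n. b n) = (\<Sum>n=0..k-1. b n)"
  proof (rule suminf_finite)
    fix n assume n: "n \<notin> {0..k-1}"
    have "qpoch_fin \<zeta> (\<zeta>\<^sup>2) n = 0"
      unfolding qpoch_fin_def
    proof (rule prod_zero)
      have "\<zeta> * (\<zeta>\<^sup>2) ^ (k - 1) = \<zeta> ^ Suc (2 * (k - 1))" by (simp add: power_mult)
      also have "Suc (2 * (k - 1)) = m" using k by (simp add: m_def)
      finally show "\<exists>j\<in>{..<n}. 1 - \<zeta> * (\<zeta>\<^sup>2) ^ j = 0" using n k z(1) by (intro bexI[of _ "k - 1"]) auto
    qed simp
    then show "b n = 0" by (simp add: b_def)
  qed simp
  ultimately show ?thesis unfolding a_def b_def by simp
qed

text \<open>Now \<zeta>^2 has order k and \<zeta>^k = -1, so a block of k factors is close to 1 + u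
  and dividing by it supports convergence. At \<zeta> itself a block equals 2 while the power of
  \<zeta> has period k; hence b (n + k) = b n / 2, and the limit series is twice its first
  period.\<close>

lemma even_order_limit:
  assumes k: "k \<ge> 1" and \<zeta>: "primitive_root_of_unity (2 * k) \<zeta>" and d: "d \<le> 1"
  shows "((\<lambda>r. \<Sum>n. (of_real r * \<zeta>) ^ (2 * n\<^sup>2 + 2 * d * n) / qpoch_fin (of_real r * \<zeta>) ((of_real r * \<zeta>)\<^sup>2) (n + d))
    \<longlongrightarrow> 2 * (\<Sum>n<k. \<zeta> ^ (2 * n\<^sup>2 + 2 * d * n) / qpoch_fin \<zeta> (\<zeta>\<^sup>2) (n + d))) (at_left (1::real))"
    and "qpoch_fin \<zeta> (\<zeta>\<^sup>2) k = 2"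
proof -
  have z: "\<zeta> ^ (2 * k) = 1" "\<And>j. 0 < j \<Longrightarrow> j < 2 * k \<Longrightarrow> \<zeta> ^ j \<noteq> 1"
    using \<zeta> by (auto simp: primitive_root_of_unity_def)
  have kp: "k > 0" using k by simp
  have nz: "norm \<zeta> = 1" by (rule norm_root_of_unity[OF z(1)]) (use k in simp)
  have w: "(\<zeta>\<^sup>2) ^ k = 1" "\<And>j. 0 < j \<Longrightarrow> j < k \<Longrightarrow> (\<zeta>\<^sup>2) ^ j \<noteq> 1"
    using z by (auto simp flip: power_mult)
  have zk: "\<zeta> ^ k = -1"
  proof -
    have "(\<zeta> ^ k)\<^sup>2 = 1" using z(1) by (simp add: power_mult[symmetric] mult.commute)
    then show ?thesis using z(2)[of k] kp by (auto simp: power2_eq_1_iff)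
  qed
  have odd1: "\<zeta> ^ j \<noteq> 1" if "odd j" for j
  proof
    assume "\<zeta> ^ j = 1"
    then have "(\<zeta> ^ k) ^ j = 1" by (metis mult.commute power_mult power_one)
    then show False using that by (simp add: zk)
  qed
  have fin_nz: "qpoch_fin \<zeta> (\<zeta>\<^sup>2) n \<noteq> 0" for n
  proof -
    have "1 - \<zeta> * (\<zeta>\<^sup>2) ^ j \<noteq> 0" for j
      using odd1[of "Suc (2 * j)"] by (simp add: power_mult)
    then show ?thesis by (simp add: qpoch_fin_def)
  qed
  define a where "a = (\<lambda>n (r::real). (of_real r * \<zeta>) ^ (2 * n\<^sup>2 + 2 * d * n) / qpoch_fin (of_real r * \<zeta>) ((of_real r * \<zeta>)\<^sup>2) (n + d))"
  define b where "b = (\<lambda>n. \<zeta> ^ (2 * n\<^sup>2 + 2 * d * n) / qpoch_fin \<zeta> (\<zeta>\<^sup>2) (n + d))"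
  have lim: "((\<lambda>r. a n r) \<longlongrightarrow> b n) (at_left 1)" for n
    unfolding a_def b_def by (intro tendsto_divide tendsto_power_radial tendsto_qpoch_fin_radial fin_nz)
  have be: "\<forall>\<^sub>F r in at_left (1::real). 0 < r \<and> r < 1 \<and> (\<forall>s. norm ((\<Prod>i<k. 1 - (of_real r * \<zeta>) ^ (s + 2 * i)) - (1 - of_real (r ^ (s * k)) * \<zeta> ^ (s * k))) \<le> 1/4)"
    by (rule block_eventually[OF kp w(1) _ nz]) (rule w(2))
  have "\<forall>\<^sub>F r in at_left 1. \<forall>n. norm (a (n + k) r) \<le> 3/4 * norm (a n r)"
    using be
  proof eventually_elim
    case (elim r)
    then have r: "0 < r" "r < 1" by auto
    show ?case
    proof
      fix n
      define Q where "Q = of_real r * \<zeta>"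
      define B where "B = (\<Prod>i<k. 1 - Q ^ ((2 * (n + d) + 1) + 2 * i))"
      define u where "u = r ^ ((2 * (n + d) + 1) * k)"
      have u: "0 \<le> u" "u \<le> 1" using r by (auto simp: u_def power_le_one)
      have "\<zeta> ^ ((2 * (n + d) + 1) * k) = (\<zeta> ^ k) ^ (2 * (n + d) + 1)" by (metis mult.commute power_mult)
      also have "\<dots> = -1" by (simp add: zk)
      finally have zz: "\<zeta> ^ ((2 * (n + d) + 1) * k) = -1" .
      have "norm (B - (1 - of_real u * \<zeta> ^ ((2 * (n + d) + 1) * k))) \<le> 1/4"
        using elim unfolding B_def Q_def u_def by blast
      then have "norm (B - of_real (1 + u)) \<le> 1/4" unfolding zz by simp
      moreover have "norm (complex_of_real (1 + u)) = 1 + u" unfolding norm_of_real using u by simp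
      ultimately have B: "norm B \<ge> 1 + u - 1/4"
        using norm_triangle_sub[of "of_real (1 + u)" B] by (simp add: norm_minus_commute)
      have nQ: "norm Q = r" using r nz by (simp add: Q_def norm_mult)
      have e: "2 * (n + k)\<^sup>2 + 2 * d * (n + k) = (2 * n\<^sup>2 + 2 * d * n) + (4 * n * k + 2 * k\<^sup>2 + 2 * d * k)"
        by (simp add: power2_eq_square algebra_simps)
      have e': "n + k + d = n + d + k" by simp
      have "norm (a (n + k) r) = norm (a n r) * (r ^ (4 * n * k + 2 * k\<^sup>2 + 2 * d * k) / norm B)"
        unfolding a_def Q_def[symmetric] e e' qpoch_fin_add[of Q "n + d" k] B_def
        by (simp add: norm_mult norm_power norm_divide nQ power_add)
      also have "\<dots> \<le> norm (a n r) * (u / (1 + u - 1/4))"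
      proof (intro mult_left_mono frac_le B)
        have "k \<le> k\<^sup>2" by (simp add: power2_eq_square)
        then have "(2 * (n + d) + 1) * k \<le> 4 * n * k + 2 * k\<^sup>2 + 2 * d * k"
          by (simp add: algebra_simps)
        then show "r ^ (4 * n * k + 2 * k\<^sup>2 + 2 * d * k) \<le> u"
          unfolding u_def using r by (intro power_decreasing) auto
      qed (use u in auto)
      also have "u / (1 + u - 1/4) \<le> 3/4" using u by (simp add: divide_simps)
      finally show "norm (a (n + k) r) \<le> 3/4 * norm (a n r)" by (simp add: mult_left_mono)
    qed
  qed
  note L = suminf_periodic_bound_limit[OF kp _ _ _ this lim]
  have sb: "summable b" by (rule L(1)) auto
  have lim': "((\<lambda>r. \<Sum>n. a n r) \<longlongrightarrow> (\<Sum>n. b n)) (at_left 1)" by (rule L(2)) auto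
  have block: "(\<Prod>i<k. 1 - \<zeta> ^ ((2 * n + 1) + 2 * i)) = 2" for n
  proof -
    have "(\<Prod>i<k. 1 - \<zeta> ^ (2 * n + 1) * (\<zeta>\<^sup>2) ^ i) = 1 - (\<zeta> ^ (2 * n + 1)) ^ k"
      by (rule prod_primitive_root[OF kp w])
    also have "(\<zeta> ^ (2 * n + 1)) ^ k = (\<zeta> ^ k) ^ (2 * n + 1)" by (metis mult.commute power_mult)
    also have "1 - \<dots> = 2" by (simp add: zk)
    finally show ?thesis by (simp add: power_add power_mult mult.assoc)
  qed
  have per: "b (n + k) = b n / 2" for n
  proof -
    have e: "2 * (n + k)\<^sup>2 + 2 * d * (n + k) = (2 * n\<^sup>2 + 2 * d * n) + 2 * k * (2 * n + k + d)"
      by (simp add: power2_eq_square algebra_simps)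
    have e': "n + k + d = n + d + k" by simp
    have "\<zeta> ^ (2 * k * (2 * n + k + d)) = 1" unfolding power_mult[of \<zeta> "2 * k"] z(1) by simp
    then show ?thesis unfolding b_def e e' qpoch_fin_add[of \<zeta> "n + d" k] block power_add[of \<zeta> "2 * n\<^sup>2 + 2 * d * n"] by simp
  qed
  have "(\<Sum>n. b n) = (\<Sum>n. b (n + k)) + (\<Sum>n<k. b n)" by (rule suminf_split_initial_segment[OF sb])
  also have "(\<Sum>n. b (n + k)) = (\<Sum>n. b n) / 2" unfolding per by (rule suminf_divide[OF sb])
  finally have "(\<Sum>n. b n) = 2 * (\<Sum>n<k. b n)" by (simp add: field_simps)
  then show "((\<lambda>r. \<Sum>n. (of_real r * \<zeta>) ^ (2 * n\<^sup>2 + 2 * d * n) / qpoch_fin (of_real r * \<zeta>) ((of_real r * \<zeta>)\<^sup>2) (n + d))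
    \<longlongrightarrow> 2 * (\<Sum>n<k. \<zeta> ^ (2 * n\<^sup>2 + 2 * d * n) / qpoch_fin \<zeta> (\<zeta>\<^sup>2) (n + d))) (at_left (1::real))"
    using lim' unfolding a_def b_def by simp
  show "qpoch_fin \<zeta> (\<zeta>\<^sup>2) k = 2" using qpoch_fin_add[of \<zeta> 0 k] block[of 0] by simp
qed

lemma has_radial_limit_cong:
  assumes "\<And>q. norm q < 1 \<Longrightarrow> q \<noteq> 0 \<Longrightarrow> f q = g q" and \<zeta>: "norm \<zeta> = 1"
    and g: "((\<lambda>r. g (of_real r * \<zeta>)) \<longlongrightarrow> l) (at_left (1::real))"
  shows "has_radial_limit f \<zeta> l"
  unfolding has_radial_limit_def
proof (rule Lim_transform_eventually[OF g])
  have "\<forall>\<^sub>F r in at_left (1::real). 0 < r \<and> r < 1"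
    using eventually_at_left_real[of 0 "1::real"] by (auto elim!: eventually_mono)
  then show "\<forall>\<^sub>F r in at_left (1::real). g (of_real r * \<zeta>) = f (of_real r * \<zeta>)"
  proof eventually_elim
    case (elim r)
    then have "norm (of_real r * \<zeta>) < 1" "of_real r * \<zeta> \<noteq> 0" using \<zeta> by (auto simp: norm_mult)
    then show ?case using assms(1) by metis
  qed
qed

lemma radial_limits_odd:
  assumes k: "k \<ge> 1" and \<zeta>: "primitive_root_of_unity (2 * k - 1) \<zeta>"
  shows "has_radial_limit (\<lambda>q. chi0 q - 2 * B_chi0 q) \<zeta>
          (- 3 * (\<Sum>n=0..k-1. (- \<zeta>) ^ (n\<^sup>2) * qpoch_fin \<zeta> (\<zeta>\<^sup>2) n) + 2)"
    and "has_radial_limit (\<lambda>q. chi1 q - 2 * B_chi1 q) \<zeta>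
          (3 * inverse \<zeta> * (\<Sum>n=0..k-1. (- \<zeta>) ^ ((n + 1)\<^sup>2) * qpoch_fin \<zeta> (\<zeta>\<^sup>2) n))"
proof -
  have nz: "norm \<zeta> = 1"
    using \<zeta> k by (auto simp: primitive_root_of_unity_def intro: norm_root_of_unity)
  then have z0: "\<zeta> \<noteq> 0" by auto
  have p0: "(- \<zeta>) ^ n\<^sup>2 = (-1) ^ n * \<zeta> ^ (n\<^sup>2 + 0 * n)" for n
    by (simp add: power_minus[of \<zeta>] uminus_power_if)
  have p1: "inverse \<zeta> * (- \<zeta>) ^ (n + 1)\<^sup>2 = - ((-1) ^ n * \<zeta> ^ (n\<^sup>2 + 2 * n))" for n
  proof -
    have e: "(n + 1)\<^sup>2 = Suc (n\<^sup>2 + 2 * n)" by (simp add: power2_eq_square)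
    show ?thesis unfolding e power_minus[of \<zeta>] using z0 by (simp add: uminus_power_if)
  qed
  show "has_radial_limit (\<lambda>q. chi0 q - 2 * B_chi0 q) \<zeta>
          (- 3 * (\<Sum>n=0..k-1. (- \<zeta>) ^ (n\<^sup>2) * qpoch_fin \<zeta> (\<zeta>\<^sup>2) n) + 2)"
  proof (rule has_radial_limit_cong[OF _ nz])
    show "chi0 q - 2 * B_chi0 q = - 3 * (\<Sum>n. (-1) ^ n * q ^ (n\<^sup>2 + 0 * n) * qpoch_fin q (q\<^sup>2) n) + 2"
      if "norm q < 1" "q \<noteq> 0" for q
      unfolding chi_series(1)[OF that] B_chi_series(1)[OF that] by simp
    show "((\<lambda>r. - 3 * (\<Sum>n. (-1) ^ n * (of_real r * \<zeta>) ^ (n\<^sup>2 + 0 * n) * qpoch_fin (of_real r * \<zeta>) ((of_real r * \<zeta>)\<^sup>2) n) + 2)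
      \<longlongrightarrow> - 3 * (\<Sum>n=0..k-1. (- \<zeta>) ^ (n\<^sup>2) * qpoch_fin \<zeta> (\<zeta>\<^sup>2) n) + 2) (at_left (1::real))"
      unfolding p0 by (intro tendsto_add tendsto_mult tendsto_const odd_order_limit[OF k \<zeta>])
  qed
  have eq: "3 * inverse \<zeta> * (\<Sum>n=0..k-1. (- \<zeta>) ^ ((n + 1)\<^sup>2) * qpoch_fin \<zeta> (\<zeta>\<^sup>2) n) =
      - 3 * (\<Sum>n=0..k-1. (-1) ^ n * \<zeta> ^ (n\<^sup>2 + 2 * n) * qpoch_fin \<zeta> (\<zeta>\<^sup>2) n)"
  proof -
    have "inverse \<zeta> * (\<Sum>n=0..k-1. (- \<zeta>) ^ ((n + 1)\<^sup>2) * qpoch_fin \<zeta> (\<zeta>\<^sup>2) n) =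
        (\<Sum>n=0..k-1. (inverse \<zeta> * (- \<zeta>) ^ ((n + 1)\<^sup>2)) * qpoch_fin \<zeta> (\<zeta>\<^sup>2) n)"
      unfolding sum_distrib_left by (simp only: mult.assoc)
    then show ?thesis unfolding p1 by (simp add: sum_negf)
  qed
  show "has_radial_limit (\<lambda>q. chi1 q - 2 * B_chi1 q) \<zeta>
          (3 * inverse \<zeta> * (\<Sum>n=0..k-1. (- \<zeta>) ^ ((n + 1)\<^sup>2) * qpoch_fin \<zeta> (\<zeta>\<^sup>2) n))"
    unfolding eq
  proof (rule has_radial_limit_cong[OF _ nz])
    show "chi1 q - 2 * B_chi1 q = - 3 * (\<Sum>n. (-1) ^ n * q ^ (n\<^sup>2 + 2 * n) * qpoch_fin q (q\<^sup>2) n)"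
      if "norm q < 1" "q \<noteq> 0" for q
      unfolding chi_series(2)[OF that] B_chi_series(2)[OF that] by simp
    show "((\<lambda>r. - 3 * (\<Sum>n. (-1) ^ n * (of_real r * \<zeta>) ^ (n\<^sup>2 + 2 * n) * qpoch_fin (of_real r * \<zeta>) ((of_real r * \<zeta>)\<^sup>2) n))
      \<longlongrightarrow> - 3 * (\<Sum>n=0..k-1. (-1) ^ n * \<zeta> ^ (n\<^sup>2 + 2 * n) * qpoch_fin \<zeta> (\<zeta>\<^sup>2) n)) (at_left (1::real))"
      by (intro tendsto_mult tendsto_const odd_order_limit[OF k \<zeta>])
  qed
qed

lemma radial_limits_even:
  assumes k: "k \<ge> 1" and \<zeta>: "primitive_root_of_unity (2 * k) \<zeta>"
  shows "has_radial_limit (\<lambda>q. chi0 q + B_chi0 q) \<zeta>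
          (6 * (\<Sum>n=1..k. \<zeta> ^ (2 * n\<^sup>2) / qpoch_fin \<zeta> (\<zeta>\<^sup>2) n) + 2)"
    and "has_radial_limit (\<lambda>q. chi1 q + B_chi1 q) \<zeta>
          (6 * (\<Sum>n=1..k. \<zeta> ^ (2 * n * (n - 1)) / qpoch_fin \<zeta> (\<zeta>\<^sup>2) n))"
proof -
  have nz: "norm \<zeta> = 1"
    using \<zeta> k by (auto simp: primitive_root_of_unity_def intro: norm_root_of_unity)
  have z: "\<zeta> ^ (2 * k) = 1" using \<zeta> by (simp add: primitive_root_of_unity_def)
  have k2: "qpoch_fin \<zeta> (\<zeta>\<^sup>2) k = 2" by (rule even_order_limit(2)[OF k \<zeta>, of 0]) simp
  \<comment> \<open>Moving the range from 0..k-1 to 1..k drops the term 1 and adds the term 1/2,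
    because (\<zeta>;\<zeta>^2)_k = 2; six times this change accounts for the constants +2 and
    -1.\<close>
  have eq0: "6 * (\<Sum>n=1..k. \<zeta> ^ (2 * n\<^sup>2) / qpoch_fin \<zeta> (\<zeta>\<^sup>2) n) + 2 =
      3 * (2 * (\<Sum>n<k. \<zeta> ^ (2 * n\<^sup>2 + 2 * 0 * n) / qpoch_fin \<zeta> (\<zeta>\<^sup>2) (n + 0))) - 1"
  proof -
    define b where "b = (\<lambda>n. \<zeta> ^ (2 * n\<^sup>2) / qpoch_fin \<zeta> (\<zeta>\<^sup>2) n)"
    have "\<zeta> ^ (2 * k\<^sup>2) = (\<zeta> ^ (2 * k)) ^ k" by (simp add: power2_eq_square mult.assoc flip: power_mult)
    then have bk: "b k = 1/2" and b0: "b 0 = 1" using k2 z by (simp_all add: b_def)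
    have "(\<Sum>n<k. b n) + b k = b 0 + (\<Sum>n=1..k. b n)"
    proof -
      have "(\<Sum>n<k. b n) + b k = (\<Sum>n\<le>k. b n)" by (simp flip: lessThan_Suc_atMost)
      also have "\<dots> = b 0 + (\<Sum>n=1..k. b n)" by (simp add: sum.atMost_shift sum.atLeast1_atMost_eq)
      finally show ?thesis .
    qed
    then have "(\<Sum>n<k. b n) = 1 + (\<Sum>n=1..k. b n) - 1/2" unfolding bk b0 by (metis add_diff_cancel_right')
    then have s: "(\<Sum>n<k. b n) = (\<Sum>n=1..k. b n) + 1/2" by simp
    show ?thesis using s unfolding b_def by (simp add: algebra_simps)
  qed
  have eq1: "6 * (\<Sum>n=1..k. \<zeta> ^ (2 * n * (n - 1)) / qpoch_fin \<zeta> (\<zeta>\<^sup>2) n) =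
      3 * (2 * (\<Sum>n<k. \<zeta> ^ (2 * n\<^sup>2 + 2 * 1 * n) / qpoch_fin \<zeta> (\<zeta>\<^sup>2) (n + 1)))"
  proof -
    have e: "2 * Suc n * (Suc n - 1) = 2 * n\<^sup>2 + 2 * 1 * n" for n by (simp add: power2_eq_square algebra_simps)
    have "(\<Sum>n=1..k. \<zeta> ^ (2 * n * (n - 1)) / qpoch_fin \<zeta> (\<zeta>\<^sup>2) n) =
        (\<Sum>n<k. \<zeta> ^ (2 * Suc n * (Suc n - 1)) / qpoch_fin \<zeta> (\<zeta>\<^sup>2) (Suc n))"
      by (simp only: One_nat_def sum.atLeast1_atMost_eq)
    also have "\<dots> = (\<Sum>n<k. \<zeta> ^ (2 * n\<^sup>2 + 2 * 1 * n) / qpoch_fin \<zeta> (\<zeta>\<^sup>2) (n + 1))"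
      by (rule sum.cong) (simp_all only: e Suc_eq_plus1[symmetric])
    finally have "(\<Sum>n=1..k. \<zeta> ^ (2 * n * (n - 1)) / qpoch_fin \<zeta> (\<zeta>\<^sup>2) n) =
        (\<Sum>n<k. \<zeta> ^ (2 * n\<^sup>2 + 2 * 1 * n) / qpoch_fin \<zeta> (\<zeta>\<^sup>2) (n + 1))" .
    then show ?thesis by simp
  qed
  show "has_radial_limit (\<lambda>q. chi0 q + B_chi0 q) \<zeta>
          (6 * (\<Sum>n=1..k. \<zeta> ^ (2 * n\<^sup>2) / qpoch_fin \<zeta> (\<zeta>\<^sup>2) n) + 2)"
    unfolding eq0
  proof (rule has_radial_limit_cong[OF _ nz])
    show "chi0 q + B_chi0 q = 3 * (\<Sum>n. q ^ (2 * n\<^sup>2 + 2 * 0 * n) / qpoch_fin q (q\<^sup>2) (n + 0)) - 1"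
      if "norm q < 1" "q \<noteq> 0" for q
      unfolding chi_series(1)[OF that] B_chi_series(1)[OF that] by simp
    show "((\<lambda>r. 3 * (\<Sum>n. (of_real r * \<zeta>) ^ (2 * n\<^sup>2 + 2 * 0 * n) / qpoch_fin (of_real r * \<zeta>) ((of_real r * \<zeta>)\<^sup>2) (n + 0)) - 1)
      \<longlongrightarrow> 3 * (2 * (\<Sum>n<k. \<zeta> ^ (2 * n\<^sup>2 + 2 * 0 * n) / qpoch_fin \<zeta> (\<zeta>\<^sup>2) (n + 0))) - 1) (at_left (1::real))"
      by (intro tendsto_diff tendsto_mult tendsto_const even_order_limit(1)[OF k \<zeta>]) simp
  qed
  show "has_radial_limit (\<lambda>q. chi1 q + B_chi1 q) \<zeta>
          (6 * (\<Sum>n=1..k. \<zeta> ^ (2 * n * (n - 1)) / qpoch_fin \<zeta> (\<zeta>\<^sup>2) n))"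
    unfolding eq1
  proof (rule has_radial_limit_cong[OF _ nz])
    have e: "2 * n * (n + 1) = 2 * n\<^sup>2 + 2 * 1 * n" for n :: nat by (simp add: power2_eq_square algebra_simps)
    show "chi1 q + B_chi1 q = 3 * (\<Sum>n. q ^ (2 * n\<^sup>2 + 2 * 1 * n) / qpoch_fin q (q\<^sup>2) (n + 1))"
      if "norm q < 1" "q \<noteq> 0" for q
      unfolding chi_series(2)[OF that] B_chi_series(2)[OF that] e by simp
    show "((\<lambda>r. 3 * (\<Sum>n. (of_real r * \<zeta>) ^ (2 * n\<^sup>2 + 2 * 1 * n) / qpoch_fin (of_real r * \<zeta>) ((of_real r * \<zeta>)\<^sup>2) (n + 1)))
      \<longlongrightarrow> 3 * (2 * (\<Sum>n<k. \<zeta> ^ (2 * n\<^sup>2 + 2 * 1 * n) / qpoch_fin \<zeta> (\<zeta>\<^sup>2) (n + 1)))) (at_left (1::real))"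
      by (intro tendsto_mult tendsto_const even_order_limit(1)[OF k \<zeta>]) simp
  qed
qed

section \<open>Sigma function, Klein forms and eta function\<close>

definition e2pi :: "complex \<Rightarrow> complex" where
  "e2pi z = exp (2 * of_real pi * \<i> * z)"

lemma e2pi_add: "e2pi (x + y) = e2pi x * e2pi y"
  by (simp add: e2pi_def distrib_left exp_add)

lemma e2pi_nonzero [simp]: "e2pi x \<noteq> 0"
  by (simp add: e2pi_def)

lemma e2pi_minus: "e2pi (- x) = inverse (e2pi x)"
  by (simp add: e2pi_def exp_minus)

lemma e2pi_diff: "e2pi (x - y) = e2pi x / e2pi y"
  by (simp add: e2pi_def right_diff_distrib exp_diff)

lemma e2pi_0 [simp]: "e2pi 0 = 1"
  by (simp add: e2pi_def)

lemma e2pi_eq_1_iff: "e2pi z = 1 \<longleftrightarrow> z \<in> \<int>"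
proof
  assume "e2pi z = 1"
  then obtain n :: int where n: "Re (2 * of_real pi * \<i> * z) = 0" "Im (2 * of_real pi * \<i> * z) = of_int (2 * n) * pi"
    unfolding e2pi_def exp_eq_1 by blast
  then have "Im z = 0" "Re z = of_int n" by auto
  then have "z = of_int n" by (simp add: complex_eq_iff)
  then show "z \<in> \<int>" by simp
next
  assume "z \<in> \<int>"
  then obtain n :: int where "z = of_int n" by (elim Ints_cases)
  then show "e2pi z = 1" by (simp add: e2pi_def exp_eq_1)
qed

lemma e2pi_of_int [simp]: "e2pi (of_int n) = 1"
  by (simp add: e2pi_eq_1_iff)

lemma norm_e2pi: "norm (e2pi z) = exp (- 2 * pi * Im z)"
  by (simp add: e2pi_def norm_exp_eq_Re)

lemma norm_e2pi_less_1: "Im \<tau> > 0 \<Longrightarrow> norm (e2pi \<tau>) < 1"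
  by (simp add: norm_e2pi)

lemma e2pi_power: "e2pi z ^ n = e2pi (of_nat n * z)"
  by (simp add: e2pi_def exp_of_nat_mult[symmetric] mult_ac)

lemma e2pi_holomorphic [holomorphic_intros]:
  "f holomorphic_on A \<Longrightarrow> (\<lambda>z. e2pi (f z)) holomorphic_on A"
  unfolding e2pi_def by (intro holomorphic_intros)

text \<open>The Weierstrass sigma function of \<open>\<int> + \<int>\<tau>\<close>, up to a constant and the factor \<open>exp (\<eta>\<^sub>2 z\<^sup>2 / 2)\<close>.\<close>
definition sig :: "complex \<Rightarrow> complex \<Rightarrow> complex" where
  "sig z \<tau> = e2pi (- z / 2) * qpoch_inf (e2pi z) (e2pi \<tau>) * qpoch_inf (e2pi (\<tau> - z)) (e2pi \<tau>) / (qpoch_inf (e2pi \<tau>) (e2pi \<tau>))\<^sup>2"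

lemma e2pi_half: "e2pi (1/2) = -1"
  by (simp add: e2pi_def)

lemma sig_add_1: "sig (z + 1) \<tau> = - sig z \<tau>"
proof -
  have "e2pi (- (z + 1) / 2) = - e2pi (- z / 2)"
  proof -
    have "- (z + 1) / 2 = - z / 2 - 1/2" by (simp add: field_simps)
    then show ?thesis by (simp only: e2pi_diff e2pi_half) simp
  qed
  moreover have "e2pi (z + 1) = e2pi z" using e2pi_of_int[of 1] by (simp add: e2pi_add)
  moreover have "e2pi (\<tau> - (z + 1)) = e2pi (\<tau> - z)"
    using e2pi_of_int[of 1] by (simp add: e2pi_diff e2pi_add)
  ultimately show ?thesis by (simp only: sig_def) simp
qed

text \<open>The first product loses the factor 1 - w and the second gains 1 - 1/w; their quotient is
  -1/w.\<close>

lemma sig_add_tau: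
  assumes "Im \<tau> > 0"
  shows "sig (z + \<tau>) \<tau> = - e2pi (- \<tau> / 2 - z) * sig z \<tau>"
proof -
  define w q where "w = e2pi z" and "q = e2pi \<tau>"
  have q: "norm q < 1" using assms by (simp add: q_def norm_e2pi_less_1)
  have w0: "w \<noteq> 0" by (simp add: w_def)
  have 1: "qpoch_inf w q = (1 - w) * qpoch_inf (w * q) q" by (rule qpoch_inf_rec[OF q])
  have 2: "qpoch_inf (1 / w) q = (1 - 1 / w) * qpoch_inf (q / w) q"
    using qpoch_inf_rec[OF q, of "1 / w"] by simp
  have "qpoch_inf (w * q) q * qpoch_inf (1 / w) q = - (1 / w) * (qpoch_inf w q * qpoch_inf (q / w) q)"
    unfolding 1 2 using w0 by (simp add: field_simps)
  moreover have "e2pi (- (z + \<tau>) / 2) * (1 / w) = e2pi (- \<tau> / 2 - z) * e2pi (- z / 2)"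
  proof -
    have "- (z + \<tau>) / 2 - z = (- \<tau> / 2 - z) + (- z / 2)" by (simp add: field_simps)
    then have "e2pi (- (z + \<tau>) / 2 - z) = e2pi ((- \<tau> / 2 - z) + (- z / 2))" by (rule arg_cong)
    then show ?thesis by (simp only: e2pi_diff[of "- (z + \<tau>) / 2"] e2pi_add w_def) simp
  qed
  ultimately have "e2pi (- (z + \<tau>) / 2) * (qpoch_inf (w * q) q * qpoch_inf (1 / w) q) =
      - (e2pi (- \<tau> / 2 - z) * e2pi (- z / 2)) * (qpoch_inf w q * qpoch_inf (q / w) q)"
    by (metis (no_types, lifting) mult.assoc mult_minus_left mult_minus_right)
  moreover have "e2pi (\<tau> - (z + \<tau>)) = 1 / w" "e2pi (z + \<tau>) = w * q" "e2pi (\<tau> - z) = q / w"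
    by (simp_all add: w_def q_def e2pi_add e2pi_diff e2pi_minus inverse_eq_divide)
  ultimately show ?thesis
    by (simp only: sig_def w_def[symmetric] q_def[symmetric]) (simp add: mult.assoc)
qed

lemma int_shift_induct:
  fixes P :: "int \<Rightarrow> bool"
  assumes "P 0" "\<And>n. P n \<longleftrightarrow> P (n + 1)"
  shows "P n"
proof (induction n rule: int_induct[where k = 0])
  case (step2 i)
  then show ?case using assms(2)[of "i - 1"] by simp
qed (use assms in auto)

lemma sig_shift:
  assumes "Im \<tau> > 0"
  shows "sig (z + of_int m * \<tau> + of_int n) \<tau> =
    (-1) powi (m + n) * e2pi (- (of_int m)\<^sup>2 * \<tau> / 2 - of_int m * z) * sig z \<tau>"
proof -
  have A: "sig (z + of_int n) \<tau> = (-1) powi n * sig z \<tau>" for n z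
  proof (induction n rule: int_shift_induct)
    case (2 n)
    have "sig (z + of_int (n + 1)) \<tau> = - sig (z + of_int n) \<tau>"
      using sig_add_1[of "z + of_int n" \<tau>] by (simp add: add_ac)
    moreover have "(-1::complex) powi (n + 1) = - ((-1) powi n)" by (simp add: power_int_add)
    ultimately show ?case by auto
  qed simp
  have B: "sig (z + of_int m * \<tau>) \<tau> = (-1) powi m * e2pi (- (of_int m)\<^sup>2 * \<tau> / 2 - of_int m * z) * sig z \<tau>" for m
  proof (induction m rule: int_shift_induct)
    case (2 m)
    have "z + of_int (m + 1) * \<tau> = (z + of_int m * \<tau>) + \<tau>" by (simp add: algebra_simps)
    then have 1: "sig (z + of_int (m + 1) * \<tau>) \<tau> = - e2pi (- \<tau> / 2 - (z + of_int m * \<tau>)) * sig (z + of_int m * \<tau>) \<tau>"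
      using sig_add_tau[OF assms, of "z + of_int m * \<tau>"] by (simp only:)
    have "- (of_int (m + 1))\<^sup>2 * \<tau> / 2 - of_int (m + 1) * z =
        (- \<tau> / 2 - (z + of_int m * \<tau>)) + (- (of_int m)\<^sup>2 * \<tau> / 2 - of_int m * z)"
      by (simp add: power2_eq_square field_simps)
    then have 2: "e2pi (- (of_int (m + 1))\<^sup>2 * \<tau> / 2 - of_int (m + 1) * z) =
        e2pi (- \<tau> / 2 - (z + of_int m * \<tau>)) * e2pi (- (of_int m)\<^sup>2 * \<tau> / 2 - of_int m * z)"
      by (simp only: e2pi_add)
    have 3: "(-1::complex) powi (m + 1) = - ((-1) powi m)" by (simp add: power_int_add)
    show ?case unfolding 1 2 3 by (simp add: mult.assoc mult.left_commute)
  qed simp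
  show ?thesis unfolding A B by (simp add: power_int_add mult_ac)
qed

lemma sig_eq_0_iff:
  assumes "Im \<tau> > 0"
  shows "sig z \<tau> = 0 \<longleftrightarrow> (\<exists>m n :: int. z = of_int m * \<tau> + of_int n)"
proof
  have q: "norm (e2pi \<tau>) < 1" using assms by (rule norm_e2pi_less_1)
  assume "sig z \<tau> = 0"
  then consider "qpoch_inf (e2pi z) (e2pi \<tau>) = 0" | "qpoch_inf (e2pi (\<tau> - z)) (e2pi \<tau>) = 0"
    using qpoch_inf_nonzero[OF q q] by (auto simp: sig_def)
  then show "\<exists>m n :: int. z = of_int m * \<tau> + of_int n"
  proof cases
    case 1
    then obtain j where "e2pi z * e2pi \<tau> ^ j = 1" using qpoch_inf_eq_0_iff[OF q] by blast
    then have "z + of_nat j * \<tau> \<in> \<int>" by (simp add: e2pi_power flip: e2pi_add e2pi_eq_1_iff)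
    then obtain n :: int where "z + of_nat j * \<tau> = of_int n" by (elim Ints_cases)
    then have "z = of_int (- int j) * \<tau> + of_int n" by (simp add: algebra_simps)
    then show ?thesis by blast
  next
    case 2
    then obtain j where "e2pi (\<tau> - z) * e2pi \<tau> ^ j = 1" using qpoch_inf_eq_0_iff[OF q] by blast
    then have "\<tau> - z + of_nat j * \<tau> \<in> \<int>" by (simp add: e2pi_power flip: e2pi_add e2pi_eq_1_iff)
    then obtain n :: int where "\<tau> - z + of_nat j * \<tau> = of_int n" by (elim Ints_cases)
    then have "z = of_int (int j + 1) * \<tau> + of_int (- n)" by (simp add: algebra_simps)
    then show ?thesis by blast
  qed
next
  assume "\<exists>m n :: int. z = of_int m * \<tau> + of_int n"
  then obtain m n :: int where z: "z = 0 + of_int m * \<tau> + of_int n" by auto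
  have "qpoch_inf 1 (e2pi \<tau>) = 0"
    using qpoch_inf_rec[OF norm_e2pi_less_1[OF assms], of 1] by simp
  then have "sig 0 \<tau> = 0" by (simp add: sig_def)
  then show "sig z \<tau> = 0" unfolding z sig_shift[OF assms] by simp
qed

text \<open>\<open>sig\<close> without its zero at 0. The division by (q;q)^2 normalises the value
  at z = 0 to 1, so that quotients of sigma functions of different lattices have a limit at 0
  independent of the lattices, see \<open>sig_ratio_tendsto\<close>.\<close>

definition sig_reg :: "complex \<Rightarrow> complex \<Rightarrow> complex" where
  "sig_reg z \<tau> = e2pi (- z / 2) * qpoch_inf (e2pi (z + \<tau>)) (e2pi \<tau>) * qpoch_inf (e2pi (\<tau> - z)) (e2pi \<tau>) / (qpoch_inf (e2pi \<tau>) (e2pi \<tau>))\<^sup>2"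

lemma sig_conv_reg:
  assumes "Im \<tau> > 0"
  shows "sig z \<tau> = (1 - e2pi z) * sig_reg z \<tau>"
  using qpoch_inf_rec[OF norm_e2pi_less_1[OF assms], of "e2pi z"]
  by (simp add: sig_def sig_reg_def e2pi_add)

lemma sig_reg_holomorphic:
  assumes "Im \<tau> > 0"
  shows "(\<lambda>z. sig_reg z \<tau>) holomorphic_on A"
proof -
  have "(\<lambda>z. sig_reg z \<tau>) holomorphic_on UNIV"
    unfolding sig_reg_def
    by (intro holomorphic_intros qpoch_inf_holomorphic)
       (use norm_e2pi_less_1[OF assms] qpoch_inf_nonzero[OF norm_e2pi_less_1[OF assms] norm_e2pi_less_1[OF assms]] in auto)
  then show ?thesis by (rule holomorphic_on_subset) auto
qed

lemma sig_holomorphic: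
  assumes "Im \<tau> > 0"
  shows "(\<lambda>z. sig z \<tau>) holomorphic_on A"
  unfolding sig_conv_reg[OF assms] by (intro holomorphic_intros sig_reg_holomorphic assms)

lemma sig_reg_0: "Im \<tau> > 0 \<Longrightarrow> sig_reg 0 \<tau> = 1"
  using qpoch_inf_nonzero[OF norm_e2pi_less_1 norm_e2pi_less_1, of \<tau>] by (simp add: sig_reg_def power2_eq_square)

lemma sig_reg_tendsto: "Im \<tau> > 0 \<Longrightarrow> ((\<lambda>z. sig_reg z \<tau>) \<longlongrightarrow> 1) (at 0)"
proof -
  assume \<tau>: "Im \<tau> > 0"
  have "((\<lambda>z. sig_reg z \<tau>) \<longlongrightarrow> sig_reg 0 \<tau>) (at 0)"
    using holomorphic_on_imp_continuous_on[OF sig_reg_holomorphic[OF \<tau>, of UNIV]] by (auto simp: continuous_on_def)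
  then show ?thesis by (simp only: sig_reg_0[OF \<tau>])
qed

lemma one_minus_e2pi_tendsto:
  "((\<lambda>z. (1 - e2pi (c * z)) / z) \<longlongrightarrow> - (2 * of_real pi * \<i> * c)) (at 0)"
proof -
  have "((\<lambda>z. 1 - e2pi (c * z)) has_field_derivative - (2 * of_real pi * \<i> * c)) (at 0)"
    unfolding e2pi_def by (auto intro!: derivative_eq_intros)
  then show ?thesis by (simp add: has_field_derivative_iff)
qed

lemma sig_ratio_tendsto:
  assumes "Im \<tau> > 0" "Im \<tau>' > 0" "c \<noteq> 0"
  shows "((\<lambda>z. sig (c * z) \<tau>' / sig z \<tau>) \<longlongrightarrow> c) (at 0)"
proof -
  have "((\<lambda>z. c * z) \<longlongrightarrow> c * 0) (at 0)" by (intro tendsto_intros)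
  then have "filterlim (\<lambda>z. c * z) (at 0) (at 0)"
    using assms(3) by (auto simp: filterlim_at eventually_at_filter)
  from filterlim_compose[OF sig_reg_tendsto[OF assms(2)] this]
  have "((\<lambda>z. sig_reg (c * z) \<tau>') \<longlongrightarrow> 1) (at 0)" .
  then have "((\<lambda>z. ((1 - e2pi (c * z)) / z) / ((1 - e2pi (1 * z)) / z) * (sig_reg (c * z) \<tau>' / sig_reg z \<tau>))
     \<longlongrightarrow> (- (2 * of_real pi * \<i> * c)) / (- (2 * of_real pi * \<i> * 1)) * (1 / 1)) (at 0)"
    by (intro tendsto_intros one_minus_e2pi_tendsto sig_reg_tendsto assms) auto
  then have "((\<lambda>z. ((1 - e2pi (c * z)) / z) / ((1 - e2pi (1 * z)) / z) * (sig_reg (c * z) \<tau>' / sig_reg z \<tau>)) \<longlongrightarrow> c) (at 0)"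
    by simp
  then show ?thesis
  proof (rule Lim_transform_eventually)
    show "\<forall>\<^sub>F z in at 0. ((1 - e2pi (c * z)) / z) / ((1 - e2pi (1 * z)) / z) * (sig_reg (c * z) \<tau>' / sig_reg z \<tau>)
        = sig (c * z) \<tau>' / sig z \<tau>"
      by (auto simp: eventually_at_filter sig_conv_reg assms)
  qed
qed

text \<open>All values are already attained on the compact period parallelogram \<open>K\<close>, so
  Liouville's theorem applies.\<close>

lemma entire_doubly_periodic_const:
  assumes f: "f holomorphic_on UNIV" and \<tau>: "Im \<tau> > 0"
    and 1: "\<And>z. f (z + 1) = f z" and 2: "\<And>z. f (z + \<tau>) = f z"
  shows "f z = f 0"
proof -
  have A: "f (z + of_int n) = f z" for n z
  proof (induction n rule: int_shift_induct)
    case (2 n)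
    then show ?case using 1[of "z + of_int n"] by (simp add: add_ac)
  qed simp
  have B: "f (z + of_int m * \<tau>) = f z" for m z
  proof (induction m rule: int_shift_induct)
    case (2 m)
    have "z + of_int (m + 1) * \<tau> = (z + of_int m * \<tau>) + \<tau>" by (simp add: algebra_simps)
    then show ?case using assms(4)[of "z + of_int m * \<tau>"] by metis
  qed simp
  define K where "K = (\<lambda>x. complex_of_real (fst x) * \<tau> + of_real (snd x)) ` ({0..1} \<times> {0..1::real})"
  have "compact K"
    unfolding K_def by (intro compact_continuous_image compact_Times compact_Icc continuous_intros)
  moreover have "continuous_on K f"
    using holomorphic_on_imp_continuous_on[OF f] continuous_on_subset by blast
  ultimately have "bounded (f ` K)" by (intro compact_imp_bounded compact_continuous_image)
  moreover have "f z \<in> f ` K" for z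
  proof -
    define s where "s = Im z / Im \<tau>"
    define r where "r = Re z - s * Re \<tau>"
    have "z = of_real s * \<tau> + of_real r"
      using \<tau> by (simp add: complex_eq_iff s_def r_def)
    also have "\<dots> = (of_real (frac s) * \<tau> + of_real (frac r)) + of_int \<lfloor>s\<rfloor> * \<tau> + of_int \<lfloor>r\<rfloor>"
      by (simp add: frac_def algebra_simps)
    finally have "f z = f (of_real (frac s) * \<tau> + of_real (frac r))" by (simp only: A B)
    moreover have "of_real (frac s) * \<tau> + of_real (frac r) \<in> K"
      unfolding K_def
      by (rule image_eqI[where x = "(frac s, frac r)"]) (auto simp: less_imp_le[OF frac_lt_1])
    ultimately show ?thesis by blast
  qed
  then have "range f = f ` K" by auto
  ultimately have "bounded (range f)" by simp
  then obtain c where "\<And>z. f z = c" using Liouville_theorem[OF f] by (auto simp: constant_on_def)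
  then show ?thesis by simp
qed

text \<open>Since 1/j and \<tau>/j lie in the lattice of \<tau>', shifting z by 1 or \<tau> changes
  \<open>N\<close> according to the shift law for \<tau>', and the quadratic exponential is exactly
  what converts the resulting factors into those of \<open>sig z \<tau>\<close>. The quotient
  \<open>R\<close> is then doubly periodic. Its possible singularities are lattice points; the one
  at 0 is removable with value 1, and periodicity transports this to all others, so \<open>R\<close>
  is entire and equal to 1.\<close>

theorem sig_modular:
  fixes a b c d :: int
  assumes det: "a * d - b * c = 1" and \<tau>: "Im \<tau> > 0"
  defines "j \<equiv> of_int c * \<tau> + of_int d" and "\<tau>' \<equiv> (of_int a * \<tau> + of_int b) / (of_int c * \<tau> + of_int d)"
  assumes \<tau>': "Im \<tau>' > 0" and j0: "j \<noteq> 0"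
  shows "j * sig (z / j) \<tau>' = e2pi (of_int c * z\<^sup>2 / (2 * j)) * sig z \<tau>"
proof -
  define N where "N = (\<lambda>z. j * sig (z / j) \<tau>' * e2pi (- (of_int c * z\<^sup>2 / (2 * j))))"
  define L where "L = {z. sig z \<tau> = 0}"
  have cdet: "of_int a * of_int d - of_int b * of_int c = (1::complex)"
    by (metis det of_int_1 of_int_diff of_int_mult)
  have tj: "\<tau>' * j = of_int a * \<tau> + of_int b" using j0 by (simp add: \<tau>'_def j_def)
  have one_j: "1 / j = of_int (- c) * \<tau>' + of_int a"
  proof -
    have "(of_int (- c) * \<tau>' + of_int a) * j = - of_int c * (\<tau>' * j) + of_int a * j" by (simp add: algebra_simps)
    also have "\<dots> = 1" unfolding tj unfolding j_def using cdet by (simp add: algebra_simps)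
    finally show ?thesis using j0 by (simp add: field_simps)
  qed
  have tau_j: "\<tau> / j = of_int d * \<tau>' + of_int (- b)"
  proof -
    have "(of_int d * \<tau>' + of_int (- b)) * j = of_int d * (\<tau>' * j) - of_int b * j" by (simp add: algebra_simps)
    also have "\<dots> = (of_int a * of_int d - of_int b * of_int c) * \<tau>" unfolding tj unfolding j_def by (simp add: algebra_simps)
    also have "\<dots> = \<tau>" unfolding cdet by simp
    finally show ?thesis using j0 by (simp add: field_simps)
  qed
  \<comment> \<open>Neither a and c nor b and d are both even; therefore a - c - ca and d - b - bd
    are odd, which fixes the signs of the two shifts.\<close>
  have par: "odd (a * d - b * c)" using det by simp
  have sgn: "(-1::complex) powi k = e2pi (of_int k / 2)" for k
  proof (cases "even k")
    case True
    then obtain i where "k = 2 * i" by (elim evenE)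
    then show ?thesis using True by simp
  next
    case False
    then obtain i where "k = 2 * i + 1" by (elim oddE)
    then have "of_int k / 2 = of_int i + (1/2 :: complex)" by (simp add: field_simps)
    then have "e2pi (of_int k / 2) = -1" by (simp only: e2pi_add e2pi_of_int e2pi_half) simp
    then show ?thesis using False by simp
  qed
  have e_odd: "e2pi (of_int k / 2) = -1" if "odd k" for k
    using that unfolding sgn[symmetric] by simp
  have rearr: "u * (A * B * S) * C = u * S * (A * B * C)" for u A B S C :: complex
    by simp
  have N1: "N (z + 1) = - N z" for z
  proof -
    have "(z + 1) / j = z / j + of_int (- c) * \<tau>' + of_int a"
      using one_j by (simp add: add_divide_distrib)
    then have s: "sig ((z + 1) / j) \<tau>' = e2pi (of_int (- c + a) / 2) * e2pi (- (of_int (- c))\<^sup>2 * \<tau>' / 2 - of_int (- c) * (z / j)) * sig (z / j) \<tau>'"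
      by (simp only: sig_shift[OF \<tau>'] sgn)
    have "of_int (- c + a) / 2 + (- (of_int (- c))\<^sup>2 * \<tau>' / 2 - of_int (- c) * (z / j)) + - (of_int c * (z + 1)\<^sup>2 / (2 * j)) =
       - (of_int c * z\<^sup>2 / (2 * j)) + of_int (- c + a) / 2 - of_int c * (of_int c * \<tau>' + 1 / j) / 2"
      using j0 by (simp add: field_simps power2_eq_square)
    also have "\<dots> = - (of_int c * z\<^sup>2 / (2 * j)) + of_int (a - c - c * a) / 2"
      unfolding one_j by (simp add: field_simps)
    finally have "e2pi (of_int (- c + a) / 2) * e2pi (- (of_int (- c))\<^sup>2 * \<tau>' / 2 - of_int (- c) * (z / j)) * e2pi (- (of_int c * (z + 1)\<^sup>2 / (2 * j)))
      = e2pi (- (of_int c * z\<^sup>2 / (2 * j))) * e2pi (of_int (a - c - c * a) / 2)"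
      by (simp only: e2pi_add[symmetric])
    moreover have "e2pi (of_int (a - c - c * a) / 2) = -1" by (rule e_odd) (use par in auto)
    ultimately have "e2pi (of_int (- c + a) / 2) * e2pi (- (of_int (- c))\<^sup>2 * \<tau>' / 2 - of_int (- c) * (z / j)) * e2pi (- (of_int c * (z + 1)\<^sup>2 / (2 * j)))
      = - e2pi (- (of_int c * z\<^sup>2 / (2 * j)))" by (simp only: mult_minus_right mult_1_right)
    note E = this
    show ?thesis unfolding N_def s rearr E by simp
  qed
  have N2: "N (z + \<tau>) = - e2pi (- \<tau> / 2 - z) * N z" for z
  proof -
    have "(z + \<tau>) / j = z / j + of_int d * \<tau>' + of_int (- b)"
      using tau_j by (simp add: add_divide_distrib)
    then have s: "sig ((z + \<tau>) / j) \<tau>' = e2pi (of_int (d + - b) / 2) * e2pi (- (of_int d)\<^sup>2 * \<tau>' / 2 - of_int d * (z / j)) * sig (z / j) \<tau>'"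
      by (simp only: sig_shift[OF \<tau>'] sgn)
    have "(of_int d)\<^sup>2 * (\<tau>' * j) + of_int c * \<tau>\<^sup>2 = \<tau> * j + of_int (b * d) * j"
    proof -
      have "(of_int d)\<^sup>2 * (\<tau>' * j) + of_int c * \<tau>\<^sup>2 - (\<tau> * j + of_int (b * d) * j)
        = \<tau> * of_int d * ((of_int a * of_int d - of_int b * of_int c) - 1)"
        unfolding tj unfolding j_def by (simp add: algebra_simps power2_eq_square)
      then show ?thesis unfolding cdet by simp
    qed
    then have c1: "(of_int d)\<^sup>2 * \<tau>' + of_int c * \<tau>\<^sup>2 / j = \<tau> + of_int (b * d)"
      using j0 by (simp add: field_simps)
    have c2: "z * of_int d / j + of_int c * \<tau> * z / j = z"
    proof -
      have "z * of_int d / j + of_int c * \<tau> * z / j = (z * of_int d + of_int c * \<tau> * z) / j"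
        by (simp only: add_divide_distrib)
      also have "z * of_int d + of_int c * \<tau> * z = z * j" unfolding j_def by (simp add: algebra_simps)
      finally show ?thesis using j0 by simp
    qed
    have "of_int (d + - b) / 2 + (- (of_int d)\<^sup>2 * \<tau>' / 2 - of_int d * (z / j)) + - (of_int c * (z + \<tau>)\<^sup>2 / (2 * j)) =
       - (of_int c * z\<^sup>2 / (2 * j)) + of_int (d - b) / 2 - ((of_int d)\<^sup>2 * \<tau>' + of_int c * \<tau>\<^sup>2 / j) / 2 - (z * of_int d / j + of_int c * \<tau> * z / j)"
      using j0 by (simp add: field_simps power2_eq_square)
    also have "\<dots> = (- \<tau> / 2 - z) + - (of_int c * z\<^sup>2 / (2 * j)) + of_int (d - b - b * d) / 2"
      unfolding c1 c2 by (simp add: field_simps)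
    finally have "e2pi (of_int (d + - b) / 2) * e2pi (- (of_int d)\<^sup>2 * \<tau>' / 2 - of_int d * (z / j)) * e2pi (- (of_int c * (z + \<tau>)\<^sup>2 / (2 * j)))
      = e2pi (- \<tau> / 2 - z) * e2pi (- (of_int c * z\<^sup>2 / (2 * j))) * e2pi (of_int (d - b - b * d) / 2)"
      by (simp only: e2pi_add[symmetric])
    moreover have "e2pi (of_int (d - b - b * d) / 2) = -1" by (rule e_odd) (use par in auto)
    ultimately have "e2pi (of_int (d + - b) / 2) * e2pi (- (of_int d)\<^sup>2 * \<tau>' / 2 - of_int d * (z / j)) * e2pi (- (of_int c * (z + \<tau>)\<^sup>2 / (2 * j)))
      = - (e2pi (- \<tau> / 2 - z) * e2pi (- (of_int c * z\<^sup>2 / (2 * j))))" by (simp only: mult_minus_right mult_1_right)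
    note E = this
    show ?thesis unfolding N_def s rearr E by (simp add: mult_ac)
  qed
  \<comment> \<open>The value on the lattice is the limit of the quotient at 0, where j and the
    derivative 1/j of z/j cancel.\<close>
  define R where "R = (\<lambda>z. if z \<in> L then 1 else N z / sig z \<tau>)"
  have L1: "z + 1 \<in> L \<longleftrightarrow> z \<in> L" and L2: "z + \<tau> \<in> L \<longleftrightarrow> z \<in> L" for z
    by (simp_all add: L_def sig_add_1 sig_add_tau[OF \<tau>])
  have R1: "R (z + 1) = R z" for z by (simp add: R_def L1 N1 sig_add_1)
  have R2: "R (z + \<tau>) = R z" for z by (simp add: R_def L2 N2 sig_add_tau[OF \<tau>])
  have Nh: "N holomorphic_on A" for A
  proof -
    have "(\<lambda>z. sig z \<tau>') holomorphic_on UNIV" by (rule sig_holomorphic[OF \<tau>'])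
    then have "((\<lambda>z. sig z \<tau>') \<circ> (\<lambda>z. z / j)) holomorphic_on UNIV"
      by (rule holomorphic_on_compose_gen[rotated]) (use j0 in \<open>auto intro!: holomorphic_intros\<close>)
    then have "N holomorphic_on UNIV"
      unfolding N_def o_def using j0 by (intro holomorphic_intros) auto
    then show ?thesis by (rule holomorphic_on_subset) auto
  qed
  have Lc: "open (- L)"
  proof -
    have "- L = (\<lambda>z. sig z \<tau>) -` (- {0})" by (auto simp: L_def)
    moreover have "open ((\<lambda>z. sig z \<tau>) -` (- {0}))"
      using holomorphic_on_imp_continuous_on[OF sig_holomorphic[OF \<tau>, of UNIV]]
      by (intro open_vimage) auto
    ultimately show ?thesis by simp
  qed
  have Rh: "R holomorphic_on (- L)"
  proof -
    have "(\<lambda>z. N z / sig z \<tau>) holomorphic_on (- L)"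
      by (intro holomorphic_intros Nh sig_holomorphic \<tau>) (auto simp: L_def)
    then show ?thesis by (rule holomorphic_transform) (auto simp: R_def)
  qed
  have zero_L: "0 \<in> L" using sig_eq_0_iff[OF \<tau>, of 0] by (auto simp: L_def intro!: exI[of _ 0])
  have "\<forall>\<^sub>F z in at 0. sig_reg z \<tau> \<noteq> 0"
    by (rule tendsto_imp_eventually_ne[OF sig_reg_tendsto[OF \<tau>]]) simp
  then obtain \<epsilon> where \<epsilon>: "\<epsilon> > 0" "\<And>z. z \<noteq> 0 \<Longrightarrow> dist z 0 < \<epsilon> \<Longrightarrow> sig_reg z \<tau> \<noteq> 0"
    by (auto simp: eventually_at)
  define B where "B = ball (0::complex) (min \<epsilon> 1)"
  have BL: "z \<notin> L" if "z \<in> B" "z \<noteq> 0" for z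
  proof
    assume "z \<in> L"
    then have "e2pi z = 1" using \<epsilon>(2)[of z] that by (auto simp: L_def sig_conv_reg[OF \<tau>] B_def)
    then obtain n :: int where n: "z = of_int n" by (auto simp: e2pi_eq_1_iff elim: Ints_cases)
    then show False using that by (auto simp: B_def)
  qed
  have RB: "R holomorphic_on B"
  proof (rule no_isolated_singularity'[where K = "{0}"])
    show "R holomorphic_on (B - {0})"
      using Rh by (rule holomorphic_on_subset) (use BL in auto)
    fix x :: complex assume "x \<in> {0}"
    then have x: "x = 0" by simp
    have "((\<lambda>z. j * (sig ((1 / j) * z) \<tau>' / sig z \<tau>) * e2pi (- (of_int c * z\<^sup>2 / (2 * j)))) \<longlongrightarrow>
        j * (1 / j) * e2pi (- (of_int c * 0\<^sup>2 / (2 * j)))) (at 0)"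
    proof (intro tendsto_mult tendsto_const sig_ratio_tendsto \<tau> \<tau>')
      show "((\<lambda>z. e2pi (- (of_int c * z\<^sup>2 / (2 * j)))) \<longlongrightarrow> e2pi (- (of_int c * 0\<^sup>2 / (2 * j)))) (at 0)"
        unfolding e2pi_def by (intro tendsto_intros) (use j0 in auto)
    qed (use j0 in auto)
    then have "((\<lambda>z. j * (sig ((1 / j) * z) \<tau>' / sig z \<tau>) * e2pi (- (of_int c * z\<^sup>2 / (2 * j)))) \<longlongrightarrow> 1) (at 0)"
      using j0 by simp
    then have "(R \<longlongrightarrow> 1) (at 0)"
    proof (rule Lim_transform_eventually)
      have "\<forall>\<^sub>F z in at 0. z \<in> B - {0}"
        using \<epsilon>(1) by (intro eventually_at_in_open) (auto simp: B_def)
      then show "\<forall>\<^sub>F z in at 0. j * (sig ((1 / j) * z) \<tau>' / sig z \<tau>) * e2pi (- (of_int c * z\<^sup>2 / (2 * j))) = R z"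
        by eventually_elim (use BL in \<open>auto simp: R_def N_def\<close>)
    qed
    then show "(R \<longlongrightarrow> R x) (at x within B)"
      using zero_L by (auto simp: x R_def intro: tendsto_within_subset)
  qed (auto simp: B_def)
  have shift: "R (z + (of_int m * \<tau> + of_int n)) = R z" for z m n
  proof -
    have A: "R (z + of_int n) = R z" for n z
    proof (induction n rule: int_shift_induct)
      case (2 n)
      then show ?case using R1[of "z + of_int n"] by (simp add: add_ac)
    qed simp
    have B: "R (z + of_int m * \<tau>) = R z" for m z
    proof (induction m rule: int_shift_induct)
      case (2 m)
      have "z + of_int (m + 1) * \<tau> = (z + of_int m * \<tau>) + \<tau>" by (simp add: algebra_simps)
      then show ?case using R2[of "z + of_int m * \<tau>"] by metis
    qed simp
    show ?thesis using A[of "z + of_int m * \<tau>" n] B[of z m] by (simp add: add.assoc)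
  qed
  have "R field_differentiable (at z)" for z
  proof (cases "z \<in> L")
    case False
    then show ?thesis using Rh Lc holomorphic_on_imp_differentiable_at by blast
  next
    case True
    then obtain m n :: int where z: "z = of_int m * \<tau> + of_int n" using sig_eq_0_iff[OF \<tau>] by (auto simp: L_def)
    have "0 \<in> B" using \<epsilon>(1) by (simp add: B_def)
    then have "R field_differentiable (at 0)"
      using RB by (intro holomorphic_on_imp_differentiable_at[of _ B]) (auto simp: B_def)
    then obtain D where "(R has_field_derivative D) (at (z - z))" by (auto simp: field_differentiable_def)
    then have "((\<lambda>x. R (x - z)) has_field_derivative D) (at z)"
      using DERIV_shift[of R D z "- z"] by simp
    moreover have "R (x - z) = R x" for x using shift[of "x - z" m n] by (simp add: z)
    ultimately show ?thesis by (auto simp: field_differentiable_def)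
  qed
  then have "R holomorphic_on UNIV" by (simp add: holomorphic_on_def)
  then have "R z = R 0" by (rule entire_doubly_periodic_const[OF _ \<tau> R1 R2])
  then have R: "R z = 1" using zero_L by (simp add: R_def)
  show ?thesis
  proof (cases "z \<in> L")
    case False
    then have "N z = sig z \<tau>" using R by (simp add: R_def L_def split: if_splits)
    then have "e2pi (of_int c * z\<^sup>2 / (2 * j)) * sig z \<tau> = j * sig (z / j) \<tau>' * (e2pi (- (of_int c * z\<^sup>2 / (2 * j))) * e2pi (of_int c * z\<^sup>2 / (2 * j)))"
      by (simp add: N_def mult_ac)
    then show ?thesis by (simp flip: e2pi_add)
  next
    case True
    then obtain m n :: int where z: "z = of_int m * \<tau> + of_int n" using sig_eq_0_iff[OF \<tau>] by (auto simp: L_def)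
    have "z / j = of_int m * (\<tau> / j) + of_int n * (1 / j)" by (simp add: z add_divide_distrib)
    also have "\<dots> = of_int (m * d - n * c) * \<tau>' + of_int (n * a - m * b)"
      unfolding tau_j one_j by (simp add: algebra_simps)
    finally have "sig (z / j) \<tau>' = 0" using sig_eq_0_iff[OF \<tau>'] by blast
    then show ?thesis using True by (simp add: L_def)
  qed
qed

section \<open>Klein forms and their transformation\<close>

definition mob :: "int \<Rightarrow> int \<Rightarrow> int \<Rightarrow> int \<Rightarrow> complex \<Rightarrow> complex" where
  "mob a b c d \<tau> = (of_int a * \<tau> + of_int b) / (of_int c * \<tau> + of_int d)"

lemma cocycle_nonzero:
  assumes det: "a * d - b * c = (1::int)" and \<tau>: "Im \<tau> > 0"
  shows "of_int c * \<tau> + of_int d \<noteq> 0"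
proof
  assume eq: "of_int c * \<tau> + of_int d = 0"
  then have "Im (of_int c * \<tau> + of_int d) = 0" "Re (of_int c * \<tau> + of_int d) = 0" by simp_all
  then have "c = 0" using \<tau> by simp
  moreover then have "d = 0" using eq by simp
  ultimately show False using det by simp
qed

lemma Im_mob:
  assumes det: "a * d - b * c = (1::int)" and \<tau>: "Im \<tau> > 0"
  shows "Im (mob a b c d \<tau>) > 0"
proof -
  let ?j = "of_int c * \<tau> + of_int d"
  have j: "?j \<noteq> 0" by (rule cocycle_nonzero[OF assms])
  have "mob a b c d \<tau> = (of_int a * \<tau> + of_int b) * cnj ?j / of_real ((norm ?j)\<^sup>2)"
    unfolding mob_def by (subst complex_div_cnj) simp
  then have "Im (mob a b c d \<tau>) = Im ((of_int a * \<tau> + of_int b) * cnj ?j) / (norm ?j)\<^sup>2"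
    by (simp only: Im_divide_of_real)
  also have "Im ((of_int a * \<tau> + of_int b) * cnj ?j) = of_int (a * d - b * c) * Im \<tau>"
    by (simp add: algebra_simps)
  also have "\<dots> = Im \<tau>" unfolding det by simp
  finally show ?thesis using \<tau> j by simp
qed

lemma sgn_e2pi: "(-1::complex) powi k = e2pi (of_int k / 2)"
proof (cases "even k")
  case True
  then obtain i where "k = 2 * i" by (elim evenE)
  then show ?thesis using True by simp
next
  case False
  then obtain i where "k = 2 * i + 1" by (elim oddE)
  then have "of_int k / 2 = of_int i + (1/2 :: complex)" by (simp add: field_simps)
  then have "e2pi (of_int k / 2) = -1" by (simp only: e2pi_add e2pi_of_int e2pi_half) simp
  then show ?thesis using False by simp
qed

lemma e2pi_even: "even k \<Longrightarrow> e2pi (of_int k / 2) = 1"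
  by (simp flip: sgn_e2pi)

lemma norm_e2pi_real [simp]: "norm (e2pi (of_real x)) = 1"
  by (simp add: norm_e2pi)

text \<open>The Klein form of characteristic (x, y), up to a constant. The exponential absorbs the
  quadratic factor of \<open>sig_modular\<close>, so a matrix simply acts on the row vector (x, y)
  from the right, with weight -1.\<close>

definition klein :: "real \<Rightarrow> real \<Rightarrow> complex \<Rightarrow> complex" where
  "klein x y \<tau> = e2pi (of_real x * (of_real x * \<tau> + of_real y) / 2) * sig (of_real x * \<tau> + of_real y) \<tau>"

text \<open>With (u, v) the transformed characteristic and z = u\<tau> + v, the determinant
  condition gives x = ud - vc and hence x + cz = uj. Therefore the exponents x z/(2j) and c z^2/(2j)
  add up to u z/2, the exponent of the transformed Klein form.\<close>

lemma klein_modular: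
  assumes det: "a * d - b * c = 1" and \<tau>: "Im \<tau> > 0"
  shows "klein x y (mob a b c d \<tau>) =
    klein (x * of_int a + y * of_int c) (x * of_int b + y * of_int d) \<tau> / (of_int c * \<tau> + of_int d)"
proof -
  define j where "j = of_int c * \<tau> + of_int d"
  define u v where "u = x * of_int a + y * of_int c" and "v = x * of_int b + y * of_int d"
  define z where "z = of_real u * \<tau> + of_real v"
  have j: "j \<noteq> 0" unfolding j_def by (rule cocycle_nonzero[OF det \<tau>])
  have cdet: "of_int a * of_int d - of_int b * of_int c = (1::real)"
    by (metis det of_int_1 of_int_diff of_int_mult)
  have zj: "of_real x * mob a b c d \<tau> + of_real y = z / j"
  proof -
    have "of_real x * mob a b c d \<tau> + of_real y = (of_real x * (of_int a * \<tau> + of_int b) + of_real y * j) / j"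
    proof -
      have "x * (M / j) + y = (x * M + y * j) / j" for x M y :: complex using j by (simp add: field_simps)
      then show ?thesis unfolding mob_def j_def[symmetric] .
    qed
    also have "of_real x * (of_int a * \<tau> + of_int b) + of_real y * j = z"
      by (simp add: z_def u_def v_def j_def algebra_simps)
    finally show ?thesis .
  qed
  have "u * of_int d - v * of_int c = x * (of_int a * of_int d - of_int b * of_int c)"
    by (simp add: u_def v_def algebra_simps)
  then have x: "x = u * of_int d - v * of_int c" unfolding cdet by simp
  have s: "sig (z / j) (mob a b c d \<tau>) = e2pi (of_int c * z\<^sup>2 / (2 * j)) * sig z \<tau> / j"
    using sig_modular[OF det \<tau>, of z] Im_mob[OF det \<tau>] j by (simp add: mob_def j_def field_simps)
  have "of_real x * (z / j) / 2 + of_int c * z\<^sup>2 / (2 * j) = of_real u * z / 2"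
  proof -
    have "of_real x + of_int c * z = of_real u * j"
      unfolding x z_def j_def by (simp add: algebra_simps)
    moreover have "of_real x * (z / j) / 2 + of_int c * z\<^sup>2 / (2 * j) = z * (of_real x + of_int c * z) / (2 * j)"
      using j by (simp add: field_simps power2_eq_square)
    ultimately show ?thesis using j by (simp add: field_simps)
  qed
  then have "e2pi (of_real x * (z / j) / 2) * e2pi (of_int c * z\<^sup>2 / (2 * j)) = e2pi (of_real u * z / 2)"
    by (simp only: e2pi_add[symmetric])
  then have "e2pi (of_real x * (z / j) / 2) * sig (z / j) (mob a b c d \<tau>) = e2pi (of_real u * z / 2) * sig z \<tau> / j"
    unfolding s by (metis (no_types, lifting) mult.assoc times_divide_eq_right)
  then show ?thesis
    unfolding klein_def zj u_def[symmetric] v_def[symmetric] z_def[symmetric] j_def[symmetric] .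
qed

lemma klein_shift:
  assumes \<tau>: "Im \<tau> > 0"
  shows "klein (x + of_int m) (y + of_int n) \<tau> =
    e2pi (of_real ((x * of_int n - y * of_int m + of_int (m * n + m + n)) / 2)) * klein x y \<tau>"
proof -
  define z where "z = of_real x * \<tau> + of_real y"
  have zz: "of_real (x + of_int m) * \<tau> + of_real (y + of_int n) = z + of_int m * \<tau> + of_int n"
    by (simp add: z_def algebra_simps)
  have "of_real (x + of_int m) * (z + of_int m * \<tau> + of_int n) / 2 + (of_int (m + n) / 2 + (- (of_int m)\<^sup>2 * \<tau> / 2 - of_int m * z))
     = of_real ((x * of_int n - y * of_int m + of_int (m * n + m + n)) / 2) + of_real x * z / 2"
    by (simp add: z_def power2_eq_square field_simps)
  then have "e2pi (of_real (x + of_int m) * (z + of_int m * \<tau> + of_int n) / 2) * (e2pi (of_int (m + n) / 2) * e2pi (- (of_int m)\<^sup>2 * \<tau> / 2 - of_int m * z))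
     = e2pi (of_real ((x * of_int n - y * of_int m + of_int (m * n + m + n)) / 2)) * e2pi (of_real x * z / 2)"
    by (simp only: e2pi_add[symmetric])
  then show ?thesis
    unfolding klein_def zz sig_shift[OF \<tau>] sgn_e2pi z_def[symmetric] by (metis (no_types, lifting) mult.assoc)
qed

lemma klein_nonzero:
  assumes \<tau>: "Im \<tau> > 0" and xy: "\<not> (x \<in> \<int> \<and> y \<in> \<int>)"
  shows "klein x y \<tau> \<noteq> 0"
proof
  assume "klein x y \<tau> = 0"
  then obtain m n :: int where e: "of_real x * \<tau> + of_real y = of_int m * \<tau> + of_int n"
    using sig_eq_0_iff[OF \<tau>] by (auto simp: klein_def)
  then have "Im (of_real x * \<tau> + of_real y) = Im (of_int m * \<tau> + of_int n)" by simp
  then have "x = of_int m" using \<tau> by simp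
  moreover then have "complex_of_real y = of_int n" using e by simp
  then have "y = of_int n" by (metis of_real_eq_iff of_real_of_int_eq)
  ultimately show False using xy by simp
qed

lemma open_upper_half_plane: "open upper_half_plane"
  unfolding upper_half_plane_def by (simp add: open_halfspace_Im_gt)

lemma sig_holomorphic_both:
  assumes f: "f holomorphic_on A" and g: "g holomorphic_on A" and A: "open A" and up: "\<And>z. z \<in> A \<Longrightarrow> Im (g z) > 0"
  shows "(\<lambda>z. sig (f z) (g z)) holomorphic_on A"
  unfolding sig_def
  by (intro holomorphic_intros qpoch_inf_holomorphic f g A norm_e2pi_less_1 up)
     (use up qpoch_inf_nonzero[OF norm_e2pi_less_1 norm_e2pi_less_1] in auto)

lemma klein_holomorphic:
  assumes g: "g holomorphic_on A" and A: "open A" and up: "\<And>z. z \<in> A \<Longrightarrow> Im (g z) > 0"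
  shows "(\<lambda>z. klein x y (g z)) holomorphic_on A"
  unfolding klein_def by (intro holomorphic_intros sig_holomorphic_both g A up) auto

section \<open>The eta function\<close>

definition eta :: "complex \<Rightarrow> complex" where
  "eta \<tau> = e2pi (\<tau> / 24) * qpoch_inf (e2pi \<tau>) (e2pi \<tau>)"

lemma eta_nonzero: "Im \<tau> > 0 \<Longrightarrow> eta \<tau> \<noteq> 0"
  using qpoch_inf_nonzero[OF norm_e2pi_less_1 norm_e2pi_less_1, of \<tau>] by (simp add: eta_def)

lemma eta_holomorphic:
  assumes g: "g holomorphic_on A" and A: "open A" and up: "\<And>z. z \<in> A \<Longrightarrow> Im (g z) > 0"
  shows "(\<lambda>z. eta (g z)) holomorphic_on A"
  unfolding eta_def by (intro holomorphic_intros qpoch_inf_holomorphic g A norm_e2pi_less_1 up) auto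

lemma klein_expand:
  "klein x y \<tau> = e2pi (of_real ((x - 1) / 2) * (of_real x * \<tau> + of_real y)) * qpoch_inf (e2pi (of_real x * \<tau> + of_real y)) (e2pi \<tau>)
     * qpoch_inf (e2pi (\<tau> - (of_real x * \<tau> + of_real y))) (e2pi \<tau>) / (qpoch_inf (e2pi \<tau>) (e2pi \<tau>))\<^sup>2"
proof -
  have "of_real ((x - 1) / 2) * (of_real x * \<tau> + of_real y) = of_real x * (of_real x * \<tau> + of_real y) / 2 + - (of_real x * \<tau> + of_real y) / 2"
    by (simp add: field_simps)
  then have "e2pi (of_real ((x - 1) / 2) * (of_real x * \<tau> + of_real y)) =
      e2pi (of_real x * (of_real x * \<tau> + of_real y) / 2) * e2pi (- (of_real x * \<tau> + of_real y) / 2)"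
    by (simp only: e2pi_add)
  then show ?thesis unfolding klein_def sig_def by simp
qed

definition klein3 :: "complex \<Rightarrow> complex" where
  "klein3 \<tau> = klein (1/2) 0 \<tau> * klein 0 (1/2) \<tau> * klein (1/2) (1/2) \<tau>"

text \<open>With t^2 = q the three Klein forms contain the square of (t;q)(-t;q)(-q;q) =
  (q;q^2)(-q;q), which is 1 by Euler's identity. Six factors (q;q) in the denominator remain, and
  the powers of q cancel against those of the sixth power of eta.\<close>

lemma klein3_eta:
  assumes \<tau>: "Im \<tau> > 0"
  shows "klein3 \<tau> * eta \<tau> ^ 6 = 2 * e2pi (- 3 / 8)"
proof -
  define t q where "t = e2pi (\<tau> / 2)" and "q = e2pi \<tau>"
  have q: "norm q < 1" using \<tau> by (simp add: q_def norm_e2pi_less_1)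
  have tq: "t\<^sup>2 = q" by (simp add: t_def q_def e2pi_power)
  define P where "P = qpoch_inf q q"
  have P: "P \<noteq> 0" unfolding P_def by (rule qpoch_inf_nonzero[OF q q])
  have half: "e2pi (\<tau> / 2 + 1 / 2) = - t" by (simp add: e2pi_add e2pi_half t_def)
  have e2: "e2pi (\<tau> - \<tau> / 2) = t" by (simp add: t_def)
  have e3: "e2pi (\<tau> - (\<tau> / 2 + 1 / 2)) = - t"
  proof -
    have "\<tau> - (\<tau> / 2 + 1 / 2) = \<tau> / 2 - 1 / 2" by simp
    then show ?thesis by (simp only: e2pi_diff e2pi_half t_def) simp
  qed
  have k1: "klein (1/2) 0 \<tau> = e2pi (- \<tau> / 8) * (qpoch_inf t q)\<^sup>2 / P\<^sup>2"
    unfolding klein_expand by (simp add: e2 power2_eq_square P_def q_def[symmetric] t_def[symmetric])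
  have k2: "klein 0 (1/2) \<tau> = e2pi (- 1 / 4) * (qpoch_inf (-1) q * qpoch_inf (- q) q) / P\<^sup>2"
    unfolding klein_expand by (simp add: e2pi_half e2pi_diff P_def q_def[symmetric])
  have k3: "klein (1/2) (1/2) \<tau> = e2pi (- (\<tau> + 1) / 8) * (qpoch_inf (- t) q)\<^sup>2 / P\<^sup>2"
  proof -
    have "of_real ((1 / 2 - 1) / 2) * (of_real (1/2) * \<tau> + of_real (1/2)) = - (\<tau> + 1) / 8" by (simp add: field_simps)
    moreover have "of_real (1/2) * \<tau> + of_real (1/2) = \<tau> / 2 + 1 / 2" by simp
    ultimately show ?thesis
      unfolding klein_expand by (simp only: half e3 q_def[symmetric] P_def[symmetric]) (simp add: power2_eq_square)
  qed
  have m1: "qpoch_inf (-1) q = 2 * qpoch_inf (- q) q" using qpoch_inf_rec[OF q, of "-1"] by simp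
  have m2: "(qpoch_inf t q * qpoch_inf (- t) q) * qpoch_inf (- q) q = 1"
    unfolding qpoch_inf_minus_mult[OF q] tq by (rule euler_odd_distinct[OF q])
  have et: "eta \<tau> ^ 6 = e2pi (\<tau> / 4) * P ^ 6"
    unfolding eta_def q_def[symmetric] P_def[symmetric] power_mult_distrib e2pi_power by simp
  have "- \<tau> / 8 + - 1 / 4 + - (\<tau> + 1) / 8 + \<tau> / 4 = - 3 / 8" by (simp add: field_simps)
  then have ex: "e2pi (- \<tau> / 8) * e2pi (- 1 / 4) * e2pi (- (\<tau> + 1) / 8) * e2pi (\<tau> / 4) = e2pi (- 3 / 8)"
    by (simp only: e2pi_add[symmetric])
  have "klein3 \<tau> * eta \<tau> ^ 6 = 2 * (e2pi (- \<tau> / 8) * e2pi (- 1 / 4) * e2pi (- (\<tau> + 1) / 8) * e2pi (\<tau> / 4)) *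
     ((qpoch_inf t q * qpoch_inf (- t) q) * qpoch_inf (- q) q)\<^sup>2 * (P ^ 6 / (P\<^sup>2 * P\<^sup>2 * P\<^sup>2))"
    unfolding klein3_def k1 k2 k3 m1 et by (simp add: power2_eq_square)
  also have "P ^ 6 / (P\<^sup>2 * P\<^sup>2 * P\<^sup>2) = 1" using P by (simp flip: power_add)
  finally show ?thesis unfolding m2 ex by simp
qed

lemma klein_half_reduce:
  obtains u where "norm u = 1" "\<And>\<tau>. Im \<tau> > 0 \<Longrightarrow> klein (of_int k / 2) (of_int l / 2) \<tau> = u * klein (of_int (k mod 2) / 2) (of_int (l mod 2) / 2) \<tau>"
proof -
  have h: "of_int k / 2 = of_int (k mod 2) / 2 + (of_int (k div 2) :: real)" for k
  proof -
    have "of_int k = (of_int (2 * (k div 2) + k mod 2) :: real)" by (simp only: mult_div_mod_eq)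
    then have "of_int k = 2 * of_int (k div 2) + (of_int (k mod 2) :: real)"
      by (simp only: of_int_add of_int_mult of_int_numeral)
    then show ?thesis by linarith
  qed
  show ?thesis
  proof (rule that)
    let ?x = "((of_int (k mod 2) / 2) * of_int (l div 2) - (of_int (l mod 2) / 2) * of_int (k div 2) + of_int (k div 2 * (l div 2) + k div 2 + l div 2)) / 2 :: real"
    show "norm (e2pi (of_real ?x)) = 1" by (rule norm_e2pi_real)
    fix \<tau> :: complex assume "Im \<tau> > 0"
    from klein_shift[OF this, of "of_int (k mod 2) / 2" "k div 2" "of_int (l mod 2) / 2" "l div 2"]
    show "klein (of_int k / 2) (of_int l / 2) \<tau> = e2pi (of_real ?x) * klein (of_int (k mod 2) / 2) (of_int (l mod 2) / 2) \<tau>"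
      by (simp only: h[symmetric])
  qed
qed

text \<open>Modulo integers the matrix permutes the three nonzero half periods; the six parity
  patterns are the elements of SL2 over the field with two elements. Reducing the characteristics
  costs only constants of modulus 1.\<close>

lemma klein3_modular:
  assumes det: "a * d - b * c = 1"
  obtains u where "norm u = 1"
    "\<And>\<tau>. Im \<tau> > 0 \<Longrightarrow> klein3 (mob a b c d \<tau>) * (of_int c * \<tau> + of_int d) ^ 3 = u * klein3 \<tau>"
proof -
  obtain u1 where u1: "norm u1 = 1" "\<And>\<tau>. Im \<tau> > 0 \<Longrightarrow> klein (of_int a / 2) (of_int b / 2) \<tau> = u1 * klein (of_int (a mod 2) / 2) (of_int (b mod 2) / 2) \<tau>"
    by (rule klein_half_reduce[of a b]) (rule that)
  obtain u2 where u2: "norm u2 = 1" "\<And>\<tau>. Im \<tau> > 0 \<Longrightarrow> klein (of_int c / 2) (of_int d / 2) \<tau> = u2 * klein (of_int (c mod 2) / 2) (of_int (d mod 2) / 2) \<tau>"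
    by (rule klein_half_reduce[of c d]) (rule that)
  obtain u3 where u3: "norm u3 = 1" "\<And>\<tau>. Im \<tau> > 0 \<Longrightarrow> klein (of_int (a + c) / 2) (of_int (b + d) / 2) \<tau> = u3 * klein (of_int ((a + c) mod 2) / 2) (of_int ((b + d) mod 2) / 2) \<tau>"
    by (rule klein_half_reduce[of "a + c" "b + d"]) (rule that)
  show ?thesis
  proof (rule that[of "u1 * u2 * u3"])
    show "norm (u1 * u2 * u3) = 1" using u1 u2 u3 by (simp add: norm_mult)
    fix \<tau> assume \<tau>: "Im \<tau> > 0"
    define j where "j = of_int c * \<tau> + of_int d"
    have j: "j \<noteq> 0" unfolding j_def by (rule cocycle_nonzero[OF det \<tau>])
    have "klein3 (mob a b c d \<tau>) = (klein (of_int a / 2) (of_int b / 2) \<tau> / j) * (klein (of_int c / 2) (of_int d / 2) \<tau> / j) *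
        (klein (of_int (a + c) / 2) (of_int (b + d) / 2) \<tau> / j)"
      unfolding klein3_def klein_modular[OF det \<tau>] j_def[symmetric] by (simp add: add_divide_distrib)
    then have 1: "klein3 (mob a b c d \<tau>) * j ^ 3 = klein (of_int a / 2) (of_int b / 2) \<tau> * klein (of_int c / 2) (of_int d / 2) \<tau> *
        klein (of_int (a + c) / 2) (of_int (b + d) / 2) \<tau>"
      using j by (simp add: power3_eq_cube)
    have "odd (a * d - b * c)" using det by simp
    then consider "odd a" "even b" "even c" "odd d" | "odd a" "even b" "odd c" "odd d" | "odd a" "odd b" "even c" "odd d"
      | "even a" "odd b" "odd c" "even d" | "even a" "odd b" "odd c" "odd d" | "odd a" "odd b" "odd c" "even d"
      by auto
    then have "klein (of_int (a mod 2) / 2) (of_int (b mod 2) / 2) \<tau> * klein (of_int (c mod 2) / 2) (of_int (d mod 2) / 2) \<tau> *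
        klein (of_int ((a + c) mod 2) / 2) (of_int ((b + d) mod 2) / 2) \<tau> = klein3 \<tau>"
    proof cases
      case 1 then have "a mod 2 = 1" "b mod 2 = 0" "c mod 2 = 0" "d mod 2 = 1" "(a + c) mod 2 = 1" "(b + d) mod 2 = 1" by presburger+
      then show ?thesis by (simp add: klein3_def)
    next
      case 2 then have "a mod 2 = 1" "b mod 2 = 0" "c mod 2 = 1" "d mod 2 = 1" "(a + c) mod 2 = 0" "(b + d) mod 2 = 1" by presburger+
      then show ?thesis by (simp add: klein3_def)
    next
      case 3 then have "a mod 2 = 1" "b mod 2 = 1" "c mod 2 = 0" "d mod 2 = 1" "(a + c) mod 2 = 1" "(b + d) mod 2 = 0" by presburger+
      then show ?thesis by (simp add: klein3_def)
    next
      case 4 then have "a mod 2 = 0" "b mod 2 = 1" "c mod 2 = 1" "d mod 2 = 0" "(a + c) mod 2 = 1" "(b + d) mod 2 = 1" by presburger+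
      then show ?thesis by (simp add: klein3_def)
    next
      case 5 then have "a mod 2 = 0" "b mod 2 = 1" "c mod 2 = 1" "d mod 2 = 1" "(a + c) mod 2 = 1" "(b + d) mod 2 = 0" by presburger+
      then show ?thesis by (simp add: klein3_def)
    next
      case 6 then have "a mod 2 = 1" "b mod 2 = 1" "c mod 2 = 1" "d mod 2 = 0" "(a + c) mod 2 = 0" "(b + d) mod 2 = 1" by presburger+
      then show ?thesis by (simp add: klein3_def)
    qed
    then show "klein3 (mob a b c d \<tau>) * (of_int c * \<tau> + of_int d) ^ 3 = u1 * u2 * u3 * klein3 \<tau>"
      using 1 unfolding u1(2)[OF \<tau>] u2(2)[OF \<tau>] u3(2)[OF \<tau>] j_def by (simp add: mult_ac)
  qed
qed

lemma cocycle_powr_holomorphic: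
  "(\<lambda>\<tau>. (of_int c * \<tau> + of_int d) powr s) holomorphic_on upper_half_plane"
proof (cases "c = 0")
  case True
  then show ?thesis by (simp add: holomorphic_on_const)
next
  case False
  have "of_int c * \<tau> + of_int d \<notin> \<real>\<^sub>\<le>\<^sub>0" if "\<tau> \<in> upper_half_plane" for \<tau> :: complex
    using that False by (auto simp: upper_half_plane_def complex_nonpos_Reals_iff)
  then show ?thesis by (intro holomorphic_intros) auto
qed

text \<open>The sixth power of the quotient \<open>E\<close> is constant by the relation to
  \<open>klein3\<close>. So \<open>E\<close> is a continuous function with finitely many values on
  the connected upper half-plane and hence constant; its value is the multiplier. Holomorphy of the
  principal square root holds because c\<tau> + d avoids the negative real axis unless c =
  0.\<close>

theorem eta_modular:
  assumes det: "a * d - b * c = 1"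
  obtains v where "norm v = 1"
    "\<And>\<tau>. Im \<tau> > 0 \<Longrightarrow> eta (mob a b c d \<tau>) = v * (of_int c * \<tau> + of_int d) powr (1/2) * eta \<tau>"
proof -
  obtain u where u: "norm u = 1" "\<And>\<tau>. Im \<tau> > 0 \<Longrightarrow> klein3 (mob a b c d \<tau>) * (of_int c * \<tau> + of_int d) ^ 3 = u * klein3 \<tau>"
    by (rule klein3_modular[OF det]) (rule that)
  define E where "E = (\<lambda>\<tau>. eta (mob a b c d \<tau>) / ((of_int c * \<tau> + of_int d) powr (1/2) * eta \<tau>))"
  have sq: "((x::complex) powr (1/2)) ^ 6 = x ^ 3" if "x \<noteq> 0" for x
  proof -
    have "(x powr (1/2)) ^ 6 = ((x powr (1/2))\<^sup>2) ^ 3" by (simp flip: power_mult)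
    also have "(x powr (1/2))\<^sup>2 = x" using that by (simp add: power2_eq_square flip: powr_add)
    finally show ?thesis .
  qed
  have E6: "E \<tau> ^ 6 = inverse u" if \<tau>: "Im \<tau> > 0" for \<tau>
  proof -
    let ?j = "of_int c * \<tau> + of_int d"
    have j: "?j \<noteq> 0" by (rule cocycle_nonzero[OF det \<tau>])
    note \<tau>' = Im_mob[OF det \<tau>]
    have k: "klein3 \<tau> \<noteq> 0" using klein3_eta[OF \<tau>] by auto
    have k': "klein3 (mob a b c d \<tau>) \<noteq> 0" using klein3_eta[OF \<tau>'] by auto
    have "eta \<tau> ^ 6 = 2 * e2pi (- 3 / 8) / klein3 \<tau>" using klein3_eta[OF \<tau>] k by (simp add: field_simps)
    moreover have "eta (mob a b c d \<tau>) ^ 6 = 2 * e2pi (- 3 / 8) / klein3 (mob a b c d \<tau>)" using klein3_eta[OF \<tau>'] k' by (simp add: field_simps)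
    ultimately have "E \<tau> ^ 6 = klein3 \<tau> / (klein3 (mob a b c d \<tau>) * ?j ^ 3)"
      unfolding E_def power_divide power_mult_distrib sq[OF j] by simp
    also have "\<dots> = inverse u" unfolding u(2)[OF \<tau>] using k by (simp add: inverse_eq_divide)
    finally show ?thesis .
  qed
  have "E holomorphic_on upper_half_plane"
    unfolding E_def
  proof (intro holomorphic_on_divide holomorphic_on_mult cocycle_powr_holomorphic eta_holomorphic open_upper_half_plane holomorphic_on_id)
    show "mob a b c d holomorphic_on upper_half_plane"
      unfolding mob_def[abs_def] by (intro holomorphic_intros cocycle_nonzero[OF det]) (simp add: upper_half_plane_def)
  qed (use Im_mob[OF det] cocycle_nonzero[OF det] eta_nonzero in \<open>auto simp: upper_half_plane_def\<close>)
  then have cont: "continuous_on upper_half_plane E" by (rule holomorphic_on_imp_continuous_on)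
  have "convex upper_half_plane" unfolding upper_half_plane_def by (rule convex_halfspace_Im_gt)
  then have "connected upper_half_plane" by (rule convex_connected)
  moreover have "finite (E ` upper_half_plane)"
  proof (rule finite_subset)
    show "E ` upper_half_plane \<subseteq> {z. z ^ 6 = inverse u}" using E6 by (auto simp: upper_half_plane_def)
    show "finite {z::complex. z ^ 6 = inverse u}" by (rule finite_nth_roots) simp
  qed
  ultimately have "E constant_on upper_half_plane"
    using continuous_finite_range_constant[OF _ cont] by blast
  then obtain v where v: "\<And>\<tau>. Im \<tau> > 0 \<Longrightarrow> E \<tau> = v" by (auto simp: constant_on_def upper_half_plane_def)
  show ?thesis
  proof (rule that[of v])
    have "norm (v ^ 6) = 1" using E6[of \<i>] v[of \<i>] u(1) by (simp add: norm_inverse)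
    then have "norm v ^ 6 = 1" by (simp add: norm_power)
    then show "norm v = 1" using power_eq_1_iff[of "norm v" 6] by simp
    fix \<tau> assume \<tau>: "Im \<tau> > 0"
    show "eta (mob a b c d \<tau>) = v * (of_int c * \<tau> + of_int d) powr (1/2) * eta \<tau>"
      using v[OF \<tau>] cocycle_nonzero[OF det \<tau>] eta_nonzero[OF \<tau>] by (auto simp: E_def field_simps)
  qed
qed

section \<open>Expansions at the cusps\<close>

text \<open>A form of meromorphy at infinity that is easily seen to be closed under sums and
  products. \<open>G\<close> is holomorphic on the whole unit disc, so its Taylor series represents
  \<open>g\<close> on the entire half-plane, as \<open>meromorphic_at_i_infinity\<close>
  demands.\<close>

definition cusp_merom :: "(complex \<Rightarrow> complex) \<Rightarrow> bool" where
  "cusp_merom g \<longleftrightarrow> (\<exists>h N G. (h::nat) > 0 \<and> G holomorphic_on ball 0 1 \<and>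
     (\<forall>\<tau>. Im \<tau> > 0 \<longrightarrow> g \<tau> = e2pi (- (of_nat N * \<tau> / of_nat h)) * G (e2pi (\<tau> / of_nat h))))"

lemma cusp_meromI:
  assumes "(h::nat) > 0" "G holomorphic_on ball 0 1"
    "\<And>\<tau>. Im \<tau> > 0 \<Longrightarrow> g \<tau> = e2pi (- (of_nat N * \<tau> / of_nat h)) * G (e2pi (\<tau> / of_nat h))"
  shows "cusp_merom g"
  using assms unfolding cusp_merom_def by blast

lemma cusp_merom_cong: "(\<And>\<tau>. Im \<tau> > 0 \<Longrightarrow> f \<tau> = g \<tau>) \<Longrightarrow> cusp_merom g \<Longrightarrow> cusp_merom f"
  by (auto simp: cusp_merom_def)

lemma cusp_merom_rescale:
  assumes "G holomorphic_on ball 0 1" "(h::nat) > 0" "(m::nat) > 0"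
  shows "(\<lambda>x. G (x ^ m)) holomorphic_on ball 0 1"
    and "e2pi (- (of_nat N * \<tau> / of_nat h)) * G (e2pi (\<tau> / of_nat h)) =
      e2pi (- (of_nat (N * m) * \<tau> / of_nat (h * m))) * G (e2pi (\<tau> / of_nat (h * m)) ^ m)"
proof -
  have "(G \<circ> (\<lambda>x. x ^ m)) holomorphic_on ball 0 1"
    by (rule holomorphic_on_compose_gen[OF _ assms(1)])
       (use assms in \<open>auto intro!: holomorphic_intros simp: norm_power power_less_one_iff\<close>)
  then show "(\<lambda>x. G (x ^ m)) holomorphic_on ball 0 1" by (simp add: o_def)
  have "e2pi (\<tau> / of_nat (h * m)) ^ m = e2pi (\<tau> / of_nat h)"
    using assms by (simp add: e2pi_power)
  moreover have "of_nat (N * m) * \<tau> / of_nat (h * m) = of_nat N * \<tau> / of_nat h" using assms by simp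
  ultimately show "e2pi (- (of_nat N * \<tau> / of_nat h)) * G (e2pi (\<tau> / of_nat h)) =
      e2pi (- (of_nat (N * m) * \<tau> / of_nat (h * m))) * G (e2pi (\<tau> / of_nat (h * m)) ^ m)"
    by (simp only:)
qed

lemma cusp_merom_common:
  assumes "cusp_merom f" "cusp_merom g"
  obtains h A B F G where "(h::nat) > 0" "F holomorphic_on ball 0 1" "G holomorphic_on ball 0 1"
    "\<And>\<tau>. Im \<tau> > 0 \<Longrightarrow> f \<tau> = e2pi (- (of_nat A * \<tau> / of_nat h)) * F (e2pi (\<tau> / of_nat h))"
    "\<And>\<tau>. Im \<tau> > 0 \<Longrightarrow> g \<tau> = e2pi (- (of_nat B * \<tau> / of_nat h)) * G (e2pi (\<tau> / of_nat h))"
proof -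
  obtain h1 N1 G1 where 1: "(h1::nat) > 0" "G1 holomorphic_on ball 0 1"
    "\<And>\<tau>. Im \<tau> > 0 \<Longrightarrow> f \<tau> = e2pi (- (of_nat N1 * \<tau> / of_nat h1)) * G1 (e2pi (\<tau> / of_nat h1))"
    using assms(1) unfolding cusp_merom_def by blast
  obtain h2 N2 G2 where 2: "(h2::nat) > 0" "G2 holomorphic_on ball 0 1"
    "\<And>\<tau>. Im \<tau> > 0 \<Longrightarrow> g \<tau> = e2pi (- (of_nat N2 * \<tau> / of_nat h2)) * G2 (e2pi (\<tau> / of_nat h2))"
    using assms(2) unfolding cusp_merom_def by blast
  show ?thesis
  proof (rule that)
    show "h1 * h2 > 0" using 1 2 by simp
    show "(\<lambda>x. G1 (x ^ h2)) holomorphic_on ball 0 1" "(\<lambda>x. G2 (x ^ h1)) holomorphic_on ball 0 1"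
      using cusp_merom_rescale(1) 1 2 by blast+
    show "f \<tau> = e2pi (- (of_nat (N1 * h2) * \<tau> / of_nat (h1 * h2))) * G1 (e2pi (\<tau> / of_nat (h1 * h2)) ^ h2)" if "Im \<tau> > 0" for \<tau>
      unfolding 1(3)[OF that] by (rule cusp_merom_rescale(2)[OF 1(2,1) 2(1)])
    show "g \<tau> = e2pi (- (of_nat (N2 * h1) * \<tau> / of_nat (h1 * h2))) * G2 (e2pi (\<tau> / of_nat (h1 * h2)) ^ h1)" if "Im \<tau> > 0" for \<tau>
      unfolding 2(3)[OF that] mult.commute[of h1 h2] by (rule cusp_merom_rescale(2)[OF 2(2,1) 1(1)])
  qed
qed

lemma cusp_merom_mult:
  assumes "cusp_merom f" "cusp_merom g"
  shows "cusp_merom (\<lambda>\<tau>. f \<tau> * g \<tau>)"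
proof -
  obtain h A B F G where *: "(h::nat) > 0" "F holomorphic_on ball 0 1" "G holomorphic_on ball 0 1"
    "\<And>\<tau>. Im \<tau> > 0 \<Longrightarrow> f \<tau> = e2pi (- (of_nat A * \<tau> / of_nat h)) * F (e2pi (\<tau> / of_nat h))"
    "\<And>\<tau>. Im \<tau> > 0 \<Longrightarrow> g \<tau> = e2pi (- (of_nat B * \<tau> / of_nat h)) * G (e2pi (\<tau> / of_nat h))"
    by (rule cusp_merom_common[OF assms]) (rule that)
  show ?thesis
  proof (rule cusp_meromI[OF *(1)])
    show "(\<lambda>x. F x * G x) holomorphic_on ball 0 1" using * by (intro holomorphic_intros)
    fix \<tau> assume \<tau>: "Im \<tau> > 0"
    have "- (of_nat (A + B) * \<tau> / of_nat h) = - (of_nat A * \<tau> / of_nat h) + - (of_nat B * \<tau> / of_nat h)"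
      by (simp add: distrib_right add_divide_distrib)
    then have "e2pi (- (of_nat (A + B) * \<tau> / of_nat h)) = e2pi (- (of_nat A * \<tau> / of_nat h)) * e2pi (- (of_nat B * \<tau> / of_nat h))"
      by (simp only: e2pi_add)
    then show "f \<tau> * g \<tau> = e2pi (- (of_nat (A + B) * \<tau> / of_nat h)) * (F (e2pi (\<tau> / of_nat h)) * G (e2pi (\<tau> / of_nat h)))"
      unfolding *(4,5)[OF \<tau>] by (simp only: mult_ac)
  qed
qed

lemma cusp_merom_add:
  assumes "cusp_merom f" "cusp_merom g"
  shows "cusp_merom (\<lambda>\<tau>. f \<tau> + g \<tau>)"
proof -
  obtain h A B F G where *: "(h::nat) > 0" "F holomorphic_on ball 0 1" "G holomorphic_on ball 0 1"
    "\<And>\<tau>. Im \<tau> > 0 \<Longrightarrow> f \<tau> = e2pi (- (of_nat A * \<tau> / of_nat h)) * F (e2pi (\<tau> / of_nat h))"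
    "\<And>\<tau>. Im \<tau> > 0 \<Longrightarrow> g \<tau> = e2pi (- (of_nat B * \<tau> / of_nat h)) * G (e2pi (\<tau> / of_nat h))"
    by (rule cusp_merom_common[OF assms]) (rule that)
  show ?thesis
  proof (rule cusp_meromI[OF *(1)])
    show "(\<lambda>x. x ^ B * F x + x ^ A * G x) holomorphic_on ball 0 1" using * by (intro holomorphic_intros)
    fix \<tau> assume \<tau>: "Im \<tau> > 0"
    have "e2pi (- (of_nat (A + B) * \<tau> / of_nat h)) * e2pi (\<tau> / of_nat h) ^ B = e2pi (- (of_nat A * \<tau> / of_nat h))"
      unfolding e2pi_power e2pi_add[symmetric] by (rule arg_cong[where f = e2pi]) (simp add: distrib_right add_divide_distrib)
    moreover have "e2pi (- (of_nat (A + B) * \<tau> / of_nat h)) * e2pi (\<tau> / of_nat h) ^ A = e2pi (- (of_nat B * \<tau> / of_nat h))"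
      unfolding e2pi_power e2pi_add[symmetric] by (rule arg_cong[where f = e2pi]) (simp add: distrib_right add_divide_distrib)
    ultimately show "f \<tau> + g \<tau> = e2pi (- (of_nat (A + B) * \<tau> / of_nat h)) *
        (e2pi (\<tau> / of_nat h) ^ B * F (e2pi (\<tau> / of_nat h)) + e2pi (\<tau> / of_nat h) ^ A * G (e2pi (\<tau> / of_nat h)))"
      unfolding *(4,5)[OF \<tau>] by (simp only: distrib_left mult.assoc[symmetric])
  qed
qed

lemma cusp_merom_const: "cusp_merom (\<lambda>_. c)"
  by (rule cusp_meromI[of 1 "\<lambda>_. c" _ 0]) (auto intro!: holomorphic_intros)

lemma cusp_merom_power: "cusp_merom f \<Longrightarrow> cusp_merom (\<lambda>\<tau>. f \<tau> ^ n)"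
  by (induction n) (auto intro!: cusp_merom_const cusp_merom_mult)

lemma cusp_merom_e2pi:
  assumes r: "r \<in> \<rat>"
  shows "cusp_merom (\<lambda>\<tau>. e2pi (of_real r * \<tau>))"
proof -
  obtain m n :: nat where mn: "n \<noteq> 0" "\<bar>r\<bar> = of_nat m / of_nat n" using r by (elim Rats_abs_nat_div_natE)
  show ?thesis
  proof (cases "r \<ge> 0")
    case True
    then have "complex_of_real r = of_nat m / of_nat n" using mn by simp
    then show ?thesis using mn
      by (intro cusp_meromI[of n "\<lambda>x. x ^ m" _ 0]) (auto intro!: holomorphic_intros simp: e2pi_power)
  next
    case False
    then have "r = - (of_nat m / of_nat n)" using mn by simp
    then have "complex_of_real r = - (of_nat m / of_nat n)" by simp
    then show ?thesis using mn
      by (intro cusp_meromI[of n "\<lambda>x. 1" _ m]) (auto intro!: holomorphic_intros)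
  qed
qed

text \<open>With a common denominator h both arguments are powers x^m and x^n of x = e2pi
  (\<tau>/h), up to constants of modulus 1. A zero in the disc would force |x|^(m+nj) = 1 for some
  j, hence m = j = 0 and then u = 1, which the last assumption excludes.\<close>

lemma cusp_merom_qpoch:
  assumes \<alpha>: "\<alpha> \<in> \<rat>" "\<alpha> \<ge> 0" and \<beta>: "\<beta> \<in> \<rat>" "\<beta> > 0" and uv: "norm u = 1" "norm v = 1"
  shows "cusp_merom (\<lambda>\<tau>. qpoch_inf (u * e2pi (of_real \<alpha> * \<tau>)) (v * e2pi (of_real \<beta> * \<tau>)))"
    and "\<alpha> > 0 \<or> u \<noteq> 1 \<Longrightarrow> cusp_merom (\<lambda>\<tau>. inverse (qpoch_inf (u * e2pi (of_real \<alpha> * \<tau>)) (v * e2pi (of_real \<beta> * \<tau>))))"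
proof -
  obtain m1 n1 :: nat where 1: "n1 \<noteq> 0" "\<alpha> = of_nat m1 / of_nat n1" using \<alpha> by (elim Rats_abs_nat_div_natE) auto
  obtain m2 n2 :: nat where 2: "n2 \<noteq> 0" "\<beta> = of_nat m2 / of_nat n2" using \<beta> by (elim Rats_abs_nat_div_natE) auto
  define h m n where "h = n1 * n2" and "m = m1 * n2" and "n = m2 * n1"
  have h: "h > 0" using 1 2 by (simp add: h_def)
  have \<alpha>': "complex_of_real \<alpha> = of_nat m / of_nat h" and \<beta>': "complex_of_real \<beta> = of_nat n / of_nat h"
    using 1 2 by (simp_all add: h_def m_def n_def)
  have n: "n > 0" using 1 2(1) \<beta>(2) unfolding 2(2) n_def by (cases "m2 = 0") auto
  have m: "m > 0" if "\<alpha> > 0" using 1(1) 2 that unfolding 1(2) m_def by (cases "m1 = 0") auto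
  have e: "e2pi (of_real \<alpha> * \<tau>) = e2pi (\<tau> / of_nat h) ^ m" "e2pi (of_real \<beta> * \<tau>) = e2pi (\<tau> / of_nat h) ^ n" for \<tau>
    by (simp_all add: e2pi_power \<alpha>' \<beta>')
  have lt: "norm (v * x ^ n) < 1" if "x \<in> ball 0 1" for x
    using that n uv by (simp add: norm_mult norm_power power_less_one_iff)
  have hol: "(\<lambda>x. qpoch_inf (u * x ^ m) (v * x ^ n)) holomorphic_on ball 0 1"
    by (intro qpoch_inf_holomorphic holomorphic_intros lt) auto
  show "cusp_merom (\<lambda>\<tau>. qpoch_inf (u * e2pi (of_real \<alpha> * \<tau>)) (v * e2pi (of_real \<beta> * \<tau>)))"
    by (rule cusp_meromI[OF h hol, of _ 0]) (simp add: e)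
  assume c: "\<alpha> > 0 \<or> u \<noteq> 1"
  have nz: "qpoch_inf (u * x ^ m) (v * x ^ n) \<noteq> 0" if x: "x \<in> ball 0 1" for x
  proof
    assume "qpoch_inf (u * x ^ m) (v * x ^ n) = 0"
    then obtain j where j: "u * x ^ m * (v * x ^ n) ^ j = 1" using qpoch_inf_eq_0_iff[OF lt[OF x]] by blast
    then have "norm (u * x ^ m * (v * x ^ n) ^ j) = 1" by simp
    then have "norm x ^ (m + n * j) = 1" by (simp add: norm_mult norm_power uv power_add power_mult)
    then have "m + n * j = 0" using x power_less_one_iff[of "norm x" "m + n * j"] by (cases "m + n * j = 0") auto
    then have "m = 0" "j = 0" using n by auto
    then show False using j c m by auto
  qed
  show "cusp_merom (\<lambda>\<tau>. inverse (qpoch_inf (u * e2pi (of_real \<alpha> * \<tau>)) (v * e2pi (of_real \<beta> * \<tau>))))"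
    by (rule cusp_meromI[OF h, of "\<lambda>x. inverse (qpoch_inf (u * x ^ m) (v * x ^ n))" _ 0])
       (auto intro!: holomorphic_on_inverse hol nz simp: e)
qed

context
  fixes \<beta> \<rho> :: real
  assumes \<beta>: "\<beta> \<in> \<rat>" "\<beta> > 0" and \<rho>: "\<rho> \<in> \<rat>"
begin

text \<open>The argument \<beta>\<tau> + \<rho> is the shape that 5\<tau> assumes after passage to
  another cusp, see \<open>scale5\<close>.\<close>

lemma cusp_eta:
  "cusp_merom (\<lambda>\<tau>. eta (of_real \<beta> * \<tau> + of_real \<rho>))" "cusp_merom (\<lambda>\<tau>. inverse (eta (of_real \<beta> * \<tau> + of_real \<rho>)))"
proof -
  have e: "e2pi (of_real \<beta> * \<tau> + of_real \<rho>) = e2pi (of_real \<rho>) * e2pi (of_real \<beta> * \<tau>)" for \<tau>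
    by (simp add: e2pi_add mult.commute)
  have e24: "e2pi ((of_real \<beta> * \<tau> + of_real \<rho>) / 24) = e2pi (of_real (\<rho> / 24)) * e2pi (of_real (\<beta> / 24) * \<tau>)" for \<tau>
    by (simp add: add_divide_distrib e2pi_add mult.commute)
  have e24': "inverse (e2pi (of_real (\<beta> / 24) * \<tau>)) = e2pi (of_real (- (\<beta> / 24)) * \<tau>)" for \<tau>
    by (simp add: e2pi_minus)
  show "cusp_merom (\<lambda>\<tau>. eta (of_real \<beta> * \<tau> + of_real \<rho>))"
    unfolding eta_def e e24
    by (intro cusp_merom_mult cusp_merom_const cusp_merom_e2pi cusp_merom_qpoch) (use \<beta> in auto)
  show "cusp_merom (\<lambda>\<tau>. inverse (eta (of_real \<beta> * \<tau> + of_real \<rho>)))"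
    unfolding eta_def e e24 inverse_mult_distrib e24'
    by (intro cusp_merom_mult cusp_merom_const cusp_merom_e2pi cusp_merom_qpoch) (use \<beta> in auto)
qed

text \<open>For 0 \<le> x < 1 the products in \<open>klein_expand\<close> have exponents x\<beta>
  \<ge> 0 and (1 - x)\<beta> > 0, as required by \<open>cusp_merom_qpoch\<close>. Only the first can
  acquire a zero, and only if x = 0 and y is an integer.\<close>

lemma cusp_klein_reduced:
  assumes x: "x \<in> \<rat>" "0 \<le> x" "x < 1"
  shows "cusp_merom (\<lambda>\<tau>. klein x y (of_real \<beta> * \<tau> + of_real \<rho>))"
    and "\<not> (x = 0 \<and> y \<in> \<int>) \<Longrightarrow> cusp_merom (\<lambda>\<tau>. inverse (klein x y (of_real \<beta> * \<tau> + of_real \<rho>)))"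
proof -
  define s where "s = (\<lambda>\<tau>. complex_of_real \<beta> * \<tau> + of_real \<rho>)"
  have sd: "complex_of_real \<beta> * \<tau> + of_real \<rho> = s \<tau>" for \<tau> by (simp add: s_def)
  have e0: "e2pi (s \<tau>) = e2pi (of_real \<rho>) * e2pi (of_real \<beta> * \<tau>)" for \<tau>
    by (simp add: s_def e2pi_add mult.commute)
  have e1: "e2pi (of_real x * s \<tau> + of_real y) = e2pi (of_real (x * \<rho> + y)) * e2pi (of_real (x * \<beta>) * \<tau>)" for \<tau>
    unfolding e2pi_add[symmetric] by (rule arg_cong[where f = e2pi]) (simp add: s_def algebra_simps)
  have e2: "e2pi (s \<tau> - (of_real x * s \<tau> + of_real y)) = e2pi (of_real ((1 - x) * \<rho> - y)) * e2pi (of_real ((1 - x) * \<beta>) * \<tau>)" for \<tau>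
    unfolding e2pi_add[symmetric] by (rule arg_cong[where f = e2pi]) (simp add: s_def algebra_simps)
  have e3: "e2pi (of_real ((x - 1) / 2) * (of_real x * s \<tau> + of_real y)) =
      e2pi (of_real ((x - 1) / 2 * (x * \<rho> + y))) * e2pi (of_real ((x - 1) / 2 * (x * \<beta>)) * \<tau>)" for \<tau>
    unfolding e2pi_add[symmetric] by (rule arg_cong[where f = e2pi]) (simp add: s_def field_simps)
  have e3': "inverse (e2pi (of_real c * \<tau>)) = e2pi (of_real (- c) * \<tau>)" for c \<tau> by (simp add: e2pi_minus)
  have dv: "u / p\<^sup>2 = u * inverse p ^ 2" "inverse (u / p\<^sup>2) = inverse u * p\<^sup>2" for u p :: complex
    by (simp_all add: divide_inverse power_inverse)
  note dv' = dv(2)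
  have rat: "x * \<beta> \<in> \<rat>" "(1 - x) * \<beta> \<in> \<rat>" "(x - 1) / 2 * (x * \<beta>) \<in> \<rat>" using x \<beta> by auto
  have rat': "- ((x - 1) / 2 * (x * \<beta>)) \<in> \<rat>" using rat(3) by (simp only: Rats_minus_iff)
  have pos: "x * \<beta> \<ge> 0" "(1 - x) * \<beta> > 0" using x \<beta> by auto
  note Q1 = cusp_merom_qpoch[OF rat(1) pos(1) \<beta> norm_e2pi_real[of "x * \<rho> + y"] norm_e2pi_real[of \<rho>]]
  note Q2 = cusp_merom_qpoch[OF rat(2) less_imp_le[OF pos(2)] \<beta> norm_e2pi_real[of "(1 - x) * \<rho> - y"] norm_e2pi_real[of \<rho>]]
  note Q3 = cusp_merom_qpoch[OF \<beta>(1) less_imp_le[OF \<beta>(2)] \<beta> norm_e2pi_real[of \<rho>] norm_e2pi_real[of \<rho>]]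
  have Q3': "cusp_merom (\<lambda>\<tau>. inverse (qpoch_inf (e2pi (of_real \<rho>) * e2pi (of_real \<beta> * \<tau>)) (e2pi (of_real \<rho>) * e2pi (of_real \<beta> * \<tau>))))"
    by (rule Q3(2)) (use \<beta> in simp)
  show "cusp_merom (\<lambda>\<tau>. klein x y (of_real \<beta> * \<tau> + of_real \<rho>))"
    unfolding sd klein_expand e0 e1 e2 e3 dv(1)
    by (intro cusp_merom_mult cusp_merom_const cusp_merom_power cusp_merom_e2pi rat Q1(1) Q2(1) Q3')
  assume c: "\<not> (x = 0 \<and> y \<in> \<int>)"
  have Q1': "cusp_merom (\<lambda>\<tau>. inverse (qpoch_inf (e2pi (of_real (x * \<rho> + y)) * e2pi (of_real (x * \<beta>) * \<tau>)) (e2pi (of_real \<rho>) * e2pi (of_real \<beta> * \<tau>))))"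
  proof (rule Q1(2))
    show "0 < x * \<beta> \<or> e2pi (of_real (x * \<rho> + y)) \<noteq> 1"
    proof (cases "x = 0")
      case True
      then have "complex_of_real (x * \<rho> + y) \<notin> \<int>" using c by simp
      then show ?thesis unfolding e2pi_eq_1_iff by blast
    qed (use x \<beta> in auto)
  qed
  have Q2': "cusp_merom (\<lambda>\<tau>. inverse (qpoch_inf (e2pi (of_real ((1 - x) * \<rho> - y)) * e2pi (of_real ((1 - x) * \<beta>) * \<tau>)) (e2pi (of_real \<rho>) * e2pi (of_real \<beta> * \<tau>))))"
    by (rule Q2(2)) (use pos in simp)
  show "cusp_merom (\<lambda>\<tau>. inverse (klein x y (of_real \<beta> * \<tau> + of_real \<rho>)))"
    unfolding sd klein_expand e0 e1 e2 e3 dv'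
      inverse_mult_distrib e3'
    by (intro cusp_merom_mult cusp_merom_const cusp_merom_power cusp_merom_e2pi rat' Q1' Q2' Q3(1))
qed

lemma cusp_klein:
  assumes x: "x \<in> \<rat>"
  shows "cusp_merom (\<lambda>\<tau>. klein x y (of_real \<beta> * \<tau> + of_real \<rho>))"
    and "\<not> (x \<in> \<int> \<and> y \<in> \<int>) \<Longrightarrow> cusp_merom (\<lambda>\<tau>. inverse (klein x y (of_real \<beta> * \<tau> + of_real \<rho>)))"
proof -
  have fx: "frac x \<in> \<rat>" unfolding frac_def using x by (intro Rats_diff) auto
  note fx = fx frac_ge_0[of x] frac_lt_1[of x]
  have eq: "klein x y (of_real \<beta> * \<tau> + of_real \<rho>) =
     e2pi (of_real ((frac x * of_int 0 - y * of_int \<lfloor>x\<rfloor> + of_int (\<lfloor>x\<rfloor> * 0 + \<lfloor>x\<rfloor> + 0)) / 2)) * klein (frac x) y (of_real \<beta> * \<tau> + of_real \<rho>)"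
    if "Im \<tau> > 0" for \<tau>
  proof -
    have "Im (of_real \<beta> * \<tau> + of_real \<rho>) > 0" using that \<beta> by simp
    from klein_shift[OF this, of "frac x" "\<lfloor>x\<rfloor>" y 0]
    show ?thesis by (simp add: frac_def)
  qed
  show "cusp_merom (\<lambda>\<tau>. klein x y (of_real \<beta> * \<tau> + of_real \<rho>))"
    by (rule cusp_merom_cong[OF eq]) (auto intro!: cusp_merom_mult cusp_merom_const cusp_klein_reduced fx)
  assume c: "\<not> (x \<in> \<int> \<and> y \<in> \<int>)"
  then have c': "\<not> (frac x = 0 \<and> y \<in> \<int>)" by (simp add: frac_eq_0_iff)
  show "cusp_merom (\<lambda>\<tau>. inverse (klein x y (of_real \<beta> * \<tau> + of_real \<rho>)))"
    by (rule cusp_merom_cong[OF arg_cong[where f = inverse, OF eq]])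
       (auto simp only: inverse_mult_distrib intro!: cusp_merom_mult cusp_merom_const cusp_klein_reduced fx c')
qed

end

lemma cusp_merom_imp_meromorphic_at_i_infinity:
  assumes "cusp_merom g"
  shows "meromorphic_at_i_infinity g"
proof -
  obtain h N G where *: "(h::nat) > 0" "G holomorphic_on ball 0 1"
     "\<And>\<tau>. Im \<tau> > 0 \<Longrightarrow> g \<tau> = e2pi (- (of_nat N * \<tau> / of_nat h)) * G (e2pi (\<tau> / of_nat h))"
    using assms unfolding cusp_merom_def by blast
  define a where "a = (\<lambda>n. (deriv ^^ n) G 0 / fact n)"
  have "(\<lambda>n. a n * exp (2 * of_real pi * \<i> * of_real (- real N + real n) * \<tau> / of_nat h)) sums g \<tau>" if \<tau>: "Im \<tau> > 0" for \<tau>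
  proof -
    have "Im (\<tau> / of_nat h) > 0" using \<tau> * by simp
    then have "e2pi (\<tau> / of_nat h) \<in> ball 0 1" by (simp add: norm_e2pi_less_1)
    then have "(\<lambda>n. a n * (e2pi (\<tau> / of_nat h) - 0) ^ n) sums G (e2pi (\<tau> / of_nat h))"
      unfolding a_def by (intro holomorphic_power_series[OF *(2)])
    then have "(\<lambda>n. e2pi (- (of_nat N * \<tau> / of_nat h)) * (a n * (e2pi (\<tau> / of_nat h) - 0) ^ n)) sums g \<tau>"
      unfolding *(3)[OF \<tau>] by (rule sums_mult)
    moreover have "e2pi (- (of_nat N * \<tau> / of_nat h)) * (a n * (e2pi (\<tau> / of_nat h) - 0) ^ n) =
        a n * exp (2 * of_real pi * \<i> * of_real (- real N + real n) * \<tau> / of_nat h)" for n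
    proof -
      have "e2pi (- (of_nat N * \<tau> / of_nat h)) * e2pi (\<tau> / of_nat h) ^ n = e2pi (of_real (- real N + real n) * \<tau> / of_nat h)"
        unfolding e2pi_power e2pi_add[symmetric]
        by (rule arg_cong[where f = e2pi]) (simp add: distrib_right left_diff_distrib add_divide_distrib diff_divide_distrib)
      also have "\<dots> = exp (2 * of_real pi * \<i> * of_real (- real N + real n) * \<tau> / of_nat h)"
        by (simp add: e2pi_def mult.assoc)
      finally show ?thesis by simp
    qed
    ultimately show ?thesis by (simp only:)
  qed
  then show ?thesis
    unfolding meromorphic_at_i_infinity_def using *(1)
    by (intro exI[of _ h] exI[of _ "- real N"] exI[of _ a]) (auto simp: upper_half_plane_def)
qed

text \<open>The matrix with diagonal (5, 1) times the given one is rewritten as an integral matrix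
  of determinant 1 times an upper triangular one. If 5 divides c, the diagonal matrix moves through
  and \<beta> = 5; otherwise a solution r of c r = d modulo 5 gives \<beta> = 1/5 and \<rho> = r/5.
  The number \<open>s\<close> is the ratio of the automorphy factors.\<close>

lemma scale5:
  assumes det: "a * d - b * c = (1::int)"
  obtains a' b' c' d' :: int and \<beta> \<rho> s :: real where "a' * d' - b' * c' = 1" "\<beta> \<in> \<rat>" "\<beta> > 0" "\<rho> \<in> \<rat>" "s \<noteq> 0"
    "\<And>\<tau>. Im \<tau> > 0 \<Longrightarrow> 5 * mob a b c d \<tau> = mob a' b' c' d' (of_real \<beta> * \<tau> + of_real \<rho>)"
    "\<And>\<tau>::complex. of_int c' * (of_real \<beta> * \<tau> + of_real \<rho>) + of_int d' = (of_int c * \<tau> + of_int d) / of_real s"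
proof (cases "5 dvd c")
  case True
  then obtain e where e: "c = 5 * e" by (elim dvdE)
  show ?thesis
    by (rule that[of a d "5 * b" e 5 0 1]) (use det in \<open>auto simp: e mob_def algebra_simps\<close>)
next
  case False
  have "prime (5::int)" by simp
  then have "coprime c 5" using False by (metis prime_imp_coprime coprime_commute)
  then obtain x where x: "[c * x = 1] (mod 5)" using cong_solve_coprime_int by blast
  have "[c * (x * d) = 1 * d] (mod 5)" using cong_mult[OF x cong_refl[of d]] by (simp add: mult.assoc)
  then have "5 dvd d - c * (x * d)" by (metis cong_iff_dvd_diff cong_sym mult_1)
  then obtain k where k: "d - c * (x * d) = 5 * k" by (elim dvdE)
  define r where "r = x * d"
  have d: "d = c * r + 5 * k" using k by (simp add: r_def)
  show ?thesis
  proof (rule that[of "5 * a" k "b - a * r" c "1/5" "of_int r / 5" 5])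
    show "5 * a * k - (b - a * r) * c = 1" using det by (simp add: d algebra_simps)
    show j: "of_int c * (of_real (1/5) * \<tau> + of_real (of_int r / 5)) + of_int k = (of_int c * \<tau> + of_int d) / of_real 5" for \<tau> :: complex
      by (simp add: d field_simps)
    show "5 * mob a b c d \<tau> = mob (5 * a) (b - a * r) c k (of_real (1/5) * \<tau> + of_real (of_int r / 5))" for \<tau>
    proof -
      have "of_int (5 * a) * (of_real (1/5) * \<tau> + of_real (of_int r / 5)) + of_int (b - a * r) = of_int a * \<tau> + of_int b"
        by (simp add: field_simps)
      note eq = this
      show ?thesis unfolding mob_def j eq by simp
    qed
  qed auto
qed

section \<open>Modularity for \<open>\<Gamma>\<^sub>1(10)\<close>\<close>

text \<open>Twice the difference of the two shift phases is split into 2V, with V the intended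
  phase, and an even integer E, for which e2pi (E/2) = 1. Each application exhibits its own
  E.\<close>

lemma klein_quot_shift:
  assumes \<tau>: "Im \<tau> > 0" "Im \<tau>' > 0" and E: "even E"
    and eq: "(x * of_int n - y * of_int m + of_int (m * n + m + n)) - (x' * of_int n' - y' * of_int m' + of_int (m' * n' + m' + n')) = 2 * V + of_int E"
  shows "klein (x + of_int m) (y + of_int n) \<tau> / klein (x' + of_int m') (y' + of_int n') \<tau>' =
    e2pi (of_real V) * (klein x y \<tau> / klein x' y' \<tau>')"
proof -
  define P where "P = (x * of_int n - y * of_int m + of_int (m * n + m + n)) / 2"
  define Q where "Q = (x' * of_int n' - y' * of_int m' + of_int (m' * n' + m' + n')) / 2"
  have "P - Q = V + of_int E / 2" using eq by (simp add: P_def Q_def field_simps)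
  then have "complex_of_real (P - Q) = of_real (V + of_int E / 2)" by (rule arg_cong)
  then have "of_real P - of_real Q = complex_of_real V + of_int E / 2" by simp
  then have PQ: "e2pi (of_real P) / e2pi (of_real Q) = e2pi (of_real V)"
    using e2pi_even[OF E] by (simp add: e2pi_add flip: e2pi_diff)
  show ?thesis
    unfolding klein_shift[OF \<tau>(1)] klein_shift[OF \<tau>(2)] P_def[symmetric] Q_def[symmetric] PQ[symmetric] by simp
qed

text \<open>A quotient of weight 0. The values y = 0 and y = 1/2 correspond to t and -t for t = e2pi
  (\<tau>/2); \<rho> = 0 and \<rho> = 1 belong to \<open>B_chi0\<close> and \<open>B_chi1\<close>,
  where the products of exponents 1, 9 and 3, 7 modulo 10 occur in the denominator.\<close>

definition klein_quot :: "real \<Rightarrow> int \<Rightarrow> complex \<Rightarrow> complex" where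
  "klein_quot y \<rho> \<tau> = klein (1/2) y \<tau> / klein (of_int (2 * \<rho> + 1) / 10) y (5 * \<tau>)"

text \<open>The phase (\<rho> - 2)/20 cancels the constant in the product expansion of the second
  quotient, and \<rho>/2 is a sign, + for the even part (\<rho> = 0) and - for the odd part (\<rho>
  = 1).\<close>

definition klein_sum :: "int \<Rightarrow> complex \<Rightarrow> complex" where
  "klein_sum \<rho> \<tau> = klein_quot 0 \<rho> \<tau> + e2pi (of_real (of_int (\<rho> - 2) / 20 + of_int \<rho> / 2)) * klein_quot (1/2) \<rho> \<tau>"

text \<open>The factor common to both terms of a parity part; its products contain only even powers
  of t. The weight is 3/2 - 2 + 1 = 1/2. It is used with l = 2 for \<open>B_chi0\<close> and l = 1
  for \<open>B_chi1\<close>.\<close>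

definition eta_klein :: "int \<Rightarrow> complex \<Rightarrow> complex" where
  "eta_klein l \<tau> = eta \<tau> ^ 3 / (eta (5 * \<tau>) ^ 4 * klein (of_int l / 5) 0 (5 * \<tau>))"

lemma mob_scale5:
  assumes "c = 5 * e"
  shows "5 * mob a b c d \<tau> = mob a (5 * b) e d (5 * \<tau>)" "of_int e * (5 * \<tau>) + of_int d = of_int c * \<tau> + of_int d"
  using assms by (simp_all add: mob_def algebra_simps)

context
  fixes a b c d m m' c' :: int
  assumes det: "a * d - b * c = 1" and abc: "a = 1 + 10 * m" "d = 1 + 10 * m'" "c = 10 * c'"
begin

lemma gamma_relation: "m + m' = b * c' - 10 * (m * m')"
  using det unfolding abc by (simp add: algebra_simps)

text \<open>The determinant condition links the parities of the entries; some of the integers left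
  over in the phase computations are even only because of it.\<close>

lemma gamma_parity: "even (m + m') \<longleftrightarrow> even (b * c')"
  unfolding gamma_relation by simp

lemma gamma_det5: "a * d - 5 * b * (2 * c') = 1"
  using det unfolding abc by (simp add: algebra_simps)

lemma gamma_scale5:
  "5 * mob a b c d \<tau> = mob a (5 * b) (2 * c') d (5 * \<tau>)" "of_int (2 * c') * (5 * \<tau>) + of_int d = of_int c * \<tau> + of_int d"
  by (rule mob_scale5; simp add: abc)+

lemma klein_quot_mob:
  assumes \<tau>: "Im \<tau> > 0"
  shows "klein_quot y \<rho> (mob a b c d \<tau>) =
    klein (1/2 * of_int a + y * of_int c) (1/2 * of_int b + y * of_int d) \<tau> /
    klein (of_int (2 * \<rho> + 1) / 10 * of_int a + y * of_int (2 * c')) (of_int (2 * \<rho> + 1) / 10 * of_int (5 * b) + y * of_int d) (5 * \<tau>)"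
proof -
  have \<tau>5: "Im (5 * \<tau>) > 0" using \<tau> by simp
  have "(u / j) / (w / j) = u / w" if "j \<noteq> 0" for u w j :: complex using that by simp
  from this[OF cocycle_nonzero[OF det \<tau>]] show ?thesis
    unfolding klein_quot_def klein_modular[OF det \<tau>] gamma_scale5(1) klein_modular[OF gamma_det5 \<tau>5] gamma_scale5(2) .
qed

text \<open>For even b each Klein quotient is reproduced with the phase V. For odd b the two are
  exchanged with phases V + w and V - w, where w is the phase of the coefficient in
  \<open>klein_sum\<close>, so the sum again acquires the phase V.\<close>

lemma klein_sum_gamma:
  assumes \<tau>: "Im \<tau> > 0"
  shows "klein_sum \<rho> (mob a b c d \<tau>) = e2pi (of_real (of_int (5 - (2 * \<rho> + 1)\<^sup>2) * of_int b / 40)) * klein_sum \<rho> \<tau>"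
proof (cases "even b")
  case True
  then obtain s where b: "b = 2 * s" by (elim evenE)
  \<comment> \<open>The summand b/8 comes from the characteristic 1/2 of the numerator, and
    (2\<rho>+1)^2 b/40 from the characteristic (2\<rho>+1)/10 of the denominator at 5\<tau>.\<close>
  define V :: real where "V = of_int (5 - (2 * \<rho> + 1)\<^sup>2) * of_int b / 40"
  have \<tau>5: "Im (5 * \<tau>) > 0" using \<tau> by simp
  have p: "even m \<longleftrightarrow> even m'" using gamma_parity b by simp
  have shift: "klein (1/2 + of_int (5 * m)) (0 + of_int s) \<tau> / klein (of_int (2 * \<rho> + 1) / 10 + of_int ((2 * \<rho> + 1) * m)) (0 + of_int ((2 * \<rho> + 1) * s)) (5 * \<tau>) =
    e2pi (of_real V) * (klein (1/2) 0 \<tau> / klein (of_int (2 * \<rho> + 1) / 10) 0 (5 * \<tau>))"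
  proof (rule klein_quot_shift[OF \<tau> \<tau>5])
    \<comment> \<open>This is the integer that remains of the doubled shift phases once 2V is
      removed.\<close>
    show "even (5 * m * s + 5 * m + s - ((2 * \<rho> + 1) * m * ((2 * \<rho> + 1) * s) + (2 * \<rho> + 1) * m + (2 * \<rho> + 1) * s))"
      by auto
  qed (simp add: V_def b field_simps power2_eq_square)
  have args: "1/2 * of_int a + 0 * of_int c = (1/2::real) + of_int (5 * m)" "1/2 * of_int b + 0 * of_int d = (0::real) + of_int s"
    "of_int (2 * \<rho> + 1) / 10 * of_int a + 0 * of_int (2 * c') = (of_int (2 * \<rho> + 1) / 10 :: real) + of_int ((2 * \<rho> + 1) * m)"
    "of_int (2 * \<rho> + 1) / 10 * of_int (5 * b) + 0 * of_int d = (0 + of_int ((2 * \<rho> + 1) * s) :: real)"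
    by (simp_all add: abc b field_simps)
  have 1: "klein_quot 0 \<rho> (mob a b c d \<tau>) = e2pi (of_real V) * klein_quot 0 \<rho> \<tau>"
    unfolding klein_quot_mob[OF \<tau>] args unfolding klein_quot_def by (rule shift)
  have shift: "klein (1/2 + of_int (5 * (m + c'))) (1/2 + of_int (s + 5 * m')) \<tau> /
      klein (of_int (2 * \<rho> + 1) / 10 + of_int ((2 * \<rho> + 1) * m + c')) (1/2 + of_int ((2 * \<rho> + 1) * s + 5 * m')) (5 * \<tau>) =
    e2pi (of_real V) * (klein (1/2) (1/2) \<tau> / klein (of_int (2 * \<rho> + 1) / 10) (1/2) (5 * \<tau>))"
  proof (rule klein_quot_shift[OF \<tau> \<tau>5])
    show "even ((2 - \<rho>) * (m' - m) - 2 * c' + (5 * (m + c') * (s + 5 * m') + 5 * (m + c') + (s + 5 * m'))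
      - (((2 * \<rho> + 1) * m + c') * ((2 * \<rho> + 1) * s + 5 * m') + ((2 * \<rho> + 1) * m + c') + ((2 * \<rho> + 1) * s + 5 * m')))"
      using p by auto
  qed (simp add: V_def b field_simps power2_eq_square)
  have args: "1/2 * of_int a + (1/2) * of_int c = (1/2::real) + of_int (5 * (m + c'))" "1/2 * of_int b + (1/2) * of_int d = (1/2::real) + of_int (s + 5 * m')"
    "of_int (2 * \<rho> + 1) / 10 * of_int a + (1/2) * of_int (2 * c') = (of_int (2 * \<rho> + 1) / 10 :: real) + of_int ((2 * \<rho> + 1) * m + c')"
    "of_int (2 * \<rho> + 1) / 10 * of_int (5 * b) + (1/2) * of_int d = (1/2 + of_int ((2 * \<rho> + 1) * s + 5 * m') :: real)"
    by (simp_all add: abc b field_simps)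
  have 2: "klein_quot (1/2) \<rho> (mob a b c d \<tau>) = e2pi (of_real V) * klein_quot (1/2) \<rho> \<tau>"
    unfolding klein_quot_mob[OF \<tau>] args unfolding klein_quot_def by (rule shift)
  show ?thesis unfolding klein_sum_def 1 2 V_def[symmetric] by (simp add: distrib_left)
next
  case False
  then obtain s where b: "b = 2 * s + 1" by (elim oddE)
  define V :: real where "V = of_int (5 - (2 * \<rho> + 1)\<^sup>2) * of_int b / 40"
  define w :: real where "w = of_int (\<rho> - 2) / 20 + of_int \<rho> / 2"
  have \<tau>5: "Im (5 * \<tau>) > 0" using \<tau> by simp
  have p: "(even m \<longleftrightarrow> even m') \<longleftrightarrow> even c'" using gamma_parity b by simp
  have shift: "klein (1/2 + of_int (5 * m)) (1/2 + of_int s) \<tau> /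
      klein (of_int (2 * \<rho> + 1) / 10 + of_int ((2 * \<rho> + 1) * m)) (1/2 + of_int ((2 * \<rho> + 1) * s + \<rho>)) (5 * \<tau>) =
    e2pi (of_real (V + w)) * (klein (1/2) (1/2) \<tau> / klein (of_int (2 * \<rho> + 1) / 10) (1/2) (5 * \<tau>))"
  proof (rule klein_quot_shift[OF \<tau> \<tau>5])
    show "even ((\<rho> - 2) * m + (5 * m * s + 5 * m + s)
      - ((2 * \<rho> + 1) * m * ((2 * \<rho> + 1) * s + \<rho>) + (2 * \<rho> + 1) * m + ((2 * \<rho> + 1) * s + \<rho>)) - \<rho>)"
      by auto
  qed (simp add: V_def w_def b field_simps power2_eq_square)
  have args: "1/2 * of_int a + 0 * of_int c = (1/2::real) + of_int (5 * m)" "1/2 * of_int b + 0 * of_int d = (1/2::real) + of_int s"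
    "of_int (2 * \<rho> + 1) / 10 * of_int a + 0 * of_int (2 * c') = (of_int (2 * \<rho> + 1) / 10 :: real) + of_int ((2 * \<rho> + 1) * m)"
    "of_int (2 * \<rho> + 1) / 10 * of_int (5 * b) + 0 * of_int d = (1/2 + of_int ((2 * \<rho> + 1) * s + \<rho>) :: real)"
    by (simp_all add: abc b field_simps)
  have 1: "klein_quot 0 \<rho> (mob a b c d \<tau>) = e2pi (of_real (V + w)) * klein_quot (1/2) \<rho> \<tau>"
    unfolding klein_quot_mob[OF \<tau>] args unfolding klein_quot_def by (rule shift)
  have shift: "klein (1/2 + of_int (5 * (m + c'))) (0 + of_int (s + 1 + 5 * m')) \<tau> /
      klein (of_int (2 * \<rho> + 1) / 10 + of_int ((2 * \<rho> + 1) * m + c')) (0 + of_int ((2 * \<rho> + 1) * s + \<rho> + 1 + 5 * m')) (5 * \<tau>) =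
    e2pi (of_real (V - w)) * (klein (1/2) 0 \<tau> / klein (of_int (2 * \<rho> + 1) / 10) 0 (5 * \<tau>))"
  proof (rule klein_quot_shift[OF \<tau> \<tau>5])
    show "even ((2 - \<rho>) * m' + \<rho> + (5 * (m + c') * (s + 1 + 5 * m') + 5 * (m + c') + (s + 1 + 5 * m'))
      - (((2 * \<rho> + 1) * m + c') * ((2 * \<rho> + 1) * s + \<rho> + 1 + 5 * m') + ((2 * \<rho> + 1) * m + c') + ((2 * \<rho> + 1) * s + \<rho> + 1 + 5 * m')))"
      using p by auto
  qed (simp add: V_def w_def b field_simps power2_eq_square)
  have args: "1/2 * of_int a + (1/2) * of_int c = (1/2::real) + of_int (5 * (m + c'))" "1/2 * of_int b + (1/2) * of_int d = (0::real) + of_int (s + 1 + 5 * m')"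
    "of_int (2 * \<rho> + 1) / 10 * of_int a + (1/2) * of_int (2 * c') = (of_int (2 * \<rho> + 1) / 10 :: real) + of_int ((2 * \<rho> + 1) * m + c')"
    "of_int (2 * \<rho> + 1) / 10 * of_int (5 * b) + (1/2) * of_int d = (0 + of_int ((2 * \<rho> + 1) * s + \<rho> + 1 + 5 * m') :: real)"
    by (simp_all add: abc b field_simps)
  have 2: "klein_quot (1/2) \<rho> (mob a b c d \<tau>) = e2pi (of_real (V - w)) * klein_quot 0 \<rho> \<tau>"
    unfolding klein_quot_mob[OF \<tau>] args unfolding klein_quot_def by (rule shift)
  have "e2pi (of_real w) * e2pi (of_real (V - w)) = e2pi (of_real V)"
    unfolding e2pi_add[symmetric] by simp
  moreover have "e2pi (of_real (V + w)) = e2pi (of_real V) * e2pi (of_real w)"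
    by (simp add: e2pi_add)
  ultimately show ?thesis
    unfolding klein_sum_def 1 2 V_def[symmetric] w_def[symmetric] by (simp add: distrib_left mult.assoc[symmetric])
qed

text \<open>Let J be the square root of c\<tau> + d. As c is divisible by 5, the matrix acting on
  5\<tau> is integral with the same automorphy factor, so the three ingredients contribute J^3,
  J^(-4) and J^2, together J.\<close>

lemma eta_klein_gamma:
  obtains v where "norm v = 1"
    "\<And>\<tau>. Im \<tau> > 0 \<Longrightarrow> eta_klein l (mob a b c d \<tau>) = v * (of_int c * \<tau> + of_int d) powr (1/2) * eta_klein l \<tau>"
proof -
  obtain v1 where v1: "norm v1 = 1" "\<And>\<tau>. Im \<tau> > 0 \<Longrightarrow> eta (mob a b c d \<tau>) = v1 * (of_int c * \<tau> + of_int d) powr (1/2) * eta \<tau>"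
    by (rule eta_modular[OF det]) (rule that)
  obtain v2 where v2: "norm v2 = 1" "\<And>\<tau>. Im \<tau> > 0 \<Longrightarrow> eta (mob a (5 * b) (2 * c') d \<tau>) = v2 * (of_int (2 * c') * \<tau> + of_int d) powr (1/2) * eta \<tau>"
    by (rule eta_modular[OF gamma_det5]) (rule that)
  define u where "u = e2pi (of_real ((of_int l / 5 * of_int (l * b) - 0 * of_int (2 * l * m) + of_int (2 * l * m * (l * b) + 2 * l * m + l * b)) / 2))"
  have u: "norm u = 1" "u \<noteq> 0" unfolding u_def by (simp_all only: norm_e2pi_real e2pi_nonzero not_False_eq_True)
  show ?thesis
  proof (rule that[of "v1 ^ 3 / (v2 ^ 4 * u)"])
    show "norm (v1 ^ 3 / (v2 ^ 4 * u)) = 1" by (simp add: norm_divide norm_mult norm_power u v1 v2)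
    fix \<tau> assume \<tau>: "Im \<tau> > 0"
    then have \<tau>5: "Im (5 * \<tau>) > 0" by simp
    define j where "j = of_int c * \<tau> + of_int d"
    define J where "J = j powr (1/2)"
    have j: "j \<noteq> 0" unfolding j_def by (rule cocycle_nonzero[OF det \<tau>])
    have JJ: "J ^ 2 = j" unfolding J_def using j by (simp add: power2_eq_square flip: powr_add)
    have J0: "J \<noteq> 0" using j JJ by auto
    have e1: "eta (mob a b c d \<tau>) = v1 * J * eta \<tau>" unfolding J_def j_def by (rule v1(2)[OF \<tau>])
    have e2: "eta (5 * mob a b c d \<tau>) = v2 * J * eta (5 * \<tau>)"
      unfolding gamma_scale5(1) v2(2)[OF \<tau>5] gamma_scale5(2) J_def j_def ..
    have "of_int l / 5 * of_int a = of_int l / 5 + (of_int (2 * l * m) :: real)"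
      "of_int l / 5 * of_int (5 * b) = 0 + (of_int (l * b) :: real)"
      by (simp_all add: abc field_simps)
    then have e3: "klein (of_int l / 5) 0 (5 * mob a b c d \<tau>) = u * klein (of_int l / 5) 0 (5 * \<tau>) / J ^ 2"
      unfolding gamma_scale5(1) klein_modular[OF gamma_det5 \<tau>5] gamma_scale5(2) JJ j_def u_def
      by (simp only: mult_zero_left add_0_right klein_shift[OF \<tau>5])
    have "(v1 * J * x) ^ 3 / ((v2 * J * y) ^ 4 * (u * k / J ^ 2)) = v1 ^ 3 / (v2 ^ 4 * u) * J * (x ^ 3 / (y ^ 4 * k))"
      for x y k using J0 by (simp add: power_mult_distrib power4_eq_xxxx power3_eq_cube power2_eq_square mult_ac)
    then show "eta_klein l (mob a b c d \<tau>) = v1 ^ 3 / (v2 ^ 4 * u) * (of_int c * \<tau> + of_int d) powr (1/2) * eta_klein l \<tau>"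
      unfolding eta_klein_def e1 e2 e3 J_def j_def .
  qed
qed

end

section \<open>The bilateral series in terms of eta and Klein forms\<close>

lemma div_5_not_Ints:
  assumes "\<not> 5 dvd l"
  shows "of_int l / 5 \<notin> (\<int> :: real set)"
proof
  assume "of_int l / 5 \<in> (\<int> :: real set)"
  then obtain n where "of_int l / 5 = (of_int n :: real)" by (elim Ints_cases)
  then have "of_int l = (of_int (5 * n) :: real)" by simp
  then have "l = 5 * n" by (simp only: of_int_eq_iff)
  then show False using assms by simp
qed

lemma eta_klein_nonzero:
  assumes "Im \<tau> > 0" "\<not> 5 dvd l"
  shows "eta_klein l \<tau> \<noteq> 0"
proof -
  have "klein (of_int l / 5) 0 (5 * \<tau>) \<noteq> 0"
    using assms div_5_not_Ints by (intro klein_nonzero) auto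
  then show ?thesis using assms by (simp add: eta_klein_def eta_nonzero)
qed

lemma klein_frac:
  fixes k n :: nat and \<sigma> :: complex
  assumes n: "n > 0" and k: "k \<le> n"
  defines "T \<equiv> e2pi (\<sigma> / of_nat n)" and "x \<equiv> real k / real n"
  shows "klein x 0 \<sigma> = e2pi (of_real ((x - 1) * x / 2) * \<sigma>) *
      (qpoch_inf (T ^ k) (T ^ n) * qpoch_inf (T ^ (n - k)) (T ^ n) / (qpoch_inf (T ^ n) (T ^ n))\<^sup>2)"
    and "klein x (1/2) \<sigma> = e2pi (of_real ((x - 1) / 4)) * e2pi (of_real ((x - 1) * x / 2) * \<sigma>) *
      (qpoch_inf (- (T ^ k)) (T ^ n) * qpoch_inf (- (T ^ (n - k))) (T ^ n) / (qpoch_inf (T ^ n) (T ^ n))\<^sup>2)"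
proof -
  have q: "e2pi \<sigma> = T ^ n" using n by (simp add: T_def e2pi_power)
  have 1: "e2pi (of_real x * \<sigma>) = T ^ k" by (simp add: T_def e2pi_power x_def)
  have 2: "e2pi (\<sigma> - of_real x * \<sigma>) = T ^ (n - k)"
    unfolding T_def e2pi_power
    by (rule arg_cong[where f = e2pi]) (use n k in \<open>simp add: x_def of_nat_diff field_simps\<close>)
  have e: "e2pi (of_real ((x - 1) / 2) * (of_real x * \<sigma>)) = e2pi (of_real ((x - 1) * x / 2) * \<sigma>)" by (simp add: mult.assoc)
  show "klein x 0 \<sigma> = e2pi (of_real ((x - 1) * x / 2) * \<sigma>) *
      (qpoch_inf (T ^ k) (T ^ n) * qpoch_inf (T ^ (n - k)) (T ^ n) / (qpoch_inf (T ^ n) (T ^ n))\<^sup>2)"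
    unfolding klein_expand of_real_0 add_0_right q 1 2 e by simp
  have f1: "e2pi (of_real x * \<sigma> + of_real (1/2)) = - (T ^ k)"
    by (simp add: e2pi_add 1 e2pi_half)
  have "e2pi (\<sigma> - (of_real x * \<sigma> + of_real (1/2))) = e2pi (\<sigma> - of_real x * \<sigma>) / e2pi (1/2)"
    unfolding e2pi_diff[symmetric] by (simp add: diff_diff_eq)
  then have f2: "e2pi (\<sigma> - (of_real x * \<sigma> + of_real (1/2))) = - (T ^ (n - k))"
    by (simp add: 2 e2pi_half)
  have e': "e2pi (of_real ((x - 1) / 2) * (of_real x * \<sigma> + of_real (1/2))) = e2pi (of_real ((x - 1) / 4)) * e2pi (of_real ((x - 1) * x / 2) * \<sigma>)"
    unfolding e2pi_add[symmetric] by (rule arg_cong[where f = e2pi]) (simp add: field_simps)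
  show "klein x (1/2) \<sigma> = e2pi (of_real ((x - 1) / 4)) * e2pi (of_real ((x - 1) * x / 2) * \<sigma>) *
      (qpoch_inf (- (T ^ k)) (T ^ n) * qpoch_inf (- (T ^ (n - k))) (T ^ n) / (qpoch_inf (T ^ n) (T ^ n))\<^sup>2)"
    unfolding klein_expand q f1 f2 e' by simp
qed

lemma quot_rearrange:
  fixes e1 :: complex
  shows "(e1 * (a / p)) / (e2 * (c / r)) = (e1 / e2) * (r / p) * (a / c)"
  by (simp add: mult_ac)

text \<open>As k and 10 - k are odd, the products for y = 1/2 are those for y = 0 at -t, up to a
  constant phase; this is how the substitution t -> -t becomes visible on characteristics.\<close>

lemma klein_quot_product:
  fixes k :: nat and \<tau> :: complex
  assumes k: "int k = 2 * \<rho> + 1" "k \<le> 10"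
  defines "t \<equiv> e2pi (\<tau> / 2)" and "s \<equiv> real k * (10 - real k) / 40 - 1 / 8"
  defines "R \<equiv> (qpoch_inf (t ^ 10) (t ^ 10))\<^sup>2 / (qpoch_inf (t\<^sup>2) (t\<^sup>2))\<^sup>2"
  shows "klein_quot 0 \<rho> \<tau> = e2pi (of_real s * \<tau>) * R *
      ((qpoch_inf t (t\<^sup>2))\<^sup>2 / (qpoch_inf (t ^ k) (t ^ 10) * qpoch_inf (t ^ (10 - k)) (t ^ 10)))"
    and "klein_quot (1/2) \<rho> \<tau> = e2pi (of_real ((10 - real k) / 40 - 1 / 8)) * e2pi (of_real s * \<tau>) * R *
      ((qpoch_inf (- t) (t\<^sup>2))\<^sup>2 / (qpoch_inf (- (t ^ k)) (t ^ 10) * qpoch_inf (- (t ^ (10 - k))) (t ^ 10)))"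
proof -
  have r: "of_int (2 * \<rho> + 1) / 10 = real k / real 10" unfolding k(1)[symmetric] by simp
  have t: "e2pi (\<tau> / of_nat 2) = t" "e2pi (5 * \<tau> / of_nat 10) = t"
    by (simp_all add: t_def)
  note K2 = klein_frac[of 2 1 \<tau>, unfolded t, simplified]
  define x where "x = real k / real 10"
  have K10: "klein x 0 (5 * \<tau>) = e2pi (of_real ((x - 1) * x / 2) * (5 * \<tau>)) *
      (qpoch_inf (t ^ k) (t ^ 10) * qpoch_inf (t ^ (10 - k)) (t ^ 10) / (qpoch_inf (t ^ 10) (t ^ 10))\<^sup>2)"
    "klein x (1/2) (5 * \<tau>) = (e2pi (of_real ((x - 1) / 4)) * e2pi (of_real ((x - 1) * x / 2) * (5 * \<tau>))) *
      (qpoch_inf (- (t ^ k)) (t ^ 10) * qpoch_inf (- (t ^ (10 - k))) (t ^ 10) / (qpoch_inf (t ^ 10) (t ^ 10))\<^sup>2)"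
    unfolding x_def
    by (rule klein_frac[of 10 k "5 * \<tau>", unfolded t]; use k(2) in simp)+
  have k1: "klein (1/2) 0 \<tau> = e2pi (of_real (- 1/8) * \<tau>) * ((qpoch_inf t (t\<^sup>2))\<^sup>2 / (qpoch_inf (t\<^sup>2) (t\<^sup>2))\<^sup>2)"
    using K2(1) by (simp add: power2_eq_square)
  have k2: "klein (1/2) (1/2) \<tau> = (e2pi (of_real (- 1/8)) * e2pi (of_real (- 1/8) * \<tau>)) * ((qpoch_inf (- t) (t\<^sup>2))\<^sup>2 / (qpoch_inf (t\<^sup>2) (t\<^sup>2))\<^sup>2)"
    using K2(2) by (simp add: power2_eq_square)
  have e: "e2pi (of_real (- 1/8) * \<tau>) / e2pi (of_real ((x - 1) * x / 2) * (5 * \<tau>)) = e2pi (of_real s * \<tau>)"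
    unfolding e2pi_diff[symmetric] by (rule arg_cong[where f = e2pi]) (simp add: s_def x_def field_simps)
  have e': "e2pi (of_real (- 1/8)) / e2pi (of_real ((x - 1) / 4)) = e2pi (of_real ((10 - real k) / 40 - 1 / 8))"
    unfolding e2pi_diff[symmetric] by (rule arg_cong[where f = e2pi]) (simp add: x_def field_simps)
  show "klein_quot 0 \<rho> \<tau> = e2pi (of_real s * \<tau>) * R *
      ((qpoch_inf t (t\<^sup>2))\<^sup>2 / (qpoch_inf (t ^ k) (t ^ 10) * qpoch_inf (t ^ (10 - k)) (t ^ 10)))"
    unfolding klein_quot_def r x_def[symmetric] k1 K10 quot_rearrange R_def e ..
  have "e2pi (of_real (- 1/8)) * e2pi (of_real (- 1/8) * \<tau>) / (e2pi (of_real ((x - 1) / 4)) * e2pi (of_real ((x - 1) * x / 2) * (5 * \<tau>))) =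
      e2pi (of_real ((10 - real k) / 40 - 1 / 8)) * e2pi (of_real s * \<tau>)"
    unfolding e[symmetric] e'[symmetric] by simp
  note ee = this
  show "klein_quot (1/2) \<rho> \<tau> = e2pi (of_real ((10 - real k) / 40 - 1 / 8)) * e2pi (of_real s * \<tau>) * R *
      ((qpoch_inf (- t) (t\<^sup>2))\<^sup>2 / (qpoch_inf (- (t ^ k)) (t ^ 10) * qpoch_inf (- (t ^ (10 - k))) (t ^ 10)))"
    unfolding klein_quot_def r x_def[symmetric] k2 K10 quot_rearrange R_def ee ..
qed

text \<open>In the exponent, -17/24 is 3/24 - 20/24 from the eta factors, and l(5 - l)/10 comes from
  the Klein form at 5\<tau>.\<close>

lemma eta_klein_product:
  assumes l: "l \<le> 5" and \<tau>: "Im \<tau> > 0"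
  defines "t \<equiv> e2pi (\<tau> / 2)"
  shows "eta_klein (int l) \<tau> = e2pi (of_real (real l * (5 - real l) / 10 - 17 / 24) * \<tau>) *
     (qpoch_inf (t\<^sup>2) (t\<^sup>2) ^ 3 / ((qpoch_inf (t ^ 10) (t ^ 10))\<^sup>2 * (qpoch_inf (t ^ (2 * l)) (t ^ 10) * qpoch_inf (t ^ (10 - 2 * l)) (t ^ 10))))"
proof -
  define P where "P = qpoch_inf (t ^ 10) (t ^ 10)"
  have t1: "norm t < 1" unfolding t_def using \<tau> by (intro norm_e2pi_less_1) simp
  have P: "P \<noteq> 0" unfolding P_def using t1 by (intro qpoch_inf_nonzero) (simp_all add: norm_power power_less_one_iff)
  have q: "e2pi \<tau> = t\<^sup>2" "e2pi (5 * \<tau>) = t ^ 10" by (simp_all add: t_def e2pi_power)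
  have t: "e2pi (5 * \<tau> / of_nat 10) = t" by (simp add: t_def)
  define x where "x = real (2 * l) / real 10"
  have x: "of_int (int l) / 5 = x" by (simp add: x_def)
  have k: "klein x 0 (5 * \<tau>) = e2pi (of_real ((x - 1) * x / 2) * (5 * \<tau>)) *
      (qpoch_inf (t ^ (2 * l)) (t ^ 10) * qpoch_inf (t ^ (10 - 2 * l)) (t ^ 10) / P\<^sup>2)"
    using klein_frac(1)[of 10 "2 * l" "5 * \<tau>", unfolded t, folded x_def] l by (simp add: P_def)
  have e: "e2pi (\<tau> / 24) ^ 3 / (e2pi (5 * \<tau> / 24) ^ 4 * e2pi (of_real ((x - 1) * x / 2) * (5 * \<tau>))) =
      e2pi (of_real (real l * (5 - real l) / 10 - 17 / 24) * \<tau>)"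
    unfolding e2pi_power e2pi_add[symmetric] e2pi_diff[symmetric]
    by (rule arg_cong[where f = e2pi]) (simp add: x_def field_simps)
  have "(u * p) ^ 3 / ((v * P) ^ 4 * (w * (D / P\<^sup>2))) = (u ^ 3 / (v ^ 4 * w)) * (p ^ 3 / (P\<^sup>2 * D))" for u v w p D
    using P by (simp add: power_mult_distrib power4_eq_xxxx power2_eq_square)
  then show ?thesis
    unfolding eta_klein_def eta_def x k q P_def[symmetric] e[symmetric] .
qed

lemma qpoch_inf_dissect_5:
  assumes "norm t < 1"
  shows "qpoch_inf t t = qpoch_inf t (t ^ 5) * qpoch_inf (t ^ 2) (t ^ 5) * qpoch_inf (t ^ 3) (t ^ 5) * qpoch_inf (t ^ 4) (t ^ 5) * qpoch_inf (t ^ 5) (t ^ 5)"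
  using qpoch_inf_dissect[OF assms, of 5 t] by (simp add: eval_nat_numeral lessThan_Suc mult_ac)

lemma qpoch_inf_dissect_10:
  assumes "norm t < 1"
  shows "qpoch_inf (t ^ k) (t ^ 5) = qpoch_inf (t ^ k) (t ^ 10) * qpoch_inf (t ^ (k + 5)) (t ^ 10)"
proof -
  have t5: "norm (t ^ 5) < 1" using assms by (simp add: norm_power power_less_one_iff)
  have "(t ^ 5) ^ 2 = t ^ 10" by simp
  then show ?thesis using qpoch_inf_dissect[OF t5, of 2 "t ^ k"] by (simp add: numeral_2_eq_2 lessThan_Suc power_add mult_ac)
qed

text \<open>The three residue classes modulo 5 that are present equal (t;t) divided by the two
  missing ones, so each left side is (t;t)^2 over two classes modulo 5. Splitting these modulo 10
  and (t;t) modulo 2 isolates the even powers of t, which t -> -t preserves, from the odd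
  ones.\<close>

lemma B_chi_theta_quotients:
  assumes t: "norm t < 1"
  shows "qpoch_inf (t ^ 5) (t ^ 5) * qpoch_inf (t ^ 3) (t ^ 5) * qpoch_inf (t ^ 2) (t ^ 5) * qpoch_inf t t =
    (qpoch_inf (t\<^sup>2) (t\<^sup>2))\<^sup>2 / (qpoch_inf (t ^ 4) (t ^ 10) * qpoch_inf (t ^ 6) (t ^ 10)) *
    ((qpoch_inf t (t\<^sup>2))\<^sup>2 / (qpoch_inf t (t ^ 10) * qpoch_inf (t ^ 9) (t ^ 10)))"
    and "qpoch_inf (t ^ 5) (t ^ 5) * qpoch_inf (t ^ 4) (t ^ 5) * qpoch_inf t (t ^ 5) * qpoch_inf t t =
    (qpoch_inf (t\<^sup>2) (t\<^sup>2))\<^sup>2 / (qpoch_inf (t ^ 2) (t ^ 10) * qpoch_inf (t ^ 8) (t ^ 10)) *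
    ((qpoch_inf t (t\<^sup>2))\<^sup>2 / (qpoch_inf (t ^ 3) (t ^ 10) * qpoch_inf (t ^ 7) (t ^ 10)))"
proof -
  have two: "qpoch_inf t t = qpoch_inf t (t\<^sup>2) * qpoch_inf (t\<^sup>2) (t\<^sup>2)"
    using qpoch_inf_dissect[OF t, of 2 t] by (simp add: numeral_2_eq_2 lessThan_Suc mult_ac)
  have nz: "qpoch_inf (t ^ Suc k) (t ^ 10) \<noteq> 0" for k
    using t by (intro qpoch_inf_nonzero) (simp_all only: norm_power power_less_one_iff norm_ge_zero, simp_all)
  have nz: "qpoch_inf t (t ^ 10) \<noteq> 0" "qpoch_inf (t ^ 9) (t ^ 10) \<noteq> 0" "qpoch_inf (t ^ 4) (t ^ 10) \<noteq> 0" "qpoch_inf (t ^ 6) (t ^ 10) \<noteq> 0"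
    "qpoch_inf (t ^ 2) (t ^ 10) \<noteq> 0" "qpoch_inf (t ^ 8) (t ^ 10) \<noteq> 0" "qpoch_inf (t ^ 3) (t ^ 10) \<noteq> 0" "qpoch_inf (t ^ 7) (t ^ 10) \<noteq> 0"
    using nz[of 0] nz[of 8] nz[of 3] nz[of 5] nz[of 1] nz[of 7] nz[of 2] nz[of 6] by (simp_all add: eval_nat_numeral)
  note d = qpoch_inf_dissect_10[OF t]
  have d1: "qpoch_inf t (t ^ 5) = qpoch_inf t (t ^ 10) * qpoch_inf (t ^ 6) (t ^ 10)"
    "qpoch_inf (t ^ 2) (t ^ 5) = qpoch_inf (t ^ 2) (t ^ 10) * qpoch_inf (t ^ 7) (t ^ 10)"
    "qpoch_inf (t ^ 3) (t ^ 5) = qpoch_inf (t ^ 3) (t ^ 10) * qpoch_inf (t ^ 8) (t ^ 10)"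
    "qpoch_inf (t ^ 4) (t ^ 5) = qpoch_inf (t ^ 4) (t ^ 10) * qpoch_inf (t ^ 9) (t ^ 10)"
    using d[of 1] d[of 2] d[of 3] d[of 4] by simp_all
  have sq: "(qpoch_inf t t)\<^sup>2 = (qpoch_inf (t\<^sup>2) (t\<^sup>2))\<^sup>2 * (qpoch_inf t (t\<^sup>2))\<^sup>2"
    unfolding two by (simp add: power_mult_distrib)
  have *: "u5 * u3 * u2 * v = V2 / (b * c) * (W2 / (a * d))"
    if "v = u1 * u2 * u3 * u4 * u5" "u1 = a * c" "u4 = b * d" "v\<^sup>2 = V2 * W2" "a \<noteq> 0" "b \<noteq> 0" "c \<noteq> 0" "d \<noteq> 0"
    for u1 u2 u3 u4 u5 v a b c d V2 W2 :: complex
  proof -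
    have "V2 / (b * c) * (W2 / (a * d)) = v\<^sup>2 / (u1 * u4)" unfolding that(2-4) by (simp add: mult_ac)
    also have "\<dots> = u5 * u3 * u2 * v" using that(5-8) unfolding power2_eq_square that(2,3)
      by (subst that(1)) (simp add: that(2,3))
    finally show ?thesis ..
  qed
  show "qpoch_inf (t ^ 5) (t ^ 5) * qpoch_inf (t ^ 3) (t ^ 5) * qpoch_inf (t ^ 2) (t ^ 5) * qpoch_inf t t =
    (qpoch_inf (t\<^sup>2) (t\<^sup>2))\<^sup>2 / (qpoch_inf (t ^ 4) (t ^ 10) * qpoch_inf (t ^ 6) (t ^ 10)) *
    ((qpoch_inf t (t\<^sup>2))\<^sup>2 / (qpoch_inf t (t ^ 10) * qpoch_inf (t ^ 9) (t ^ 10)))"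
    by (rule *[OF qpoch_inf_dissect_5[OF t] d1(1) d1(4) sq]) (rule nz)+
  have dis: "qpoch_inf t t = qpoch_inf (t ^ 3) (t ^ 5) * qpoch_inf t (t ^ 5) * qpoch_inf (t ^ 4) (t ^ 5) * qpoch_inf (t ^ 2) (t ^ 5) * qpoch_inf (t ^ 5) (t ^ 5)"
    unfolding qpoch_inf_dissect_5[OF t] by (simp only: mult_ac)
  show "qpoch_inf (t ^ 5) (t ^ 5) * qpoch_inf (t ^ 4) (t ^ 5) * qpoch_inf t (t ^ 5) * qpoch_inf t t =
    (qpoch_inf (t\<^sup>2) (t\<^sup>2))\<^sup>2 / (qpoch_inf (t ^ 2) (t ^ 10) * qpoch_inf (t ^ 8) (t ^ 10)) *
    ((qpoch_inf t (t\<^sup>2))\<^sup>2 / (qpoch_inf (t ^ 3) (t ^ 10) * qpoch_inf (t ^ 7) (t ^ 10)))"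
    by (rule *[OF dis d1(3) d1(2) sq]) (rule nz)+
qed

text \<open>Under t -> -t only \<open>S\<close> changes, to \<open>S'\<close>, so the even part is
  the common factor times (S + S')/2. The exponent 1/120 compensates -13/120 from
  \<open>eta_klein\<close> and 1/10 from the Klein quotients.\<close>

lemma B_chi0_eq_klein:
  assumes \<tau>: "Im \<tau> > 0"
  shows "B_chi0 (e2pi \<tau>) = 1 / 2 * e2pi (of_real (1 / 120) * \<tau>) * (eta_klein 2 \<tau> * klein_sum 0 \<tau>)"
proof -
  define t where "t = e2pi (\<tau> / 2)"
  have t: "norm t < 1" "t \<noteq> 0" unfolding t_def using \<tau> by (auto intro: norm_e2pi_less_1)
  have tm: "norm (- t) < 1" using t by simp
  have q: "e2pi \<tau> = t\<^sup>2" by (simp add: t_def e2pi_power)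
  define P where "P = qpoch_inf (t\<^sup>2) (t\<^sup>2)"
  define R where "R = qpoch_inf (t ^ 10) (t ^ 10)"
  define D where "D = qpoch_inf (t ^ 4) (t ^ 10) * qpoch_inf (t ^ 6) (t ^ 10)"
  define S where "S = (qpoch_inf t (t\<^sup>2))\<^sup>2 / (qpoch_inf t (t ^ 10) * qpoch_inf (t ^ 9) (t ^ 10))"
  define S' where "S' = (qpoch_inf (- t) (t\<^sup>2))\<^sup>2 / (qpoch_inf (- t) (t ^ 10) * qpoch_inf (- (t ^ 9)) (t ^ 10))"
  have P: "P \<noteq> 0" unfolding P_def using t norm_square_less_1 by (intro qpoch_inf_nonzero) auto
  have R: "R \<noteq> 0" unfolding R_def using t by (intro qpoch_inf_nonzero) (simp_all add: norm_power power_less_one_iff)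
  have "P * B_chi0 (t\<^sup>2) = (P\<^sup>2 / D * S + P\<^sup>2 / D * S') / 2"
    using B_chi_products(3)[OF t] B_chi_theta_quotients(1)[OF t(1)] B_chi_theta_quotients(1)[OF tm]
    by (simp add: P_def D_def S_def S'_def)
  also have "\<dots> = P * (P / D * (S + S') / 2)"
    by (simp add: power2_eq_square distrib_left add_divide_distrib mult_ac)
  finally have B: "B_chi0 (t\<^sup>2) = P / D * (S + S') / 2"
    using P by (simp only: mult_cancel_left) simp
  have e: "e2pi (of_real (-1 / 10)) * e2pi (of_real (1 / 10)) = 1"
    unfolding e2pi_add[symmetric] by simp
  have X: "klein_quot 0 0 \<tau> = e2pi (of_real (1 / 10) * \<tau>) * (R\<^sup>2 / P\<^sup>2) * S"
    using klein_quot_product(1)[of 1 0 \<tau>] by (simp add: t_def[symmetric] P_def R_def S_def)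
  have Y: "klein_quot (1/2) 0 \<tau> = e2pi (of_real (1 / 10)) * e2pi (of_real (1 / 10) * \<tau>) * (R\<^sup>2 / P\<^sup>2) * S'"
    using klein_quot_product(2)[of 1 0 \<tau>] by (simp add: t_def[symmetric] P_def R_def S'_def)
  have F: "klein_sum 0 \<tau> = e2pi (of_real (1 / 10) * \<tau>) * (R\<^sup>2 / P\<^sup>2) * (S + S')"
  proof -
    have "u * (v * E * W * x) = (u * v) * (E * W * x)" for u v E W x :: complex by simp
    then have "e2pi (of_real (-1 / 10)) * klein_quot (1/2) 0 \<tau> =
        (e2pi (of_real (-1 / 10)) * e2pi (of_real (1 / 10))) * (e2pi (of_real (1 / 10) * \<tau>) * (R\<^sup>2 / P\<^sup>2) * S')"
      unfolding Y .
    then have "e2pi (of_real (-1 / 10)) * klein_quot (1/2) 0 \<tau> = e2pi (of_real (1 / 10) * \<tau>) * (R\<^sup>2 / P\<^sup>2) * S'"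
      unfolding e by simp
    moreover have "of_int (0 - 2) / 20 + of_int 0 / 2 = (-1 / 10 :: real)" by simp
    ultimately show ?thesis unfolding klein_sum_def X by (simp only: distrib_left)
  qed
  have G: "eta_klein 2 \<tau> = e2pi (of_real (-13 / 120) * \<tau>) * (P ^ 3 / (R\<^sup>2 * D))"
    using eta_klein_product[of 2 \<tau>] \<tau> by (simp add: t_def[symmetric] P_def R_def D_def)
  have E: "e2pi (of_real (1 / 120) * \<tau>) * e2pi (of_real (-13 / 120) * \<tau>) * e2pi (of_real (1 / 10) * \<tau>) = 1"
    unfolding e2pi_add[symmetric] by (simp add: field_simps)
  have "1 / 2 * e1 * (e2 * (P ^ 3 / (R\<^sup>2 * D)) * (e3 * (R\<^sup>2 / P\<^sup>2) * x)) = (e1 * e2 * e3) * (P / D * x / 2)" for e1 e2 e3 x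
    using P R by (simp add: power3_eq_cube power2_eq_square mult_ac)
  note rearrange = this
  show ?thesis unfolding F G q B rearrange E by simp
qed

text \<open>The odd part leads to S - S'. The exponents -71/120, -37/120 and 2/5 add up to -1/2,
  which accounts for the division by t.\<close>

lemma B_chi1_eq_klein:
  assumes \<tau>: "Im \<tau> > 0"
  shows "B_chi1 (e2pi \<tau>) = - 1 / 2 * e2pi (of_real (- 71 / 120) * \<tau>) * (eta_klein 1 \<tau> * klein_sum 1 \<tau>)"
proof -
  define t where "t = e2pi (\<tau> / 2)"
  have t: "norm t < 1" "t \<noteq> 0" unfolding t_def using \<tau> by (auto intro: norm_e2pi_less_1)
  have tm: "norm (- t) < 1" using t by simp
  have q: "e2pi \<tau> = t\<^sup>2" by (simp add: t_def e2pi_power)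
  define P where "P = qpoch_inf (t\<^sup>2) (t\<^sup>2)"
  define R where "R = qpoch_inf (t ^ 10) (t ^ 10)"
  define D where "D = qpoch_inf (t ^ 2) (t ^ 10) * qpoch_inf (t ^ 8) (t ^ 10)"
  define S where "S = (qpoch_inf t (t\<^sup>2))\<^sup>2 / (qpoch_inf (t ^ 3) (t ^ 10) * qpoch_inf (t ^ 7) (t ^ 10))"
  define S' where "S' = (qpoch_inf (- t) (t\<^sup>2))\<^sup>2 / (qpoch_inf (- (t ^ 3)) (t ^ 10) * qpoch_inf (- (t ^ 7)) (t ^ 10))"
  have P: "P \<noteq> 0" unfolding P_def using t norm_square_less_1 by (intro qpoch_inf_nonzero) auto
  have R: "R \<noteq> 0" unfolding R_def using t by (intro qpoch_inf_nonzero) (simp_all add: norm_power power_less_one_iff)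
  have "t * (P * B_chi1 (t\<^sup>2)) = - ((P\<^sup>2 / D * S - P\<^sup>2 / D * S') / 2)"
    using B_chi_products(4)[OF t] B_chi_theta_quotients(2)[OF t(1)] B_chi_theta_quotients(2)[OF tm]
    by (simp add: P_def D_def S_def S'_def)
  also have "\<dots> = P * (- (P / D * (S - S') / 2))"
    by (simp add: power2_eq_square right_diff_distrib diff_divide_distrib mult_ac)
  finally have "P * (t * B_chi1 (t\<^sup>2)) = P * (- (P / D * (S - S') / 2))"
    by (simp only: mult.left_commute)
  then have "t * B_chi1 (t\<^sup>2) = - (P / D * (S - S') / 2)"
    using P by (simp only: mult_cancel_left) simp
  moreover have "x = y / t" if "t * x = y" for x y using t(2) that by auto
  ultimately have B: "B_chi1 (t\<^sup>2) = - (P / D * (S - S') / 2) / t" by blast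
  have e: "e2pi (of_real (9 / 20)) * e2pi (of_real (1 / 20)) = - 1"
    \<comment> \<open>The two phases add up to 1/2, which is the sign that turns the sum of the
      quotients into a difference.\<close>
    unfolding e2pi_add[symmetric] e2pi_half[symmetric] by (rule arg_cong[where f = e2pi]) simp
  have X: "klein_quot 0 1 \<tau> = e2pi (of_real (2 / 5) * \<tau>) * (R\<^sup>2 / P\<^sup>2) * S"
    using klein_quot_product(1)[of 3 1 \<tau>] by (simp add: t_def[symmetric] P_def R_def S_def)
  have Y: "klein_quot (1/2) 1 \<tau> = e2pi (of_real (1 / 20)) * e2pi (of_real (2 / 5) * \<tau>) * (R\<^sup>2 / P\<^sup>2) * S'"
    using klein_quot_product(2)[of 3 1 \<tau>] by (simp add: t_def[symmetric] P_def R_def S'_def)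
  have F: "klein_sum 1 \<tau> = e2pi (of_real (2 / 5) * \<tau>) * (R\<^sup>2 / P\<^sup>2) * (S - S')"
  proof -
    have "u * (v * E * W * x) = (u * v) * (E * W * x)" for u v E W x :: complex by simp
    then have "e2pi (of_real (9 / 20)) * klein_quot (1/2) 1 \<tau> =
        (e2pi (of_real (9 / 20)) * e2pi (of_real (1 / 20))) * (e2pi (of_real (2 / 5) * \<tau>) * (R\<^sup>2 / P\<^sup>2) * S')"
      unfolding Y .
    then have "e2pi (of_real (9 / 20)) * klein_quot (1/2) 1 \<tau> = - (e2pi (of_real (2 / 5) * \<tau>) * (R\<^sup>2 / P\<^sup>2) * S')"
      unfolding e by simp
    moreover have "of_int (1 - 2) / 20 + of_int 1 / 2 = (9 / 20 :: real)" by simp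
    ultimately show ?thesis unfolding klein_sum_def X by (simp only: right_diff_distrib add_uminus_conv_diff)
  qed
  have G: "eta_klein 1 \<tau> = e2pi (of_real (-37 / 120) * \<tau>) * (P ^ 3 / (R\<^sup>2 * D))"
    using eta_klein_product[of 1 \<tau>] \<tau> by (simp add: t_def[symmetric] P_def R_def D_def)
  have E: "e2pi (of_real (- 71 / 120) * \<tau>) * e2pi (of_real (-37 / 120) * \<tau>) * e2pi (of_real (2 / 5) * \<tau>) = 1 / t"
  proof -
    have "of_real (- 71 / 120) * \<tau> + of_real (-37 / 120) * \<tau> + of_real (2 / 5) * \<tau> = - (\<tau> / 2)" by (simp add: field_simps)
    then show ?thesis unfolding e2pi_add[symmetric] by (simp only: e2pi_minus t_def inverse_eq_divide)
  qed
  have "- 1 / 2 * e1 * (e2 * (P ^ 3 / (R\<^sup>2 * D)) * (e3 * (R\<^sup>2 / P\<^sup>2) * x)) = (e1 * e2 * e3) * (- (P / D * x / 2))" for e1 e2 e3 x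
    using P R by (simp add: power3_eq_cube power2_eq_square mult_ac)
  note rearrange = this
  show ?thesis unfolding F G q B rearrange E by simp
qed

no_notation fps_nth (infixl "$" 75)

section \<open>The multiplier system and the cusps\<close>

lemma act_mob: "act A \<tau> = mob (A$1$1) (A$1$2) (A$2$1) (A$2$2) \<tau>"
  by (simp add: act_def moebius_def mob_def)

lemma automorphy_half: "automorphy (1/2) A \<tau> = (of_int (A$2$1) * \<tau> + of_int (A$2$2)) powr (1/2)"
  by (simp add: automorphy_def)

lemma SL2Z_det: "A \<in> SL2Z \<Longrightarrow> A$1$1 * A$2$2 - A$1$2 * A$2$1 = 1"
  by (simp add: SL2Z_def det_2)

lemma Gamma1_10_E:
  assumes "A \<in> Gamma1 10"
  obtains m m' c' where "A$1$1 = 1 + 10 * m" "A$2$2 = 1 + 10 * m'" "A$2$1 = 10 * c'"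
    "A$1$1 * A$2$2 - A$1$2 * A$2$1 = 1"
proof -
  have det: "A$1$1 * A$2$2 - A$1$2 * A$2$1 = 1" using assms by (intro SL2Z_det) (simp add: Gamma1_def)
  have "10 dvd A$1$1 - 1" "10 dvd A$2$1" "10 dvd A$2$2 - 1"
    using assms by (auto simp: Gamma1_def cong_iff_dvd_diff cong_0_iff)
  then obtain m c' m' where "A$1$1 - 1 = 10 * m" "A$2$1 = 10 * c'" "A$2$2 - 1 = 10 * m'"
    by (elim dvdE)
  then show ?thesis using det by (intro that[of m m' c']) auto
qed

lemma act_upper: "A \<in> SL2Z \<Longrightarrow> Im \<tau> > 0 \<Longrightarrow> Im (act A \<tau>) > 0"
  unfolding act_mob by (rule Im_mob[OF SL2Z_det])

lemma automorphy_nonzero: "A \<in> SL2Z \<Longrightarrow> Im \<tau> > 0 \<Longrightarrow> automorphy (1/2) A \<tau> \<noteq> 0"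
  unfolding automorphy_half using cocycle_nonzero[OF SL2Z_det] by simp

lemma matrix_mult_entry:
  fixes A B :: "int^2^2"
  shows "(A ** B) $ i $ k = A $ i $ 1 * B $ 1 $ k + A $ i $ 2 * B $ 2 $ k"
  by (simp add: matrix_matrix_mult_def sum_2)

lemma Gamma1_SL2Z: "A \<in> Gamma1 N \<Longrightarrow> A \<in> SL2Z"
  by (simp add: Gamma1_def)

lemma Gamma1_mult:
  assumes "A \<in> Gamma1 10" "B \<in> Gamma1 10"
  shows "A ** B \<in> Gamma1 10"
proof -
  obtain m m' c' where A: "A$1$1 = 1 + 10 * m" "A$2$2 = 1 + 10 * m'" "A$2$1 = 10 * c'"
    using Gamma1_10_E[OF assms(1)] .
  obtain n n' e' where B: "B$1$1 = 1 + 10 * n" "B$2$2 = 1 + 10 * n'" "B$2$1 = 10 * e'"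
    using Gamma1_10_E[OF assms(2)] .
  have "(A ** B)$1$1 - 1 = 10 * (m + n + 10 * m * n + A$1$2 * e')"
    "(A ** B)$2$2 - 1 = 10 * (m' + n' + 10 * m' * n' + c' * B$1$2)"
    "(A ** B)$2$1 = 10 * (c' + 10 * c' * n + e' + 10 * m' * e')"
    unfolding matrix_mult_entry A B by (simp_all add: algebra_simps)
  then have "10 dvd (A ** B)$1$1 - 1" "10 dvd (A ** B)$2$2 - 1" "10 dvd (A ** B)$2$1"
    by simp_all
  moreover have "det (A ** B) = 1"
    using assms by (simp add: det_mul Gamma1_def SL2Z_def)
  ultimately show ?thesis
    by (simp add: Gamma1_def SL2Z_def cong_iff_dvd_diff cong_0_iff)
qed

lemma act_mult:
  assumes B: "B \<in> SL2Z" and \<tau>: "Im \<tau> > 0"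
  shows "act (A ** B) \<tau> = act A (act B \<tau>)"
proof -
  have j: "of_int (B$2$1) * \<tau> + of_int (B$2$2) \<noteq> 0" by (rule cocycle_nonzero[OF SL2Z_det[OF B] \<tau>])
  have "((a * x + b * y) * t + (a * z + b * w)) / ((c * x + d * y) * t + (c * z + d * w)) =
      (a * ((x * t + z) / (y * t + w)) + b) / (c * ((x * t + z) / (y * t + w)) + d)"
    if "y * t + w \<noteq> 0" for a b c d x y z w t :: complex
  proof -
    have "a * ((x * t + z) / (y * t + w)) + b = ((a * x + b * y) * t + (a * z + b * w)) / (y * t + w)"
      "c * ((x * t + z) / (y * t + w)) + d = ((c * x + d * y) * t + (c * z + d * w)) / (y * t + w)"
      using that by (simp_all add: divide_simps) (simp_all add: algebra_simps)
    then show ?thesis using that by simp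
  qed
  from this[OF j] show ?thesis
    unfolding act_mob mob_def matrix_mult_entry of_int_add of_int_mult .
qed

text \<open>The transformation law provides a constant for each matrix; evaluation at \<i> makes
  this constant a function of the matrix.\<close>

definition eta_klein_multiplier :: "int \<Rightarrow> int^2^2 \<Rightarrow> complex" where
  "eta_klein_multiplier l A = eta_klein l (act A \<i>) / (automorphy (1/2) A \<i> * eta_klein l \<i>)"

lemma eta_klein_multiplier:
  assumes A: "A \<in> Gamma1 10" and l: "\<not> 5 dvd l"
  shows "norm (eta_klein_multiplier l A) = 1"
    and "Im \<tau> > 0 \<Longrightarrow> eta_klein l (act A \<tau>) = eta_klein_multiplier l A * automorphy (1/2) A \<tau> * eta_klein l \<tau>"
proof -
  obtain m m' c' where 1: "A$1$1 = 1 + 10 * m" "A$2$2 = 1 + 10 * m'" "A$2$1 = 10 * c'"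
    "A$1$1 * A$2$2 - A$1$2 * A$2$1 = 1" by (rule Gamma1_10_E[OF A])
  obtain v where v': "norm v = 1" "\<And>\<tau>. Im \<tau> > 0 \<Longrightarrow> eta_klein l (mob (A$1$1) (A$1$2) (A$2$1) (A$2$2) \<tau>) =
      v * (of_int (A$2$1) * \<tau> + of_int (A$2$2)) powr (1/2) * eta_klein l \<tau>"
    by (rule eta_klein_gamma[OF 1(4,1,2,3), of l]) (rule that)
  note v = v'(1) v'(2)[folded act_mob automorphy_half]
  have "eta_klein_multiplier l A = v"
    using v(2)[of \<i>] automorphy_nonzero[OF Gamma1_SL2Z[OF A], of \<i>] eta_klein_nonzero[of \<i> l] l
    by (simp add: eta_klein_multiplier_def)
  then show "norm (eta_klein_multiplier l A) = 1"
    and "Im \<tau> > 0 \<Longrightarrow> eta_klein l (act A \<tau>) = eta_klein_multiplier l A * automorphy (1/2) A \<tau> * eta_klein l \<tau>"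
    using v by simp_all
qed

definition chi_multiplier :: "int \<Rightarrow> int \<Rightarrow> int^2^2 \<Rightarrow> complex" where
  "chi_multiplier l \<rho> A = eta_klein_multiplier l A * e2pi (of_real (of_int (5 - (2 * \<rho> + 1)\<^sup>2) * of_int (A$1$2) / 40))"

text \<open>For the part of weight 1/2 the cocycle law follows by transforming
  \<open>eta_klein\<close> under A ** B in two ways and dividing by \<open>eta_klein\<close>, which
  has no zeros. The remaining phase is a character because the upper right entry, taken modulo 10,
  is additive on \<Gamma>_1(10).\<close>

lemma multiplier_system_chi:
  assumes l: "\<not> 5 dvd l"
  shows "multiplier_system (Gamma1 10) (1/2) (chi_multiplier l \<rho>)"
  unfolding multiplier_system_def
proof (intro conjI ballI)
  fix A assume "A \<in> Gamma1 10"
  then show "norm (chi_multiplier l \<rho> A) = 1"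
    using eta_klein_multiplier(1)[OF _ l, of A] by (simp only: chi_multiplier_def norm_mult norm_e2pi_real)
next
  fix A B \<tau> assume A: "A \<in> Gamma1 10" and B: "B \<in> Gamma1 10" and "\<tau> \<in> upper_half_plane"
  then have \<tau>: "Im \<tau> > 0" by (simp add: upper_half_plane_def)
  note B' = Gamma1_SL2Z[OF B]
  have "eta_klein_multiplier l (A ** B) * automorphy (1/2) (A ** B) \<tau> * eta_klein l \<tau> = eta_klein l (act A (act B \<tau>))"
    unfolding act_mult[OF B' \<tau>, symmetric] by (rule eta_klein_multiplier(2)[OF Gamma1_mult[OF A B] l \<tau>, symmetric])
  also have "\<dots> = (eta_klein_multiplier l A * automorphy (1/2) A (act B \<tau>)) * (eta_klein_multiplier l B * automorphy (1/2) B \<tau>) * eta_klein l \<tau>"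
    unfolding eta_klein_multiplier(2)[OF A l act_upper[OF B' \<tau>]] eta_klein_multiplier(2)[OF B l \<tau>] by (simp only: mult.assoc)
  finally have 1: "eta_klein_multiplier l (A ** B) * automorphy (1/2) (A ** B) \<tau> =
      (eta_klein_multiplier l A * automorphy (1/2) A (act B \<tau>)) * (eta_klein_multiplier l B * automorphy (1/2) B \<tau>)"
    using eta_klein_nonzero[OF \<tau> l] by (simp only: mult_right_cancel not_False_eq_True)
  obtain m where m: "A$1$1 = 1 + 10 * m" using Gamma1_10_E[OF A] .
  obtain n where n: "B$2$2 = 1 + 10 * n" using Gamma1_10_E[OF B] .
  \<comment> \<open>A quarter of 5 - (2\<rho>+1)^2, so that the phase has denominator 10 instead of
    40.\<close>
  define \<kappa> where "\<kappa> = 1 - \<rho> - \<rho>\<^sup>2"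
  have \<kappa>: "(of_int (5 - (2 * \<rho> + 1)\<^sup>2) * of_int b / 40 :: real) = of_int (\<kappa> * b) / 10" for b
    by (simp add: \<kappa>_def power2_eq_square field_simps)
  have "\<kappa> * (A ** B)$1$2 = \<kappa> * A$1$2 + \<kappa> * B$1$2 + 10 * (\<kappa> * (m * B$1$2 + n * A$1$2))"
    unfolding matrix_mult_entry m n by (simp add: algebra_simps)
  then have "complex_of_real (of_int (\<kappa> * (A ** B)$1$2) / 10) =
      of_real (of_int (\<kappa> * A$1$2) / 10) + of_real (of_int (\<kappa> * B$1$2) / 10) + of_int (\<kappa> * (m * B$1$2 + n * A$1$2))"
    by (simp add: add_divide_distrib)
  then have 2: "e2pi (of_real (of_int (\<kappa> * (A ** B)$1$2) / 10)) =
      e2pi (of_real (of_int (\<kappa> * A$1$2) / 10)) * e2pi (of_real (of_int (\<kappa> * B$1$2) / 10))"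
    by (simp only: e2pi_add e2pi_of_int mult_1_right)
  have "(x * w) * u = ((x1 * w1) * u1) * ((x2 * w2) * u2)" if "x * u = (x1 * u1) * (x2 * u2)" "w = w1 * w2"
    for x w u x1 w1 u1 x2 w2 u2 :: complex
  proof -
    have "(x * w) * u = (x * u) * w" by (simp add: mult_ac)
    then show ?thesis unfolding that by (simp add: mult_ac)
  qed
  from this[OF 1 2] show "chi_multiplier l \<rho> (A ** B) * automorphy (1/2) (A ** B) \<tau> =
      (chi_multiplier l \<rho> A * automorphy (1/2) A (act B \<tau>)) * (chi_multiplier l \<rho> B * automorphy (1/2) B \<tau>)"
    unfolding chi_multiplier_def \<kappa> .
qed

text \<open>Combining the two numbers with coefficients d and -c returns \<kappa>, so they cannot
  both be integers. Thus Klein forms in denominators remain free of zeros after any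
  transformation.\<close>

lemma det_not_Ints:
  fixes \<kappa> y :: real and a b c d :: int
  assumes det: "a * d - b * c = 1" and \<kappa>: "\<kappa> \<notin> \<int>"
  shows "\<not> (\<kappa> * of_int a + y * of_int c \<in> \<int> \<and> \<kappa> * of_int b + y * of_int d \<in> \<int>)"
proof
  assume int: "\<kappa> * of_int a + y * of_int c \<in> \<int> \<and> \<kappa> * of_int b + y * of_int d \<in> \<int>"
  then have "(\<kappa> * of_int a + y * of_int c) * of_int d - (\<kappa> * of_int b + y * of_int d) * of_int c \<in> \<int>"
    by (intro Ints_diff Ints_mult) auto
  also have "(\<kappa> * of_int a + y * of_int c) * of_int d - (\<kappa> * of_int b + y * of_int d) * of_int c = \<kappa> * of_int (a * d - b * c)"
    by (simp add: algebra_simps)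
  finally show False using \<kappa> unfolding det by simp
qed

lemma odd_div_10_not_Ints: "of_int (2 * \<rho> + 1) / 10 \<notin> (\<int> :: real set)"
proof
  assume "of_int (2 * \<rho> + 1) / 10 \<in> (\<int> :: real set)"
  then obtain n where "of_int (2 * \<rho> + 1) / 10 = (of_int n :: real)" by (elim Ints_cases)
  then have "of_int (2 * \<rho> + 1) = (of_int (10 * n) :: real)" by simp
  then have "2 * \<rho> + 1 = 10 * n" by (simp only: of_int_eq_iff)
  then show False by presburger
qed

lemma chi_holomorphic:
  assumes l: "\<not> 5 dvd l"
  shows "(\<lambda>\<tau>. eta_klein l \<tau> * klein_sum \<rho> \<tau>) holomorphic_on upper_half_plane"
  unfolding eta_klein_def klein_sum_def klein_quot_def
  by (intro holomorphic_intros eta_holomorphic klein_holomorphic open_upper_half_plane)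
     (use klein_nonzero odd_div_10_not_Ints div_5_not_Ints[OF l] eta_nonzero in \<open>auto simp: upper_half_plane_def\<close>)

text \<open>By \<open>scale5\<close> the slashed function is again a combination of eta, Klein forms
  and inverses, taken at \<tau> and at \<beta>\<tau> + \<theta>, in which all powers of the
  automorphy factor cancel; each ingredient has an expansion of the required kind.\<close>

lemma cusp_merom_slash:
  assumes A: "A \<in> SL2Z" and l: "\<not> 5 dvd l"
    and f: "\<And>\<tau>. Im \<tau> > 0 \<Longrightarrow> f \<tau> = C * (eta_klein l \<tau> * klein_sum \<rho> \<tau>)"
  shows "cusp_merom (slash (1/2) f A)"
proof -
  define a b c d where "a = A$1$1" and "b = A$1$2" and "c = A$2$1" and "d = A$2$2"
  have det: "a * d - b * c = 1" unfolding a_def b_def c_def d_def by (rule SL2Z_det[OF A])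
  obtain a' b' c' d' :: int and \<beta> \<theta> s :: real where det': "a' * d' - b' * c' = 1"
    and \<beta>: "\<beta> \<in> \<rat>" "\<beta> > 0" and \<theta>: "\<theta> \<in> \<rat>" and s: "s \<noteq> 0"
    and five: "\<And>\<tau>. Im \<tau> > 0 \<Longrightarrow> 5 * mob a b c d \<tau> = mob a' b' c' d' (of_real \<beta> * \<tau> + of_real \<theta>)"
    and j': "\<And>\<tau>::complex. of_int c' * (of_real \<beta> * \<tau> + of_real \<theta>) + of_int d' = (of_int c * \<tau> + of_int d) / of_real s"
    by (rule scale5[OF det]) (rule that)
  obtain v1 where v1: "norm v1 = 1" "\<And>\<tau>. Im \<tau> > 0 \<Longrightarrow> eta (mob a b c d \<tau>) = v1 * (of_int c * \<tau> + of_int d) powr (1/2) * eta \<tau>"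
    by (rule eta_modular[OF det]) (rule that)
  obtain v2 where v2: "norm v2 = 1" "\<And>\<tau>. Im \<tau> > 0 \<Longrightarrow> eta (mob a' b' c' d' \<tau>) = v2 * (of_int c' * \<tau> + of_int d') powr (1/2) * eta \<tau>"
    by (rule eta_modular[OF det']) (rule that)
  define \<kappa> :: real where "\<kappa> = of_int l / 5"
  define r :: real where "r = of_int (2 * \<rho> + 1) / 10"
  define w where "w = e2pi (of_real (of_int (\<rho> - 2) / 20 + of_int \<rho> / 2))"
  define \<sigma> where "\<sigma> = (\<lambda>\<tau>. complex_of_real \<beta> * \<tau> + of_real \<theta>)"
  define K where "K = (\<lambda>y \<tau>. klein (1/2 * of_int a + y * of_int c) (1/2 * of_int b + y * of_int d) \<tau>)"
  define L where "L = (\<lambda>x y \<tau>. klein (x * of_int a' + y * of_int c') (x * of_int b' + y * of_int d') (\<sigma> \<tau>))"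
  have main: "slash (1/2) f A \<tau> = C * (v1 ^ 3 / v2 ^ 4 * of_real s) * (eta \<tau> ^ 3 * inverse (eta (\<sigma> \<tau>)) ^ 4 * inverse (L \<kappa> 0 \<tau>)) *
       (inverse (of_real s) * (K 0 \<tau> * inverse (L r 0 \<tau>) + w * (K (1/2) \<tau> * inverse (L r (1/2) \<tau>))))" if \<tau>: "Im \<tau> > 0" for \<tau>
  proof -
    define j where "j = of_int c * \<tau> + of_int d"
    define J where "J = j powr (1/2)"
    define S where "S = complex_of_real s"
    have j: "j \<noteq> 0" unfolding j_def by (rule cocycle_nonzero[OF det \<tau>])
    have JJ: "J ^ 2 = j" unfolding J_def using j by (simp add: power2_eq_square flip: powr_add)
    have J0: "J \<noteq> 0" using j JJ by auto
    have S: "S \<noteq> 0" using s by (simp add: S_def)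
    define I where "I = (j / S) powr (1/2)"
    have I2: "I ^ 2 = j / S" unfolding I_def using j S by (simp add: power2_eq_square flip: powr_add)
    \<comment> \<open>Only the fourth power of \<open>I\<close> enters, so the principal square
      roots of j and of j / S never have to be compared.\<close>
    have I4: "I ^ 4 = (j / S)\<^sup>2" unfolding I2[symmetric] by simp
    have \<sigma>: "Im (\<sigma> \<tau>) > 0" using \<tau> \<beta> by (simp add: \<sigma>_def)
    have js: "of_int c' * \<sigma> \<tau> + of_int d' = j / S" unfolding \<sigma>_def j_def S_def by (rule j')
    have e1: "eta (mob a b c d \<tau>) = v1 * J * eta \<tau>" unfolding J_def j_def by (rule v1(2)[OF \<tau>])
    have five': "5 * mob a b c d \<tau> = mob a' b' c' d' (\<sigma> \<tau>)" unfolding \<sigma>_def by (rule five[OF \<tau>])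
    have e2: "eta (5 * mob a b c d \<tau>) = v2 * I * eta (\<sigma> \<tau>)"
      unfolding five' v2(2)[OF \<sigma>] js I_def ..
    have k5: "klein x y (5 * mob a b c d \<tau>) = L x y \<tau> / (j / S)" for x y
      unfolding five' klein_modular[OF det' \<sigma>] js L_def ..
    have k1: "klein (1/2) y (mob a b c d \<tau>) = K y \<tau> / j" for y
      unfolding klein_modular[OF det \<tau>] j_def K_def ..
    have "(v1 * J * x) ^ 3 / ((v2 * I * y) ^ 4 * (k / (j / S))) = (v1 ^ 3 / v2 ^ 4 * S) * (x ^ 3 * inverse y ^ 4 * inverse k) * J" for x y k
      unfolding power_mult_distrib I4 unfolding JJ[symmetric] using J0 S
      by (simp add: power4_eq_xxxx power3_eq_cube power2_eq_square divide_inverse mult_ac, simp add: field_simps)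
    then have E: "eta_klein l (mob a b c d \<tau>) = (v1 ^ 3 / v2 ^ 4 * S) * (eta \<tau> ^ 3 * inverse (eta (\<sigma> \<tau>)) ^ 4 * inverse (L \<kappa> 0 \<tau>)) * J"
      unfolding eta_klein_def e1 e2 k5 \<kappa>_def .
    have "(x / j) / (y / (j / S)) = inverse S * (x * inverse y)" for x y using j S by (simp add: divide_inverse mult_ac)
    then have Q: "klein_quot y \<rho> (mob a b c d \<tau>) = inverse S * (K y \<tau> * inverse (L r y \<tau>))" for y
      unfolding klein_quot_def k1 k5 r_def .
    have \<tau>': "Im (mob a b c d \<tau>) > 0" by (rule Im_mob[OF det \<tau>])
    have "slash (1/2) f A \<tau> = f (mob a b c d \<tau>) / J"
      unfolding slash_def act_mob automorphy_half a_def b_def c_def d_def J_def j_def ..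
    also have "\<dots> = C * (eta_klein l (mob a b c d \<tau>) * klein_sum \<rho> (mob a b c d \<tau>)) / J"
      unfolding f[OF \<tau>'] ..
    also have "\<dots> = C * (v1 ^ 3 / v2 ^ 4 * S) * (eta \<tau> ^ 3 * inverse (eta (\<sigma> \<tau>)) ^ 4 * inverse (L \<kappa> 0 \<tau>)) *
       (inverse S * (K 0 \<tau> * inverse (L r 0 \<tau>) + w * (K (1/2) \<tau> * inverse (L r (1/2) \<tau>))))"
    proof -
      have "C * ((p * q * J) * (i * x + w * (i * y))) / J = C * p * q * (i * (x + w * y))" for p q x y i
        using J0 by (simp add: distrib_left add_divide_distrib mult_ac)
      then show ?thesis unfolding klein_sum_def Q E w_def .
    qed
    finally show ?thesis unfolding S_def .
  qed
  have one: "(1::real) \<in> \<rat>" "(1::real) > 0" "(0::real) \<in> \<rat>" by simp_all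
  have half: "(1/2::real) \<in> \<rat>" by simp
  have r: "r \<in> \<rat>" "\<kappa> \<in> \<rat>" unfolding r_def \<kappa>_def by (intro Rats_divide Rats_of_int Rats_number_of)+
  have cK: "cusp_merom (K y)" if "y \<in> \<rat>" for y
  proof -
    have "1/2 * of_int a + y * of_int c \<in> \<rat>" using that by (intro Rats_add Rats_mult half Rats_of_int)
    from cusp_klein(1)[OF one this] show ?thesis unfolding K_def by simp
  qed
  have cL: "cusp_merom (\<lambda>\<tau>. inverse (L x y \<tau>))" if "x \<in> \<rat>" "y \<in> \<rat>" "x \<notin> \<int>" for x y
    unfolding L_def \<sigma>_def
    by (rule cusp_klein(2)[OF \<beta> \<theta>]) (use that det_not_Ints[OF det'] in \<open>auto intro!: Rats_add Rats_mult\<close>)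
  have ce: "cusp_merom eta" using cusp_eta(1)[OF one] by simp
  have ce': "cusp_merom (\<lambda>\<tau>. inverse (eta (\<sigma> \<tau>)))" unfolding \<sigma>_def by (rule cusp_eta(2)[OF \<beta> \<theta>])
  have nz: "r \<notin> \<int>" "\<kappa> \<notin> \<int>" unfolding r_def \<kappa>_def by (rule odd_div_10_not_Ints, rule div_5_not_Ints[OF l])
  show ?thesis
    by (rule cusp_merom_cong[OF main], assumption)
       (intro cusp_merom_mult cusp_merom_add cusp_merom_const cusp_merom_power ce ce' cL cK r nz half one)
qed

lemma modular_form_chi:
  assumes l: "\<not> 5 dvd l" and f: "\<And>\<tau>. Im \<tau> > 0 \<Longrightarrow> f \<tau> = C * (eta_klein l \<tau> * klein_sum \<rho> \<tau>)"
  shows "modular_form (Gamma1 10) (1/2) (chi_multiplier l \<rho>) f"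
  unfolding modular_form_def
proof (intro conjI ballI)
  have "(\<lambda>\<tau>. C * (eta_klein l \<tau> * klein_sum \<rho> \<tau>)) holomorphic_on upper_half_plane"
    by (intro holomorphic_on_mult[OF holomorphic_on_const] chi_holomorphic l)
  then show "f holomorphic_on upper_half_plane"
    by (rule holomorphic_transform) (simp add: f upper_half_plane_def)
next
  fix A \<tau> assume A: "A \<in> Gamma1 10" and "\<tau> \<in> upper_half_plane"
  then have \<tau>: "Im \<tau> > 0" by (simp add: upper_half_plane_def)
  obtain m m' c' where 1: "A$1$1 = 1 + 10 * m" "A$2$2 = 1 + 10 * m'" "A$2$1 = 10 * c'"
    "A$1$1 * A$2$2 - A$1$2 * A$2$1 = 1" by (rule Gamma1_10_E[OF A])
  note F = klein_sum_gamma[OF 1(4,1,2,3) \<tau>, of \<rho>, folded act_mob]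
  show "f (act A \<tau>) = chi_multiplier l \<rho> A * automorphy (1/2) A \<tau> * f \<tau>"
    unfolding f[OF \<tau>] f[OF act_upper[OF Gamma1_SL2Z[OF A] \<tau>]] F eta_klein_multiplier(2)[OF A l \<tau>] chi_multiplier_def
    by (simp only: mult_ac)
next
  fix A assume "A \<in> SL2Z"
  then show "meromorphic_at_i_infinity (slash (1/2) f A)"
    by (intro cusp_merom_imp_meromorphic_at_i_infinity cusp_merom_slash[OF _ l f])
qed

lemma modular_up_to_q_power_chi:
  assumes l: "\<not> 5 dvd l"
    and B: "\<And>\<tau>. Im \<tau> > 0 \<Longrightarrow> B (e2pi \<tau>) = C * e2pi ((- of_rat r) * \<tau>) * (eta_klein l \<tau> * klein_sum \<rho> \<tau>)"
  shows "modular_up_to_q_power (Gamma1 10) (1/2) B"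
  unfolding modular_up_to_q_power_def
proof (intro exI conjI)
  show "multiplier_system (Gamma1 10) (1/2) (chi_multiplier l \<rho>)" by (rule multiplier_system_chi[OF l])
  show "modular_form (Gamma1 10) (1/2) (chi_multiplier l \<rho>)
      (\<lambda>\<tau>. exp (2 * of_real pi * \<i> * of_rat r * \<tau>) * B (exp (2 * of_real pi * \<i> * \<tau>)))"
  proof (rule modular_form_chi[OF l])
    fix \<tau> :: complex assume \<tau>: "Im \<tau> > 0"
    have "exp (2 * of_real pi * \<i> * of_rat r * \<tau>) * B (exp (2 * of_real pi * \<i> * \<tau>)) = e2pi (of_rat r * \<tau>) * B (e2pi \<tau>)"
      by (simp only: e2pi_def mult.assoc)
    also have "\<dots> = C * (e2pi (of_rat r * \<tau>) * e2pi ((- of_rat r) * \<tau>)) * (eta_klein l \<tau> * klein_sum \<rho> \<tau>)"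
      unfolding B[OF \<tau>] by (simp only: mult_ac)
    also have "e2pi (of_rat r * \<tau>) * e2pi ((- of_rat r) * \<tau>) = 1"
      unfolding e2pi_add[symmetric] by simp
    finally show "exp (2 * of_real pi * \<i> * of_rat r * \<tau>) * B (exp (2 * of_real pi * \<i> * \<tau>)) = C * (eta_klein l \<tau> * klein_sum \<rho> \<tau>)"
      by simp
  qed
qed

lemma modular_B_chi0: "modular_up_to_q_power (Gamma1 10) (1/2) B_chi0"
proof (rule modular_up_to_q_power_chi)
  fix \<tau> :: complex assume "Im \<tau> > 0"
  then show "B_chi0 (e2pi \<tau>) = 1 / 2 * e2pi ((- of_rat (- 1 / 120)) * \<tau>) * (eta_klein 2 \<tau> * klein_sum 0 \<tau>)"
    using B_chi0_eq_klein[of \<tau>] by (simp add: of_rat_divide of_rat_minus)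
qed simp

lemma modular_B_chi1: "modular_up_to_q_power (Gamma1 10) (1/2) B_chi1"
proof (rule modular_up_to_q_power_chi)
  fix \<tau> :: complex assume "Im \<tau> > 0"
  then show "B_chi1 (e2pi \<tau>) = - 1 / 2 * e2pi ((- of_rat (71 / 120)) * \<tau>) * (eta_klein 1 \<tau> * klein_sum 1 \<tau>)"
    using B_chi1_eq_klein[of \<tau>] by (simp add: of_rat_divide of_rat_minus)
qed simp

theorem theorem4p1:
  shows "(\<forall>(k::nat) (\<zeta>::complex). k \<ge> 1 \<and> primitive_root_of_unity (2 * k - 1) \<zeta> \<longrightarrow>
            has_radial_limit (\<lambda>q. chi0 q - 2 * B_chi0 q) \<zeta>
              (- 3 * (\<Sum>n=0..k-1. (- \<zeta>) ^ (n\<^sup>2) * qpoch_fin \<zeta> (\<zeta>\<^sup>2) n) + 2) \<and>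
            has_radial_limit (\<lambda>q. chi1 q - 2 * B_chi1 q) \<zeta>
              (3 * inverse \<zeta> * (\<Sum>n=0..k-1. (- \<zeta>) ^ ((n + 1)\<^sup>2) * qpoch_fin \<zeta> (\<zeta>\<^sup>2) n))) \<and>
         (\<forall>(k::nat) (\<zeta>::complex). k \<ge> 1 \<and> primitive_root_of_unity (2 * k) \<zeta> \<longrightarrow>
            has_radial_limit (\<lambda>q. chi0 q + B_chi0 q) \<zeta>
              (6 * (\<Sum>n=1..k. \<zeta> ^ (2 * n\<^sup>2) / qpoch_fin \<zeta> (\<zeta>\<^sup>2) n) + 2) \<and>
            has_radial_limit (\<lambda>q. chi1 q + B_chi1 q) \<zeta>
              (6 * (\<Sum>n=1..k. \<zeta> ^ (2 * n * (n - 1)) / qpoch_fin \<zeta> (\<zeta>\<^sup>2) n))) \<and>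
         modular_up_to_q_power (Gamma1 10) (1 / 2) B_chi0 \<and>
         modular_up_to_q_power (Gamma1 10) (1 / 2) B_chi1"
  using radial_limits_odd radial_limits_even modular_B_chi0 modular_B_chi1 by blast

end
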